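(* There exists a $d\times d$-matrix $\Lambda$ such that, with $\tilde R:=\Lambda R$, $\tilde{\mathscr C}:=(\Lambda^\top)^{-1}\mathscr C$ and $\tilde{\mathscr C}^{0,*}:=(\Lambda^\top)^{-1}\mathscr C^{0,*}$ (preimages under $\Lambda^\top$), the following hold for all $1\le j\le d$: (i) $\Delta\tilde R^j>-1$ up to evanescence; (ii) $e_j\in\tilde{\mathscr C}\cap\tilde{\mathscr C}^{0,*}$, where $e_j$ is the $j$th unit vector of $\mathbb R^d$; (iii) the model $(\tilde R,\tilde{\mathscr C})$ admits the same wealth processes as $(R,\mathscr C)$.
   Context: Fix $T\in(0,\infty)$, $\delta\in\{0,1\}$, $x_0>0$, and a filtered probability space $(\Omega,\mathcal F,(\mathcal F_t)_{t\in[0,T]},P)$ satisfying the usual conditions with $\mathcal F_0$ $P$-trivial. $R$ is an $\mathbb R^d$-valued Lévy process (càdlàg semimartingale, stationary independent increments with respect to the filtration, $R_0=0$) with Lévy measure $F^R$, and $\mathscr C\subseteq\mathbb R^d$ is a set containing $0$; the pair $(R,\mathscr C)$ is called the model. Set $\mathscr C^{0,*}=\{y\in\mathbb R^d: F^R[x:y^\top x\le-1]=0\}$. A trading strategy is a predictable $R$-integrable $\mathbb R^d$-valued process $\pi$; a propensity to consume is a nonnegative optional process $\kappa$ with $\int_0^T\kappa_s\,ds<\infty$ a.s.; the wealth process is $X(\pi,\kappa)=x_0\,\mathcal E\big(\int\pi\,dR-\delta\int\kappa_s\,ds\big)$ (stochastic exponential). $(\pi,\kappa)$ is admissible if $X(\pi,\kappa)>0$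 and $\pi_t(\omega)\in\mathscr C$ for all $(\omega,t)$. The same notions are defined for $(\tilde R,\tilde{\mathscr C})$ with $R,\mathscr C$ replaced by $\tilde R,\tilde{\mathscr C}$. Two models admit the same wealth processes if their sets $\{X(\pi,\kappa):(\pi,\kappa)\text{ admissible}\}$ coincide (up to indistinguishability). *)

theory Defs
  imports "HOL-Probability.Probability"
begin

text \<open>
  Processes are curried functions of time and scenario. Only times in \<open>{0..T}\<close> and scenarios in
  \<open>space M\<close> are meaningful. The filtration is indexed by all reals so that the library's
  \<open>filtration\<close> and \<open>stopping_time\<close> apply; its members outside \<open>{0..T}\<close> play no role
  (a filtration on \<open>{0..T}\<close> may be extended constantly on either side).
  As usual in stochastic calculus, equations between processes are understood up to
  indistinguishability.
\<close>

type_synonym ('w, 'v) process = "real \<Rightarrow> 'w \<Rightarrow> 'v"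

definition usual_conditions :: "'w measure \<Rightarrow> (real \<Rightarrow> 'w measure) \<Rightarrow> real \<Rightarrow> bool" where
  "usual_conditions M F T \<longleftrightarrow>
     prob_space M \<and> complete_measure M \<and>
     filtration (space M) F \<and> (\<forall>t. subalgebra M (F t)) \<and>
     null_sets M \<subseteq> sets (F 0) \<and>
     (\<forall>t\<in>{0..<T}. sets (F t) = (\<Inter>s\<in>{t<..T}. sets (F s)))"

definition trivial_sigma_algebra :: "'w measure \<Rightarrow> 'w measure \<Rightarrow> bool" where
  "trivial_sigma_algebra M G \<longleftrightarrow> (\<forall>A\<in>sets G. measure M A = 0 \<or> measure M A = 1)"

definition indist :: "'w measure \<Rightarrow> real \<Rightarrow> ('w, 'v) process \<Rightarrow> ('w, 'v) process \<Rightarrow> bool" where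
  "indist M T X Y \<longleftrightarrow> (AE \<omega> in M. \<forall>t\<in>{0..T}. X t \<omega> = Y t \<omega>)"


subsection \<open>Path properties and measurability of processes\<close>

definition adapted :: "(real \<Rightarrow> 'w measure) \<Rightarrow> real \<Rightarrow> ('w, 'v::topological_space) process \<Rightarrow> bool" where
  "adapted F T X \<longleftrightarrow> (\<forall>t\<in>{0..T}. X t \<in> borel_measurable (F t))"

definition cadlag_path :: "real \<Rightarrow> (real \<Rightarrow> 'v::topological_space) \<Rightarrow> bool" where
  "cadlag_path T f \<longleftrightarrow>
     (\<forall>t\<in>{0..<T}. (f \<longlongrightarrow> f t) (at_right t)) \<and>
     (\<forall>t\<in>{0<..T}. \<exists>l. (f \<longlongrightarrow> l) (at_left t))"

definition cadlag_adapted ::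
  "'w measure \<Rightarrow> (real \<Rightarrow> 'w measure) \<Rightarrow> real \<Rightarrow> ('w, 'v::topological_space) process \<Rightarrow> bool" where
  "cadlag_adapted M F T X \<longleftrightarrow>
     adapted F T X \<and> (\<forall>\<omega>\<in>space M. cadlag_path T (\<lambda>t. X t \<omega>))"

text \<open>Convention: \<open>X\<^sub>0\<^sub>- = X\<^sub>0\<close>, so there is no jump at time 0.\<close>

definition left_lim :: "('w, 'v::t2_space) process \<Rightarrow> ('w, 'v) process" where
  "left_lim X t \<omega> = (if t \<le> 0 then X 0 \<omega> else Lim (at_left t) (\<lambda>s. X s \<omega>))"

definition jump :: "('w, 'v::real_normed_vector) process \<Rightarrow> ('w, 'v) process" where
  "jump X t \<omega> = X t \<omega> - left_lim X t \<omega>"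

definition finite_variation_path :: "real \<Rightarrow> (real \<Rightarrow> real) \<Rightarrow> bool" where
  "finite_variation_path T f \<longleftrightarrow>
     (\<exists>B. \<forall>n. \<forall>p::nat \<Rightarrow> real. mono p \<and> range p \<subseteq> {0..T} \<longrightarrow>
        (\<Sum>i<n. \<bar>f (p (Suc i)) - f (p i)\<bar>) \<le> B)"

definition predictable_sigma :: "'w measure \<Rightarrow> (real \<Rightarrow> 'w measure) \<Rightarrow> real \<Rightarrow> (real \<times> 'w) measure" where
  "predictable_sigma M F T = sigma ({0..T} \<times> space M)
     ({{0} \<times> A | A. A \<in> sets (F 0)} \<union>
      {{s<..t} \<times> A | s t A. 0 \<le> s \<and> s \<le> t \<and> t \<le> T \<and> A \<in> sets (F s)})"

definition predictable ::
  "'w measure \<Rightarrow> (real \<Rightarrow> 'w measure) \<Rightarrow> real \<Rightarrow> ('w, 'v::topological_space) process \<Rightarrow> bool" where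
  "predictable M F T H \<longleftrightarrow> case_prod H \<in> borel_measurable (predictable_sigma M F T)"

definition optional_sigma :: "'w measure \<Rightarrow> (real \<Rightarrow> 'w measure) \<Rightarrow> real \<Rightarrow> (real \<times> 'w) measure" where
  "optional_sigma M F T = sigma ({0..T} \<times> space M)
     {case_prod X -` B \<inter> ({0..T} \<times> space M) | X B.
        cadlag_adapted M F T (X :: ('w, real) process) \<and> B \<in> sets borel}"

definition optional ::
  "'w measure \<Rightarrow> (real \<Rightarrow> 'w measure) \<Rightarrow> real \<Rightarrow> ('w, 'v::topological_space) process \<Rightarrow> bool" where
  "optional M F T H \<longleftrightarrow> case_prod H \<in> borel_measurable (optional_sigma M F T)"


subsection \<open>Semimartingales\<close>

definition martingale_on ::
  "'w measure \<Rightarrow> (real \<Rightarrow> 'w measure) \<Rightarrow> real \<Rightarrow> ('w, real) process \<Rightarrow> bool" where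
  "martingale_on M F T X \<longleftrightarrow>
     adapted F T X \<and> (\<forall>t\<in>{0..T}. integrable M (X t)) \<and>
     (\<forall>s t. 0 \<le> s \<and> s \<le> t \<and> t \<le> T \<longrightarrow>
        (AE \<omega> in M. real_cond_exp M (F s) (X t) \<omega> = X s \<omega>))"

text \<open>On a finite horizon, a localizing sequence is one that almost surely attains \<open>T\<close>.\<close>

definition local_martingale ::
  "'w measure \<Rightarrow> (real \<Rightarrow> 'w measure) \<Rightarrow> real \<Rightarrow> ('w, real) process \<Rightarrow> bool" where
  "local_martingale M F T X \<longleftrightarrow>
     cadlag_adapted M F T X \<and>
     (\<exists>\<tau> :: nat \<Rightarrow> 'w \<Rightarrow> real.
        (\<forall>n. stopping_time F (\<tau> n) \<and> (\<forall>\<omega>\<in>space M. \<tau> n \<omega> \<in> {0..T})) \<and>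
        (AE \<omega> in M. incseq (\<lambda>n. \<tau> n \<omega>) \<and> (\<exists>n. \<tau> n \<omega> = T)) \<and>
        (\<forall>n. martingale_on M F T (\<lambda>t \<omega>. X (min t (\<tau> n \<omega>)) \<omega> - X 0 \<omega>)))"

definition real_semimartingale ::
  "'w measure \<Rightarrow> (real \<Rightarrow> 'w measure) \<Rightarrow> real \<Rightarrow> ('w, real) process \<Rightarrow> bool" where
  "real_semimartingale M F T X \<longleftrightarrow>
     cadlag_adapted M F T X \<and>
     (\<exists>N A. local_martingale M F T N \<and> cadlag_adapted M F T A \<and>
        (\<forall>\<omega>\<in>space M. finite_variation_path T (\<lambda>t. A t \<omega>)) \<and>
        (\<forall>\<omega>\<in>space M. N 0 \<omega> = 0 \<and> A 0 \<omega> = 0) \<and>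
        indist M T X (\<lambda>t \<omega>. X 0 \<omega> + N t \<omega> + A t \<omega>))"

definition semimartingale ::
  "'w measure \<Rightarrow> (real \<Rightarrow> 'w measure) \<Rightarrow> real \<Rightarrow> ('w, 'v::euclidean_space) process \<Rightarrow> bool" where
  "semimartingale M F T X \<longleftrightarrow>
     cadlag_adapted M F T X \<and>
     (\<forall>b\<in>Basis. real_semimartingale M F T (\<lambda>t \<omega>. X t \<omega> \<bullet> b))"


subsection \<open>Stochastic integrals\<close>

text \<open>
  For bounded predictable integrands, \<open>H \<mapsto> \<integral>H dX\<close> is the linear map which is given by the
  elementary formula on simple integrands and is continuous for bounded pointwise convergence of
  integrands and uniform convergence in probability of integrals; for a semimartingale \<open>X\<close> it
  exists and is unique up to indistinguishability (Jacod and Shiryaev, Limit Theorems for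
  Stochastic Processes, I.4.31).
\<close>

definition bounded_predictable ::
  "'w measure \<Rightarrow> (real \<Rightarrow> 'w measure) \<Rightarrow> real \<Rightarrow> ('w, 'v::real_normed_vector) process \<Rightarrow> bool" where
  "bounded_predictable M F T H \<longleftrightarrow>
     predictable M F T H \<and> (\<exists>c. \<forall>t\<in>{0..T}. \<forall>\<omega>\<in>space M. norm (H t \<omega>) \<le> c)"

definition ucp_lim :: "'w measure \<Rightarrow> real \<Rightarrow> (nat \<Rightarrow> ('w, real) process) \<Rightarrow> ('w, real) process \<Rightarrow> bool" where
  "ucp_lim M T Y Z \<longleftrightarrow>
     (\<forall>\<epsilon>>0. (\<lambda>n. measure M {\<omega>\<in>space M. \<exists>t\<in>{0..T}. \<bar>Y n t \<omega> - Z t \<omega>\<bar> > \<epsilon>}) \<longlonglongrightarrow> 0)"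

definition integration_operator ::
  "'w measure \<Rightarrow> (real \<Rightarrow> 'w measure) \<Rightarrow> real \<Rightarrow> ('w, 'v::euclidean_space) process \<Rightarrow>
   (('w, 'v) process \<Rightarrow> ('w, real) process) \<Rightarrow> bool" where
  "integration_operator M F T X J \<longleftrightarrow>
     (\<forall>H. bounded_predictable M F T H \<longrightarrow> cadlag_adapted M F T (J H)) \<and>
     (\<forall>\<xi>. \<xi> \<in> borel_measurable (F 0) \<and> bounded (\<xi> ` space M) \<longrightarrow>
        indist M T (J (\<lambda>u \<omega>. indicat_real {0} u *\<^sub>R \<xi> \<omega>)) (\<lambda>u \<omega>. 0)) \<and>
     (\<forall>s t \<xi>. 0 \<le> s \<and> s \<le> t \<and> t \<le> T \<and> \<xi> \<in> borel_measurable (F s) \<and> bounded (\<xi> ` space M) \<longrightarrow>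
        indist M T (J (\<lambda>u \<omega>. indicat_real {s<..t} u *\<^sub>R \<xi> \<omega>))
                   (\<lambda>u \<omega>. \<xi> \<omega> \<bullet> (X (min u t) \<omega> - X (min u s) \<omega>))) \<and>
     (\<forall>H K a b. bounded_predictable M F T H \<and> bounded_predictable M F T K \<longrightarrow>
        indist M T (J (\<lambda>u \<omega>. a *\<^sub>R H u \<omega> + b *\<^sub>R K u \<omega>)) (\<lambda>u \<omega>. a * J H u \<omega> + b * J K u \<omega>)) \<and>
     (\<forall>Hn H c. (\<forall>n. predictable M F T (Hn n)) \<and> predictable M F T H \<and>
        (\<forall>n. \<forall>t\<in>{0..T}. \<forall>\<omega>\<in>space M. norm (Hn n t \<omega>) \<le> c) \<and>
        (\<forall>t\<in>{0..T}. \<forall>\<omega>\<in>space M. (\<lambda>n. Hn n t \<omega>) \<longlonglongrightarrow> H t \<omega>) \<longrightarrow>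
        ucp_lim M T (\<lambda>n. J (Hn n)) (J H))"

definition bounded_stoch_integral ::
  "'w measure \<Rightarrow> (real \<Rightarrow> 'w measure) \<Rightarrow> real \<Rightarrow>
   ('w, 'v::euclidean_space) process \<Rightarrow> ('w, 'v) process \<Rightarrow> ('w, real) process \<Rightarrow> bool" where
  "bounded_stoch_integral M F T H X Z \<longleftrightarrow>
     bounded_predictable M F T H \<and> cadlag_adapted M F T Z \<and>
     (\<exists>J. integration_operator M F T X J \<and> indist M T Z (J H))"

text \<open>
  Convergence in the semimartingale (Emery) topology: the integrals of \<open>K\<close> with respect to
  \<open>Z - Z\<^sub>n\<close> tend to zero, uniformly on \<open>{0..T}\<close> in probability, uniformly over all predictable
  \<open>K\<close> bounded by 1. (It is only used for processes vanishing at time 0.)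
\<close>

definition emery_lim ::
  "'w measure \<Rightarrow> (real \<Rightarrow> 'w measure) \<Rightarrow> real \<Rightarrow> (nat \<Rightarrow> ('w, real) process) \<Rightarrow> ('w, real) process \<Rightarrow> bool" where
  "emery_lim M F T Zn Z \<longleftrightarrow>
     (\<forall>\<epsilon>>0. \<exists>n0. \<forall>n\<ge>n0. \<forall>K::('w, real) process.
        predictable M F T K \<and> (\<forall>t\<in>{0..T}. \<forall>\<omega>\<in>space M. \<bar>K t \<omega>\<bar> \<le> 1) \<longrightarrow>
        (\<exists>D. bounded_stoch_integral M F T K (\<lambda>t \<omega>. Z t \<omega> - Zn n t \<omega>) D \<and>
             measure M {\<omega>\<in>space M. \<exists>t\<in>{0..T}. \<bar>D t \<omega>\<bar> > \<epsilon>} \<le> \<epsilon>))"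

text \<open>
  \<open>has_stoch_integral M F T H X Z\<close>: the predictable process \<open>H\<close> is \<open>X\<close>-integrable (in the vector
  sense) and \<open>Z\<close> is a version of \<open>\<integral>H dX\<close>, that is, \<open>Z\<close> is the limit in the semimartingale topology
  of the integrals of the truncations \<open>H 1{|H| \<le> n}\<close> (Chou, Meyer and Stricker; Memin).
\<close>

definition has_stoch_integral ::
  "'w measure \<Rightarrow> (real \<Rightarrow> 'w measure) \<Rightarrow> real \<Rightarrow>
   ('w, 'v::euclidean_space) process \<Rightarrow> ('w, 'v) process \<Rightarrow> ('w, real) process \<Rightarrow> bool" where
  "has_stoch_integral M F T H X Z \<longleftrightarrow>
     predictable M F T H \<and> semimartingale M F T Z \<and> (AE \<omega> in M. Z 0 \<omega> = 0) \<and>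
     (\<exists>Zn. (\<forall>n::nat. bounded_stoch_integral M F T
                (\<lambda>t \<omega>. if norm (H t \<omega>) \<le> real n then H t \<omega> else 0) X (Zn n)) \<and>
           emery_lim M F T Zn Z)"

text \<open>The stochastic exponential as the solution of \<open>E = 1 + \<integral>E\<^sub>- dY\<close>.\<close>

definition stoch_exponential ::
  "'w measure \<Rightarrow> (real \<Rightarrow> 'w measure) \<Rightarrow> real \<Rightarrow> ('w, real) process \<Rightarrow> ('w, real) process \<Rightarrow> bool" where
  "stoch_exponential M F T Y E \<longleftrightarrow>
     cadlag_adapted M F T E \<and>
     (\<exists>Z. has_stoch_integral M F T (left_lim E) Y Z \<and> indist M T E (\<lambda>t \<omega>. 1 + Z t \<omega>))"


subsection \<open>Levy processes\<close>

definition levy_process ::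
  "'w measure \<Rightarrow> (real \<Rightarrow> 'w measure) \<Rightarrow> real \<Rightarrow> ('w, 'v::euclidean_space) process \<Rightarrow> bool" where
  "levy_process M F T R \<longleftrightarrow>
     semimartingale M F T R \<and> (AE \<omega> in M. R 0 \<omega> = 0) \<and>
     (\<forall>s t. 0 \<le> s \<and> s \<le> t \<and> t \<le> T \<longrightarrow>
        prob_space.indep_set M (sets (F s))
          {(\<lambda>\<omega>. R t \<omega> - R s \<omega>) -` B \<inter> space M | B. B \<in> sets borel} \<and>
        distr M borel (\<lambda>\<omega>. R t \<omega> - R s \<omega>) = distr M borel (R (t - s)))"

text \<open>
  The Levy measure of a Borel set \<open>B\<close>: the expected number, per unit of time, of nonzero jumps
  with values in \<open>B\<close>.
\<close>

definition levy_measure :: "'w measure \<Rightarrow> real \<Rightarrow> ('w, 'v::euclidean_space) process \<Rightarrow> 'v set \<Rightarrow> ennreal" where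
  "levy_measure M T R B =
     (\<integral>\<^sup>+\<omega>. emeasure (count_space UNIV) {t\<in>{0<..T}. jump R t \<omega> \<in> B - {0}} \<partial>M) / ennreal T"

definition C0star :: "'w measure \<Rightarrow> real \<Rightarrow> ('w, 'v::euclidean_space) process \<Rightarrow> 'v set" where
  "C0star M T R = {y. levy_measure M T R {x. y \<bullet> x \<le> -1} = 0}"


subsection \<open>Wealth processes\<close>

definition trading_strategy ::
  "'w measure \<Rightarrow> (real \<Rightarrow> 'w measure) \<Rightarrow> real \<Rightarrow>
   ('w, 'v::euclidean_space) process \<Rightarrow> ('w, 'v) process \<Rightarrow> bool" where
  "trading_strategy M F T R \<pi> \<longleftrightarrow> predictable M F T \<pi> \<and> (\<exists>G. has_stoch_integral M F T \<pi> R G)"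

definition propensity_to_consume ::
  "'w measure \<Rightarrow> (real \<Rightarrow> 'w measure) \<Rightarrow> real \<Rightarrow> ('w, real) process \<Rightarrow> bool" where
  "propensity_to_consume M F T \<kappa> \<longleftrightarrow>
     optional M F T \<kappa> \<and> (\<forall>t\<in>{0..T}. \<forall>\<omega>\<in>space M. \<kappa> t \<omega> \<ge> 0) \<and>
     (AE \<omega> in M. set_integrable lborel {0..T} (\<lambda>s. \<kappa> s \<omega>))"

text \<open>\<open>X\<close> is a version of \<open>x0\<close> times the stochastic exponential of \<open>\<integral>\<pi> dR - \<delta> \<integral>\<kappa>\<^sub>s ds\<close>.\<close>

definition is_wealth ::
  "'w measure \<Rightarrow> (real \<Rightarrow> 'w measure) \<Rightarrow> real \<Rightarrow> real \<Rightarrow> real \<Rightarrow> ('w, 'v::euclidean_space) process \<Rightarrow>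
   ('w, 'v) process \<Rightarrow> ('w, real) process \<Rightarrow> ('w, real) process \<Rightarrow> bool" where
  "is_wealth M F T x0 \<delta> R \<pi> \<kappa> X \<longleftrightarrow>
     cadlag_adapted M F T X \<and>
     (\<exists>G Y E. has_stoch_integral M F T \<pi> R G \<and>
        cadlag_adapted M F T Y \<and>
        indist M T Y (\<lambda>t \<omega>. G t \<omega> - \<delta> * (LINT s:{0..t}|lborel. \<kappa> s \<omega>)) \<and>
        stoch_exponential M F T Y E \<and>
        indist M T X (\<lambda>t \<omega>. x0 * E t \<omega>))"

definition admissible ::
  "'w measure \<Rightarrow> (real \<Rightarrow> 'w measure) \<Rightarrow> real \<Rightarrow> real \<Rightarrow> real \<Rightarrow> ('w, 'v::euclidean_space) process \<Rightarrow>
   'v set \<Rightarrow> ('w, 'v) process \<Rightarrow> ('w, real) process \<Rightarrow> bool" where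
  "admissible M F T x0 \<delta> R C \<pi> \<kappa> \<longleftrightarrow>
     trading_strategy M F T R \<pi> \<and> propensity_to_consume M F T \<kappa> \<and>
     (\<exists>X. is_wealth M F T x0 \<delta> R \<pi> \<kappa> X \<and> (AE \<omega> in M. \<forall>t\<in>{0..T}. X t \<omega> > 0)) \<and>
     (\<forall>t\<in>{0..T}. \<forall>\<omega>\<in>space M. \<pi> t \<omega> \<in> C)"

definition wealth_processes ::
  "'w measure \<Rightarrow> (real \<Rightarrow> 'w measure) \<Rightarrow> real \<Rightarrow> real \<Rightarrow> real \<Rightarrow> ('w, 'v::euclidean_space) process \<Rightarrow>
   'v set \<Rightarrow> ('w, real) process set" where
  "wealth_processes M F T x0 \<delta> R C =
     {X. \<exists>\<pi> \<kappa>. admissible M F T x0 \<delta> R C \<pi> \<kappa> \<and> is_wealth M F T x0 \<delta> R \<pi> \<kappa> X}"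

definition same_wealth_processes ::
  "'w measure \<Rightarrow> (real \<Rightarrow> 'w measure) \<Rightarrow> real \<Rightarrow> real \<Rightarrow> real \<Rightarrow> ('w, 'v::euclidean_space) process \<Rightarrow>
   'v set \<Rightarrow> ('w, 'v) process \<Rightarrow> 'v set \<Rightarrow> bool" where
  "same_wealth_processes M F T x0 \<delta> R C R' C' \<longleftrightarrow>
     (\<forall>X\<in>wealth_processes M F T x0 \<delta> R C.
        \<exists>X'\<in>wealth_processes M F T x0 \<delta> R' C'. indist M T X X') \<and>
     (\<forall>X'\<in>wealth_processes M F T x0 \<delta> R' C'.
        \<exists>X\<in>wealth_processes M F T x0 \<delta> R C. indist M T X X')"

end

theory Submission
  imports Defs
begin

text \<open>
  Choose from \<open>C \<inter> C0star\<close> a basis of its span and let it be the columns of the transpose of \<open>\<Lambda>\<close>,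
  padded with zeros. Then (ii) is immediate, (i) says that vectors of \<open>C0star\<close> admit no jump of \<open>R\<close>
  with return at most \<open>-1\<close>, and a strategy for \<open>\<Lambda> R\<close> becomes one for \<open>R\<close> with the same integral by
  applying the transpose of \<open>\<Lambda>\<close>. Conversely, positivity of the wealth forces \<open>\<pi> \<bullet> \<Delta>R > -1\<close>, and the
  compensation formula for the jumps of \<open>R\<close> turns this into \<open>\<pi> \<in> C0star\<close> for almost every time and
  scenario. Replacing \<open>\<pi>\<close> by 0 elsewhere does not change the integral, and what remains takes values
  in the range of the transpose of \<open>\<Lambda>\<close>.

  That a Levy integral ignores integrands vanishing almost everywhere rests on an explicit
  construction of the integral: on a short interval of length \<open>h\<close> the mean and variance of the
  truncated increment and the probability of a large one are \<open>O(h)\<close>, so elementary integrals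
  are continuous from \<open>L\<^sup>2(dt \<otimes> P)\<close> to uniform convergence in probability. Integrals of unbounded
  integrands are reduced to bounded ones by the associativity of the integral.
\<close>

text \<open>The definitions only say what an integral is. That \<open>R\<close> can be integrated at
  all, and that the integral forgets \<open>Q\<close>-null sets, has to be produced from the law of
  its increments. These may have no moments, so they are cut off at a level \<open>a\<close>, and
  the truncated mean and variance are controlled through the characteristic function. For an
  integral \<open>Z\<close> of \<open>R\<close> no such law is at hand; its own integration operator
  is extracted from the Emery convergence that defines \<open>Z\<close>. The second obstacle is that
  unbounded integrals are defined by the truncations of one particular integrand. Passing to a
  strategy with a different norm changes all these truncations. So \<open>Z\<close> is recognised
  instead by its integrals of bounded multipliers \<open>K\<close> for which \<open>K H\<close> is
  bounded too, a description insensitive to how \<open>H\<close> was cut. Finally, the intersection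
  of \<open>C\<close> and \<open>C0star\<close> is in general neither a subspace nor closed, so the
  unit vectors must be sent to elements of that set itself.\<close>

section \<open>Cadlag paths\<close>

definition left_limit :: "(real \<Rightarrow> 'v::t2_space) \<Rightarrow> real \<Rightarrow> 'v" where
  "left_limit f t = (if t \<le> 0 then f 0 else Lim (at_left t) f)"

definition path_jump :: "(real \<Rightarrow> 'v::real_normed_vector) \<Rightarrow> real \<Rightarrow> 'v" where
  "path_jump f t = f t - left_limit f t"

lemma left_lim_eq: "left_lim X t \<omega> = left_limit (\<lambda>s. X s \<omega>) t"
  by (simp add: left_lim_def left_limit_def)

lemma jump_eq: "jump X t \<omega> = path_jump (\<lambda>s. X s \<omega>) t"
  by (simp add: jump_def path_jump_def left_lim_eq)

lemma left_limitI: "0 < t \<Longrightarrow> (f \<longlongrightarrow> l) (at_left t) \<Longrightarrow> left_limit f t = l"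
  by (simp add: left_limit_def tendsto_Lim)

lemma left_limit_0: "t \<le> 0 \<Longrightarrow> left_limit f t = f 0"
  by (simp add: left_limit_def)

lemma path_jump_0 [simp]: "path_jump f 0 = 0"
  by (simp add: path_jump_def left_limit_0)

lemma cadlag_left_limit: "cadlag_path T f \<Longrightarrow> 0 < t \<Longrightarrow> t \<le> T \<Longrightarrow> (f \<longlongrightarrow> left_limit f t) (at_left t)"
  unfolding cadlag_path_def by (metis greaterThanAtMost_iff left_limitI)

lemma cadlag_right: "cadlag_path T f \<Longrightarrow> 0 \<le> t \<Longrightarrow> t < T \<Longrightarrow> (f \<longlongrightarrow> f t) (at_right t)"
  unfolding cadlag_path_def by simp

lemma cadlag_path_compose:
  fixes f :: "real \<Rightarrow> 'v::t2_space"
  assumes "cadlag_path T f" "\<And>x. isCont h x"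
  shows "cadlag_path T (\<lambda>t. h (f t))"
  unfolding cadlag_path_def
  using isCont_tendsto_compose[OF assms(2)] cadlag_right[OF assms(1)] cadlag_left_limit[OF assms(1)]
  by (metis atLeastLessThan_iff greaterThanAtMost_iff)

lemma left_limit_compose:
  assumes "cadlag_path T f" "t \<le> T" "\<And>x. isCont h x"
  shows "left_limit (\<lambda>t. h (f t)) t = h (left_limit f t)"
proof (cases "t \<le> 0")
  case False
  then show ?thesis
    using isCont_tendsto_compose[OF assms(3) cadlag_left_limit[OF assms(1) _ assms(2)]]
    by (intro left_limitI) auto
qed (simp add: left_limit_0)

text \<open>With \<open>cadlag_path_compose\<close> this reduces sums and products of paths to a
  continuous map of the pair.\<close>

lemma cadlag_path_Pair:
  fixes f :: "real \<Rightarrow> 'v::t2_space" and g :: "real \<Rightarrow> 'u::t2_space"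
  assumes "cadlag_path T f" "cadlag_path T g"
  shows "cadlag_path T (\<lambda>t. (f t, g t))"
  unfolding cadlag_path_def
  using tendsto_Pair[OF cadlag_right[OF assms(1)] cadlag_right[OF assms(2)]]
    tendsto_Pair[OF cadlag_left_limit[OF assms(1)] cadlag_left_limit[OF assms(2)]]
  by (metis atLeastLessThan_iff greaterThanAtMost_iff)

lemma left_limit_Pair:
  assumes "cadlag_path T f" "cadlag_path T g" "t \<le> T"
  shows "left_limit (\<lambda>t. (f t, g t)) t = (left_limit f t, left_limit g t)"
proof (cases "t \<le> 0")
  case False
  then show ?thesis
    using tendsto_Pair[OF cadlag_left_limit[OF assms(1)] cadlag_left_limit[OF assms(2)]] assms(3)
    by (intro left_limitI) auto
qed (simp add: left_limit_0)

lemma cadlag_path_const [simp]: "cadlag_path T (\<lambda>t. c)"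
  unfolding cadlag_path_def by auto

lemma cadlag_path_continuous:
  assumes "continuous_on {0..T} f"
  shows "cadlag_path T f"
proof -
  have "(f \<longlongrightarrow> f t) (at_right t)" if "t \<in> {0..<T}" for t
    using continuous_on_Icc_at_rightD[of t T f] continuous_on_subset[OF assms, of "{t..T}"] that by auto
  moreover have "(f \<longlongrightarrow> f t) (at_left t)" if "t \<in> {0<..T}" for t
    using continuous_on_Icc_at_leftD[of 0 t f] continuous_on_subset[OF assms, of "{0..t}"] that by auto
  ultimately show ?thesis unfolding cadlag_path_def by blast
qed

lemma path_jump_continuous:
  assumes "continuous_on {0..T} f" "t \<le> T" "0 \<le> t"
  shows "path_jump f t = 0"
proof (cases "t = 0")
  case False
  then have "(f \<longlongrightarrow> f t) (at_left t)"
    using continuous_on_Icc_at_leftD[of 0 t f] continuous_on_subset[OF assms(1), of "{0..t}"] assms by auto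
  then show ?thesis using left_limitI[of t f "f t"] False assms by (simp add: path_jump_def)
qed simp

text \<open>Approach from the right may touch \<open>t\<close>, because the right limit is the value
  \<open>f t\<close>; at \<open>t = T\<close> the sequence is constant. From the left, in
  \<open>cadlag_seq_left\<close>, it has to stay strictly below \<open>t\<close>.\<close>

lemma cadlag_seq_right:
  assumes f: "cadlag_path T f" and t: "0 \<le> t" and v: "\<And>n. t \<le> v n" "\<And>n. v n \<le> T" "v \<longlonglongrightarrow> t"
  shows "(\<lambda>n. f (v n)) \<longlonglongrightarrow> f t"
proof (cases "t < T")
  case True
  have "at t within {t..} = at_right t"
    by (auto simp: at_within_def intro!: arg_cong[where f=principal] arg_cong2[where f=inf])
  then have "continuous (at t within {t..}) f"
    using cadlag_right[OF f t True] by (simp add: continuous_within)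
  then show ?thesis
    by (rule continuous_within_tendsto_compose') (use v in auto)
next
  case False
  then have "v n = t" for n using v(1)[of n] v(2)[of n] by simp
  then show ?thesis by simp
qed

lemma cadlag_seq_left:
  assumes f: "cadlag_path T f" and t: "t \<le> T" and v: "\<And>n. 0 \<le> v n" "\<And>n. v n < t" "v \<longlonglongrightarrow> t"
  shows "(\<lambda>n. f (v n)) \<longlonglongrightarrow> left_limit f t"
proof -
  have "0 < t" using v(1)[of 0] v(2)[of 0] by simp
  then have "(f \<longlongrightarrow> left_limit f t) (at_left t)" by (rule cadlag_left_limit[OF f _ t])
  moreover have "filterlim v (at_left t) sequentially"
    using v by (intro filterlim_at_withinI) (auto simp: less_imp_neq eventually_sequentiallyI)
  ultimately show ?thesis by (rule filterlim_compose)
qed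

text \<open>Times at which the path blows up have a convergent subsequence, and a further
  subsequence stays on one side of its limit. There the path converges, so it is bounded along
  it.\<close>

lemma bounded_cadlag:
  fixes f :: "real \<Rightarrow> 'v::real_normed_vector"
  assumes f: "cadlag_path T f"
  shows "bounded (f ` {0..T})"
proof (rule ccontr)
  assume "\<not> bounded (f ` {0..T})"
  then have "\<forall>n::nat. \<exists>t\<in>{0..T}. norm (f t) > n"
    unfolding bounded_iff by (metis image_iff linorder_not_le)
  then obtain u :: "nat \<Rightarrow> real" where u: "\<And>n. u n \<in> {0..T}" "\<And>n. norm (f (u n)) > real n" by metis
  obtain t r where t: "t \<in> {0..T}" "strict_mono r" "(u \<circ> r) \<longlonglongrightarrow> t"
    using compact_Icc[of 0 T] u(1) unfolding compact_def by metis
  have "\<exists>s l. strict_mono s \<and> (\<lambda>n. f (u (r (s n)))) \<longlonglongrightarrow> l"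
  proof (cases "\<forall>\<^sub>F n in sequentially. u (r n) < t")
    case True
    then obtain N where N: "\<And>n. n \<ge> N \<Longrightarrow> u (r n) < t" by (auto simp: eventually_sequentially)
    have "(\<lambda>n. f (u (r (n + N)))) \<longlonglongrightarrow> left_limit f t"
      using LIMSEQ_ignore_initial_segment[OF t(3), of N] u(1) N t(1)
      by (intro cadlag_seq_left[OF f]) (auto simp: comp_def)
    then show ?thesis by (intro exI[of _ "\<lambda>n. n + N"]) (auto simp: strict_mono_def)
  next
    case False
    then obtain s :: "nat \<Rightarrow> nat" where s: "strict_mono s" "\<And>n. \<not> u (r (s n)) < t"
      using not_eventually_sequentiallyD by blast
    have "(\<lambda>n. f (u (r (s n)))) \<longlonglongrightarrow> f t"
      using LIMSEQ_subseq_LIMSEQ[OF t(3) s(1)] u(1) s t(1)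
      by (intro cadlag_seq_right[OF f]) (auto simp: comp_def not_less)
    then show ?thesis using s by blast
  qed
  then obtain s l where s: "strict_mono s" "(\<lambda>n. f (u (r (s n)))) \<longlonglongrightarrow> l" by blast
  then obtain B where B: "\<And>n. norm (f (u (r (s n)))) \<le> B"
    using convergent_imp_bounded[OF s(2)] unfolding bounded_iff by auto
  obtain n :: nat where n: "real n > B" using reals_Archimedean2 by blast
  have "n \<le> r (s n)" using seq_suble[OF t(2)] seq_suble[OF s(1)] by (meson order_trans)
  then show False using u(2)[of "r (s n)"] B[of n] n by linarith
qed

text \<open>Large increments over shrinking intervals can only come from a jump. If infinitely many
  of the intervals lay on one side of the limit time \<open>t\<close>, both end points would see the
  same one-sided limit and the increments would tend to 0. So eventually
  \<open>v < t \<le> w\<close>, and the increments tend to the jump at \<open>t\<close>.\<close>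

lemma cadlag_close_jump:
  fixes f :: "real \<Rightarrow> 'v::real_normed_vector"
  assumes f: "cadlag_path T f"
    and vw: "\<And>n. 0 \<le> v n" "\<And>n. v n < w n" "\<And>n. w n \<le> T" "(\<lambda>n. w n - v n) \<longlonglongrightarrow> 0"
    and e: "e > 0" "\<And>n. norm (f (w n) - f (v n)) \<ge> e"
  obtains t r where "0 < t" "t \<le> T" "strict_mono r" "\<And>n. v (r n) < t" "\<And>n. t \<le> w (r n)"
    "(v \<circ> r) \<longlonglongrightarrow> t" "(w \<circ> r) \<longlonglongrightarrow> t" "norm (path_jump f t) \<ge> e"
proof -
  have vT: "v n \<in> {0..T}" for n using vw(1,2,3)[of n] by auto
  obtain t r where t: "t \<in> {0..T}" "strict_mono r" "(v \<circ> r) \<longlonglongrightarrow> t"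
    using compact_Icc[of 0 T] vT unfolding compact_def by metis
  have w: "(w \<circ> r) \<longlonglongrightarrow> t"
    using tendsto_add[OF LIMSEQ_subseq_LIMSEQ[OF vw(4) t(2)] t(3)] by (simp add: comp_def)
  have 1: "\<forall>\<^sub>F n in sequentially. v (r n) < t"
  proof (rule ccontr)
    assume "\<not> ?thesis"
    then obtain s :: "nat \<Rightarrow> nat" where s: "strict_mono s" "\<And>n. \<not> v (r (s n)) < t"
      using not_eventually_sequentiallyD by blast
    have "(\<lambda>n. f (v (r (s n)))) \<longlonglongrightarrow> f t"
      using LIMSEQ_subseq_LIMSEQ[OF t(3) s(1)] s t(1) vT
      by (intro cadlag_seq_right[OF f]) (auto simp: comp_def not_less)
    moreover have "t \<le> w (r (s n))" for n using s(2)[of n] vw(2)[of "r (s n)"] by linarith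
    then have "(\<lambda>n. f (w (r (s n)))) \<longlonglongrightarrow> f t"
      using LIMSEQ_subseq_LIMSEQ[OF w s(1)] vw(3) t(1)
      by (intro cadlag_seq_right[OF f]) (auto simp: comp_def)
    ultimately have "(\<lambda>n. norm (f (w (r (s n))) - f (v (r (s n))))) \<longlonglongrightarrow> norm (f t - f t)"
      by (intro tendsto_intros)
    then have "e \<le> norm (f t - f t)" by (rule LIMSEQ_le_const) (use e in auto)
    then show False using e by simp
  qed
  have 2: "\<forall>\<^sub>F n in sequentially. t \<le> w (r n)"
  proof (rule ccontr)
    assume "\<not> ?thesis"
    then obtain s :: "nat \<Rightarrow> nat" where s: "strict_mono s" "\<And>n. \<not> t \<le> w (r (s n))"
      using not_eventually_sequentiallyD by blast
    have wt: "w (r (s n)) < t" for n using s(2)[of n] by simp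
    have "(\<lambda>n. f (v (r (s n)))) \<longlonglongrightarrow> left_limit f t"
      using LIMSEQ_subseq_LIMSEQ[OF t(3) s(1)] t(1) vT vw(2) wt
      by (intro cadlag_seq_left[OF f]) (auto simp: comp_def intro: less_trans)
    moreover have "(\<lambda>n. f (w (r (s n)))) \<longlonglongrightarrow> left_limit f t"
      using LIMSEQ_subseq_LIMSEQ[OF w s(1)] t(1) wt order.trans[OF vw(1) less_imp_le[OF vw(2)]]
      by (intro cadlag_seq_left[OF f]) (auto simp: comp_def)
    ultimately have "(\<lambda>n. norm (f (w (r (s n))) - f (v (r (s n)))))
        \<longlonglongrightarrow> norm (left_limit f t - left_limit f t)"
      by (intro tendsto_intros)
    then have "e \<le> norm (left_limit f t - left_limit f t)" by (rule LIMSEQ_le_const) (use e in auto)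
    then show False using e by simp
  qed
  obtain N where N: "\<And>n. n \<ge> N \<Longrightarrow> v (r n) < t \<and> t \<le> w (r n)"
    using eventually_conj[OF 1 2] by (auto simp: eventually_sequentially)
  define q where "q n = r (n + N)" for n
  have q: "strict_mono q" "\<And>n. v (q n) < t" "\<And>n. t \<le> w (q n)"
    using t(2) N by (auto simp: q_def strict_mono_def)
  have vq: "(v \<circ> q) \<longlonglongrightarrow> t" and wq: "(w \<circ> q) \<longlonglongrightarrow> t"
    using LIMSEQ_ignore_initial_segment[OF t(3), of N] LIMSEQ_ignore_initial_segment[OF w, of N]
    by (simp_all add: comp_def q_def)
  have "(\<lambda>n. f (v (q n))) \<longlonglongrightarrow> left_limit f t"
    using vq q vw(1) t(1) by (intro cadlag_seq_left[OF f]) (auto simp: comp_def)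
  moreover have "(\<lambda>n. f (w (q n))) \<longlonglongrightarrow> f t"
    using wq q vw(3) t(1) by (intro cadlag_seq_right[OF f]) (auto simp: comp_def)
  ultimately have "(\<lambda>n. norm (f (w (q n)) - f (v (q n)))) \<longlonglongrightarrow> norm (f t - left_limit f t)"
    by (intro tendsto_intros)
  then have "e \<le> norm (path_jump f t)" unfolding path_jump_def by (rule LIMSEQ_le_const) (use e in auto)
  moreover have "0 < t" using q(2)[of 0] vw(1)[of "q 0"] by linarith
  ultimately show ?thesis using that[of t q] q vq wq t(1) by auto
qed

text \<open>Otherwise intervals of length below \<open>1 / real (Suc n)\<close> without a big jump
  would contradict \<open>cadlag_close_jump\<close>. The bound \<open>e\<close> is not weakened,
  since there the jump is the limit of the increments themselves.\<close>

lemma cadlag_modulus: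
  fixes f :: "real \<Rightarrow> 'v::real_normed_vector"
  assumes f: "cadlag_path T f" and e: "e > 0"
  obtains \<delta> where "\<delta> > 0"
    "\<And>v w. 0 \<le> v \<Longrightarrow> v < w \<Longrightarrow> w \<le> T \<Longrightarrow> w - v < \<delta> \<Longrightarrow> norm (f w - f v) \<ge> e \<Longrightarrow>
       \<exists>u\<in>{v<..w}. norm (path_jump f u) \<ge> e"
proof -
  have "\<exists>\<delta>>0. \<forall>v w. 0 \<le> v \<longrightarrow> v < w \<longrightarrow> w \<le> T \<longrightarrow> w - v < \<delta> \<longrightarrow> norm (f w - f v) \<ge> e \<longrightarrow>
       (\<exists>u\<in>{v<..w}. norm (path_jump f u) \<ge> e)"
  proof (rule ccontr)
    assume *: "\<not> ?thesis"
    then have "\<exists>v w. 0 \<le> v \<and> v < w \<and> w \<le> T \<and> w - v < 1 / real (Suc n) \<and> norm (f w - f v) \<ge> e \<and>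
       \<not> (\<exists>u\<in>{v<..w}. norm (path_jump f u) \<ge> e)" for n
      by (meson zero_less_divide_1_iff of_nat_0_less_iff zero_less_Suc)
    then obtain v w where vw: "\<And>n. 0 \<le> v n" "\<And>n. v n < w n" "\<And>n. w n \<le> T"
      "\<And>n. w n - v n < 1 / real (Suc n)" "\<And>n. norm (f (w n) - f (v n)) \<ge> e"
      "\<And>n. \<not> (\<exists>u\<in>{v n<..w n}. norm (path_jump f u) \<ge> e)" by metis
    have "(\<lambda>n. w n - v n) \<longlonglongrightarrow> 0"
      by (rule tendsto_sandwich[OF _ _ tendsto_const LIMSEQ_inverse_real_of_nat])
        (use vw(2,4) in \<open>auto intro!: always_eventually less_imp_le simp: inverse_eq_divide\<close>)
    from cadlag_close_jump[OF f vw(1,2,3) this e vw(5)] show False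
      using vw(6) by (metis greaterThanAtMost_iff)
  qed
  then show ?thesis using that by blast
qed

text \<open>At an accumulation point \<open>t\<close> of big jump times \<open>u n\<close>, pick
  \<open>v n\<close> slightly to the left of \<open>u n\<close> with an increment of at least
  \<open>e / 2\<close>, and not left of \<open>t\<close> when \<open>u n\<close> is right of
  \<open>t\<close>. No interval \<open>{v n<..u n}\<close> then contains \<open>t\<close>, which
  \<open>cadlag_close_jump\<close> forbids.\<close>

lemma finite_big_jumps:
  fixes f :: "real \<Rightarrow> 'v::real_normed_vector"
  assumes f: "cadlag_path T f" and e: "e > 0"
  shows "finite {u\<in>{0<..T}. norm (path_jump f u) \<ge> e}" (is "finite ?J")
proof (rule ccontr)
  assume inf: "infinite ?J"
  have "?J \<subseteq> {0..T}" by auto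
  then obtain t where t: "t \<in> {0..T}" "t islimpt ?J"
    using inf compact_Icc[of 0 T] compact_eq_Bolzano_Weierstrass by meson
  obtain u where u: "\<And>n. u n \<in> ?J - {t}" "u \<longlonglongrightarrow> t"
    using t(2) unfolding islimpt_sequential by blast
  have "\<exists>v. 0 \<le> v \<and> v < u n \<and> u n - v < 1 / Suc n \<and> norm (f (u n) - f v) \<ge> e / 2 \<and> (t < u n \<longrightarrow> t \<le> v)" for n
  proof -
    have un: "0 < u n" "u n \<le> T" "u n \<noteq> t" "norm (path_jump f (u n)) \<ge> e" using u(1)[of n] by auto
    have "((\<lambda>v. norm (f (u n) - f v)) \<longlongrightarrow> norm (path_jump f (u n))) (at_left (u n))"
      unfolding path_jump_def by (intro tendsto_intros cadlag_left_limit[OF f un(1,2)])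
    then have "\<forall>\<^sub>F v in at_left (u n). norm (f (u n) - f v) > e / 2"
      by (rule order_tendstoD) (use un e in auto)
    moreover have "\<forall>\<^sub>F v in at_left (u n). v \<in> {max (max 0 (u n - 1 / Suc n)) (if t < u n then t else 0)<..<u n}"
      by (rule eventually_at_leftI[of "max (max 0 (u n - 1 / Suc n)) (if t < u n then t else 0)"])
        (use un in auto)
    ultimately have "\<forall>\<^sub>F v in at_left (u n). 0 \<le> v \<and> v < u n \<and> u n - v < 1 / Suc n \<and> norm (f (u n) - f v) \<ge> e / 2 \<and> (t < u n \<longrightarrow> t \<le> v)"
      by eventually_elim (auto split: if_splits)
    then show ?thesis using eventually_happens' trivial_limit_at_left_real by blast
  qed
  then obtain v where v: "\<And>n. 0 \<le> v n" "\<And>n. v n < u n" "\<And>n. u n - v n < 1 / Suc n"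
    "\<And>n. norm (f (u n) - f (v n)) \<ge> e / 2" "\<And>n. t < u n \<Longrightarrow> t \<le> v n" by metis
  have lim: "(\<lambda>n. u n - v n) \<longlonglongrightarrow> 0"
    by (rule tendsto_sandwich[OF _ _ tendsto_const LIMSEQ_inverse_real_of_nat])
      (use v(2,3) in \<open>auto intro!: always_eventually less_imp_le simp: inverse_eq_divide\<close>)
  have uT: "u n \<le> T" "u n \<noteq> t" for n using u(1)[of n] by auto
  obtain s r where s: "strict_mono r" "\<And>n. v (r n) < s" "\<And>n. s \<le> u (r n)" "(u \<circ> r) \<longlonglongrightarrow> s"
    using cadlag_close_jump[OF f v(1,2) uT(1) lim _ v(4)] e by (metis half_gt_zero)
  have "s = t" using LIMSEQ_unique[OF s(4) LIMSEQ_subseq_LIMSEQ[OF u(2) s(1)]] .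
  then show False using s(2,3)[of 0] v(5)[of "r 0"] uT(2)[of "r 0"] by force
qed

text \<open>A uniform distance between paths passes to their left limits, which are therefore
  Cauchy; then the two limits are exchanged. The second claim is what carries jumps through limits
  of integrals in \<open>op_jump\<close>.\<close>

lemma cadlag_uniform_limit:
  fixes f :: "nat \<Rightarrow> real \<Rightarrow> 'v::banach"
  assumes f: "\<And>n. cadlag_path T (f n)" and g: "uniform_limit {0..T} f g sequentially"
  shows "cadlag_path T g"
    and "t \<in> {0..T} \<Longrightarrow> (\<lambda>n. left_limit (f n) t) \<longlonglongrightarrow> left_limit g t"
proof -
  have ft: "(\<lambda>n. f n t) \<longlonglongrightarrow> g t" if "t \<in> {0..T}" for t
    by (rule tendsto_uniform_limitI[OF g that])
  have R: "(g \<longlongrightarrow> g t) (at_right t)" if "t \<in> {0..<T}" for t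
  proof (rule swap_uniform_limit'[OF _ ft g])
    show "\<forall>\<^sub>F n in sequentially. (f n \<longlongrightarrow> f n t) (at_right t)"
      using f that by (auto intro!: always_eventually cadlag_right)
    show "\<forall>\<^sub>F x in at_right t. x \<in> {0..T}"
      by (rule eventually_at_rightI[of _ T]) (use that in auto)
  qed (use that in auto)
  have L: "\<exists>l. (g \<longlongrightarrow> l) (at_left t) \<and> (\<lambda>n. left_limit (f n) t) \<longlonglongrightarrow> l" if t: "t \<in> {0<..T}" for t
  proof -
    have fl: "(f n \<longlongrightarrow> left_limit (f n) t) (at_left t)" for n
      using f t by (auto intro!: cadlag_left_limit)
    have ev: "\<forall>\<^sub>F x in at_left t. x \<in> {0..T}"
      by (rule eventually_at_leftI[of 0]) (use t in auto)
    have "Cauchy (\<lambda>n. left_limit (f n) t)"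
    proof (rule metric_CauchyI)
      fix e :: real assume e: "e > 0"
      obtain N where N: "\<And>n x. n \<ge> N \<Longrightarrow> x \<in> {0..T} \<Longrightarrow> dist (f n x) (g x) < e / 4"
        using uniform_limitD[OF g, of "e / 4"] e unfolding eventually_sequentially
        by (metis zero_less_divide_iff zero_less_numeral)
      show "\<exists>M. \<forall>m\<ge>M. \<forall>n\<ge>M. dist (left_limit (f m) t) (left_limit (f n) t) < e"
      proof (intro exI allI impI)
        fix m n assume mn: "m \<ge> N" "n \<ge> N"
        have "\<forall>\<^sub>F x in at_left t. dist (f m x) (f n x) \<le> e / 2"
          using ev
        proof eventually_elim
          case (elim x)
          have "dist (f m x) (f n x) \<le> dist (f m x) (g x) + dist (f n x) (g x)"
            by (rule dist_triangle2)
          then show ?case using N[OF mn(1) elim] N[OF mn(2) elim] by linarith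
        qed
        then have "dist (left_limit (f m) t) (left_limit (f n) t) \<le> e / 2"
          by (intro tendsto_upperbound[OF tendsto_dist[OF fl fl]]) auto
        then show "dist (left_limit (f m) t) (left_limit (f n) t) < e" using e by linarith
      qed
    qed
    then obtain l where l: "(\<lambda>n. left_limit (f n) t) \<longlonglongrightarrow> l"
      using Cauchy_convergent_iff convergent_def by blast
    have "(g \<longlongrightarrow> l) (at_left t)"
      by (rule swap_uniform_limit'[OF _ l g ev]) (use fl in auto)
    with l show ?thesis by blast
  qed
  show "cadlag_path T g" unfolding cadlag_path_def using R L by blast
  show "(\<lambda>n. left_limit (f n) t) \<longlonglongrightarrow> left_limit g t" if "t \<in> {0..T}"
  proof (cases "t = 0")
    case True
    then show ?thesis using ft[of 0] that by (simp add: left_limit_0)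
  next
    case False
    then show ?thesis using L[of t] left_limitI[of t g] that by force
  qed
qed

text \<open>This makes suprema over all times measurable. A value in an open set persists a little
  to the right, except at \<open>T\<close>, which is why \<open>T\<close> joins the
  rationals.\<close>

lemma cadlag_ex_dense:
  assumes f: "cadlag_path T f" and U: "open U" and T: "T > 0"
  shows "(\<exists>t\<in>{0..T}. f t \<in> U) \<longleftrightarrow> (\<exists>t\<in>{0..T} \<inter> (\<rat> \<union> {T}). f t \<in> U)"
proof
  assume "\<exists>t\<in>{0..T}. f t \<in> U"
  then obtain t where t: "t \<in> {0..T}" "f t \<in> U" by blast
  show "\<exists>t\<in>{0..T} \<inter> (\<rat> \<union> {T}). f t \<in> U"
  proof (cases "t = T")
    case False
    then have "\<forall>\<^sub>F s in at_right t. f s \<in> U"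
      using t by (intro topological_tendstoD[OF cadlag_right[OF f] U]) auto
    then obtain b where b: "b > t" "\<And>s. t < s \<Longrightarrow> s < b \<Longrightarrow> f s \<in> U"
      unfolding eventually_at_right_field by blast
    obtain q where "q \<in> \<rat>" "t < q" "q < min b T"
      using Rats_dense_in_real[of t "min b T"] b(1) False t(1) by auto
    then show ?thesis using b(2)[of q] t(1) by (intro bexI[of _ q]) auto
  qed (use t in auto)
qed auto

text \<open>At \<open>u = c\<close> the stopped path still has the left limit of \<open>f\<close>:
  stopping at \<open>c\<close> keeps the jump at \<open>c\<close>.\<close>

lemma left_limit_min:
  assumes f: "cadlag_path T f" and c: "0 \<le> c" "c \<le> T"
  shows "cadlag_path T (\<lambda>u. f (min u c))"
    and "u \<le> T \<Longrightarrow> left_limit (\<lambda>u. f (min u c)) u = (if u \<le> c then left_limit f u else f c)"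
proof -
  have L: "((\<lambda>u. f (min u c)) \<longlongrightarrow> (if u \<le> c then left_limit f u else f c)) (at_left u)" if "0 < u" "u \<le> T" for u
  proof (cases "u \<le> c")
    case True
    then have "\<forall>\<^sub>F v in at_left u. f v = f (min v c)"
      by (intro eventually_at_leftI[of "u - 1"]) auto
    from tendsto_cong[OF this] show ?thesis using cadlag_left_limit[OF f that] True by simp
  next
    case False
    then have "\<forall>\<^sub>F v in at_left u. f c = f (min v c)"
      by (intro eventually_at_leftI[of c]) auto
    from Lim_transform_eventually[OF tendsto_const this] show ?thesis using False by simp
  qed
  have R: "((\<lambda>u. f (min u c)) \<longlongrightarrow> f (min u c)) (at_right u)" if "0 \<le> u" "u < T" for u
  proof (cases "u < c")
    case True
    then have "\<forall>\<^sub>F v in at_right u. f v = f (min v c)"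
      by (intro eventually_at_rightI[of _ c]) auto
    from tendsto_cong[OF this] show ?thesis using cadlag_right[OF f that] True by simp
  next
    case False
    then have "\<forall>\<^sub>F v in at_right u. f c = f (min v c)"
      by (intro eventually_at_rightI[of _ "u + 1"]) auto
    from Lim_transform_eventually[OF tendsto_const this] show ?thesis using False by simp
  qed
  show "cadlag_path T (\<lambda>u. f (min u c))" unfolding cadlag_path_def
    using L R by (metis atLeastLessThan_iff greaterThanAtMost_iff)
  show "left_limit (\<lambda>u. f (min u c)) u = (if u \<le> c then left_limit f u else f c)" if "u \<le> T"
  proof (cases "u \<le> 0")
    case True
    then show ?thesis using c by (simp add: left_limit_0)
  next
    case False
    then show ?thesis using L[of u] that by (intro left_limitI) auto
  qed
qed

lemma ex_grid_cell:
  fixes s h u :: real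
  assumes "0 < h" "s < u" "u \<le> s + h" "N > 0"
  shows "\<exists>i<N. s + real i * h / real N < u \<and> u \<le> s + real (Suc i) * h / real N"
proof -
  define z where "z = (u - s) * N / h"
  have "(u - s) * N \<le> h * N" using assms by (intro mult_right_mono) auto
  then have z: "0 < z" "z \<le> N" using assms by (auto simp: z_def field_simps)
  define i where "i = nat (\<lceil>z\<rceil> - 1)"
  have "real i = of_int \<lceil>z\<rceil> - 1" using z by (simp add: i_def)
  then have i: "real i < z" "z \<le> real (Suc i)" by linarith+
  have "i < N" using i z by linarith
  moreover have "u = s + z * h / N" using assms by (simp add: z_def field_simps)
  moreover have "real i * h / N < z * h / N" "z * h / N \<le> real (Suc i) * h / N"
    using i assms by (auto intro!: divide_strict_right_mono divide_right_mono mult_right_mono)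
  ultimately show ?thesis by auto
qed

lemma grid_cell_mono:
  fixes s h :: real
  assumes "0 \<le> h" "i < j"
  shows "s + real (Suc i) * h / real N \<le> s + real j * h / real N"
proof -
  have "real (Suc i) \<le> real j" using assms by simp
  then have "real (Suc i) * h / real N \<le> real j * h / real N"
    by (intro divide_right_mono mult_right_mono) (use assms in auto)
  then show ?thesis by simp
qed

text \<open>It turns a sum over jumps into functions of increments, to which independence applies.
  On a fine grid, \<open>cadlag_modulus\<close> puts a big jump into every cell whose increment is
  at least \<open>e\<close>, and distinct big jumps fall into distinct cells; \<open>g\<close> kills
  the remaining cells. The increment over the cell of a fixed jump time tends to that jump.\<close>

lemma discretize_jump_sum:
  fixes f :: "real \<Rightarrow> 'v::real_normed_vector" and g :: "'v \<Rightarrow> real"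
  assumes f: "cadlag_path T f" and e: "e > 0" and g: "\<And>x. isCont g x" "\<And>x. norm x < e \<Longrightarrow> g x = 0"
    and st: "0 \<le> s" "0 < h" "s + h \<le> T"
  shows "(\<lambda>n. \<Sum>i<Suc n. g (f (s + real (Suc i) * h / real (Suc n)) - f (s + real i * h / real (Suc n))))
    \<longlonglongrightarrow> (\<Sum>u\<in>{u\<in>{s<..s + h}. norm (path_jump f u) \<ge> e}. g (path_jump f u))"
proof -
  define J where "J = {u\<in>{s<..s + h}. norm (path_jump f u) \<ge> e}"
  define l where "l n i = s + real i * h / real (Suc n)" for n i
  define d where "d n i = f (l n (Suc i)) - f (l n i)" for n i
  have J: "finite J" "J \<subseteq> {s<..s + h}"
    unfolding J_def by (rule finite_subset[OF _ finite_big_jumps[OF f e]]) (use st in auto)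
  have lT: "0 \<le> l n i" "l n (Suc i) \<le> T" "l n i < l n (Suc i)" "l n (Suc i) - l n i = h / Suc n" if "i < Suc n" for n i
  proof -
    show "0 \<le> l n i" using st by (simp add: l_def)
    show eq: "l n (Suc i) - l n i = h / Suc n"
      by (simp add: l_def diff_divide_distrib[symmetric] algebra_simps)
    moreover have "h / Suc n > 0" using st by simp
    ultimately show "l n i < l n (Suc i)" by linarith
    have "real (Suc i) * h \<le> real (Suc n) * h" using that st by (intro mult_right_mono) auto
    then have "real (Suc i) * h / real (Suc n) \<le> h" by (simp add: field_simps)
    then show "l n (Suc i) \<le> T" using st unfolding l_def by linarith
  qed
  define k where "k n u = (SOME i. i < Suc n \<and> l n i < u \<and> u \<le> l n (Suc i))" for n u
  have k: "k n u < Suc n \<and> l n (k n u) < u \<and> u \<le> l n (Suc (k n u))" if "u \<in> {s<..s + h}" for n u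
  proof -
    have "\<exists>i. i < Suc n \<and> l n i < u \<and> u \<le> l n (Suc i)"
      using ex_grid_cell[OF st(2), of s u "Suc n"] that unfolding l_def by auto
    then show ?thesis unfolding k_def by (rule someI_ex)
  qed
  have k_unique: "k n u = i" if "u \<in> {s<..s + h}" "l n i < u" "u \<le> l n (Suc i)" for n u i
  proof (rule ccontr)
    assume "k n u \<noteq> i"
    then consider "k n u < i" | "i < k n u" by linarith
    then show False
      using grid_cell_mono[of h "k n u" i s "Suc n"] grid_cell_mono[of h i "k n u" s "Suc n"]
        k[OF that(1), of n] that st by cases (auto simp: l_def)
  qed
  obtain \<delta> where \<delta>: "\<delta> > 0"
    "\<And>v w. 0 \<le> v \<Longrightarrow> v < w \<Longrightarrow> w \<le> T \<Longrightarrow> w - v < \<delta> \<Longrightarrow> norm (f w - f v) \<ge> e \<Longrightarrow>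
       \<exists>u\<in>{v<..w}. norm (path_jump f u) \<ge> e"
    using cadlag_modulus[OF f e] by metis
  have "\<forall>u\<in>J. \<exists>d>0. \<forall>v\<in>J. v \<noteq> u \<longrightarrow> d \<le> dist u v"
    using finite_set_avoid[OF J(1)] by blast
  then obtain \<eta>0 where \<eta>0: "\<And>u. u \<in> J \<Longrightarrow> \<eta>0 u > 0" "\<And>u v. u \<in> J \<Longrightarrow> v \<in> J \<Longrightarrow> v \<noteq> u \<Longrightarrow> \<eta>0 u \<le> dist u v"
    by metis
  \<comment> \<open>A lower bound for the distance between big jump times; \<open>insert 1\<close>
    keeps the minimum defined when there is none.\<close>
  define \<eta> where "\<eta> = Min (insert 1 (\<eta>0 ` J))"
  have \<eta>: "\<eta> > 0" "\<And>u v. u \<in> J \<Longrightarrow> v \<in> J \<Longrightarrow> v \<noteq> u \<Longrightarrow> \<eta> \<le> dist u v"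
  proof -
    show "\<eta> > 0" using J(1) \<eta>0(1) by (auto simp: \<eta>_def)
    fix u v assume uv: "u \<in> J" "v \<in> J" "v \<noteq> u"
    have "\<eta> \<le> \<eta>0 u" using J(1) uv by (simp add: \<eta>_def)
    then show "\<eta> \<le> dist u v" using \<eta>0(2)[OF uv] by simp
  qed
  have mesh: "(\<lambda>n. h / real (Suc n)) \<longlonglongrightarrow> 0"
    using LIMSEQ_inverse_real_of_nat tendsto_mult_right_zero[of "\<lambda>n. inverse (real (Suc n))"]
    by (simp add: divide_inverse)
  have "\<forall>\<^sub>F n in sequentially. h / real (Suc n) < min \<delta> \<eta>"
    by (rule order_tendstoD(2)[OF mesh]) (use \<delta>(1) \<eta>(1) in auto)
  then have ev: "\<forall>\<^sub>F n in sequentially. (\<Sum>u\<in>J. g (d n (k n u))) = (\<Sum>i<Suc n. g (d n i))"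
  proof eventually_elim
    case (elim n)
    then have n: "h / Suc n < \<delta>" "h / Suc n < \<eta>" by auto
    have "inj_on (k n) J"
    proof (rule inj_onI)
      fix u v assume uv: "u \<in> J" "v \<in> J" "k n u = k n v"
      have "dist u v < \<eta>"
        using k[of u n] k[of v n] lT(4)[of "k n u" n] uv J(2) n by (force simp: dist_real_def)
      then show "u = v" using \<eta>(2)[OF uv(1,2)] by force
    qed
    then have "(\<Sum>u\<in>J. g (d n (k n u))) = (\<Sum>i\<in>k n ` J. g (d n i))" by (simp add: sum.reindex)
    also have "\<dots> = (\<Sum>i<Suc n. g (d n i))"
    proof (rule sum.mono_neutral_left)
      show "k n ` J \<subseteq> {..<Suc n}" using k J(2) by blast
      show "\<forall>i\<in>{..<Suc n} - k n ` J. g (d n i) = 0"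
      proof
        fix i assume i: "i \<in> {..<Suc n} - k n ` J"
        show "g (d n i) = 0"
        proof (rule ccontr)
          assume "g (d n i) \<noteq> 0"
          then have "norm (d n i) \<ge> e" using g(2) by force
          then obtain u where u: "u \<in> {l n i<..l n (Suc i)}" "norm (path_jump f u) \<ge> e"
            using \<delta>(2)[of "l n i" "l n (Suc i)"] lT[of i n] i n unfolding d_def by auto
          have "u \<in> {s<..s + h}"
          proof -
            have "s \<le> l n i" using st by (simp add: l_def)
            moreover have "l n (Suc i) \<le> s + h"
              using grid_cell_mono[of h i "Suc n" s "Suc n"] i st by (auto simp: l_def)
            ultimately show ?thesis using u by auto
          qed
          then have "u \<in> J" "k n u = i" using u k_unique[of u n i] by (auto simp: J_def)
          then show False using i by blast
        qed
      qed
    qed simp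
    finally show ?case .
  qed
  have "(\<lambda>n. \<Sum>u\<in>J. g (d n (k n u))) \<longlonglongrightarrow> (\<Sum>u\<in>J. g (path_jump f u))"
  proof (rule tendsto_sum)
    fix u assume u: "u \<in> J"
    then have uh: "u \<in> {s<..s + h}" using J(2) by blast
    note ku = k[OF uh] and lk = lT[OF k[OF uh, THEN conjunct1]]
    have 1: "(\<lambda>n. l n (k n u)) \<longlonglongrightarrow> u"
    proof (rule tendsto_sandwich[OF _ _ _ tendsto_const])
      show "(\<lambda>n. u - h / Suc n) \<longlonglongrightarrow> u" using tendsto_diff[OF tendsto_const mesh, of u] by simp
    qed (use ku lk(4) in \<open>auto intro!: always_eventually simp: algebra_simps intro: less_imp_le\<close>)
    have "l n (Suc (k n u)) = l n (k n u) + h / Suc n" for n using lk(4)[of n] by linarith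
    then have 2: "(\<lambda>n. l n (Suc (k n u))) \<longlonglongrightarrow> u"
      using tendsto_add[OF 1 mesh] by (simp del: of_nat_Suc)
    have "(\<lambda>n. f (l n (k n u))) \<longlonglongrightarrow> left_limit f u"
      by (rule cadlag_seq_left[OF f _ _ _ 1]) (use ku lk uh st in auto)
    moreover have "(\<lambda>n. f (l n (Suc (k n u)))) \<longlonglongrightarrow> f u"
      by (rule cadlag_seq_right[OF f _ _ _ 2]) (use ku lk uh st in auto)
    ultimately have "(\<lambda>n. d n (k n u)) \<longlonglongrightarrow> path_jump f u"
      unfolding d_def path_jump_def by (rule tendsto_diff[rotated])
    then show "(\<lambda>n. g (d n (k n u))) \<longlonglongrightarrow> g (path_jump f u)"
      by (rule isCont_tendsto_compose[OF g(1)])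
  qed
  from Lim_transform_eventually[OF this ev] show ?thesis
    unfolding d_def l_def J_def .
qed

section \<open>Levy processes on short time intervals\<close>

text \<open>In the second order Taylor formula the remainder is \<open>cos t / 2 * x\<^sup>2\<close>
  up to sign, with \<open>t\<close> of absolute value at most 1, hence below pi / 3, where the
  cosine is at least 1/2.\<close>

lemma one_minus_cos_ge:
  fixes x :: real
  assumes "\<bar>x\<bar> \<le> 1"
  shows "x\<^sup>2 / 4 \<le> 1 - cos x"
proof -
  obtain t where t: "\<bar>t\<bar> \<le> \<bar>x\<bar>"
    "cos x = (\<Sum>m<2. cos_coeff m * x ^ m) + (cos (t + 1/2 * real 2 * pi) / fact 2) * x\<^sup>2"
    using Maclaurin_cos_expansion[of x 2] by blast
  have "cos (pi / 3) \<le> cos \<bar>t\<bar>"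
    by (rule cos_monotone_0_pi_le) (use t assms pi_gt3 in auto)
  then have c: "1 / 2 \<le> cos t" by (simp add: cos_60)
  have "1 - cos x = cos t / 2 * x\<^sup>2"
    using t(2) by (simp add: cos_coeff_def numeral_2_eq_2)
  moreover have "x\<^sup>2 / 4 \<le> cos t / 2 * x\<^sup>2"
    using mult_right_mono[OF c, of "x\<^sup>2"] by simp
  ultimately show ?thesis by simp
qed

text \<open>From \<open>q \<le> exp (- (1 - q))\<close> follows
  \<open>exp (n * (1 - q)) \<le> 4 \<le> exp 2\<close>. In this way a lower bound for
  \<open>n\<close> independent steps together becomes a bound of order \<open>1 / n\<close> for the
  defect of one step.\<close>

lemma power_ge_quarter:
  fixes q :: real
  assumes "0 \<le> q" "1 / 4 \<le> q ^ n" "n > 0"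
  shows "1 - q \<le> 2 / n"
proof -
  have "q \<le> exp (- (1 - q))" using exp_ge_add_one_self[of "- (1 - q)"] by simp
  then have "1 / 4 \<le> exp (- (1 - q)) ^ n" using assms power_mono[of q _ n] by (meson order_trans)
  also have "\<dots> = exp (- (n * (1 - q)))" by (simp add: exp_of_nat_mult[symmetric] algebra_simps)
  also have "\<dots> = 1 / exp (n * (1 - q))" by (simp only: exp_minus inverse_eq_divide)
  finally have "exp (n * (1 - q)) \<le> 4" using exp_gt_zero[of "n * (1 - q)"] by (simp add: le_divide_eq)
  also have "(4::real) \<le> exp 2"
  proof -
    have "(2::real) \<le> exp 1" using exp_ge_add_one_self[of 1] by simp
    then have "(2::real)\<^sup>2 \<le> (exp 1)\<^sup>2" by (intro power_mono) auto
    then show ?thesis by (simp add: exp_double[symmetric])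
  qed
  finally have "n * (1 - q) \<le> 2" by simp
  then show ?thesis using assms by (simp add: field_simps)
qed

text \<open>Take the integer part of \<open>T / h\<close>; the factor 2 comes from
  \<open>T / h < n + 1 \<le> 2 * n\<close>.\<close>

lemma grid_number:
  fixes h T :: real
  assumes "0 < h" "h \<le> T"
  obtains n :: nat where "n > 0" "real n * h \<le> T" "1 / real n \<le> 2 * h / T"
proof -
  define n where "n = nat \<lfloor>T / h\<rfloor>"
  have "1 \<le> T / h" using assms by simp
  then have n: "n > 0" "real n \<le> T / h" "T / h < real n + 1"
    unfolding n_def by linarith+
  have "real n * h \<le> T" using n(2) assms by (simp add: field_simps)
  moreover have "T / h \<le> 2 * real n" using n by linarith
  then have "1 / real n \<le> 2 * h / T" using n assms by (simp add: field_simps)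
  ultimately show ?thesis using n(1) that by blast
qed

definition trunc :: "real \<Rightarrow> real \<Rightarrow> real" where
  "trunc a x = (if \<bar>x\<bar> \<le> a then x else 0)"

lemma trunc_measurable [measurable]: "trunc a \<in> borel_measurable borel"
  unfolding trunc_def by measurable

lemma abs_trunc_le: "0 \<le> a \<Longrightarrow> \<bar>trunc a x\<bar> \<le> a"
  by (auto simp: trunc_def)

lemma Int_stable_vimage: "Int_stable {f -` B \<inter> \<Omega> | B. B \<in> sets N}"
proof (rule Int_stableI)
  fix a b assume "a \<in> {f -` B \<inter> \<Omega> | B. B \<in> sets N}" "b \<in> {f -` B \<inter> \<Omega> | B. B \<in> sets N}"
  then obtain A B where "a = f -` A \<inter> \<Omega>" "A \<in> sets N" "b = f -` B \<inter> \<Omega>" "B \<in> sets N" by blast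
  then have "a \<inter> b = f -` (A \<inter> B) \<inter> \<Omega> \<and> A \<inter> B \<in> sets N" by auto
  then show "a \<inter> b \<in> {f -` B \<inter> \<Omega> | B. B \<in> sets N}" by blast
qed

context prob_space
begin

lemma integrable_bounded:
  fixes Y :: "'a \<Rightarrow> 'v::{banach, second_countable_topology}"
  assumes "Y \<in> borel_measurable M" "\<And>\<omega>. \<omega> \<in> space M \<Longrightarrow> norm (Y \<omega>) \<le> c"
  shows "integrable M Y"
  by (rule integrable_const_bound[where B=c]) (use assms in auto)

text \<open>The quantity \<open>P(A) E[Y\<^sup>2; A] - E[Y; A]\<^sup>2\<close> is half the second moment of the
  symmetrization \<open>Y - Y'\<close> restricted to \<open>\<bar>Y\<bar> \<le> a\<close> and \<open>\<bar>Y'\<bar> \<le> a\<close>, which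
  is controlled by the modulus of the characteristic function.\<close>

lemma symmetrized_variance_bound:
  fixes Y :: "'a \<Rightarrow> real"
  assumes [measurable]: "Y \<in> borel_measurable M" and a: "0 < u" "0 < a" "u * (2 * a) \<le> 1"
  defines "A \<equiv> \<lambda>x. if \<bar>x\<bar> \<le> a then 1 else 0::real"
  shows "u\<^sup>2 / 2 * (expectation (\<lambda>\<omega>. A (Y \<omega>)) * expectation (\<lambda>\<omega>. (trunc a (Y \<omega>))\<^sup>2) - (expectation (\<lambda>\<omega>. trunc a (Y \<omega>)))\<^sup>2)
    \<le> 1 - ((expectation (\<lambda>\<omega>. cos (u * Y \<omega>)))\<^sup>2 + (expectation (\<lambda>\<omega>. sin (u * Y \<omega>)))\<^sup>2)"
proof -
  have [measurable]: "A \<in> borel_measurable borel" unfolding A_def by measurable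
  define p where "p = expectation (\<lambda>\<omega>. A (Y \<omega>))"
  define m1 where "m1 = expectation (\<lambda>\<omega>. trunc a (Y \<omega>))"
  define m2 where "m2 = expectation (\<lambda>\<omega>. (trunc a (Y \<omega>))\<^sup>2)"
  define C where "C = expectation (\<lambda>\<omega>. cos (u * Y \<omega>))"
  define S where "S = expectation (\<lambda>\<omega>. sin (u * Y \<omega>))"
  have ta: "\<bar>trunc a x\<bar> \<le> a" for x using abs_trunc_le a by simp
  have ta2: "(trunc a x)\<^sup>2 \<le> a\<^sup>2" for x using ta[of x] a by (simp add: abs_le_square_iff[symmetric])
  have int [simp]: "integrable M (\<lambda>\<omega>. A (Y \<omega>))" "integrable M (\<lambda>\<omega>. trunc a (Y \<omega>))"
    "integrable M (\<lambda>\<omega>. (trunc a (Y \<omega>))\<^sup>2)" "integrable M (\<lambda>\<omega>. cos (u * Y \<omega>))" "integrable M (\<lambda>\<omega>. sin (u * Y \<omega>))"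
    by (rule integrable_bounded[where c=1] integrable_bounded[where c=a] integrable_bounded[where c="a\<^sup>2"];
        use ta ta2 in \<open>auto simp: A_def\<close>)+
  \<comment> \<open>In place of an independent copy of \<open>Y\<close>, the value \<open>y\<close>
    is frozen and the law of \<open>Y\<close> is integrated twice. The addition theorem splits
    \<open>cos (u * y - u * x)\<close> into products, so that \<open>C * C + S * S\<close> appears
    at the end.\<close>
  have inner: "u\<^sup>2 / 4 * (A y * m2 - 2 * trunc a y * m1 + (trunc a y)\<^sup>2 * p) \<le> 1 - cos (u * y) * C - sin (u * y) * S" for y
  proof -
    have "expectation (\<lambda>\<omega>. u\<^sup>2 / 4 * (A y * (trunc a (Y \<omega>))\<^sup>2 - 2 * trunc a y * trunc a (Y \<omega>) + (trunc a y)\<^sup>2 * A (Y \<omega>)))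
      \<le> expectation (\<lambda>\<omega>. 1 - cos (u * y) * cos (u * Y \<omega>) - sin (u * y) * sin (u * Y \<omega>))"
    proof (rule integral_mono)
      fix \<omega>
      define x where "x = Y \<omega>"
      have eq: "1 - cos (u * y) * cos (u * x) - sin (u * y) * sin (u * x) = 1 - cos (u * y - u * x)"
        by (simp add: cos_diff)
      have "u\<^sup>2 / 4 * (A y * (trunc a x)\<^sup>2 - 2 * trunc a y * trunc a x + (trunc a y)\<^sup>2 * A x) \<le> 1 - cos (u * y - u * x)"
      proof (cases "\<bar>x\<bar> \<le> a \<and> \<bar>y\<bar> \<le> a")
        case True
        then have "\<bar>y - x\<bar> \<le> 2 * a" by linarith
        then have "u * \<bar>y - x\<bar> \<le> 1" using a by (meson mult_left_mono less_imp_le order_trans)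
        then have "\<bar>u * y - u * x\<bar> \<le> 1" using a by (simp add: abs_mult right_diff_distrib[symmetric])
        moreover have "A y * (trunc a x)\<^sup>2 - 2 * trunc a y * trunc a x + (trunc a y)\<^sup>2 * A x = (y - x)\<^sup>2"
          using True by (simp add: A_def trunc_def power2_eq_square algebra_simps)
        moreover have "u\<^sup>2 / 4 * (y - x)\<^sup>2 = (u * y - u * x)\<^sup>2 / 4"
          by (simp add: right_diff_distrib[symmetric] power_mult_distrib)
        ultimately show ?thesis using one_minus_cos_ge[of "u * y - u * x"] by simp
      next
        case False
        then have "A y * (trunc a x)\<^sup>2 - 2 * trunc a y * trunc a x + (trunc a y)\<^sup>2 * A x = 0"
          by (auto simp: A_def trunc_def)
        then show ?thesis by simp
      qed
      then show "u\<^sup>2 / 4 * (A y * (trunc a (Y \<omega>))\<^sup>2 - 2 * trunc a y * trunc a (Y \<omega>) + (trunc a y)\<^sup>2 * A (Y \<omega>))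
          \<le> 1 - cos (u * y) * cos (u * Y \<omega>) - sin (u * y) * sin (u * Y \<omega>)"
        unfolding x_def[symmetric] eq .
    qed (intro integrable_mult_right integrable_mult_left Bochner_Integration.integrable_add Bochner_Integration.integrable_diff int integrable_const)+
    also have "expectation (\<lambda>\<omega>. u\<^sup>2 / 4 * (A y * (trunc a (Y \<omega>))\<^sup>2 - 2 * trunc a y * trunc a (Y \<omega>) + (trunc a y)\<^sup>2 * A (Y \<omega>)))
      = u\<^sup>2 / 4 * (A y * m2 - 2 * trunc a y * m1 + (trunc a y)\<^sup>2 * p)"
      unfolding p_def m1_def m2_def by simp
    also have "expectation (\<lambda>\<omega>. 1 - cos (u * y) * cos (u * Y \<omega>) - sin (u * y) * sin (u * Y \<omega>)) = 1 - cos (u * y) * C - sin (u * y) * S"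
      unfolding C_def S_def by (simp add: prob_space)
    finally show ?thesis .
  qed
  have "expectation (\<lambda>\<omega>. u\<^sup>2 / 4 * (A (Y \<omega>) * m2 - 2 * trunc a (Y \<omega>) * m1 + (trunc a (Y \<omega>))\<^sup>2 * p))
    \<le> expectation (\<lambda>\<omega>. 1 - cos (u * Y \<omega>) * C - sin (u * Y \<omega>) * S)"
    by (rule integral_mono[OF _ _ inner];
      intro integrable_mult_right integrable_mult_left Bochner_Integration.integrable_add Bochner_Integration.integrable_diff int integrable_const)
  also have "expectation (\<lambda>\<omega>. u\<^sup>2 / 4 * (A (Y \<omega>) * m2 - 2 * trunc a (Y \<omega>) * m1 + (trunc a (Y \<omega>))\<^sup>2 * p))
     = u\<^sup>2 / 4 * (p * m2 - 2 * m1 * m1 + m2 * p)"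
    by (simp add: p_def[symmetric] m1_def[symmetric] m2_def[symmetric])
  also have "expectation (\<lambda>\<omega>. 1 - cos (u * Y \<omega>) * C - sin (u * Y \<omega>) * S) = 1 - C * C - S * S"
    by (simp add: C_def[symmetric] S_def[symmetric] prob_space)
  finally have "u\<^sup>2 / 4 * (p * m2 - 2 * m1 * m1 + m2 * p) \<le> 1 - C * C - S * S" .
  then show ?thesis
    unfolding p_def[symmetric] m1_def[symmetric] m2_def[symmetric] C_def[symmetric] S_def[symmetric]
    by (simp add: power2_eq_square field_simps)
qed

end

section \<open>The filtered space and processes with independent stationary increments\<close>

locale stoch_basis =
  fixes M :: "'w measure" and F :: "real \<Rightarrow> 'w measure" and T :: real
  assumes T_pos: "T > 0" and usual: "usual_conditions M F T"
begin

sublocale prob_space M using usual by (simp add: usual_conditions_def)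

lemma space_F [simp]: "space (F t) = space M"
  using usual by (auto simp: usual_conditions_def filtration_def)

lemma sets_F_mono: "s \<le> t \<Longrightarrow> sets (F s) \<subseteq> sets (F t)"
  using usual by (auto simp: usual_conditions_def filtration_def)

lemma sets_F_M: "sets (F t) \<subseteq> sets M"
  using usual by (auto simp: usual_conditions_def subalgebra_def)

lemma null_sets_F: "0 \<le> t \<Longrightarrow> N \<in> null_sets M \<Longrightarrow> N \<in> sets (F t)"
  using usual sets_F_mono[of 0 t] by (auto simp: usual_conditions_def)

lemma measurable_F_mono: "f \<in> measurable (F s) N \<Longrightarrow> s \<le> t \<Longrightarrow> f \<in> measurable (F t) N"
  using sets_F_mono[of s t] by (auto simp: measurable_def)

lemma measurable_F_M: "f \<in> measurable (F s) N \<Longrightarrow> f \<in> measurable M N"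
  using sets_F_M[of s] by (auto simp: measurable_def)

lemma cadlag_adaptedD:
  assumes "cadlag_adapted M F T X"
  shows "\<omega> \<in> space M \<Longrightarrow> cadlag_path T (\<lambda>t. X t \<omega>)"
    and "0 \<le> t \<Longrightarrow> t \<le> T \<Longrightarrow> X t \<in> borel_measurable (F t)"
    and "0 \<le> t \<Longrightarrow> t \<le> T \<Longrightarrow> X t \<in> borel_measurable M"
  using assms measurable_F_M[of "X t" t] unfolding cadlag_adapted_def adapted_def by auto

lemma sup_event_eq:
  assumes X: "cadlag_adapted M F T X" and U: "open U"
  shows "{\<omega>\<in>space M. \<exists>t\<in>{0..T}. X t \<omega> \<in> U} =
    (\<Union>t\<in>{0..T} \<inter> (\<rat> \<union> {T}). X t -` U \<inter> space M)"
  using cadlag_ex_dense[OF cadlag_adaptedD(1)[OF X] U T_pos] by blast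

lemma sup_event_measurable:
  assumes X: "cadlag_adapted M F T X" and U: "open U"
  shows "{\<omega>\<in>space M. \<exists>t\<in>{0..T}. X t \<omega> \<in> U} \<in> sets M"
  unfolding sup_event_eq[OF assms]
  by (intro sets.countable_UN' countable_Int2 countable_Un countable_rat)
    (use cadlag_adaptedD(3)[OF X] U in \<open>auto simp: measurable_def\<close>)

text \<open>The exceedance events decrease to the empty set, because every single path is
  bounded.\<close>

lemma sup_tight:
  fixes X :: "('w, 'v::real_normed_vector) process"
  assumes X: "cadlag_adapted M F T X" and e: "e > 0"
  obtains a0 where "a0 > 0" "\<And>a. a \<ge> a0 \<Longrightarrow> prob {\<omega>\<in>space M. \<exists>t\<in>{0..T}. norm (X t \<omega>) > a} < e"
proof -
  define B where "B a = {\<omega>\<in>space M. \<exists>t\<in>{0..T}. norm (X t \<omega>) > a}" for a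
  have Bm: "B a \<in> sets M" for a
  proof -
    have "open {x::'v. norm x > a}" by (intro open_Collect_less continuous_intros)
    from sup_event_measurable[OF X this] show ?thesis by (simp add: B_def)
  qed
  have "(\<Inter>n::nat. B n) = {}"
  proof safe
    fix \<omega> assume \<omega>: "\<omega> \<in> (\<Inter>n::nat. B n)"
    then have "\<omega> \<in> space M" by (auto simp: B_def)
    then obtain c where c: "\<And>t. t \<in> {0..T} \<Longrightarrow> norm (X t \<omega>) \<le> c"
      using bounded_cadlag[OF cadlag_adaptedD(1)[OF X]] unfolding bounded_iff by blast
    obtain n :: nat where "c \<le> n" using real_arch_simple by blast
    moreover have "\<omega> \<in> B n" using \<omega> by blast
    then obtain t where "t \<in> {0..T}" "norm (X t \<omega>) > n" by (auto simp: B_def)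
    ultimately show "\<omega> \<in> {}" using c[of t] by linarith
  qed
  moreover have "(\<lambda>n::nat. prob (B n)) \<longlonglongrightarrow> prob (\<Inter>n::nat. B n)"
  proof (rule finite_Lim_measure_decseq)
    show "decseq (\<lambda>n::nat. B n)"
    proof (rule decseq_SucI, rule subsetI)
      fix n \<omega> assume "\<omega> \<in> B (Suc n)"
      then obtain t where "t \<in> {0..T}" "norm (X t \<omega>) > Suc n" "\<omega> \<in> space M" by (auto simp: B_def)
      moreover from this have "norm (X t \<omega>) > n" by simp
      ultimately show "\<omega> \<in> B n" unfolding B_def by blast
    qed
  qed (use Bm in auto)
  ultimately have "(\<lambda>n::nat. prob (B n)) \<longlonglongrightarrow> 0" by simp
  then have "\<forall>\<^sub>F n::nat in sequentially. prob (B n) < e" using e by (rule order_tendstoD)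
  then obtain n :: nat where n: "prob (B n) < e" by (auto simp: eventually_sequentially)
  show ?thesis
  proof (rule that[of "real n + 1"])
    fix a assume "a \<ge> real n + 1"
    then have "B a \<subseteq> B n" by (force simp: B_def)
    from finite_measure_mono[OF this Bm] show "prob {\<omega>\<in>space M. \<exists>t\<in>{0..T}. norm (X t \<omega>) > a} < e"
      using n by (simp add: B_def)
  qed simp
qed

text \<open>The part of \<open>levy_process\<close> that survives projection to a coordinate
  (\<open>levy_component\<close>), so that one-dimensional estimates apply to \<open>R\<close>. The
  case \<open>s = t = 0\<close> forces the law of \<open>X 0\<close> to be that of the constant 0,
  see \<open>levy_zero\<close>.\<close>

definition levy_increments :: "('w, 'v::real_normed_vector) process \<Rightarrow> bool" where
  "levy_increments X \<longleftrightarrow> cadlag_adapted M F T X \<and>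
     (\<forall>s t. 0 \<le> s \<and> s \<le> t \<and> t \<le> T \<longrightarrow>
        indep_set (sets (F s)) {(\<lambda>\<omega>. X t \<omega> - X s \<omega>) -` B \<inter> space M | B. B \<in> sets borel} \<and>
        distr M borel (\<lambda>\<omega>. X t \<omega> - X s \<omega>) = distr M borel (X (t - s)))"

lemma levy_process_increments: "levy_process M F T X \<Longrightarrow> levy_increments X"
  by (auto simp: levy_process_def levy_increments_def semimartingale_def)

lemma levy_indep_var:
  fixes X :: "('w, 'v::{real_normed_vector, second_countable_topology}) process" and Y :: "'w \<Rightarrow> 'u::topological_space"
  assumes X: "levy_increments X" and st: "0 \<le> s" "s \<le> t" "t \<le> T"
    and Y: "Y \<in> borel_measurable (F s)" and g: "g \<in> borel_measurable borel"
  shows "indep_var borel Y borel (\<lambda>\<omega>. g (X t \<omega> - X s \<omega>))"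
proof -
  have [measurable]: "X t \<in> borel_measurable M" "X s \<in> borel_measurable M" "Y \<in> borel_measurable M"
    using X st cadlag_adaptedD(3)[of X] measurable_F_M[OF Y] by (auto simp: levy_increments_def)
  let ?D = "\<lambda>\<omega>. X t \<omega> - X s \<omega>" and ?gD = "\<lambda>\<omega>. g (X t \<omega> - X s \<omega>)"
  have ind: "indep_set (sets (F s)) {?D -` B \<inter> space M | B. B \<in> sets borel}"
    using X st by (auto simp: levy_increments_def)
  have Ys: "{Y -` B \<inter> space M | B. B \<in> sets borel} \<subseteq> sets (F s)"
    using measurable_sets[OF Y] by auto
  have Ds: "{?gD -` B \<inter> space M | B. B \<in> sets borel} \<subseteq> {?D -` B \<inter> space M | B. B \<in> sets borel}"
  proof clarify
    fix B :: "'u set" assume "B \<in> sets borel"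
    then have "g -` B \<in> sets borel" using measurable_sets[OF g] by simp
    then show "\<exists>B'. ?gD -` B \<inter> space M = ?D -` B' \<inter> space M \<and> B' \<in> sets borel"
      by (intro exI[of _ "g -` B"]) auto
  qed
  have "indep_set {Y -` B \<inter> space M | B. B \<in> sets borel} {?gD -` B \<inter> space M | B. B \<in> sets borel}"
    by (rule indep_setI[OF _ _ indep_setD[OF ind]])
      (use Ys Ds indep_setD_ev1[OF ind] indep_setD_ev2[OF ind] in \<open>meson subset_trans subsetD\<close>)+
  then have "indep_set (sigma_sets (space M) {Y -` B \<inter> space M | B. B \<in> sets borel})
      (sigma_sets (space M) {?gD -` B \<inter> space M | B. B \<in> sets borel})"
    by (rule indep_set_sigma_sets) (rule Int_stable_vimage)+
  then show ?thesis unfolding indep_var_eq using g by simp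
qed

lemma levy_distr:
  fixes X :: "('w, 'v::{real_normed_vector, second_countable_topology}) process" and g :: "'v \<Rightarrow> real"
  assumes X: "levy_increments X" and st: "0 \<le> s" "s \<le> t" "t \<le> T" and [measurable]: "g \<in> borel_measurable borel"
  shows "expectation (\<lambda>\<omega>. g (X t \<omega> - X s \<omega>)) = expectation (\<lambda>\<omega>. g (X (t - s) \<omega>))"
proof -
  have [measurable]: "X t \<in> borel_measurable M" "X s \<in> borel_measurable M" "X (t - s) \<in> borel_measurable M"
    using X st cadlag_adaptedD(3)[of X] by (auto simp: levy_increments_def)
  have "expectation (\<lambda>\<omega>. g (X t \<omega> - X s \<omega>)) = (\<integral>x. g x \<partial>distr M borel (\<lambda>\<omega>. X t \<omega> - X s \<omega>))"
    by (subst integral_distr) auto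
  also have "\<dots> = (\<integral>x. g x \<partial>distr M borel (X (t - s)))"
    using X st by (simp add: levy_increments_def)
  finally show ?thesis by (subst (asm) integral_distr) auto
qed

lemma levy_expectation_mult:
  fixes X :: "('w, 'v::{real_normed_vector, second_countable_topology}) process" and g :: "'v \<Rightarrow> real"
  assumes X: "levy_increments X" and st: "0 \<le> s" "s \<le> t" "t \<le> T"
    and Y: "Y \<in> borel_measurable (F s)" "integrable M Y"
    and g [measurable]: "g \<in> borel_measurable borel" and int: "integrable M (\<lambda>\<omega>. g (X t \<omega> - X s \<omega>))"
  shows "expectation (\<lambda>\<omega>. Y \<omega> * g (X t \<omega> - X s \<omega>)) = expectation Y * expectation (\<lambda>\<omega>. g (X (t - s) \<omega>))"
proof -
  have "indep_var borel Y borel (\<lambda>\<omega>. g (X t \<omega> - X s \<omega>))"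
    by (rule levy_indep_var[OF X st Y(1) g])
  then have "expectation (\<lambda>\<omega>. Y \<omega> * g (X t \<omega> - X s \<omega>)) = expectation Y * expectation (\<lambda>\<omega>. g (X t \<omega> - X s \<omega>))"
    by (intro indep_var_lebesgue_integral) (use Y int in \<open>auto simp: comp_def\<close>)
  then show ?thesis using levy_distr[OF X st g] by simp
qed

end

text \<open>The bound is required everywhere instead of almost everywhere, so that the notion refers
  to no measure and passes between \<open>F s\<close> and \<open>M\<close>.\<close>

definition bdd_rv :: "'a measure \<Rightarrow> ('a \<Rightarrow> real) \<Rightarrow> bool" where
  "bdd_rv N f \<longleftrightarrow> f \<in> borel_measurable N \<and> (\<exists>c. \<forall>\<omega>\<in>space N. \<bar>f \<omega>\<bar> \<le> c)"

lemma bdd_rvI: "f \<in> borel_measurable N \<Longrightarrow> (\<And>\<omega>. \<omega> \<in> space N \<Longrightarrow> \<bar>f \<omega>\<bar> \<le> c) \<Longrightarrow> bdd_rv N f"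
  unfolding bdd_rv_def by blast

lemma bdd_rv_measurable: "bdd_rv N f \<Longrightarrow> f \<in> borel_measurable N"
  by (simp add: bdd_rv_def)

lemma bdd_rvE:
  assumes "bdd_rv N f"
  obtains c where "0 \<le> c" "\<And>\<omega>. \<omega> \<in> space N \<Longrightarrow> \<bar>f \<omega>\<bar> \<le> c"
proof -
  obtain c where "\<forall>\<omega>\<in>space N. \<bar>f \<omega>\<bar> \<le> c" using assms unfolding bdd_rv_def by blast
  then show ?thesis using that[of "max 0 c"] by fastforce
qed

lemma bdd_rv_const [simp]: "bdd_rv N (\<lambda>_. c)"
  by (rule bdd_rvI[where c="\<bar>c\<bar>"]) auto

lemma bdd_rv_add:
  assumes "bdd_rv N f" "bdd_rv N g"
  shows "bdd_rv N (\<lambda>\<omega>. f \<omega> + g \<omega>)"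
proof -
  obtain c where "\<And>\<omega>. \<omega> \<in> space N \<Longrightarrow> \<bar>f \<omega>\<bar> \<le> c" using bdd_rvE[OF assms(1)] by blast
  moreover obtain d where "\<And>\<omega>. \<omega> \<in> space N \<Longrightarrow> \<bar>g \<omega>\<bar> \<le> d" using bdd_rvE[OF assms(2)] by blast
  ultimately show ?thesis using assms[THEN bdd_rv_measurable]
    by (intro bdd_rvI[where c="c + d"]) (auto intro!: order_trans[OF abs_triangle_ineq] add_mono)
qed

lemma bdd_rv_mult:
  assumes "bdd_rv N f" "bdd_rv N g"
  shows "bdd_rv N (\<lambda>\<omega>. f \<omega> * g \<omega>)"
proof -
  obtain c where "0 \<le> c" "\<And>\<omega>. \<omega> \<in> space N \<Longrightarrow> \<bar>f \<omega>\<bar> \<le> c" using bdd_rvE[OF assms(1)] by blast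
  moreover obtain d where "\<And>\<omega>. \<omega> \<in> space N \<Longrightarrow> \<bar>g \<omega>\<bar> \<le> d" using bdd_rvE[OF assms(2)] by blast
  ultimately show ?thesis using assms[THEN bdd_rv_measurable]
    by (intro bdd_rvI[where c="c * d"]) (auto simp: abs_mult intro!: mult_mono)
qed

lemma bdd_rv_diff: "bdd_rv N f \<Longrightarrow> bdd_rv N g \<Longrightarrow> bdd_rv N (\<lambda>\<omega>. f \<omega> - g \<omega>)"
  using bdd_rv_add[OF _ bdd_rv_mult[OF bdd_rv_const[of N "-1"]], of f g] by simp

lemma bdd_rv_power: "bdd_rv N f \<Longrightarrow> bdd_rv N (\<lambda>\<omega>. f \<omega> ^ n)"
  by (induction n) (auto intro: bdd_rv_mult)

lemma bdd_rv_sum: "(\<And>i. i \<in> I \<Longrightarrow> bdd_rv N (f i)) \<Longrightarrow> bdd_rv N (\<lambda>\<omega>. \<Sum>i\<in>I. f i \<omega>)"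
  by (induction I rule: infinite_finite_induct) (auto intro: bdd_rv_add)

lemma bdd_rv_abs: "bdd_rv N f \<Longrightarrow> bdd_rv N (\<lambda>\<omega>. \<bar>f \<omega>\<bar>)"
  by (auto simp: bdd_rv_def)

lemma bdd_rv_compose: "bdd_rv N' g \<Longrightarrow> f \<in> measurable N N' \<Longrightarrow> bdd_rv N (\<lambda>\<omega>. g (f \<omega>))"
  unfolding bdd_rv_def by (blast intro: measurable_compose dest: measurable_space)

lemmas bdd_rv_intros = bdd_rv_const bdd_rv_add bdd_rv_mult bdd_rv_diff bdd_rv_power bdd_rv_sum bdd_rv_abs

lemma bdd_rv_trunc: "bdd_rv borel (trunc a)"
  by (rule bdd_rvI[where c="\<bar>a\<bar>"]) (auto simp: trunc_def)

lemma (in finite_measure) bdd_rv_integrable: "bdd_rv M f \<Longrightarrow> integrable M f"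
  unfolding bdd_rv_def by (metis AE_I2 integrable_const_bound real_norm_def)

context stoch_basis
begin

lemma levy_cadlag: "levy_increments X \<Longrightarrow> cadlag_adapted M F T X"
  by (simp add: levy_increments_def)

lemma levy_measurable:
  assumes "levy_increments X" "0 \<le> t" "t \<le> T"
  shows "X t \<in> borel_measurable (F t)" "X t \<in> borel_measurable M"
  using cadlag_adaptedD[OF levy_cadlag[OF assms(1)]] assms by auto

lemma levy_increment_measurable:
  fixes X :: "('w, 'v::{real_normed_vector, second_countable_topology}) process"
  assumes X: "levy_increments X" and "0 \<le> s" "s \<le> t" "t \<le> u" "u \<le> T"
  shows "(\<lambda>\<omega>. X t \<omega> - X s \<omega>) \<in> borel_measurable (F u)"
  using levy_measurable(1)[OF X, of t] levy_measurable(1)[OF X, of s] assms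
  by (intro borel_measurable_diff) (auto intro: measurable_F_mono)

lemma bdd_rv_F_mono: "bdd_rv (F s) f \<Longrightarrow> s \<le> t \<Longrightarrow> bdd_rv (F t) f"
  unfolding bdd_rv_def by (auto intro: measurable_F_mono)

lemma bdd_rv_F_M: "bdd_rv (F s) f \<Longrightarrow> bdd_rv M f"
  unfolding bdd_rv_def by (auto intro: measurable_F_M)

section \<open>Weighted sums of centred increments along a time grid\<close>

context
  fixes X :: "('w, real) process" and p :: "nat \<Rightarrow> real" and g :: "real \<Rightarrow> real"
    and D :: "nat \<Rightarrow> 'w \<Rightarrow> real" and n :: nat
  assumes X: "levy_increments X"
    and p: "\<And>i. i < n \<Longrightarrow> p i \<le> p (Suc i)" "\<And>i. i \<le> n \<Longrightarrow> 0 \<le> p i" "\<And>i. i \<le> n \<Longrightarrow> p i \<le> T"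
    and g: "bdd_rv borel g"
  defines "D \<equiv> \<lambda>i \<omega>. g (X (p (Suc i)) \<omega> - X (p i) \<omega>) - expectation (\<lambda>\<omega>. g (X (p (Suc i) - p i) \<omega>))"
begin

lemma grid_mono: "i \<le> j \<Longrightarrow> j \<le> n \<Longrightarrow> p i \<le> p j"
proof (induction j rule: nat_induct_at_least)
  case (Suc k)
  then show ?case using p(1)[of k] by auto
qed simp

lemma centered_bdd_rv: "i < k \<Longrightarrow> k \<le> n \<Longrightarrow> bdd_rv (F (p k)) (D i)"
  using grid_mono[of i "Suc i"] grid_mono[of "Suc i" k] p(2)[of i] p(3)[of k] unfolding D_def
  by (intro bdd_rv_intros bdd_rv_compose[OF g] levy_increment_measurable[OF X]) auto

text \<open>The summands are martingale differences: the weight \<Xi> k is known at time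
  \<open>p k\<close>, while \<open>D k\<close> has mean zero and is independent of the past. Hence
  the mixed terms vanish and the squares factorise.\<close>

lemma centered_sum_second_moment:
  fixes \<Xi> :: "nat \<Rightarrow> 'w \<Rightarrow> real"
  assumes \<Xi>: "\<And>i. i < k \<Longrightarrow> bdd_rv (F (p i)) (\<Xi> i)" and k: "k \<le> n"
  shows "expectation (\<lambda>\<omega>. (\<Sum>i<k. \<Xi> i \<omega> * D i \<omega>)\<^sup>2)
    = (\<Sum>i<k. expectation (\<lambda>\<omega>. (\<Xi> i \<omega>)\<^sup>2) * variance (\<lambda>\<omega>. g (X (p (Suc i) - p i) \<omega>)))"
  using assms
proof (induction k)
  case (Suc k)
  define b where "b i = expectation (\<lambda>\<omega>. g (X (p (Suc i) - p i) \<omega>))" for i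
  define S where "S \<omega> = (\<Sum>i<k. \<Xi> i \<omega> * D i \<omega>)" for \<omega>
  have S: "bdd_rv (F (p k)) S" unfolding S_def
    by (intro bdd_rv_intros centered_bdd_rv bdd_rv_F_mono[OF Suc.prems(1) grid_mono]) (use Suc.prems in auto)
  have \<Xi>k: "bdd_rv (F (p k)) (\<Xi> k)" and Dk: "bdd_rv M (D k)"
    using Suc.prems centered_bdd_rv[of k "Suc k"] by (auto intro: bdd_rv_F_M)
  have pk: "0 \<le> p k" "p k \<le> p (Suc k)" "p (Suc k) \<le> T"
    using p(1)[of k] p(2)[of k] p(3)[of "Suc k"] Suc.prems by auto
  have Xm: "X (p (Suc k) - p k) \<in> borel_measurable M" using levy_measurable(2)[OF X] pk by auto
  have D_eq: "D k = (\<lambda>\<omega>. g (X (p (Suc k)) \<omega> - X (p k) \<omega>) - b k)" by (simp add: D_def b_def fun_eq_iff)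
  note M = bdd_rv_F_M[OF S] bdd_rv_F_M[OF \<Xi>k] Dk
  have intX: "integrable M (\<lambda>\<omega>. g (X (p (Suc k) - p k) \<omega>))"
    by (intro bdd_rv_integrable bdd_rv_compose[OF g Xm])
  have cross: "expectation (\<lambda>\<omega>. (S \<omega> * \<Xi> k \<omega>) * D k \<omega>) = 0"
  proof -
    have "expectation (\<lambda>\<omega>. (S \<omega> * \<Xi> k \<omega>) * (g (X (p (Suc k)) \<omega> - X (p k) \<omega>) - b k))
      = expectation (\<lambda>\<omega>. S \<omega> * \<Xi> k \<omega>) * expectation (\<lambda>\<omega>. g (X (p (Suc k) - p k) \<omega>) - b k)"
      using S \<Xi>k g Dk M
      by (intro levy_expectation_mult[OF X pk, where g="\<lambda>x. g x - b k"])
        (auto simp: D_eq intro!: bdd_rv_integrable bdd_rv_mult borel_measurable_times borel_measurable_diff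
          dest: bdd_rv_measurable)
    also have "expectation (\<lambda>\<omega>. g (X (p (Suc k) - p k) \<omega>) - b k) = 0"
      using intX by (simp add: b_def prob_space)
    finally show ?thesis by (simp add: D_eq)
  qed
  have sq: "expectation (\<lambda>\<omega>. (\<Xi> k \<omega>)\<^sup>2 * (D k \<omega>)\<^sup>2) = expectation (\<lambda>\<omega>. (\<Xi> k \<omega>)\<^sup>2) * variance (\<lambda>\<omega>. g (X (p (Suc k) - p k) \<omega>))"
  proof -
    have "expectation (\<lambda>\<omega>. (\<Xi> k \<omega>)\<^sup>2 * (g (X (p (Suc k)) \<omega> - X (p k) \<omega>) - b k)\<^sup>2)
      = expectation (\<lambda>\<omega>. (\<Xi> k \<omega>)\<^sup>2) * expectation (\<lambda>\<omega>. (g (X (p (Suc k) - p k) \<omega>) - b k)\<^sup>2)"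
      using \<Xi>k g Dk M bdd_rv_power[OF \<Xi>k, of 2] bdd_rv_power[OF Dk, of 2]
      by (intro levy_expectation_mult[OF X pk, where g="\<lambda>x. (g x - b k)\<^sup>2"])
        (auto simp: D_eq intro!: bdd_rv_integrable bdd_rv_power borel_measurable_power borel_measurable_diff
          dest: bdd_rv_measurable)
    then show ?thesis by (simp add: D_eq b_def)
  qed
  have IH: "expectation (\<lambda>\<omega>. (S \<omega>)\<^sup>2) = (\<Sum>i<k. expectation (\<lambda>\<omega>. (\<Xi> i \<omega>)\<^sup>2) * variance (\<lambda>\<omega>. g (X (p (Suc i) - p i) \<omega>)))"
    unfolding S_def using Suc.prems by (intro Suc.IH) auto
  have I: "integrable M (\<lambda>\<omega>. (S \<omega>)\<^sup>2)" "integrable M (\<lambda>\<omega>. (S \<omega> * \<Xi> k \<omega>) * D k \<omega>)"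
    "integrable M (\<lambda>\<omega>. (\<Xi> k \<omega>)\<^sup>2 * (D k \<omega>)\<^sup>2)"
    by (intro bdd_rv_integrable bdd_rv_intros M)+
  have "expectation (\<lambda>\<omega>. (S \<omega> + \<Xi> k \<omega> * D k \<omega>)\<^sup>2)
    = expectation (\<lambda>\<omega>. ((S \<omega>)\<^sup>2 + 2 * ((S \<omega> * \<Xi> k \<omega>) * D k \<omega>)) + (\<Xi> k \<omega>)\<^sup>2 * (D k \<omega>)\<^sup>2)"
    by (simp add: power2_eq_square algebra_simps)
  also have "\<dots> = expectation (\<lambda>\<omega>. (S \<omega>)\<^sup>2) + 2 * expectation (\<lambda>\<omega>. (S \<omega> * \<Xi> k \<omega>) * D k \<omega>)
      + expectation (\<lambda>\<omega>. (\<Xi> k \<omega>)\<^sup>2 * (D k \<omega>)\<^sup>2)"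
    using I by simp
  also have "\<dots> = (\<Sum>i<Suc k. expectation (\<lambda>\<omega>. (\<Xi> i \<omega>)\<^sup>2) * variance (\<lambda>\<omega>. g (X (p (Suc i) - p i) \<omega>)))"
    using IH cross sq by simp
  finally show ?case unfolding S_def by simp
qed simp

text \<open>Kolmogorov's inequality: stop the integrands as soon as a partial sum exceeds the level.\<close>

lemma centered_sum_maximal:
  fixes \<Xi> :: "nat \<Rightarrow> 'w \<Rightarrow> real"
  assumes \<Xi>: "\<And>i. i < n \<Longrightarrow> bdd_rv (F (p i)) (\<Xi> i)" and r: "r > 0"
  shows "prob {\<omega>\<in>space M. \<exists>k\<le>n. \<bar>\<Sum>i<k. \<Xi> i \<omega> * D i \<omega>\<bar> > r}
    \<le> (\<Sum>i<n. expectation (\<lambda>\<omega>. (\<Xi> i \<omega>)\<^sup>2) * variance (\<lambda>\<omega>. g (X (p (Suc i) - p i) \<omega>))) / r\<^sup>2"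
proof -
  define S where "S k \<omega> = (\<Sum>i<k. \<Xi> i \<omega> * D i \<omega>)" for k \<omega>
  have S: "bdd_rv (F (p j)) (S k)" if "k \<le> j" "j \<le> n" for k j
    unfolding S_def by (intro bdd_rv_intros centered_bdd_rv bdd_rv_F_mono[OF \<Xi> grid_mono]) (use that in auto)
  \<comment> \<open>The indicator looks only at partial sums up to \<open>i\<close>, which are known
    at time \<open>p i\<close>, so \<open>centered_sum_second_moment\<close> still applies. The
    stopped sum freezes at the first partial sum above \<open>r\<close>, so Chebyshev's inequality
    at the final index suffices.\<close>
  define \<Xi>' where "\<Xi>' i \<omega> = \<Xi> i \<omega> * (if \<forall>k\<in>{..i}. \<bar>S k \<omega>\<bar> \<le> r then 1 else 0)" for i \<omega>
  have \<Xi>': "bdd_rv (F (p i)) (\<Xi>' i)" if "i < n" for i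
  proof -
    have "{\<omega>\<in>space (F (p i)). \<forall>k\<in>{..i}. \<bar>S k \<omega>\<bar> \<le> r} \<in> sets (F (p i))"
    proof (rule sets.sets_Collect_finite_All')
      fix k assume "k \<in> {..i}"
      then have [measurable]: "S k \<in> borel_measurable (F (p i))" using bdd_rv_measurable[OF S] that by auto
      show "{\<omega>\<in>space (F (p i)). \<bar>S k \<omega>\<bar> \<le> r} \<in> sets (F (p i))" by measurable
    qed auto
    then show ?thesis unfolding \<Xi>'_def
      by (intro bdd_rv_mult \<Xi> that bdd_rvI[where c=1] measurable_If) auto
  qed
  have \<Xi>'b: "\<bar>\<Xi>' i \<omega>\<bar> \<le> \<bar>\<Xi> i \<omega>\<bar>" for i \<omega> by (simp add: \<Xi>'_def)
  define S' where "S' \<omega> = (\<Sum>i<n. \<Xi>' i \<omega> * D i \<omega>)" for \<omega>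
  have S': "bdd_rv M S'"
    unfolding S'_def
    by (intro bdd_rv_intros bdd_rv_F_M[OF \<Xi>'] bdd_rv_F_M[OF centered_bdd_rv[OF _ order_refl]]) auto
  have "prob {\<omega>\<in>space M. \<exists>k\<le>n. \<bar>S k \<omega>\<bar> > r} \<le> prob {\<omega>\<in>space M. \<bar>S' \<omega>\<bar> \<ge> r}"
  proof (rule finite_measure_mono)
    show "{\<omega>\<in>space M. \<exists>k\<le>n. \<bar>S k \<omega>\<bar> > r} \<subseteq> {\<omega>\<in>space M. \<bar>S' \<omega>\<bar> \<ge> r}"
    proof safe
      fix \<omega> k assume k: "k \<le> n" "\<bar>S k \<omega>\<bar> > r"
      define j where "j = (LEAST k. \<bar>S k \<omega>\<bar> > r)"
      have j: "\<bar>S j \<omega>\<bar> > r" "j \<le> n" "\<And>i. i < j \<Longrightarrow> \<bar>S i \<omega>\<bar> \<le> r"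
        unfolding j_def using k LeastI[of "\<lambda>k. \<bar>S k \<omega>\<bar> > r" k] Least_le[of "\<lambda>k. \<bar>S k \<omega>\<bar> > r" k]
        by (auto dest: not_less_Least)
      have "\<Xi>' i \<omega> = 0" if "j \<le> i" for i
        using j(1) that by (force simp: \<Xi>'_def not_le)
      then have "S' \<omega> = (\<Sum>i<j. \<Xi>' i \<omega> * D i \<omega>)"
        unfolding S'_def using j(2) by (intro sum.mono_neutral_right) (auto simp: not_less)
      also have "\<dots> = S j \<omega>"
        unfolding S_def using j(3) by (intro sum.cong) (auto simp: \<Xi>'_def)
      finally show "\<bar>S' \<omega>\<bar> \<ge> r" using j(1) by simp
    qed
  qed (use bdd_rv_measurable[OF S'] in measurable)
  also have "\<dots> \<le> expectation (\<lambda>\<omega>. (S' \<omega>)\<^sup>2) / r\<^sup>2"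
    by (intro second_moment_method bdd_rv_measurable S' bdd_rv_integrable bdd_rv_power r)
  also have "expectation (\<lambda>\<omega>. (S' \<omega>)\<^sup>2) = (\<Sum>i<n. expectation (\<lambda>\<omega>. (\<Xi>' i \<omega>)\<^sup>2) * variance (\<lambda>\<omega>. g (X (p (Suc i) - p i) \<omega>)))"
    unfolding S'_def by (rule centered_sum_second_moment[OF \<Xi>' order_refl])
  also have "\<dots> \<le> (\<Sum>i<n. expectation (\<lambda>\<omega>. (\<Xi> i \<omega>)\<^sup>2) * variance (\<lambda>\<omega>. g (X (p (Suc i) - p i) \<omega>)))"
  proof (intro sum_mono mult_right_mono variance_positive integral_mono bdd_rv_integrable bdd_rv_power)
    fix i assume i: "i \<in> {..<n}"
    then show "bdd_rv M (\<Xi> i)" "bdd_rv M (\<Xi>' i)" using \<Xi> \<Xi>' by (auto intro: bdd_rv_F_M)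
    show "(\<Xi>' i \<omega>)\<^sup>2 \<le> (\<Xi> i \<omega>)\<^sup>2" for \<omega> using \<Xi>'b[of i \<omega>] by (simp add: abs_le_square_iff)
  qed
  finally show ?thesis by (simp add: S_def divide_right_mono)
qed

end

end

section \<open>Tail, variance and mean of increments over short intervals\<close>

context stoch_basis
begin

lemma levy_zero:
  fixes X :: "('w, real) process" and g :: "real \<Rightarrow> real"
  assumes X: "levy_increments X" and g [measurable]: "g \<in> borel_measurable borel"
  shows "expectation (\<lambda>\<omega>. g (X 0 \<omega>)) = g 0"
  using levy_distr[OF X _ _ _ g, of 0 0] T_pos by (simp add: prob_space)

lemma levy_distr_eq:
  "levy_increments X \<Longrightarrow> 0 \<le> s \<Longrightarrow> s \<le> t \<Longrightarrow> t \<le> T \<Longrightarrow>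
    distr M borel (\<lambda>\<omega>. X t \<omega> - X s \<omega>) = distr M borel (X (t - s))"
  by (simp add: levy_increments_def)

lemma levy_tail_power:
  fixes X :: "('w, real) process"
  assumes X: "levy_increments X" and h: "0 \<le> h" "real n * h \<le> T"
  shows "prob {\<omega>\<in>space M. \<forall>i<n. \<bar>X (real (Suc i) * h) \<omega> - X (real i * h) \<omega>\<bar> \<le> a}
      = prob {\<omega>\<in>space M. \<bar>X h \<omega>\<bar> \<le> a} ^ n"
  using h(2)
proof (induction n)
  case (Suc n)
  define g where "g x = (if \<bar>x\<bar> \<le> a then 1 else 0 :: real)" for x :: real
  have g [measurable]: "g \<in> borel_measurable borel" unfolding g_def by measurable
  have gb: "bdd_rv borel g" by (rule bdd_rvI[where c=1]) (auto simp: g_def)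
  have n: "0 \<le> real n * h" "real n * h \<le> real (Suc n) * h" "real (Suc n) * h \<le> T"
    using Suc.prems h by (auto simp: algebra_simps)
  have hT: "h \<le> T"
  proof -
    have "1 * h \<le> real (Suc n) * h" using h by (intro mult_right_mono) auto
    then show ?thesis using n by simp
  qed
  let ?D = "\<lambda>i \<omega>. X (real (Suc i) * h) \<omega> - X (real i * h) \<omega>"
  let ?A = "\<lambda>n. {\<omega>\<in>space M. \<forall>i<n. \<bar>?D i \<omega>\<bar> \<le> a}"
  have D: "?D i \<in> borel_measurable (F (real n * h))" if "i < n" for i
    using that h n
    by (intro levy_increment_measurable[OF X]) (auto intro!: mult_right_mono simp del: of_nat_Suc)
  have An: "?A n \<in> sets (F (real n * h))"
  proof -
    have "{\<omega>\<in>space (F (real n * h)). \<forall>i\<in>{..<n}. \<bar>?D i \<omega>\<bar> \<le> a} \<in> sets (F (real n * h))"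
    proof (rule sets.sets_Collect_finite_All)
      fix i assume "i \<in> {..<n}"
      then have [measurable]: "?D i \<in> borel_measurable (F (real n * h))" using D by auto
      show "{\<omega>\<in>space (F (real n * h)). \<bar>?D i \<omega>\<bar> \<le> a} \<in> sets (F (real n * h))" by measurable
    qed auto
    then show ?thesis by (simp only: Ball_def lessThan_iff space_F)
  qed
  define A where "A = ?A n"
  have An: "A \<in> sets (F (real n * h))" using An by (simp only: A_def)
  have AM: "A \<in> sets M" using An sets_F_M by blast
  have Dn [measurable]: "?D n \<in> borel_measurable M"
    by (intro measurable_F_M[of _ T] levy_increment_measurable[OF X n(1,2) n(3)]) simp
  have Xh [measurable]: "X h \<in> borel_measurable M" using levy_measurable(2)[OF X] h hT by auto
  have "prob (?A (Suc n)) = expectation (\<lambda>\<omega>. indicator A \<omega> * g (?D n \<omega>))"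
  proof -
    have eq: "?A (Suc n) = A \<inter> {\<omega>\<in>space M. \<bar>?D n \<omega>\<bar> \<le> a}" unfolding A_def by (auto simp: less_Suc_eq)
    have "expectation (\<lambda>\<omega>. indicator A \<omega> * g (?D n \<omega>))
        = expectation (indicator (A \<inter> {\<omega>\<in>space M. \<bar>?D n \<omega>\<bar> \<le> a}))"
      by (intro Bochner_Integration.integral_cong) (auto simp: g_def indicator_def)
    also have "\<dots> = prob (A \<inter> {\<omega>\<in>space M. \<bar>?D n \<omega>\<bar> \<le> a})"
      using AM by (subst Bochner_Integration.integral_indicator) (auto intro!: arg_cong[where f=prob])
    finally show ?thesis unfolding eq by simp
  qed
  also have "\<dots> = expectation (indicator A) * expectation (\<lambda>\<omega>. g (X (real (Suc n) * h - real n * h) \<omega>))"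
    by (intro levy_expectation_mult[OF X n _ _ g] bdd_rv_integrable bdd_rv_compose[OF gb] bdd_rvI[where c=1]
       borel_measurable_indicator An AM Dn) auto
  also have "expectation (\<lambda>\<omega>. g (X (real (Suc n) * h - real n * h) \<omega>)) = prob {\<omega>\<in>space M. \<bar>X h \<omega>\<bar> \<le> a}"
  proof -
    have "expectation (\<lambda>\<omega>. g (X h \<omega>)) = expectation (indicator {\<omega>\<in>space M. \<bar>X h \<omega>\<bar> \<le> a})"
      by (intro Bochner_Integration.integral_cong) (auto simp: g_def indicator_def)
    also have "\<dots> = prob {\<omega>\<in>space M. \<bar>X h \<omega>\<bar> \<le> a}" by simp
    finally show ?thesis by (simp add: algebra_simps)
  qed
  also have "expectation (indicator A) = prob A"
    using AM by (subst Bochner_Integration.integral_indicator) (auto intro!: arg_cong[where f=prob])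
  also have "prob A = prob {\<omega>\<in>space M. \<bar>X h \<omega>\<bar> \<le> a} ^ n"
    unfolding A_def by (rule Suc.IH) (use n in linarith)
  finally show ?case by (simp only: power_Suc2)
qed (simp add: prob_space)

text \<open>While the path stays within \<open>a / 2\<close>, all \<open>n\<close> increments on the
  grid of mesh \<open>h\<close> stay within \<open>a\<close>. So the \<open>n\<close>-th power of
  the probability for one increment is at least 1/4, and \<open>power_ge_quarter\<close> bounds the
  complementary probability by \<open>2 / n \<le> 4 * h / T\<close>.\<close>

lemma levy_tail:
  fixes X :: "('w, real) process"
  assumes X: "levy_increments X" and sup: "prob {\<omega>\<in>space M. \<exists>t\<in>{0..T}. \<bar>X t \<omega>\<bar> > a / 2} \<le> 3 / 4"
    and h: "0 < h" "h \<le> T"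
  shows "prob {\<omega>\<in>space M. \<bar>X h \<omega>\<bar> > a} \<le> 4 * h / T"
proof -
  obtain n where n: "n > 0" "real n * h \<le> T" "1 / real n \<le> 2 * h / T" using grid_number[OF h] by metis
  have [measurable]: "X h \<in> borel_measurable M" using levy_measurable(2)[OF X] h by auto
  let ?B = "{\<omega>\<in>space M. \<exists>t\<in>{0..T}. \<bar>X t \<omega>\<bar> > a / 2}"
  let ?A = "{\<omega>\<in>space M. \<forall>i<n. \<bar>X (real (Suc i) * h) \<omega> - X (real i * h) \<omega>\<bar> \<le> a}"
  have B: "?B \<in> sets M"
  proof -
    have "open {x::real. \<bar>x\<bar> > a / 2}" by (intro open_Collect_less continuous_intros)
    from sup_event_measurable[OF levy_cadlag[OF X] this] show ?thesis by simp
  qed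
  have grid: "real i * h \<in> {0..T}" if "i \<le> n" for i
  proof -
    have "real i * h \<le> real n * h" using that h by (intro mult_right_mono) auto
    moreover have "0 \<le> real i * h" using h by simp
    ultimately show ?thesis using n by auto
  qed
  have A: "?A \<in> sets M"
  proof -
    have "{\<omega>\<in>space M. \<forall>i\<in>{..<n}. \<bar>X (real (Suc i) * h) \<omega> - X (real i * h) \<omega>\<bar> \<le> a} \<in> sets M"
    proof (rule sets.sets_Collect_finite_All)
      fix i assume i: "i \<in> {..<n}"
      have [measurable]: "X (real (Suc i) * h) \<in> borel_measurable M" "X (real i * h) \<in> borel_measurable M"
        using i grid[of i] grid[of "Suc i"] by (auto intro!: levy_measurable(2)[OF X] simp del: of_nat_Suc)
      show "{\<omega>\<in>space M. \<bar>X (real (Suc i) * h) \<omega> - X (real i * h) \<omega>\<bar> \<le> a} \<in> sets M" by measurable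
    qed auto
    then show ?thesis by (simp only: Ball_def lessThan_iff space_F)
  qed
  have "space M - ?B \<subseteq> ?A"
  proof
    fix \<omega> assume \<omega>: "\<omega> \<in> space M - ?B"
    have X: "\<bar>X t \<omega>\<bar> \<le> a / 2" if "t \<in> {0..T}" for t using \<omega> that by force
    have "\<bar>X (real (Suc i) * h) \<omega> - X (real i * h) \<omega>\<bar> \<le> a" if "i < n" for i
      using X[OF grid[of "Suc i"]] X[OF grid[of i]] that by linarith
    then show "\<omega> \<in> ?A" using \<omega> by blast
  qed
  then have "prob (space M - ?B) \<le> prob ?A" by (rule finite_measure_mono[OF _ A])
  then have "1 / 4 \<le> prob ?A" using prob_compl[OF B] sup by linarith
  then have "1 / 4 \<le> prob {\<omega>\<in>space M. \<bar>X h \<omega>\<bar> \<le> a} ^ n"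
    using levy_tail_power[OF X _ n(2), of a] h by simp
  then have "1 - prob {\<omega>\<in>space M. \<bar>X h \<omega>\<bar> \<le> a} \<le> 2 / n" using n by (intro power_ge_quarter) auto
  moreover have "prob {\<omega>\<in>space M. \<bar>X h \<omega>\<bar> > a} = 1 - prob {\<omega>\<in>space M. \<bar>X h \<omega>\<bar> \<le> a}"
  proof -
    have "{\<omega>\<in>space M. \<bar>X h \<omega>\<bar> > a} = space M - {\<omega>\<in>space M. \<bar>X h \<omega>\<bar> \<le> a}" by auto
    then show ?thesis using prob_compl[of "{\<omega>\<in>space M. \<bar>X h \<omega>\<bar> \<le> a}"] by simp
  qed
  moreover have "2 / real n \<le> 4 * h / T" using n(3) by simp
  ultimately show ?thesis by linarith
qed

lemma levy_char_mult:
  fixes X :: "('w, real) process"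
  assumes X: "levy_increments X" and st: "0 \<le> s" "0 \<le> t" "s + t \<le> T"
  shows "char (distr M borel (X (s + t))) u = char (distr M borel (X s)) u * char (distr M borel (X t)) u"
proof -
  have "indep_var borel (X s) borel (\<lambda>\<omega>. X (s + t) \<omega> - X s \<omega>)"
    using levy_indep_var[OF X st(1), of "s + t" "X s" "\<lambda>x. x"] levy_measurable(1)[OF X st(1)] st by simp
  from char_distr_add[OF this, of u]
  have "char (distr M borel (X (s + t))) u = char (distr M borel (X s)) u * char (distr M borel (\<lambda>\<omega>. X (s + t) \<omega> - X s \<omega>)) u"
    by simp
  also have "distr M borel (\<lambda>\<omega>. X (s + t) \<omega> - X s \<omega>) = distr M borel (X (s + t - s))"
    by (rule levy_distr_eq[OF X]) (use st in auto)
  finally show ?thesis by simp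
qed

lemma levy_char_power:
  fixes X :: "('w, real) process"
  assumes X: "levy_increments X" and h: "0 \<le> h" "real n * h \<le> T"
  shows "char (distr M borel (X (real n * h))) u = char (distr M borel (X h)) u ^ n"
  using h(2)
proof (induction n)
  case 0
  have [measurable]: "X 0 \<in> borel_measurable M" using levy_measurable(2)[OF X] T_pos by auto
  have "distr M borel (X 0) = distr M borel (\<lambda>\<omega>. 0)"
    using levy_distr_eq[OF X, of 0 0] T_pos by simp
  then have "char (distr M borel (X 0)) u = char (distr M borel (\<lambda>\<omega>. 0)) u" by (rule arg_cong)
  also have "\<dots> = 1" unfolding char_def by (subst integral_distr) (auto simp: prob_space)
  finally show ?case by simp
next
  case (Suc n)
  then show ?case using levy_char_mult[OF X, of "real n * h" h] h by (simp add: algebra_simps)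
qed

lemma cmod_char_distr:
  assumes [measurable]: "Y \<in> borel_measurable M"
  shows "(cmod (char (distr M borel Y) u))\<^sup>2 = (expectation (\<lambda>\<omega>. cos (u * Y \<omega>)))\<^sup>2 + (expectation (\<lambda>\<omega>. sin (u * Y \<omega>)))\<^sup>2"
proof -
  have "char (distr M borel Y) u = (CLINT \<omega>|M. iexp (u * Y \<omega>))"
    unfolding char_def by (subst integral_distr) auto
  moreover have int: "complex_integrable M (\<lambda>\<omega>. iexp (u * Y \<omega>))"
    by (rule integrable_iexp) auto
  ultimately have "Re (char (distr M borel Y) u) = expectation (\<lambda>\<omega>. Re (iexp (u * Y \<omega>)))"
    "Im (char (distr M borel Y) u) = expectation (\<lambda>\<omega>. Im (iexp (u * Y \<omega>)))"
    by (simp_all add: integral_Re integral_Im)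
  then show ?thesis by (simp add: cmod_power2 Re_exp Im_exp)
qed

text \<open>The characteristic function at \<open>T\<close> is a product of \<open>n\<close> equal
  factors for the mesh \<open>h\<close> and a factor of modulus at most 1. A modulus of at least 1/2
  at \<open>T\<close> therefore keeps the factor for \<open>h\<close> within \<open>O(1 / n)\<close>
  of 1. By \<open>symmetrized_variance_bound\<close> this controls
  \<open>p * m2 - m1\<^sup>2\<close>, and the tail bound replaces \<open>p\<close> by 1.\<close>

lemma levy_trunc_variance:
  fixes X :: "('w, real) process"
  assumes X: "levy_increments X" and sup: "prob {\<omega>\<in>space M. \<exists>t\<in>{0..T}. \<bar>X t \<omega>\<bar> > a / 2} \<le> 3 / 4"
    and a: "a > 0" and char: "1 / 2 \<le> cmod (char (distr M borel (X T)) (1 / (2 * a)))"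
    and h: "0 < h" "h \<le> T"
  shows "variance (\<lambda>\<omega>. trunc a (X h \<omega>)) \<le> 36 * a\<^sup>2 * h / T"
proof -
  obtain n where n: "n > 0" "real n * h \<le> T" "1 / real n \<le> 2 * h / T" using grid_number[OF h] by metis
  have [measurable]: "X h \<in> borel_measurable M" using levy_measurable(2)[OF X] h by auto
  \<comment> \<open>The largest frequency that \<open>symmetrized_variance_bound\<close> allows for
    truncation at \<open>a\<close>; it makes \<open>8 * a\<^sup>2 * (u\<^sup>2 / 2) = 1\<close>. In
    the final constant, 32 comes from that bound and 4 from the tail.\<close>
  define u where "u = 1 / (2 * a)"
  define p where "p = prob {\<omega>\<in>space M. \<bar>X h \<omega>\<bar> \<le> a}"
  define m1 where "m1 = expectation (\<lambda>\<omega>. trunc a (X h \<omega>))"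
  define m2 where "m2 = expectation (\<lambda>\<omega>. (trunc a (X h \<omega>))\<^sup>2)"
  let ?\<phi> = "\<lambda>t. char (distr M borel (X t)) u"
  have le1: "cmod (?\<phi> t) \<le> 1" if "0 \<le> t" "t \<le> T" for t
  proof -
    have "X t \<in> borel_measurable M" using levy_measurable(2)[OF X] that by auto
    then interpret D: real_distribution "distr M borel (X t)" by (rule real_distribution_distr)
    show ?thesis by (rule D.cmod_char_le_1)
  qed
  have nh: "0 \<le> real n * h" "0 \<le> T - real n * h" using n h by auto
  have "1 / 2 \<le> cmod (?\<phi> (real n * h + (T - real n * h)))" using char by (simp add: u_def)
  also have "\<dots> = cmod (?\<phi> (real n * h)) * cmod (?\<phi> (T - real n * h))"
    using levy_char_mult[OF X nh] by (simp add: norm_mult)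
  also have "\<dots> \<le> cmod (?\<phi> (real n * h)) * 1"
    using le1[of "T - real n * h"] nh by (intro mult_left_mono) auto
  also have "\<dots> = cmod (?\<phi> h) ^ n"
    using levy_char_power[OF X _ n(2)] h by (simp add: norm_power)
  finally have "(1 / 2)\<^sup>2 \<le> (cmod (?\<phi> h) ^ n)\<^sup>2" by (intro power_mono) auto
  then have "1 / 4 \<le> ((cmod (?\<phi> h))\<^sup>2) ^ n"
    by (simp add: power_mult_distrib power2_eq_square)
  then have "1 - (cmod (?\<phi> h))\<^sup>2 \<le> 2 / n" using n by (intro power_ge_quarter) auto
  moreover have "u\<^sup>2 / 2 * (p * m2 - m1\<^sup>2) \<le> 1 - (cmod (?\<phi> h))\<^sup>2"
  proof -
    have "expectation (\<lambda>\<omega>. if \<bar>X h \<omega>\<bar> \<le> a then 1 else 0 :: real) = expectation (indicator {\<omega>\<in>space M. \<bar>X h \<omega>\<bar> \<le> a})"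
      by (intro Bochner_Integration.integral_cong) (auto simp: indicator_def)
    then have p: "expectation (\<lambda>\<omega>. if \<bar>X h \<omega>\<bar> \<le> a then 1 else 0 :: real) = p" by (simp add: p_def)
    have u: "0 < u" "u * (2 * a) \<le> 1" using a by (auto simp: u_def)
    have Xh: "X h \<in> borel_measurable M" by measurable
    show ?thesis
      using symmetrized_variance_bound[OF Xh u(1) a u(2)]
      unfolding p cmod_char_distr[OF Xh] m1_def m2_def .
  qed
  moreover have "2 / real n \<le> 4 * h / T" using n(3) by simp
  ultimately have "u\<^sup>2 / 2 * (p * m2 - m1\<^sup>2) \<le> 4 * h / T" by linarith
  then have "8 * a\<^sup>2 * (u\<^sup>2 / 2 * (p * m2 - m1\<^sup>2)) \<le> 8 * a\<^sup>2 * (4 * h / T)"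
    by (intro mult_left_mono) auto
  also have "8 * a\<^sup>2 * (u\<^sup>2 / 2 * (p * m2 - m1\<^sup>2)) = p * m2 - m1\<^sup>2"
    using a by (simp add: u_def power2_eq_square)
  finally have 1: "p * m2 - m1\<^sup>2 \<le> 32 * a\<^sup>2 * h / T" by (simp add: mult_ac)
  have m2a: "0 \<le> m2" "m2 \<le> a\<^sup>2"
  proof -
    have "m2 \<le> expectation (\<lambda>\<omega>. a\<^sup>2)" unfolding m2_def
    proof (intro integral_mono bdd_rv_integrable bdd_rv_power bdd_rv_compose[OF bdd_rv_trunc])
      show "(trunc a (X h \<omega>))\<^sup>2 \<le> a\<^sup>2" for \<omega>
        using abs_trunc_le[of a "X h \<omega>"] a by (simp add: power2_le_iff_abs_le)
    qed auto
    then show "m2 \<le> a\<^sup>2" by (simp add: prob_space)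
  qed (simp add: m2_def)
  have "1 - p = prob {\<omega>\<in>space M. \<bar>X h \<omega>\<bar> > a}"
  proof -
    have "{\<omega>\<in>space M. \<bar>X h \<omega>\<bar> > a} = space M - {\<omega>\<in>space M. \<bar>X h \<omega>\<bar> \<le> a}" by auto
    then show ?thesis using prob_compl[of "{\<omega>\<in>space M. \<bar>X h \<omega>\<bar> \<le> a}"] by (simp add: p_def)
  qed
  then have "1 - p \<le> 4 * h / T" using levy_tail[OF X sup h] by simp
  then have "(1 - p) * m2 \<le> 4 * h / T * a\<^sup>2" using m2a h T_pos by (intro mult_mono) auto
  then have 2: "m2 - p * m2 \<le> 4 * a\<^sup>2 * h / T" by (simp add: algebra_simps)
  have "variance (\<lambda>\<omega>. trunc a (X h \<omega>)) = m2 - m1\<^sup>2"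
    unfolding m1_def m2_def
    by (intro variance_eq bdd_rv_integrable bdd_rv_power bdd_rv_compose[OF bdd_rv_trunc]) auto
  also have "\<dots> \<le> 32 * a\<^sup>2 * h / T + 4 * a\<^sup>2 * h / T" using 1 2 by linarith
  finally show ?thesis by (simp add: field_simps)
qed

text \<open>The centred sum of \<open>n\<close> truncated increments has second moment at most
  \<open>36 * a\<^sup>2\<close>, so it reaches \<open>12 * a\<close> with probability at most 1/4.
  Paths leaving \<open>a / 2\<close> have probability at most 1/4 too, hence some scenario avoids
  both events. There nothing is truncated, the sum telescopes, and \<open>n\<close> times the mean
  is at most \<open>14 * a\<close>.\<close>

lemma levy_trunc_mean:
  fixes X :: "('w, real) process"
  assumes X: "levy_increments X" and sup: "prob {\<omega>\<in>space M. \<exists>t\<in>{0..T}. \<bar>X t \<omega>\<bar> > a / 2} \<le> 1 / 4"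
    and a: "a > 0" and char: "1 / 2 \<le> cmod (char (distr M borel (X T)) (1 / (2 * a)))"
    and h: "0 < h" "h \<le> T"
  shows "\<bar>expectation (\<lambda>\<omega>. trunc a (X h \<omega>))\<bar> \<le> 28 * a * h / T"
proof -
  obtain n where n: "n > 0" "real n * h \<le> T" "1 / real n \<le> 2 * h / T" using grid_number[OF h] by metis
  define b where "b = expectation (\<lambda>\<omega>. trunc a (X h \<omega>))"
  have grid: "real i * h \<in> {0..T}" if "i \<le> n" for i
  proof -
    have "real i * h \<le> real n * h" using that h by (intro mult_right_mono) auto
    moreover have "0 \<le> real i * h" using h by simp
    ultimately show ?thesis using n by auto
  qed
  have diff: "real (Suc i) * h - real i * h = h" for i by (simp add: algebra_simps)
  have steps: "real i * h \<le> real (Suc i) * h" for i using h by (intro mult_right_mono) auto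
  define S where "S \<omega> = (\<Sum>i<n. trunc a (X (real (Suc i) * h) \<omega> - X (real i * h) \<omega>) - b)" for \<omega>
  have bd: "bdd_rv M S"
    unfolding S_def
  proof (intro bdd_rv_intros bdd_rv_compose[OF bdd_rv_trunc] borel_measurable_diff)
    fix i assume "i \<in> {..<n}"
    then show "X (real (Suc i) * h) \<in> borel_measurable M" "X (real i * h) \<in> borel_measurable M"
      using grid[of i] grid[of "Suc i"] by (auto intro!: levy_measurable(2)[OF X] simp del: of_nat_Suc)
  qed
  have "expectation (\<lambda>\<omega>. (S \<omega>)\<^sup>2) = real n * variance (\<lambda>\<omega>. trunc a (X h \<omega>))"
    using centered_sum_second_moment[of X n "\<lambda>i. real i * h" "trunc a" n "\<lambda>_ _. 1", OF X steps _ _ bdd_rv_trunc]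
      grid by (simp add: diff S_def b_def prob_space del: of_nat_Suc)
  also have "\<dots> \<le> real n * (36 * a\<^sup>2 * h / T)"
    using levy_trunc_variance[OF X _ a char h] sup by (intro mult_left_mono) auto
  also have "\<dots> = 36 * a\<^sup>2 * (real n * h / T)" by simp
  also have "\<dots> \<le> 36 * a\<^sup>2 * 1" using n T_pos by (intro mult_left_mono) auto
  finally have var: "expectation (\<lambda>\<omega>. (S \<omega>)\<^sup>2) \<le> 36 * a\<^sup>2" by simp
  let ?B = "{\<omega>\<in>space M. \<exists>t\<in>{0..T}. \<bar>X t \<omega>\<bar> > a / 2}" and ?S = "{\<omega>\<in>space M. \<bar>S \<omega>\<bar> \<ge> 12 * a}"
  have B: "?B \<in> sets M"
  proof -
    have "open {x::real. \<bar>x\<bar> > a / 2}" by (intro open_Collect_less continuous_intros)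
    from sup_event_measurable[OF levy_cadlag[OF X] this] show ?thesis by simp
  qed
  have S: "?S \<in> sets M" using bdd_rv_measurable[OF bd] by measurable
  have "prob ?S \<le> expectation (\<lambda>\<omega>. (S \<omega>)\<^sup>2) / (12 * a)\<^sup>2"
    using a by (intro second_moment_method bdd_rv_measurable bd bdd_rv_integrable bdd_rv_power) auto
  also have "\<dots> \<le> 36 * a\<^sup>2 / (12 * a)\<^sup>2" using var by (intro divide_right_mono) auto
  also have "\<dots> = 1 / 4" using a by (simp add: power2_eq_square)
  finally have "prob (?B \<union> ?S) < 1"
    using measure_Un_le[OF B S] sup by linarith
  then have "?B \<union> ?S \<noteq> space M" using prob_space by force
  then obtain \<omega> where \<omega>: "\<omega> \<in> space M" "\<omega> \<notin> ?B" "\<omega> \<notin> ?S" by blast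
  have Xa: "\<bar>X (real i * h) \<omega>\<bar> \<le> a / 2" if "i \<le> n" for i using \<omega> grid[OF that] by force
  have "trunc a (X (real (Suc i) * h) \<omega> - X (real i * h) \<omega>) = X (real (Suc i) * h) \<omega> - X (real i * h) \<omega>" if "i < n" for i
    using Xa[of i] Xa[of "Suc i"] that unfolding trunc_def by auto
  then have "S \<omega> = (\<Sum>i<n. X (real (Suc i) * h) \<omega> - X (real i * h) \<omega>) - real n * b"
    by (simp add: S_def sum_subtractf)
  also have "(\<Sum>i<n. X (real (Suc i) * h) \<omega> - X (real i * h) \<omega>) = X (real n * h) \<omega> - X (real 0 * h) \<omega>"
    by (rule sum_lessThan_telescope)
  finally have "\<bar>real n * b\<bar> \<le> 14 * a" using \<omega>(1,3) Xa[of n] Xa[of 0] by auto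
  then have "\<bar>b\<bar> \<le> 14 * a * (1 / real n)" using n(1) by (simp add: abs_mult field_simps)
  also have "\<dots> \<le> 14 * a * (2 * h / T)" using n(3) a by (intro mult_left_mono) auto
  finally show ?thesis by (simp add: b_def)
qed

text \<open>Two demands fix \<open>a\<close>: exceeding \<open>a / 2\<close> must be improbable, and
  the characteristic function of \<open>X T\<close>, which is continuous with value 1 at 0, must
  still have modulus at least 1/2 at \<open>1 / (2 * a)\<close>. Both hold for all large
  \<open>a\<close>. The previous estimates concern \<open>h > 0\<close>; the case
  \<open>h = 0\<close> is \<open>levy_zero\<close>.\<close>

lemma levy_trunc_estimates:
  fixes X :: "('w, real) process"
  assumes X: "levy_increments X" and e: "e > 0"
  obtains a K where "a > 0" "K \<ge> 0" "prob {\<omega>\<in>space M. \<exists>t\<in>{0..T}. \<bar>X t \<omega>\<bar> > a / 2} \<le> e"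
    "\<And>h. 0 \<le> h \<Longrightarrow> h \<le> T \<Longrightarrow> prob {\<omega>\<in>space M. \<bar>X h \<omega>\<bar> > a} \<le> K * h"
    "\<And>h. 0 \<le> h \<Longrightarrow> h \<le> T \<Longrightarrow> \<bar>expectation (\<lambda>\<omega>. trunc a (X h \<omega>))\<bar> \<le> K * h"
    "\<And>h. 0 \<le> h \<Longrightarrow> h \<le> T \<Longrightarrow> variance (\<lambda>\<omega>. trunc a (X h \<omega>)) \<le> K * h"
proof -
  have "X T \<in> borel_measurable M" using levy_measurable(2)[OF X] T_pos by auto
  then interpret D: real_distribution "distr M borel (X T)" by (rule real_distribution_distr)
  have "((\<lambda>u. cmod (char (distr M borel (X T)) u)) \<longlongrightarrow> cmod (char (distr M borel (X T)) 0)) (at 0)"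
    using D.isCont_char[of 0] by (intro tendsto_norm) (simp add: isCont_def)
  then have "\<forall>\<^sub>F u in at 0. 1 / 2 < cmod (char (distr M borel (X T)) u)"
    by (rule order_tendstoD) (simp only: D.char_zero, simp)
  then obtain d where d: "d > 0" "\<And>u. u \<noteq> 0 \<Longrightarrow> dist u 0 < d \<Longrightarrow> 1 / 2 < cmod (char (distr M borel (X T)) u)"
    by (auto simp: eventually_at)
  obtain a0 where a0: "a0 > 0" "\<And>a. a \<ge> a0 \<Longrightarrow> prob {\<omega>\<in>space M. \<exists>t\<in>{0..T}. norm (X t \<omega>) > a} < min e (1 / 4)"
    using sup_tight[OF levy_cadlag[OF X], of "min e (1 / 4)"] e by auto
  define a where "a = max (2 * a0) (1 / d)"
  have a: "a > 0" "a / 2 \<ge> a0" "1 / d \<le> a" using a0 by (auto simp: a_def)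
  have sup: "prob {\<omega>\<in>space M. \<exists>t\<in>{0..T}. \<bar>X t \<omega>\<bar> > a / 2} < min e (1 / 4)"
    using a0(2)[OF a(2)] by simp
  have "1 / (2 * a) < d"
  proof -
    have "1 \<le> a * d" using a(3) d(1) by (simp add: field_simps)
    then have "1 < 2 * (a * d)" by linarith
    then show ?thesis using a(1) by (simp add: field_simps)
  qed
  then have ch: "1 / 2 \<le> cmod (char (distr M borel (X T)) (1 / (2 * a)))"
    using d(2)[of "1 / (2 * a)"] a(1) by (simp add: less_imp_le)
  define K where "K = max (4 / T) (max (36 * a\<^sup>2 / T) (28 * a / T))"
  have sup4: "prob {\<omega>\<in>space M. \<exists>t\<in>{0..T}. \<bar>X t \<omega>\<bar> > a / 2} \<le> 1 / 4"
    and sup3: "prob {\<omega>\<in>space M. \<exists>t\<in>{0..T}. \<bar>X t \<omega>\<bar> > a / 2} \<le> 3 / 4" using sup by linarith+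
  have K: "4 / T \<le> K" "36 * a\<^sup>2 / T \<le> K" "28 * a / T \<le> K" by (auto simp: K_def)
  have [measurable]: "X 0 \<in> borel_measurable M" using levy_measurable(2)[OF X] T_pos by auto
  show ?thesis
  proof (rule that[of a K])
    show "K \<ge> 0" using K(1) T_pos by (meson divide_nonneg_pos order_trans zero_le_numeral)
    show "a > 0" by (rule a(1))
    show "prob {\<omega>\<in>space M. \<exists>t\<in>{0..T}. \<bar>X t \<omega>\<bar> > a / 2} \<le> e"
      using sup by linarith
    fix h assume h: "0 \<le> h" "h \<le> T"
    show "prob {\<omega>\<in>space M. \<bar>X h \<omega>\<bar> > a} \<le> K * h"
    proof (cases "h = 0")
      case True
      have "expectation (\<lambda>\<omega>. if \<bar>X 0 \<omega>\<bar> > a then 1 else 0 :: real) = 0"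
        using levy_zero[OF X, of "\<lambda>x. if \<bar>x\<bar> > a then 1 else 0"] a by simp
      moreover have "expectation (\<lambda>\<omega>. if \<bar>X 0 \<omega>\<bar> > a then 1 else 0 :: real) = expectation (indicator {\<omega>\<in>space M. \<bar>X 0 \<omega>\<bar> > a})"
        by (intro Bochner_Integration.integral_cong) (auto simp: indicator_def)
      ultimately show ?thesis using True by simp
    next
      case False
      then have "prob {\<omega>\<in>space M. \<bar>X h \<omega>\<bar> > a} \<le> 4 / T * h" using levy_tail[OF X sup3 _ h(2)] h by (simp only: times_divide_eq_left)
      then show ?thesis using mult_right_mono[OF K(1) h(1)] by linarith
    qed
    show "\<bar>expectation (\<lambda>\<omega>. trunc a (X h \<omega>))\<bar> \<le> K * h"
    proof (cases "h = 0")
      case True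
      then show ?thesis using levy_zero[OF X trunc_measurable, of a] by (simp add: trunc_def)
    next
      case False
      then have "\<bar>expectation (\<lambda>\<omega>. trunc a (X h \<omega>))\<bar> \<le> 28 * a / T * h"
        using levy_trunc_mean[OF X sup4 a(1) ch _ h(2)] h by (simp only: times_divide_eq_left)
      then show ?thesis using mult_right_mono[OF K(3) h(1)] by linarith
    qed
    show "variance (\<lambda>\<omega>. trunc a (X h \<omega>)) \<le> K * h"
    proof (cases "h = 0")
      case True
      then show ?thesis
        using levy_zero[OF X trunc_measurable, of a] levy_zero[OF X, of "\<lambda>x. (trunc a x)\<^sup>2"] by (simp add: trunc_def)
    next
      case False
      then have "variance (\<lambda>\<omega>. trunc a (X h \<omega>)) \<le> 36 * a\<^sup>2 / T * h"
        using levy_trunc_variance[OF X sup3 a(1) ch _ h(2)] h by (simp only: times_divide_eq_left)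
      then show ?thesis using mult_right_mono[OF K(2) h(1)] by linarith
    qed
  qed
qed

end

section \<open>Elementary stochastic integrals\<close>

lemma sorted_grid:
  fixes G :: "real set"
  assumes "finite G" "0 \<in> G" "T \<in> G" "G \<subseteq> {0..T}"
  obtains p :: "nat \<Rightarrow> real" and n where "p ` {..n} = G" "p 0 = 0" "p n = T"
    "\<And>i. i < n \<Longrightarrow> p i < p (Suc i)" "\<And>i x. i < n \<Longrightarrow> x \<in> G \<Longrightarrow> x \<le> p i \<or> p (Suc i) \<le> x"
proof -
  define l where "l = sorted_list_of_set G"
  define n where "n = length l - 1"
  have l: "set l = G" "sorted_wrt (<) l" "l \<noteq> []"
    using assms strict_sorted_list_of_set[of G] unfolding l_def by auto
  then have len: "length l = Suc n" by (simp add: n_def)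
  have mono: "l ! i < l ! j" if "i < j" "j \<le> n" for i j
    using sorted_wrt_nth_less[OF l(2) that(1)] that len by simp
  have mono': "l ! i \<le> l ! j" if "i \<le> j" "j \<le> n" for i j
    using mono[of i j] that by (cases "i = j") auto
  have img: "(!) l ` {..n} = G"
    using l(1) len by (auto simp: set_conv_nth less_Suc_eq_le)
  have mem: "\<exists>i\<le>n. l ! i = x" if "x \<in> G" for x using that img by (metis atMost_iff imageE)
  show ?thesis
  proof (rule that[of "(!) l" n])
    show "(!) l ` {..n} = G" by (rule img)
    obtain i where "i \<le> n" "l ! i = 0" using mem assms by blast
    then have "l ! 0 \<le> 0" using mono'[of 0 i] by simp
    moreover have "l ! 0 \<in> G" using img by blast
    ultimately show "l ! 0 = 0" using assms(4) by force
    obtain i where "i \<le> n" "l ! i = T" using mem assms by blast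
    then have "T \<le> l ! n" using mono'[of i n] by simp
    moreover have "l ! n \<in> G" using img by blast
    ultimately show "l ! n = T" using assms(4) by force
    show "l ! i < l ! Suc i" if "i < n" for i using mono that by simp
    fix i x assume i: "i < n" "x \<in> G"
    obtain j where j: "j \<le> n" "l ! j = x" using mem i(2) by blast
    show "x \<le> l ! i \<or> l ! Suc i \<le> x"
    proof (cases "j \<le> i")
      case True then show ?thesis using mono'[of j i] i j by auto
    next
      case False then show ?thesis using mono'[of "Suc i" j] i j by auto
    qed
  qed
qed

text \<open>Intervals may overlap and repeat, so sums of elementary processes are mere
  concatenations. A disjoint description is recovered on a grid, in
  \<open>elem_int_grid\<close>.\<close>

type_synonym 'w elementary = "(real \<times> real \<times> ('w \<Rightarrow> real)) list"

definition elem :: "'w elementary \<Rightarrow> ('w, real) process" where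
  "elem rs u \<omega> = (\<Sum>(s, t, \<xi>)\<leftarrow>rs. indicat_real {s<..t} u * \<xi> \<omega>)"

definition elem_int :: "('w, real) process \<Rightarrow> 'w elementary \<Rightarrow> ('w, real) process" where
  "elem_int X rs u \<omega> = (\<Sum>(s, t, \<xi>)\<leftarrow>rs. \<xi> \<omega> * (X (min u t) \<omega> - X (min u s) \<omega>))"

definition elem_points :: "'w elementary \<Rightarrow> real set" where
  "elem_points rs = (\<Union>(s, t, \<xi>)\<in>set rs. {s, t})"

lemma elem_simps [simp]:
  "elem [] u \<omega> = 0"
  "elem ((s, t, \<xi>) # rs) u \<omega> = indicat_real {s<..t} u * \<xi> \<omega> + elem rs u \<omega>"
  "elem_int X [] u \<omega> = 0"
  "elem_int X ((s, t, \<xi>) # rs) u \<omega> = \<xi> \<omega> * (X (min u t) \<omega> - X (min u s) \<omega>) + elem_int X rs u \<omega>"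
  "elem_points [] = {}"
  "elem_points ((s, t, \<xi>) # rs) = {s, t} \<union> elem_points rs"
  by (auto simp: elem_def elem_int_def elem_points_def)

lemma elem_append: "elem (rs @ qs) u \<omega> = elem rs u \<omega> + elem qs u \<omega>"
  by (simp add: elem_def)

lemma elem_int_append: "elem_int X (rs @ qs) u \<omega> = elem_int X rs u \<omega> + elem_int X qs u \<omega>"
  by (simp add: elem_int_def)

definition elem_scale :: "real \<Rightarrow> 'w elementary \<Rightarrow> 'w elementary" where
  "elem_scale c = map (\<lambda>(s, t, \<xi>). (s, t, \<lambda>\<omega>. c * \<xi> \<omega>))"

lemma elem_scale: "elem (elem_scale c rs) u \<omega> = c * elem rs u \<omega>"
  by (induction rs) (auto simp: elem_scale_def algebra_simps)

lemma elem_int_scale: "elem_int X (elem_scale c rs) u \<omega> = c * elem_int X rs u \<omega>"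
  by (induction rs) (auto simp: elem_scale_def algebra_simps)

lemma finite_elem_points: "finite (elem_points rs)"
  by (auto simp: elem_points_def)

context stoch_basis
begin

definition valid_elem :: "'w elementary \<Rightarrow> bool" where
  "valid_elem rs \<longleftrightarrow> (\<forall>(s, t, \<xi>)\<in>set rs. 0 \<le> s \<and> s \<le> t \<and> t \<le> T \<and> bdd_rv (F s) \<xi>)"

lemma valid_elem_simps [simp]:
  "valid_elem []"
  "valid_elem ((s, t, \<xi>) # rs) \<longleftrightarrow> 0 \<le> s \<and> s \<le> t \<and> t \<le> T \<and> bdd_rv (F s) \<xi> \<and> valid_elem rs"
  "valid_elem (rs @ qs) \<longleftrightarrow> valid_elem rs \<and> valid_elem qs"
  unfolding valid_elem_def set_append ball_Un by simp_all

lemma valid_elem_scale: "valid_elem rs \<Longrightarrow> valid_elem (elem_scale c rs)"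
  by (induction rs) (auto simp: elem_scale_def intro!: bdd_rv_mult)

lemma valid_elem_points: "valid_elem rs \<Longrightarrow> elem_points rs \<subseteq> {0..T}"
  by (induction rs) (auto dest!: subsetD)

text \<open>If no end point lies inside a cell, the process is constant on the cell up to and
  including its right end, as the intervals are open on the left and closed on the right. Therefore
  the value at \<open>p (Suc i)\<close> is the weight of the increment.\<close>

lemma elem_int_grid:
  assumes p0: "p 0 = 0" and rs: "valid_elem rs"
    and mono: "\<And>i. i < n \<Longrightarrow> p i < p (Suc i)"
    and gap: "\<And>i x. i < n \<Longrightarrow> x \<in> elem_points rs \<Longrightarrow> x \<le> p i \<or> p (Suc i) \<le> x" and k: "k \<le> n"
  shows "elem_int X rs (p k) \<omega> = (\<Sum>i<k. elem rs (p (Suc i)) \<omega> * (X (p (Suc i)) \<omega> - X (p i) \<omega>))"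
  using rs gap
proof (induction rs)
  case (Cons r rs)
  obtain s t \<xi> where r: "r = (s, t, \<xi>)" by (cases r)
  have "X (min (p k) t) \<omega> - X (min (p k) s) \<omega> = (\<Sum>i<k. indicat_real {s<..t} (p (Suc i)) * (X (p (Suc i)) \<omega> - X (p i) \<omega>))"
    using k
  proof (induction k)
    case 0
    then show ?case using Cons.prems(1) by (simp add: p0 r min_def)
  next
    case (Suc k)
    then have lt: "p k < p (Suc k)" "s \<le> t" and "s \<le> p k \<or> p (Suc k) \<le> s" "t \<le> p k \<or> p (Suc k) \<le> t"
      using Cons.prems mono by (auto simp: r)
    then consider "t \<le> p k" | "p (Suc k) \<le> s" | "s \<le> p k" "p (Suc k) \<le> t" by blast
    then have "X (min (p (Suc k)) t) \<omega> - X (min (p (Suc k)) s) \<omega> = X (min (p k) t) \<omega> - X (min (p k) s) \<omega>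
      + indicat_real {s<..t} (p (Suc k)) * (X (p (Suc k)) \<omega> - X (p k) \<omega>)"
      using lt by cases (simp_all add: min_absorb1 min_absorb2)
    then show ?case using Suc by simp
  qed
  moreover have "elem_int X rs (p k) \<omega> = (\<Sum>i<k. elem rs (p (Suc i)) \<omega> * (X (p (Suc i)) \<omega> - X (p i) \<omega>))"
    using Cons by (intro Cons.IH) (auto simp: r)
  moreover have "(\<Sum>i<k. (indicat_real {s<..t} (p (Suc i)) * \<xi> \<omega> + elem rs (p (Suc i)) \<omega>) * (X (p (Suc i)) \<omega> - X (p i) \<omega>))
     = \<xi> \<omega> * (\<Sum>i<k. indicat_real {s<..t} (p (Suc i)) * (X (p (Suc i)) \<omega> - X (p i) \<omega>))
       + (\<Sum>i<k. elem rs (p (Suc i)) \<omega> * (X (p (Suc i)) \<omega> - X (p i) \<omega>))"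
    by (simp only: distrib_right sum.distrib sum_distrib_left mult.assoc mult.left_commute)
  ultimately show ?case by (simp only: r elem_simps)
qed simp

lemma elem_between:
  assumes "\<And>x. x \<in> elem_points rs \<Longrightarrow> x \<le> a \<or> b \<le> x" "a < u" "u \<le> b"
  shows "elem rs u \<omega> = elem rs b \<omega>"
  using assms
proof (induction rs)
  case (Cons r rs)
  obtain s t \<xi> where r: "r = (s, t, \<xi>)" by (cases r)
  have "indicat_real {s<..t} u = indicat_real {s<..t} b"
    using Cons.prems(1)[of s] Cons.prems(1)[of t] Cons.prems(2,3) by (auto simp: r indicator_def)
  then show ?case using Cons by (auto simp: r)
qed simp

text \<open>An interval with \<open>s < b\<close> has \<open>s \<le> a\<close>, since no end point
  lies strictly between, so its weight is known at time \<open>a\<close>. This makes the value at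
  the right end of a grid cell admissible as a weight in the martingale sums.\<close>

lemma elem_bdd_rv:
  assumes "valid_elem rs" "\<And>x. x \<in> elem_points rs \<Longrightarrow> x \<le> a \<or> b \<le> x"
  shows "bdd_rv (F a) (elem rs b)"
  using assms
proof (induction rs)
  case (Cons r rs)
  obtain s t \<xi> where r: "r = (s, t, \<xi>)" by (cases r)
  have "bdd_rv (F a) (\<lambda>\<omega>. indicat_real {s<..t} b * \<xi> \<omega>)"
  proof (cases "s < b")
    case True
    then have "s \<le> a" using Cons.prems(2)[of s] by (auto simp: r)
    then show ?thesis using Cons.prems(1) by (intro bdd_rv_mult) (auto simp: r intro: bdd_rv_F_mono)
  qed simp
  moreover have "bdd_rv (F a) (elem rs b)" using Cons by (auto simp: r)
  moreover have "elem (r # rs) b = (\<lambda>\<omega>. indicat_real {s<..t} b * \<xi> \<omega> + elem rs b \<omega>)" by (simp add: r fun_eq_iff)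
  ultimately show ?case by (simp only: bdd_rv_add)
next
  case Nil
  have "elem [] b = (\<lambda>\<omega>. 0)" by (simp add: fun_eq_iff)
  then show ?case by simp
qed

lemma cadlag_adapted_const: "cadlag_adapted M F T (\<lambda>_ _. c)"
  by (simp add: cadlag_adapted_def adapted_def)

lemma cadlag_adapted_combine:
  fixes X :: "('w, 'u::{second_countable_topology, t2_space}) process" and Y :: "('w, 'v::{second_countable_topology, t2_space}) process"
    and h :: "'u \<Rightarrow> 'v \<Rightarrow> 'x::topological_space"
  assumes X: "cadlag_adapted M F T X" and Y: "cadlag_adapted M F T Y" and h: "continuous_on UNIV (\<lambda>x. h (fst x) (snd x))"
  shows "cadlag_adapted M F T (\<lambda>t \<omega>. h (X t \<omega>) (Y t \<omega>))"
  unfolding cadlag_adapted_def adapted_def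
proof safe
  fix t assume t: "t \<in> {0..T}"
  have "(\<lambda>\<omega>. (X t \<omega>, Y t \<omega>)) \<in> borel_measurable (F t)"
    using cadlag_adaptedD(2)[OF X] cadlag_adaptedD(2)[OF Y] t by (intro borel_measurable_Pair) auto
  from measurable_compose[OF this borel_measurable_continuous_onI[OF h]]
  show "(\<lambda>\<omega>. h (X t \<omega>) (Y t \<omega>)) \<in> borel_measurable (F t)" by simp
next
  fix \<omega> assume \<omega>: "\<omega> \<in> space M"
  have "cadlag_path T (\<lambda>t. (\<lambda>x. h (fst x) (snd x)) (X t \<omega>, Y t \<omega>))"
  proof (rule cadlag_path_compose[where h="\<lambda>x. h (fst x) (snd x)"])
    show "cadlag_path T (\<lambda>t. (X t \<omega>, Y t \<omega>))"
      by (intro cadlag_path_Pair cadlag_adaptedD(1)[OF X \<omega>] cadlag_adaptedD(1)[OF Y \<omega>])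
    show "isCont (\<lambda>x. h (fst x) (snd x)) z" for z
      using h continuous_on_eq_continuous_at[OF open_UNIV] by blast
  qed
  then show "cadlag_path T (\<lambda>t. h (X t \<omega>) (Y t \<omega>))" by simp
qed

lemma cadlag_adapted_lincomb:
  fixes X Y :: "('w, 'v::{real_normed_vector, second_countable_topology}) process"
  assumes "cadlag_adapted M F T X" "cadlag_adapted M F T Y"
  shows "cadlag_adapted M F T (\<lambda>t \<omega>. a *\<^sub>R X t \<omega> + b *\<^sub>R Y t \<omega>)"
  by (rule cadlag_adapted_combine[OF assms]) (intro continuous_intros)

lemma cadlag_adapted_diff:
  fixes X Y :: "('w, 'v::{real_normed_vector, second_countable_topology}) process"
  assumes "cadlag_adapted M F T X" "cadlag_adapted M F T Y"
  shows "cadlag_adapted M F T (\<lambda>t \<omega>. X t \<omega> - Y t \<omega>)"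
  using cadlag_adapted_lincomb[OF assms, of 1 "-1"] by simp

lemma cadlag_adapted_add:
  fixes X Y :: "('w, 'v::{real_normed_vector, second_countable_topology}) process"
  assumes "cadlag_adapted M F T X" "cadlag_adapted M F T Y"
  shows "cadlag_adapted M F T (\<lambda>t \<omega>. X t \<omega> + Y t \<omega>)"
  using cadlag_adapted_lincomb[OF assms, of 1 1] by simp

lemma cadlag_adapted_stopped_increment:
  fixes X :: "('w, 'v::{real_inner, second_countable_topology}) process"
  assumes X: "cadlag_adapted M F T X" and st: "0 \<le> s" "s \<le> t" "t \<le> T" and \<xi>: "\<xi> \<in> borel_measurable (F s)"
  shows "cadlag_adapted M F T (\<lambda>u \<omega>. \<xi> \<omega> \<bullet> (X (min u t) \<omega> - X (min u s) \<omega>))"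
  unfolding cadlag_adapted_def adapted_def
proof safe
  fix \<omega> assume \<omega>: "\<omega> \<in> space M"
  have "cadlag_path T (\<lambda>u. (\<lambda>x. \<xi> \<omega> \<bullet> (fst x - snd x)) (X (min u t) \<omega>, X (min u s) \<omega>))"
    using st by (intro cadlag_path_compose[where h="\<lambda>x. \<xi> \<omega> \<bullet> (fst x - snd x)"] cadlag_path_Pair left_limit_min(1) cadlag_adaptedD(1)[OF X \<omega>])
      (auto intro!: continuous_intros)
  then show "cadlag_path T (\<lambda>u. \<xi> \<omega> \<bullet> (X (min u t) \<omega> - X (min u s) \<omega>))" by simp
next
  fix u assume u: "u \<in> {0..T}"
  show "(\<lambda>\<omega>. \<xi> \<omega> \<bullet> (X (min u t) \<omega> - X (min u s) \<omega>)) \<in> borel_measurable (F u)"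
  \<comment> \<open>Up to time \<open>s\<close> the increment vanishes, so the process is adapted
    although \<xi> becomes known only at \<open>s\<close>.\<close>
  proof (cases "u \<le> s")
    case True
    then show ?thesis using st by (simp add: min_absorb1)
  next
    case False
    have "X (min u t) \<in> borel_measurable (F (min u t))" "X (min u s) \<in> borel_measurable (F (min u s))"
      using st u by (auto intro!: cadlag_adaptedD(2)[OF X])
    then have [measurable]: "X (min u t) \<in> borel_measurable (F u)" "X (min u s) \<in> borel_measurable (F u)" "\<xi> \<in> borel_measurable (F u)"
      using False \<xi> by (auto intro: measurable_F_mono)
    show ?thesis by measurable
  qed
qed

lemma elem_int_cadlag:
  assumes X: "cadlag_adapted M F T X" and "valid_elem rs"
  shows "cadlag_adapted M F T (elem_int X rs)"
  using assms(2)
proof (induction rs)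
  case Nil
  have "elem_int X [] = (\<lambda>_ _. 0)" by (simp add: fun_eq_iff)
  then show ?case using cadlag_adapted_const by simp
next
  case (Cons r rs)
  obtain s t \<xi> where r: "r = (s, t, \<xi>)" by (cases r)
  have "cadlag_adapted M F T (\<lambda>u \<omega>. \<xi> \<omega> \<bullet> (X (min u t) \<omega> - X (min u s) \<omega>) + elem_int X rs u \<omega>)"
    using Cons r bdd_rv_measurable by (intro cadlag_adapted_add cadlag_adapted_stopped_increment X) auto
  moreover have "elem_int X (r # rs) = (\<lambda>u \<omega>. \<xi> \<omega> \<bullet> (X (min u t) \<omega> - X (min u s) \<omega>) + elem_int X rs u \<omega>)"
    by (simp add: r fun_eq_iff)
  ultimately show ?case by simp
qed

definition Q :: "(real \<times> 'w) measure" where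
  "Q = restrict_space lborel {0..T} \<Otimes>\<^sub>M M"

text \<open>The square controls the centered small increments, the absolute value their mean and the
  large increments.\<close>

definition qnorm :: "('w, real) process \<Rightarrow> real" where
  "qnorm H = (LINT z|Q. \<bar>H (fst z) (snd z)\<bar> + (H (fst z) (snd z))\<^sup>2)"

lemma space_Q: "space Q = {0..T} \<times> space M"
  by (simp add: Q_def space_pair_measure space_restrict_space)

lemma finite_time: "finite_measure (restrict_space lborel {0..T})"
  by (rule finite_measureI) (auto simp: space_restrict_space emeasure_restrict_space emeasure_lborel_Icc_eq)

lemma finite_Q: "finite_measure Q"
proof -
  show ?thesis unfolding Q_def
    by (rule finite_measure_pair_measure[OF finite_measure_axioms finite_time])
qed

end

context stoch_basis
begin

lemma Q_integral_prod:
  assumes f: "bdd_rv borel f" and g: "bdd_rv M g"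
  shows "integrable Q (\<lambda>z. f (fst z) * g (snd z))"
    and "(LINT z|Q. f (fst z) * g (snd z)) = (LINT u|restrict_space lborel {0..T}. f u) * expectation g"
proof -
  interpret QM: finite_measure Q by (rule finite_Q)
  interpret A: finite_measure "restrict_space lborel {0..T}" by (rule finite_time)
  interpret P: pair_sigma_finite "restrict_space lborel {0..T}" M ..
  have [measurable]: "f \<in> borel_measurable borel" "g \<in> borel_measurable M" using f g by (auto simp: bdd_rv_def)
  have f': "f \<in> borel_measurable (restrict_space lborel {0..T})" by (rule measurable_restrict_space1) simp
  have fb: "bdd_rv (restrict_space lborel {0..T}) f" using f f' by (auto simp: bdd_rv_def)
  have "bdd_rv Q (\<lambda>z. f (fst z) * g (snd z))"
    unfolding Q_def
    by (intro bdd_rv_mult bdd_rv_compose[OF fb] bdd_rv_compose[OF g] measurable_fst measurable_snd)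
  then show int: "integrable Q (\<lambda>z. f (fst z) * g (snd z))" by (rule QM.bdd_rv_integrable)
  have "(LINT z|Q. f (fst z) * g (snd z)) = (LINT u|restrict_space lborel {0..T}. LINT \<omega>|M. f u * g \<omega>)"
    using P.integral_fst'[of "\<lambda>z. f (fst z) * g (snd z)"] int by (simp add: Q_def)
  then show "(LINT z|Q. f (fst z) * g (snd z)) = (LINT u|restrict_space lborel {0..T}. f u) * expectation g"
    by simp
qed

text \<open>By \<open>elem_between\<close> the process does not vary in time on a cell, so the sum
  is a part of the integral that defines \<open>qnorm\<close>.\<close>

lemma grid_norm_le:
  assumes rs: "valid_elem rs" and p: "p 0 = 0" "\<And>i. i < n \<Longrightarrow> p i < p (Suc i)" "p n = T"
    and gap: "\<And>i x. i < n \<Longrightarrow> x \<in> elem_points rs \<Longrightarrow> x \<le> p i \<or> p (Suc i) \<le> x"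
    and int: "integrable Q (\<lambda>z. \<bar>elem rs (fst z) (snd z)\<bar> + (elem rs (fst z) (snd z))\<^sup>2)"
  shows "(\<Sum>i<n. (p (Suc i) - p i) * expectation (\<lambda>\<omega>. \<bar>elem rs (p (Suc i)) \<omega>\<bar> + (elem rs (p (Suc i)) \<omega>)\<^sup>2)) \<le> qnorm (elem rs)"
proof -
  let ?\<phi> = "\<lambda>x::real. \<bar>x\<bar> + x\<^sup>2"
  have mono: "p i \<le> p j" if "i \<le> j" "j \<le> n" for i j
    using that
  proof (induction j rule: nat_induct_at_least)
    case (Suc k)
    then show ?case using p(2)[of k] by auto
  qed simp
  have bdd: "bdd_rv M (\<lambda>\<omega>. ?\<phi> (elem rs (p (Suc i)) \<omega>))" if "i < n" for i
    by (intro bdd_rv_intros bdd_rv_F_M[OF elem_bdd_rv[OF rs gap[OF that]]])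
  have ind: "bdd_rv borel (indicat_real {p i<..p (Suc i)})" for i
    by (rule bdd_rvI[where c=1]) auto
  have len: "(LINT u|restrict_space lborel {0..T}. indicat_real {p i<..p (Suc i)} u) = p (Suc i) - p i" if "i < n" for i
  proof -
    have "{p i<..p (Suc i)} \<subseteq> {0..T}" using mono[of 0 i] mono[of "Suc i" n] p that by auto
    then show ?thesis using p(2)[OF that]
      by (subst Bochner_Integration.integral_indicator)
        (auto simp: space_restrict_space measure_restrict_space Int_absorb2 Int_absorb1)
  qed
  have "(\<Sum>i<n. (p (Suc i) - p i) * expectation (\<lambda>\<omega>. ?\<phi> (elem rs (p (Suc i)) \<omega>)))
    = (\<Sum>i<n. LINT z|Q. indicat_real {p i<..p (Suc i)} (fst z) * ?\<phi> (elem rs (p (Suc i)) (snd z)))"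
    using Q_integral_prod(2)[OF ind bdd] len by (intro sum.cong) auto
  also have "\<dots> = (LINT z|Q. (\<Sum>i<n. indicat_real {p i<..p (Suc i)} (fst z) * ?\<phi> (elem rs (p (Suc i)) (snd z))))"
    using Q_integral_prod(1)[OF ind bdd] by (intro Bochner_Integration.integral_sum[symmetric]) auto
  also have "\<dots> \<le> (LINT z|Q. ?\<phi> (elem rs (fst z) (snd z)))"
  proof (rule integral_mono[OF _ int])
    show "integrable Q (\<lambda>z. \<Sum>i<n. indicat_real {p i<..p (Suc i)} (fst z) * ?\<phi> (elem rs (p (Suc i)) (snd z)))"
      using Q_integral_prod(1)[OF ind bdd] by (intro Bochner_Integration.integrable_sum) auto
    fix z :: "real \<times> 'w"
    obtain u \<omega> where z: "z = (u, \<omega>)" by (cases z)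
    show "(\<Sum>i<n. indicat_real {p i<..p (Suc i)} (fst z) * ?\<phi> (elem rs (p (Suc i)) (snd z))) \<le> ?\<phi> (elem rs (fst z) (snd z))"
    proof (cases "\<exists>j<n. u \<in> {p j<..p (Suc j)}")
      case True
      then obtain j where j: "j < n" "u \<in> {p j<..p (Suc j)}" by blast
      have "indicat_real {p i<..p (Suc i)} u = 0" if "i < n" "i \<noteq> j" for i
      proof (cases "i < j")
        case True then show ?thesis using mono[of "Suc i" j] j that by auto
      next
        case False then show ?thesis using mono[of "Suc j" i] j that by auto
      qed
      then have "(\<Sum>i<n. indicat_real {p i<..p (Suc i)} u * ?\<phi> (elem rs (p (Suc i)) \<omega>))
        = (\<Sum>i\<in>{j}. indicat_real {p i<..p (Suc i)} u * ?\<phi> (elem rs (p (Suc i)) \<omega>))"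
        using j by (intro sum.mono_neutral_right) auto
      also have "\<dots> = ?\<phi> (elem rs u \<omega>)"
        using j elem_between[of rs "p j" "p (Suc j)" u \<omega>] gap[OF j(1)] by auto
      finally show ?thesis by (simp add: z)
    next
      case False
      then have "(\<Sum>i<n. indicat_real {p i<..p (Suc i)} u * ?\<phi> (elem rs (p (Suc i)) \<omega>)) = 0"
        by (intro sum.neutral) auto
      then show ?thesis by (simp add: z)
    qed
  qed
  finally show ?thesis by (simp add: qnorm_def)
qed

text \<open>Unless the path leaves \<open>a / 2\<close>, no increment is truncated and the integral
  splits into a centred and a drift part. Exceeding \<open>e / 2\<close>, the first costs
  \<open>4 / e\<^sup>2\<close> by Kolmogorov's inequality and the second \<open>2 / e\<close> by
  Markov's. The bound does not involve the grid, so it can be refined.\<close>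

lemma grid_estimate:
  fixes X :: "('w, real) process"
  assumes X: "levy_increments X" and a: "a > 0" and K: "K \<ge> 0"
    and mean: "\<And>h. 0 \<le> h \<Longrightarrow> h \<le> T \<Longrightarrow> \<bar>expectation (\<lambda>\<omega>. trunc a (X h \<omega>))\<bar> \<le> K * h"
    and var: "\<And>h. 0 \<le> h \<Longrightarrow> h \<le> T \<Longrightarrow> variance (\<lambda>\<omega>. trunc a (X h \<omega>)) \<le> K * h"
    and e: "e > 0" and rs: "valid_elem rs"
    and G: "finite G" "0 \<in> G" "T \<in> G" "G \<subseteq> {0..T}" "elem_points rs \<subseteq> G"
    and int: "integrable Q (\<lambda>z. \<bar>elem rs (fst z) (snd z)\<bar> + (elem rs (fst z) (snd z))\<^sup>2)"
  shows "prob {\<omega>\<in>space M. \<exists>t\<in>G. \<bar>elem_int X rs t \<omega>\<bar> > e}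
    \<le> prob {\<omega>\<in>space M. \<exists>t\<in>{0..T}. \<bar>X t \<omega>\<bar> > a / 2} + (4 / e\<^sup>2 + 2 / e) * K * qnorm (elem rs)"
proof -
  obtain p n where p: "p ` {..n} = G" "p 0 = 0" "p n = T" "\<And>i. i < n \<Longrightarrow> p i < p (Suc i)"
    "\<And>i x. i < n \<Longrightarrow> x \<in> G \<Longrightarrow> x \<le> p i \<or> p (Suc i) \<le> x"
    using sorted_grid[OF G(1-4)] by metis
  have pT: "0 \<le> p i" "p i \<le> T" if "i \<le> n" for i using p(1) G(4) that by fastforce+
  have gap: "x \<le> p i \<or> p (Suc i) \<le> x" if "i < n" "x \<in> elem_points rs" for i x
    using p(5) that G(5) by blast
  define \<Xi> where "\<Xi> i = elem rs (p (Suc i))" for i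
  define h where "h i = p (Suc i) - p i" for i
  define b where "b i = expectation (\<lambda>\<omega>. trunc a (X (h i) \<omega>))" for i
  define D where "D i \<omega> = trunc a (X (p (Suc i)) \<omega> - X (p i) \<omega>) - b i" for i \<omega>
  have \<Xi>: "bdd_rv (F (p i)) (\<Xi> i)" if "i < n" for i
    unfolding \<Xi>_def by (rule elem_bdd_rv[OF rs gap[OF that]])
  have h: "0 \<le> h i" "h i \<le> T" if "i < n" for i
    using p(4)[OF that] pT(1)[of i] pT(2)[of "Suc i"] that by (auto simp: h_def)
  have \<Xi>M: "bdd_rv M (\<Xi> i)" if "i < n" for i by (rule bdd_rv_F_M[OF \<Xi>[OF that]])
  let ?B = "{\<omega>\<in>space M. \<exists>t\<in>{0..T}. \<bar>X t \<omega>\<bar> > a / 2}"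
  let ?S = "{\<omega>\<in>space M. \<exists>k\<le>n. \<bar>\<Sum>i<k. \<Xi> i \<omega> * D i \<omega>\<bar> > e / 2}"
  let ?V = "{\<omega>\<in>space M. (\<Sum>i<n. \<bar>\<Xi> i \<omega>\<bar> * (K * h i)) \<ge> e / 2}"
  have B: "?B \<in> sets M"
  proof -
    have "open {x::real. \<bar>x\<bar> > a / 2}" by (intro open_Collect_less continuous_intros)
    from sup_event_measurable[OF levy_cadlag[OF X] this] show ?thesis by simp
  qed
  have Dm: "bdd_rv M (D i)" if "i < n" for i
    unfolding D_def using levy_measurable(2)[OF X pT] that
    by (intro bdd_rv_intros bdd_rv_compose[OF bdd_rv_trunc] borel_measurable_diff) auto
  have S: "?S \<in> sets M"
  proof -
    have "{\<omega>\<in>space M. \<exists>k\<in>{..n}. \<bar>\<Sum>i<k. \<Xi> i \<omega> * D i \<omega>\<bar> > e / 2} \<in> sets M"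
    proof (rule sets.sets_Collect_finite_Ex)
      fix k assume "k \<in> {..n}"
      then have "bdd_rv M (\<lambda>\<omega>. \<Sum>i<k. \<Xi> i \<omega> * D i \<omega>)"
        by (intro bdd_rv_intros \<Xi>M Dm) auto
      from bdd_rv_measurable[OF this]
      show "{\<omega>\<in>space M. \<bar>\<Sum>i<k. \<Xi> i \<omega> * D i \<omega>\<bar> > e / 2} \<in> sets M" by measurable
    qed simp
    then show ?thesis by (simp only: Bex_def atMost_iff)
  qed
  have Vm: "bdd_rv M (\<lambda>\<omega>. \<Sum>i<n. \<bar>\<Xi> i \<omega>\<bar> * (K * h i))" by (intro bdd_rv_intros \<Xi>M) auto
  have V: "?V \<in> sets M" using bdd_rv_measurable[OF Vm] by measurable
  have norm: "(\<Sum>i<n. expectation (\<lambda>\<omega>. \<bar>\<Xi> i \<omega>\<bar> + (\<Xi> i \<omega>)\<^sup>2) * (K * h i)) \<le> K * qnorm (elem rs)"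
  proof -
    have "(\<Sum>i<n. expectation (\<lambda>\<omega>. \<bar>\<Xi> i \<omega>\<bar> + (\<Xi> i \<omega>)\<^sup>2) * (K * h i))
      = K * (\<Sum>i<n. (p (Suc i) - p i) * expectation (\<lambda>\<omega>. \<bar>elem rs (p (Suc i)) \<omega>\<bar> + (elem rs (p (Suc i)) \<omega>)\<^sup>2))"
      by (simp only: sum_distrib_left h_def \<Xi>_def mult_ac)
    also have "\<dots> \<le> K * qnorm (elem rs)"
      by (rule mult_left_mono[OF grid_norm_le[OF rs p(2,4,3) gap int] K])
    finally show ?thesis .
  qed
  have "{\<omega>\<in>space M. \<exists>t\<in>G. \<bar>elem_int X rs t \<omega>\<bar> > e} \<subseteq> ?B \<union> (?S \<union> ?V)"
  proof (rule subsetI, rule ccontr)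
    fix \<omega> assume \<omega>: "\<omega> \<in> {\<omega>\<in>space M. \<exists>t\<in>G. \<bar>elem_int X rs t \<omega>\<bar> > e}" "\<omega> \<notin> ?B \<union> (?S \<union> ?V)"
    then obtain t where t: "t \<in> G" "\<bar>elem_int X rs t \<omega>\<bar> > e" by blast
    then obtain k where k: "k \<le> n" "t = p k" using p(1) by blast
    have sm: "\<omega> \<in> space M" using \<omega> by blast
    have Xa: "\<bar>X (p i) \<omega>\<bar> \<le> a / 2" if "i \<le> n" for i using \<omega> sm pT[OF that] by force
    have inc: "X (p (Suc i)) \<omega> - X (p i) \<omega> = D i \<omega> + b i" if "i < k" for i
      using Xa[of i] Xa[of "Suc i"] that k unfolding D_def trunc_def by auto
    have "elem_int X rs t \<omega> = (\<Sum>i<k. \<Xi> i \<omega> * (X (p (Suc i)) \<omega> - X (p i) \<omega>))"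
      unfolding k(2) \<Xi>_def by (rule elem_int_grid[OF p(2) rs p(4) gap k(1)])
    also have "\<dots> = (\<Sum>i<k. \<Xi> i \<omega> * D i \<omega>) + (\<Sum>i<k. \<Xi> i \<omega> * b i)"
      using inc by (simp add: distrib_left sum.distrib[symmetric])
    finally have "e < \<bar>\<Sum>i<k. \<Xi> i \<omega> * D i \<omega>\<bar> + \<bar>\<Sum>i<k. \<Xi> i \<omega> * b i\<bar>" using t(2) by linarith
    moreover have "\<bar>\<Sum>i<k. \<Xi> i \<omega> * D i \<omega>\<bar> \<le> e / 2" using \<omega>(2) sm k(1) by (force simp: not_less)
    moreover have "\<bar>\<Sum>i<k. \<Xi> i \<omega> * b i\<bar> < e / 2"
    proof -
      have "\<bar>\<Sum>i<k. \<Xi> i \<omega> * b i\<bar> \<le> (\<Sum>i<k. \<bar>\<Xi> i \<omega>\<bar> * (K * h i))"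
        unfolding b_def by (rule order_trans[OF sum_abs], unfold abs_mult, intro sum_mono mult_left_mono)
          (use mean h k in auto)
      also have "\<dots> \<le> (\<Sum>i<n. \<bar>\<Xi> i \<omega>\<bar> * (K * h i))"
        using k h K by (intro sum_mono2) auto
      also have "\<dots> < e / 2" using \<omega>(2) sm by (simp add: not_le)
      finally show ?thesis .
    qed
    ultimately show False by linarith
  qed
  then have "prob {\<omega>\<in>space M. \<exists>t\<in>G. \<bar>elem_int X rs t \<omega>\<bar> > e} \<le> prob (?B \<union> (?S \<union> ?V))"
    by (rule finite_measure_mono) (intro sets.Un B S V)
  also have "\<dots> \<le> prob ?B + (prob ?S + prob ?V)"
    by (rule order_trans[OF measure_Un_le[OF B sets.Un[OF S V]] add_left_mono[OF measure_Un_le[OF S V]]])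
  also have "prob ?S \<le> (\<Sum>i<n. expectation (\<lambda>\<omega>. (\<Xi> i \<omega>)\<^sup>2) * variance (\<lambda>\<omega>. trunc a (X (p (Suc i) - p i) \<omega>))) / (e / 2)\<^sup>2"
    unfolding D_def b_def h_def
    by (rule centered_sum_maximal[where X=X and p=p and n=n, OF X less_imp_le[OF p(4)] pT bdd_rv_trunc \<Xi>]) (use e in auto)
  also have "\<dots> \<le> (\<Sum>i<n. expectation (\<lambda>\<omega>. \<bar>\<Xi> i \<omega>\<bar> + (\<Xi> i \<omega>)\<^sup>2) * (K * h i)) / (e / 2)\<^sup>2"
    using var h unfolding h_def
    by (intro divide_right_mono sum_mono mult_mono integral_mono bdd_rv_integrable bdd_rv_intros \<Xi>M) auto
  also note norm
  also have "prob ?V \<le> expectation (\<lambda>\<omega>. \<Sum>i<n. \<bar>\<Xi> i \<omega>\<bar> * (K * h i)) / (e / 2)"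
    using e K h
    by (intro integral_Markov_inequality_measure[where A="{}"] bdd_rv_integrable Vm) (auto intro!: sum_nonneg)
  also have "expectation (\<lambda>\<omega>. \<Sum>i<n. \<bar>\<Xi> i \<omega>\<bar> * (K * h i)) \<le> K * qnorm (elem rs)"
  proof -
    have "expectation (\<lambda>\<omega>. \<Sum>i<n. \<bar>\<Xi> i \<omega>\<bar> * (K * h i)) = (\<Sum>i<n. expectation (\<lambda>\<omega>. \<bar>\<Xi> i \<omega>\<bar>) * (K * h i))"
      using \<Xi>M by (subst Bochner_Integration.integral_sum) (auto intro!: bdd_rv_integrable bdd_rv_intros)
    also have "\<dots> \<le> (\<Sum>i<n. expectation (\<lambda>\<omega>. \<bar>\<Xi> i \<omega>\<bar> + (\<Xi> i \<omega>)\<^sup>2) * (K * h i))"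
      using h K by (intro sum_mono mult_right_mono integral_mono bdd_rv_integrable bdd_rv_intros \<Xi>M) auto
    finally show ?thesis using norm by linarith
  qed
  finally have "prob {\<omega>\<in>space M. \<exists>t\<in>G. \<bar>elem_int X rs t \<omega>\<bar> > e}
    \<le> prob ?B + (K * qnorm (elem rs) / (e / 2)\<^sup>2 + K * qnorm (elem rs) / (e / 2))"
    using e by (simp add: divide_right_mono)
  also have "K * qnorm (elem rs) / (e / 2)\<^sup>2 + K * qnorm (elem rs) / (e / 2) = (4 / e\<^sup>2 + 2 / e) * K * qnorm (elem rs)"
    using e by (simp add: field_simps power2_eq_square)
  finally show ?thesis .
qed

end

section \<open>Uniform convergence in probability\<close>

context stoch_basis
begin

lemma cadlag_adapted_scale:
  fixes Y :: "('w, real) process"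
  assumes "cadlag_adapted M F T Y"
  shows "cadlag_adapted M F T (\<lambda>t \<omega>. c * Y t \<omega>)"
  using cadlag_adapted_lincomb[OF assms assms, of c 0] by simp

definition sup_prob :: "('w, real) process \<Rightarrow> real \<Rightarrow> real" where
  "sup_prob Y e = prob {\<omega>\<in>space M. \<exists>t\<in>{0..T}. \<bar>Y t \<omega>\<bar> > e}"

lemma sup_set_measurable:
  assumes "cadlag_adapted M F T (Y :: ('w, real) process)"
  shows "{\<omega>\<in>space M. \<exists>t\<in>{0..T}. \<bar>Y t \<omega>\<bar> > e} \<in> sets M"
proof -
  have "open {x::real. \<bar>x\<bar> > e}" by (intro open_Collect_less continuous_intros)
  from sup_event_measurable[OF assms this] show ?thesis by simp
qed

lemma sup_prob_nonneg: "0 \<le> sup_prob Y e"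
  by (simp add: sup_prob_def)

lemma ucp_lim_iff:
  "ucp_lim M T Y Z \<longleftrightarrow> (\<forall>e>0. (\<lambda>n. sup_prob (\<lambda>t \<omega>. Y n t \<omega> - Z t \<omega>) e) \<longlonglongrightarrow> 0)"
  by (simp add: ucp_lim_def sup_prob_def)

lemma sup_prob_le:
  assumes Y: "cadlag_adapted M F T (Y :: ('w, real) process)"
    and "AE \<omega> in M. (\<forall>t\<in>{0..T}. \<bar>Y t \<omega>\<bar> \<le> e) \<longrightarrow> (\<forall>t\<in>{0..T}. \<bar>W t \<omega>\<bar> \<le> e')"
  shows "sup_prob W e' \<le> sup_prob Y e"
  unfolding sup_prob_def
  by (rule finite_measure_mono_AE[OF _ sup_set_measurable[OF Y]])
    (use assms(2) in eventually_elim, auto simp: not_le[symmetric])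

lemma sup_prob_le2:
  assumes Y: "cadlag_adapted M F T (Y :: ('w, real) process)" and Z: "cadlag_adapted M F T (Z :: ('w, real) process)"
    and *: "AE \<omega> in M. (\<forall>t\<in>{0..T}. \<bar>Y t \<omega>\<bar> \<le> a) \<longrightarrow> (\<forall>t\<in>{0..T}. \<bar>Z t \<omega>\<bar> \<le> b) \<longrightarrow> (\<forall>t\<in>{0..T}. \<bar>W t \<omega>\<bar> \<le> e)"
  shows "sup_prob W e \<le> sup_prob Y a + sup_prob Z b"
proof -
  let ?Y = "{\<omega>\<in>space M. \<exists>t\<in>{0..T}. \<bar>Y t \<omega>\<bar> > a}" and ?Z = "{\<omega>\<in>space M. \<exists>t\<in>{0..T}. \<bar>Z t \<omega>\<bar> > b}"
  have "sup_prob W e \<le> prob (?Y \<union> ?Z)" unfolding sup_prob_def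
  proof (rule finite_measure_mono_AE)
    show "AE \<omega> in M. \<omega> \<in> {\<omega>\<in>space M. \<exists>t\<in>{0..T}. \<bar>W t \<omega>\<bar> > e} \<longrightarrow> \<omega> \<in> ?Y \<union> ?Z"
      using * by eventually_elim (auto simp: not_le[symmetric])
  qed (intro sets.Un sup_set_measurable Y Z)
  also have "\<dots> \<le> prob ?Y + prob ?Z"
    by (intro measure_Un_le sup_set_measurable Y Z)
  finally show ?thesis by (simp add: sup_prob_def)
qed

lemma sup_prob_add:
  assumes "cadlag_adapted M F T (Y :: ('w, real) process)" "cadlag_adapted M F T (Z :: ('w, real) process)"
  shows "sup_prob (\<lambda>t \<omega>. Y t \<omega> + Z t \<omega>) e \<le> sup_prob Y (e / 2) + sup_prob Z (e / 2)"
  by (rule sup_prob_le2[OF assms], rule AE_I2) (auto intro!: order_trans[OF abs_triangle_ineq] dest!: bspec)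

lemma indist_iff_sup_prob:
  assumes Y: "cadlag_adapted M F T (Y :: ('w, real) process)" and Z: "cadlag_adapted M F T (Z :: ('w, real) process)"
  shows "indist M T Y Z \<longleftrightarrow> (\<forall>e>0. sup_prob (\<lambda>t \<omega>. Y t \<omega> - Z t \<omega>) e = 0)"
proof -
  have D: "cadlag_adapted M F T (\<lambda>t \<omega>. Y t \<omega> - Z t \<omega>)" by (rule cadlag_adapted_diff[OF Y Z])
  show ?thesis
  proof
    assume "indist M T Y Z"
    then have "sup_prob (\<lambda>t \<omega>. Y t \<omega> - Z t \<omega>) e \<le> 0" if "e > 0" for e
      unfolding indist_def sup_prob_def using that
      by (subst prob_eq_0[THEN iffD2, OF sup_set_measurable[OF D]]) (auto elim!: eventually_mono)
    then show "\<forall>e>0. sup_prob (\<lambda>t \<omega>. Y t \<omega> - Z t \<omega>) e = 0"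
      using sup_prob_nonneg by (meson order_antisym)
  next
    assume *: "\<forall>e>0. sup_prob (\<lambda>t \<omega>. Y t \<omega> - Z t \<omega>) e = 0"
    have "AE \<omega> in M. \<forall>n::nat. \<forall>t\<in>{0..T}. \<bar>Y t \<omega> - Z t \<omega>\<bar> \<le> 1 / real (Suc n)"
    proof (rule AE_all_countable[THEN iffD2], rule allI)
      fix n :: nat
      have "prob {\<omega>\<in>space M. \<exists>t\<in>{0..T}. \<bar>Y t \<omega> - Z t \<omega>\<bar> > 1 / real (Suc n)} = 0"
        using * by (simp add: sup_prob_def)
      then have "AE \<omega> in M. \<omega> \<notin> {\<omega>\<in>space M. \<exists>t\<in>{0..T}. \<bar>Y t \<omega> - Z t \<omega>\<bar> > 1 / real (Suc n)}"
        using prob_eq_0[OF sup_set_measurable[OF D]] by blast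
      then show "AE \<omega> in M. \<forall>t\<in>{0..T}. \<bar>Y t \<omega> - Z t \<omega>\<bar> \<le> 1 / real (Suc n)"
        by (rule AE_mp, intro AE_I2) (auto simp: not_less)
    qed
    then show "indist M T Y Z" unfolding indist_def
    proof eventually_elim
      case (elim \<omega>)
      show ?case
      proof
        fix t assume t: "t \<in> {0..T}"
        have "\<bar>Y t \<omega> - Z t \<omega>\<bar> \<le> 0"
        proof (rule LIMSEQ_le_const[OF LIMSEQ_inverse_real_of_nat])
          show "\<exists>N. \<forall>n\<ge>N. \<bar>Y t \<omega> - Z t \<omega>\<bar> \<le> inverse (real (Suc n))"
            using elim t by (auto simp: inverse_eq_divide)
        qed
        then show "Y t \<omega> = Z t \<omega>" by simp
      qed
    qed
  qed
qed

lemma indist_sym: "indist M T Y Z \<Longrightarrow> indist M T Z Y"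
  unfolding indist_def by (auto elim: eventually_mono)

lemma indist_trans: "indist M T Y Z \<Longrightarrow> indist M T Z W \<Longrightarrow> indist M T Y W"
  unfolding indist_def by (rule AE_mp[OF _ AE_mp]) auto

lemma indist_refl [simp]: "indist M T Y Y"
  by (simp add: indist_def)

lemma indist_combine:
  assumes "indist M T Y Y'" "indist M T Z Z'"
  shows "indist M T (\<lambda>t \<omega>. h t \<omega> (Y t \<omega>) (Z t \<omega>)) (\<lambda>t \<omega>. h t \<omega> (Y' t \<omega>) (Z' t \<omega>))"
  using assms unfolding indist_def by eventually_elim auto

definition ucp0 :: "(nat \<Rightarrow> ('w, real) process) \<Rightarrow> bool" where
  "ucp0 Y \<longleftrightarrow> (\<forall>e>0. (\<lambda>n. sup_prob (Y n) e) \<longlonglongrightarrow> 0)"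

lemma ucp_lim_ucp0: "ucp_lim M T Y Z \<longleftrightarrow> ucp0 (\<lambda>n t \<omega>. Y n t \<omega> - Z t \<omega>)"
  by (simp add: ucp_lim_iff ucp0_def)

text \<open>The hypothesis compares suprema: that of \<open>W n\<close> is at most \<open>C\<close>
  times that of \<open>Y n\<close>. It is phrased through arbitrary bounds \<open>r\<close>, so that
  no supremum need be formed.\<close>

lemma ucp0_dominate:
  assumes Y: "\<And>n. cadlag_adapted M F T (Y n)" and u: "ucp0 Y" and C: "C > 0"
    and le: "\<And>n. AE \<omega> in M. \<forall>r. (\<forall>t\<in>{0..T}. \<bar>Y n t \<omega>\<bar> \<le> r) \<longrightarrow> (\<forall>t\<in>{0..T}. \<bar>W n t \<omega>\<bar> \<le> C * r)"
  shows "ucp0 W"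
  unfolding ucp0_def
proof (intro allI impI)
  fix e :: real assume e: "e > 0"
  have lim: "(\<lambda>n. sup_prob (Y n) (e / C)) \<longlonglongrightarrow> 0" using u C e by (simp add: ucp0_def)
  have "sup_prob (W n) e \<le> sup_prob (Y n) (e / C)" for n
    by (rule sup_prob_le[OF Y]) (use le[of n] C in \<open>auto elim!: eventually_mono dest!: spec[of _ "e / C"]\<close>)
  then show "(\<lambda>n. sup_prob (W n) e) \<longlonglongrightarrow> 0"
    using sup_prob_nonneg by (intro tendsto_sandwich[OF _ _ tendsto_const lim]) auto
qed

lemma ucp0_add:
  assumes Y: "\<And>n. cadlag_adapted M F T (Y n)" and Z: "\<And>n. cadlag_adapted M F T (Z n)"
    and "ucp0 Y" "ucp0 Z"
  shows "ucp0 (\<lambda>n t \<omega>. Y n t \<omega> + Z n t \<omega>)"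
  unfolding ucp0_def
proof (intro allI impI)
  fix e :: real assume e: "e > 0"
  have lim: "(\<lambda>n. sup_prob (Y n) (e / 2) + sup_prob (Z n) (e / 2)) \<longlonglongrightarrow> 0 + 0"
    using assms e by (intro tendsto_add) (auto simp: ucp0_def)
  show "(\<lambda>n. sup_prob (\<lambda>t \<omega>. Y n t \<omega> + Z n t \<omega>) e) \<longlonglongrightarrow> 0"
    by (rule tendsto_sandwich[OF _ _ tendsto_const lim[simplified]])
      (auto intro!: always_eventually sup_prob_nonneg sup_prob_add Y Z)
qed

lemma ucp0_scale:
  assumes Y: "\<And>n. cadlag_adapted M F T (Y n)" and "ucp0 Y"
  shows "ucp0 (\<lambda>n t \<omega>. c * Y n t \<omega>)"
proof (rule ucp0_dominate[OF assms, of "\<bar>c\<bar> + 1"])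
  show "AE \<omega> in M. \<forall>r. (\<forall>t\<in>{0..T}. \<bar>Y n t \<omega>\<bar> \<le> r) \<longrightarrow> (\<forall>t\<in>{0..T}. \<bar>c * Y n t \<omega>\<bar> \<le> (\<bar>c\<bar> + 1) * r)" for n
    by (intro AE_I2 allI impI ballI) (auto simp: abs_mult intro!: mult_mono)
qed auto

lemma ucp0_cong:
  assumes Y: "\<And>n. cadlag_adapted M F T (Y n)" and "ucp0 Y" "\<And>n. indist M T (Y n) (Z n)"
  shows "ucp0 Z"
proof (rule ucp0_dominate[OF assms(1,2), of 1])
  show "AE \<omega> in M. \<forall>r. (\<forall>t\<in>{0..T}. \<bar>Y n t \<omega>\<bar> \<le> r) \<longrightarrow> (\<forall>t\<in>{0..T}. \<bar>Z n t \<omega>\<bar> \<le> 1 * r)" for n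
    using assms(3)[of n] unfolding indist_def by eventually_elim auto
qed simp

lemma ucp0_const_iff:
  assumes Y: "cadlag_adapted M F T Y"
  shows "ucp0 (\<lambda>n. Y) \<longleftrightarrow> indist M T Y (\<lambda>_ _. 0)"
  using indist_iff_sup_prob[OF Y cadlag_adapted_const[of 0]] LIMSEQ_const_iff by (auto simp: ucp0_def)

lemma ucp_lim_unique:
  assumes Y: "\<And>n. cadlag_adapted M F T (Y n)" and Z: "cadlag_adapted M F T Z" and Z': "cadlag_adapted M F T Z'"
    and "ucp_lim M T Y Z" "ucp_lim M T Y Z'"
  shows "indist M T Z Z'"
proof -
  have "ucp0 (\<lambda>n t \<omega>. (Y n t \<omega> - Z' t \<omega>) + (-1) * (Y n t \<omega> - Z t \<omega>))"
    using assms by (intro ucp0_add ucp0_scale cadlag_adapted_diff cadlag_adapted_scale) (auto simp: ucp_lim_ucp0)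
  then have "ucp0 (\<lambda>n t \<omega>. Z t \<omega> - Z' t \<omega>)" by simp
  then have "indist M T (\<lambda>t \<omega>. Z t \<omega> - Z' t \<omega>) (\<lambda>_ _. 0)"
    using ucp0_const_iff cadlag_adapted_diff[OF Z Z'] by blast
  then show ?thesis by (simp add: indist_def)
qed

lemma AE_uniform_imp_ucp0:
  assumes Y: "\<And>n. cadlag_adapted M F T (Y n)"
    and AE: "AE \<omega> in M. uniform_limit {0..T} (\<lambda>n t. Y n t \<omega>) (\<lambda>_. 0) sequentially"
  shows "ucp0 Y"
  unfolding ucp0_def
proof (intro allI impI)
  fix e :: real assume e: "e > 0"
  let ?E = "\<lambda>n. {\<omega>\<in>space M. \<exists>t\<in>{0..T}. \<bar>Y n t \<omega>\<bar> > e}"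
  have "(\<lambda>n. expectation (indicat_real (?E n))) \<longlonglongrightarrow> expectation (\<lambda>_. 0 :: real)"
  proof (rule integral_dominated_convergence[where w="\<lambda>_. 1"])
    show "AE \<omega> in M. (\<lambda>n. indicat_real (?E n) \<omega>) \<longlonglongrightarrow> 0"
      using AE
    proof eventually_elim
      case (elim \<omega>)
      have "\<forall>\<^sub>F n in sequentially. indicat_real (?E n) \<omega> = 0"
        using uniform_limitD[OF elim e] by eventually_elim (auto simp: indicator_def)
      then show ?case by (rule tendsto_eventually)
    qed
  qed (use sup_set_measurable[OF Y] in \<open>auto intro!: AE_I2 simp: indicator_def\<close>)
  moreover have "expectation (indicat_real (?E n)) = sup_prob (Y n) e" for n
    using sup_set_measurable[OF Y, of e n] unfolding sup_prob_def
    by (subst Bochner_Integration.integral_indicator) (auto intro!: arg_cong[where f=prob])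
  ultimately show "(\<lambda>n. sup_prob (Y n) e) \<longlonglongrightarrow> 0" by simp
qed

section \<open>Almost sure uniform convergence and completeness\<close>

lemma borel_cantelli_sup:
  assumes Y: "\<And>n. cadlag_adapted M F T (Y n)" and le: "\<And>n. sup_prob (Y n) ((1 / 2) ^ n) \<le> (1 / 2) ^ n"
  shows "AE \<omega> in M. \<forall>\<^sub>F n in sequentially. \<forall>t\<in>{0..T}. \<bar>Y n t \<omega>\<bar> \<le> (1 / 2) ^ n"
proof -
  let ?E = "\<lambda>n. {\<omega>\<in>space M. \<exists>t\<in>{0..T}. \<bar>Y n t \<omega>\<bar> > (1 / 2) ^ n}"
  have "AE \<omega> in M. \<forall>\<^sub>F n in sequentially. \<omega> \<in> space M - ?E n"
  proof (rule borel_cantelli_AE1)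
    show "summable (\<lambda>n. prob (?E n))"
      by (rule summable_comparison_test'[of "\<lambda>n. (1 / 2) ^ n" 0]) (use le in \<open>auto simp: sup_prob_def\<close>)
  qed (use sup_set_measurable[OF Y] emeasure_finite in \<open>auto simp: top.not_eq_extremum[symmetric]\<close>)
  then show ?thesis
    by eventually_elim (auto elim!: eventually_mono simp: not_less)
qed

lemma ucp0_subseq_uniform:
  assumes Y: "\<And>n. cadlag_adapted M F T (Y n)" and u: "ucp0 Y"
  obtains r :: "nat \<Rightarrow> nat" where "strict_mono r"
    "AE \<omega> in M. uniform_limit {0..T} (\<lambda>n t. Y (r n) t \<omega>) (\<lambda>_. 0) sequentially"
proof -
  have "\<exists>r. strict_mono r \<and> (\<forall>k. sup_prob (Y (r k)) ((1 / 2) ^ k) \<le> (1 / 2) ^ k)"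
  proof -
    have "\<exists>N. \<forall>n\<ge>N. sup_prob (Y n) ((1 / 2) ^ k) \<le> (1 / 2) ^ k" for k
    proof -
      have "(\<lambda>n. sup_prob (Y n) ((1 / 2) ^ k)) \<longlonglongrightarrow> 0" using u by (simp add: ucp0_def)
      then have "\<forall>\<^sub>F n in sequentially. sup_prob (Y n) ((1 / 2) ^ k) < (1 / 2) ^ k" by (rule order_tendstoD) simp
      then show ?thesis unfolding eventually_sequentially using less_imp_le by blast
    qed
    then obtain N where N: "\<And>k n. n \<ge> N k \<Longrightarrow> sup_prob (Y n) ((1 / 2) ^ k) \<le> (1 / 2) ^ k" by metis
    \<comment> \<open>Adding up the thresholds makes \<open>r\<close> strictly increasing and keeps
      \<open>N k \<le> r k\<close>.\<close>
    define r where "r k = k + (\<Sum>i\<le>k. N i)" for k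
    have "strict_mono r" by (rule strict_monoI_Suc) (simp add: r_def)
    moreover have "N k \<le> r k" for k
      unfolding r_def by (simp add: atMost_Suc_eq_insert_0 sum.remove[of "{..k}" k] trans_le_add2)
    ultimately show ?thesis using N by blast
  qed
  then obtain r where r: "strict_mono r" "\<And>k. sup_prob (Y (r k)) ((1 / 2) ^ k) \<le> (1 / 2) ^ k" by blast
  have "AE \<omega> in M. uniform_limit {0..T} (\<lambda>n t. Y (r n) t \<omega>) (\<lambda>_. 0) sequentially"
    using borel_cantelli_sup[OF Y r(2)]
  proof eventually_elim
    case (elim \<omega>)
    show ?case
    proof (rule uniform_limitI)
      fix e :: real assume e: "e > 0"
      have "(\<lambda>n. (1 / 2 :: real) ^ n) \<longlonglongrightarrow> 0" by (rule LIMSEQ_realpow_zero) auto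
      then have "\<forall>\<^sub>F n in sequentially. (1 / 2 :: real) ^ n < e" using e by (rule order_tendstoD)
      with elim show "\<forall>\<^sub>F n in sequentially. \<forall>t\<in>{0..T}. dist (Y (r n) t \<omega>) 0 < e"
        by eventually_elim (auto intro: order_le_less_trans)
    qed
  qed
  with r(1) that show ?thesis by blast
qed

text \<open>The exceedance probabilities are summable, so by Borel-Cantelli almost every path is
  uniformly Cauchy, with geometric increments.\<close>

lemma ucp_complete:
  assumes Y: "\<And>n. cadlag_adapted M F T (Y n)"
    and le: "\<And>n. sup_prob (\<lambda>t \<omega>. Y (Suc n) t \<omega> - Y n t \<omega>) ((1 / 2) ^ n) \<le> (1 / 2) ^ n"
  obtains Z where "cadlag_adapted M F T Z" "ucp_lim M T Y Z"
proof -
  have "AE \<omega> in M. uniformly_Cauchy_on {0..T} (\<lambda>n t. Y n t \<omega>)"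
    using borel_cantelli_sup[OF cadlag_adapted_diff[OF Y Y] le]
  proof eventually_elim
    case (elim \<omega>)
    then obtain N where N: "\<And>n t. n \<ge> N \<Longrightarrow> t \<in> {0..T} \<Longrightarrow> \<bar>Y (Suc n) t \<omega> - Y n t \<omega>\<bar> \<le> (1 / 2) ^ n"
      unfolding eventually_sequentially by blast
    have step: "\<bar>Y (n + k) t \<omega> - Y n t \<omega>\<bar> \<le> 2 * (1 / 2) ^ n - 2 * (1 / 2) ^ (n + k)" if "n \<ge> N" "t \<in> {0..T}" for n k t
    proof (induction k)
      case (Suc k)
      have "\<bar>Y (Suc (n + k)) t \<omega> - Y (n + k) t \<omega>\<bar> \<le> (1 / 2) ^ (n + k)" using N[of "n + k" t] that by auto
      moreover have "(1 / 2) ^ (n + k) = 2 * (1 / 2 :: real) ^ (n + k) - 2 * (1 / 2) ^ (n + Suc k)" by simp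
      ultimately show ?case using Suc unfolding add_Suc_right by linarith
    qed simp
    show ?case
    proof (rule uniformly_Cauchy_onI')
      fix e :: real assume e: "e > 0"
      have "(\<lambda>n. 2 * (1 / 2 :: real) ^ n) \<longlonglongrightarrow> 2 * 0" by (intro tendsto_mult_left LIMSEQ_realpow_zero) auto
      then have "\<forall>\<^sub>F n in sequentially. 2 * (1 / 2 :: real) ^ n < e" using e by (intro order_tendstoD(2)) auto
      then obtain K where K: "\<And>n. n \<ge> K \<Longrightarrow> 2 * (1 / 2 :: real) ^ n < e" unfolding eventually_sequentially by blast
      show "\<exists>M. \<forall>x\<in>{0..T}. \<forall>m\<ge>M. \<forall>n>m. dist (Y m x \<omega>) (Y n x \<omega>) < e"
      proof (intro exI[of _ "max N K"] ballI allI impI)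
        fix t m n assume t: "t \<in> {0..T}" and m: "m \<ge> max N K" and n: "n > m"
        have "\<bar>Y (m + (n - m)) t \<omega> - Y m t \<omega>\<bar> \<le> 2 * (1 / 2) ^ m - 2 * (1 / 2) ^ (m + (n - m))"
          using step[of m t "n - m"] m t by auto
        also have "\<dots> < e" using K[of m] m by (smt (verit) max.bounded_iff zero_le_power divide_nonneg_nonneg)
        finally show "dist (Y m t \<omega>) (Y n t \<omega>) < e" using n by (simp add: dist_real_def)
      qed
    qed
  qed
  then obtain N where N: "N \<in> null_sets M" "\<And>\<omega>. \<omega> \<in> space M \<Longrightarrow> \<omega> \<notin> N \<Longrightarrow> uniformly_Cauchy_on {0..T} (\<lambda>n t. Y n t \<omega>)"
    unfolding eventually_ae_filter by blast
  \<comment> \<open>Completeness puts the exceptional null set into every \<open>F t\<close>, so the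
    value 0 on it keeps \<open>Z\<close> adapted, and every path is cadlag, not just almost every
    one.\<close>
  define Z where "Z t \<omega> = (if \<omega> \<in> N then 0 else lim (\<lambda>n. Y n t \<omega>))" for t \<omega>
  have unif: "uniform_limit {0..T} (\<lambda>n t. Y n t \<omega>) (\<lambda>t. Z t \<omega>) sequentially" if "\<omega> \<in> space M" "\<omega> \<notin> N" for \<omega>
  proof -
    have "uniformly_convergent_on {0..T} (\<lambda>n t. Y n t \<omega>)"
      using N(2)[OF that] by (rule Cauchy_uniformly_convergent)
    then show ?thesis using that by (simp add: uniformly_convergent_uniform_limit_iff Z_def)
  qed
  have Z: "cadlag_adapted M F T Z"
    unfolding cadlag_adapted_def adapted_def
  proof safe
    fix \<omega> assume \<omega>: "\<omega> \<in> space M"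
    show "cadlag_path T (\<lambda>t. Z t \<omega>)"
    proof (cases "\<omega> \<in> N")
      case True then show ?thesis by (simp add: Z_def)
    next
      case False
      show ?thesis by (rule cadlag_uniform_limit(1)[OF cadlag_adaptedD(1)[OF Y \<omega>] unif[OF \<omega> False]])
    qed
  next
    fix t assume t: "t \<in> {0..T}"
    have [measurable]: "N \<in> sets (F t)" "\<And>n. Y n t \<in> borel_measurable (F t)"
      using null_sets_F[OF _ N(1)] cadlag_adaptedD(2)[OF Y] t by auto
    show "Z t \<in> borel_measurable (F t)"
    proof (rule borel_measurable_LIMSEQ_real)
      show "(\<lambda>\<omega>. if \<omega> \<in> N then 0 else Y n t \<omega>) \<in> borel_measurable (F t)" for n by measurable
      fix \<omega> assume "\<omega> \<in> space (F t)"
      then show "(\<lambda>n. if \<omega> \<in> N then 0 else Y n t \<omega>) \<longlonglongrightarrow> Z t \<omega>"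
        using tendsto_uniform_limitI[OF unif t, of \<omega>] by (cases "\<omega> \<in> N") (auto simp: Z_def)
    qed
  qed
  have "AE \<omega> in M. uniform_limit {0..T} (\<lambda>n t. Y n t \<omega> - Z t \<omega>) (\<lambda>_. 0) sequentially"
    using AE_not_in[OF N(1)] AE_space
  proof eventually_elim
    case (elim \<omega>)
    have "uniform_limit {0..T} (\<lambda>n t. Y n t \<omega> - Z t \<omega>) (\<lambda>t. Z t \<omega> - Z t \<omega>) sequentially"
      by (intro uniform_limit_intros unif elim)
    then show ?case by simp
  qed
  then have "ucp0 (\<lambda>n t \<omega>. Y n t \<omega> - Z t \<omega>)"
    by (intro AE_uniform_imp_ucp0 cadlag_adapted_diff Y Z)
  then show ?thesis using that[OF Z] by (simp add: ucp_lim_ucp0)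
qed

end

section \<open>Predictable processes\<close>

context stoch_basis
begin

abbreviation "PS \<equiv> predictable_sigma M F T"

definition pred_gen :: "(real \<times> 'w) set set" where
  "pred_gen = {{0} \<times> A | A. A \<in> sets (F 0)} \<union>
      {{s<..t} \<times> A | s t A. 0 \<le> s \<and> s \<le> t \<and> t \<le> T \<and> A \<in> sets (F s)}"

lemma sets_F_space: "A \<in> sets (F t) \<Longrightarrow> A \<subseteq> space M"
  using sets.sets_into_space[of A "F t"] by simp

lemma pred_gen_Pow: "pred_gen \<subseteq> Pow ({0..T} \<times> space M)"
  using T_pos unfolding pred_gen_def by (auto dest!: sets_F_space subsetD)

lemma space_PS [simp]: "space PS = {0..T} \<times> space M"
  using pred_gen_Pow unfolding predictable_sigma_def pred_gen_def by (simp add: space_measure_of)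

lemma sets_PS: "sets PS = sigma_sets ({0..T} \<times> space M) pred_gen"
  using pred_gen_Pow unfolding predictable_sigma_def pred_gen_def by (simp add: sets_measure_of)

lemma pred_gen_interval: "0 \<le> s \<Longrightarrow> s \<le> t \<Longrightarrow> t \<le> T \<Longrightarrow> A \<in> sets (F s) \<Longrightarrow> {s<..t} \<times> A \<in> pred_gen"
  unfolding pred_gen_def by blast

lemma Int_stable_pred_gen: "Int_stable pred_gen"
proof (rule Int_stableI)
  fix a b assume ab: "a \<in> pred_gen" "b \<in> pred_gen"
  have zero: "{0} \<times> A \<in> pred_gen" if "A \<in> sets (F 0)" for A
    using that unfolding pred_gen_def by blast
  have empty: "{} \<in> pred_gen" using zero[of "{}"] by simp
  have mixed: "({0} \<times> A) \<inter> ({s<..t} \<times> B) \<in> pred_gen" if "0 \<le> s" for A B s t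
    using that empty by (auto simp: Times_Int_Times)
  have int2: "({s<..t} \<times> A) \<inter> ({s'<..t'} \<times> B) \<in> pred_gen"
    if "0 \<le> s" "s \<le> t" "t \<le> T" "A \<in> sets (F s)" "0 \<le> s'" "s' \<le> t'" "t' \<le> T" "B \<in> sets (F s')" for s t A s' t' B
  proof (cases "max s s' \<le> min t t'")
    case True
    have "A \<inter> B \<in> sets (F (max s s'))"
      using that sets_F_mono[of s "max s s'"] sets_F_mono[of s' "max s s'"] by auto
    then have "{max s s'<..min t t'} \<times> (A \<inter> B) \<in> pred_gen" using True that by (intro pred_gen_interval) auto
    then show ?thesis by (simp add: Times_Int_Times)
  next
    case False
    then have e: "{s<..t} \<inter> {s'<..t'} = {}" by auto
    show ?thesis unfolding Times_Int_Times e using empty by simp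
  qed
  have "(\<exists>A. a = {0} \<times> A \<and> A \<in> sets (F 0)) \<or> (\<exists>s t A. a = {s<..t} \<times> A \<and> 0 \<le> s \<and> s \<le> t \<and> t \<le> T \<and> A \<in> sets (F s))"
    "(\<exists>A. b = {0} \<times> A \<and> A \<in> sets (F 0)) \<or> (\<exists>s t A. b = {s<..t} \<times> A \<and> 0 \<le> s \<and> s \<le> t \<and> t \<le> T \<and> A \<in> sets (F s))"
    using ab unfolding pred_gen_def by blast+
  then show "a \<inter> b \<in> pred_gen"
  proof (elim disjE exE conjE)
    fix A B assume "a = {0} \<times> A" "A \<in> sets (F 0)" "b = {0} \<times> B" "B \<in> sets (F 0)"
    then show ?thesis using zero[of "A \<inter> B"] by (simp add: Times_Int_Times)
  next
    fix A s t B assume "a = {0} \<times> A" "b = {s<..t} \<times> B" "0 \<le> s"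
    then show ?thesis using mixed by simp
  next
    fix A s t B assume "b = {0} \<times> A" "a = {s<..t} \<times> B" "0 \<le> s"
    then show ?thesis using mixed by (simp add: Int_commute)
  next
    fix s t A s' t' B
    assume "a = {s<..t} \<times> A" "0 \<le> s" "s \<le> t" "t \<le> T" "A \<in> sets (F s)"
      "b = {s'<..t'} \<times> B" "0 \<le> s'" "s' \<le> t'" "t' \<le> T" "B \<in> sets (F s')"
    then show ?thesis using int2 by simp
  qed
qed

section \<open>Bounded predictable processes and a monotone class principle\<close>

abbreviation bp :: "('w, 'v::real_normed_vector) process \<Rightarrow> bool" where
  "bp \<equiv> bounded_predictable M F T"

lemma bpI:
  assumes "predictable M F T H" "\<And>t \<omega>. t \<in> {0..T} \<Longrightarrow> \<omega> \<in> space M \<Longrightarrow> norm (H t \<omega>) \<le> c"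
  shows "bp H"
  using assms unfolding bounded_predictable_def by blast

lemma bpE:
  assumes "bp H"
  obtains c where "0 \<le> c" "\<forall>t\<in>{0..T}. \<forall>\<omega>\<in>space M. norm (H t \<omega>) \<le> c"
proof -
  obtain c where "\<forall>t\<in>{0..T}. \<forall>\<omega>\<in>space M. norm (H t \<omega>) \<le> c" using assms unfolding bounded_predictable_def by blast
  then show ?thesis using that[of "max 0 c"] by fastforce
qed

lemma bp_predictable: "bp H \<Longrightarrow> predictable M F T H"
  by (simp add: bounded_predictable_def)

lemma bp_bdd_rv: "bp (H :: ('w, real) process) \<longleftrightarrow> bdd_rv PS (\<lambda>z. H (fst z) (snd z))"
  unfolding bounded_predictable_def predictable_def bdd_rv_def case_prod_beta' by auto

lemma predictable_compose:
  "predictable M F T H \<Longrightarrow> h \<in> borel_measurable borel \<Longrightarrow> predictable M F T (\<lambda>t \<omega>. h (H t \<omega>))"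
  unfolding predictable_def by (simp add: case_prod_beta' measurable_compose)

lemma predictable_lincomb:
  fixes H K :: "('w, 'v::euclidean_space) process"
  assumes "predictable M F T H" "predictable M F T K"
  shows "predictable M F T (\<lambda>t \<omega>. a *\<^sub>R H t \<omega> + b *\<^sub>R K t \<omega>)"
  using assms unfolding predictable_def case_prod_beta'
  by (intro borel_measurable_add borel_measurable_scaleR borel_measurable_const)

lemma predictable_scaleR:
  fixes K :: "('w, 'v::euclidean_space) process" and H :: "('w, real) process"
  assumes "predictable M F T H" "predictable M F T K"
  shows "predictable M F T (\<lambda>t \<omega>. H t \<omega> *\<^sub>R K t \<omega>)"
  using assms unfolding predictable_def case_prod_beta' by (intro borel_measurable_scaleR)

lemma bp_lincomb:
  fixes H K :: "('w, 'v::euclidean_space) process"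
  assumes "bp H" "bp K"
  shows "bp (\<lambda>t \<omega>. a *\<^sub>R H t \<omega> + b *\<^sub>R K t \<omega>)"
proof -
  obtain c where c: "0 \<le> c" "\<forall>t\<in>{0..T}. \<forall>\<omega>\<in>space M. norm (H t \<omega>) \<le> c" by (rule bpE[OF assms(1)])
  obtain d where d: "0 \<le> d" "\<forall>t\<in>{0..T}. \<forall>\<omega>\<in>space M. norm (K t \<omega>) \<le> d" by (rule bpE[OF assms(2)])
  show ?thesis
  proof (rule bpI)
    fix t \<omega> assume "t \<in> {0..T}" "\<omega> \<in> space M"
    from c(2)[rule_format, OF this] d(2)[rule_format, OF this] show "norm (a *\<^sub>R H t \<omega> + b *\<^sub>R K t \<omega>) \<le> \<bar>a\<bar> * c + \<bar>b\<bar> * d"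
      by (intro order_trans[OF norm_triangle_ineq] add_mono) (auto intro: mult_left_mono)
  qed (intro predictable_lincomb bp_predictable assms)
qed

lemma bp_scaleR:
  fixes K :: "('w, 'v::euclidean_space) process" and H :: "('w, real) process"
  assumes "bp H" "bp K"
  shows "bp (\<lambda>t \<omega>. H t \<omega> *\<^sub>R K t \<omega>)"
proof -
  obtain c where c: "0 \<le> c" "\<forall>t\<in>{0..T}. \<forall>\<omega>\<in>space M. norm (H t \<omega>) \<le> c" by (rule bpE[OF assms(1)])
  obtain d where d: "0 \<le> d" "\<forall>t\<in>{0..T}. \<forall>\<omega>\<in>space M. norm (K t \<omega>) \<le> d" by (rule bpE[OF assms(2)])
  show ?thesis
  proof (rule bpI)
    fix t \<omega> assume "t \<in> {0..T}" "\<omega> \<in> space M"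
    from c(2)[rule_format, OF this] d(2)[rule_format, OF this] c(1) show "norm (H t \<omega> *\<^sub>R K t \<omega>) \<le> c * d"
      by (auto intro!: mult_mono)
  qed (intro predictable_scaleR bp_predictable assms)
qed

lemma sets_PS_indicator:
  assumes "E \<in> sets PS"
  shows "bp (\<lambda>u \<omega>. indicat_real E (u, \<omega>) *\<^sub>R (v :: 'v::euclidean_space))"
proof (rule bpI)
  show "predictable M F T (\<lambda>u \<omega>. indicat_real E (u, \<omega>) *\<^sub>R v)"
  proof -
    have "(\<lambda>z. indicat_real E z *\<^sub>R v) \<in> borel_measurable PS"
      by (intro borel_measurable_scaleR borel_measurable_const borel_measurable_indicator assms)
    then show ?thesis by (simp add: predictable_def case_prod_beta')
  qed
  show "norm (indicat_real E (t, \<omega>) *\<^sub>R v) \<le> norm v" for t \<omega> by (simp add: indicator_def)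
qed

lemma sum_singleton: "sum f {a} = (f a :: 'v::comm_monoid_add)"
  by simp

text \<open>A functional monotone class argument: from generating rectangles to predictable sets by
  Dynkin's lemma, then to simple functions, then to bounded limits. The properties it is applied to
  are identities of integrals, which are stable under exactly these operations.\<close>

lemma bounded_predictable_induct [consumes 1, case_names zero interval lin lim]:
  fixes H :: "('w, 'v::euclidean_space) process"
  assumes H: "bp H"
    and zero: "\<And>A v. A \<in> sets (F 0) \<Longrightarrow> R (\<lambda>u \<omega>. indicat_real {0} u *\<^sub>R (indicat_real A \<omega> *\<^sub>R v))"
    and interval: "\<And>s t A v. 0 \<le> s \<Longrightarrow> s \<le> t \<Longrightarrow> t \<le> T \<Longrightarrow> A \<in> sets (F s) \<Longrightarrow>
      R (\<lambda>u \<omega>. indicat_real {s<..t} u *\<^sub>R (indicat_real A \<omega> *\<^sub>R v))"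
    and lin: "\<And>H K a b. bp H \<Longrightarrow> bp K \<Longrightarrow> R H \<Longrightarrow> R K \<Longrightarrow> R (\<lambda>u \<omega>. a *\<^sub>R H u \<omega> + b *\<^sub>R K u \<omega>)"
    and lim: "\<And>Hn H c. (\<And>n. bp (Hn n)) \<Longrightarrow> (\<And>n. R (Hn n)) \<Longrightarrow> bp H \<Longrightarrow>
      (\<And>n t \<omega>. t \<in> {0..T} \<Longrightarrow> \<omega> \<in> space M \<Longrightarrow> norm (Hn n t \<omega>) \<le> c) \<Longrightarrow>
      (\<And>t \<omega>. t \<in> {0..T} \<Longrightarrow> \<omega> \<in> space M \<Longrightarrow> (\<lambda>n. Hn n t \<omega>) \<longlonglongrightarrow> H t \<omega>) \<Longrightarrow> R H"
  shows "R H"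
proof -
  \<comment> \<open>A constant sequence in \<open>lim\<close> shows that \<open>R\<close> does not
    see values outside \<open>{0..T} \<times> space M\<close>, where predictable processes are
    unconstrained.\<close>
  have cong: "R K" if HK: "R H" "bp H" "bp K" "\<And>t \<omega>. t \<in> {0..T} \<Longrightarrow> \<omega> \<in> space M \<Longrightarrow> H t \<omega> = K t \<omega>" for H K
  proof -
    obtain c where "0 \<le> c" "\<forall>t\<in>{0..T}. \<forall>\<omega>\<in>space M. norm (H t \<omega>) \<le> c" by (rule bpE[OF HK(2)])
    then show ?thesis using HK by (intro lim[of "\<lambda>_. H" K c]) auto
  qed
  let ?I = "\<lambda>E (v::'v) u \<omega>. indicat_real E (u, \<omega>) *\<^sub>R v"
  have R0: "R (\<lambda>u \<omega>. 0)"
    using interval[of 0 0 "{}" 0] T_pos by simp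
  have gen: "R (?I E v)" if "E \<in> pred_gen" for E v
  proof -
    have "(\<exists>A. E = {0} \<times> A \<and> A \<in> sets (F 0)) \<or> (\<exists>s t A. E = {s<..t} \<times> A \<and> 0 \<le> s \<and> s \<le> t \<and> t \<le> T \<and> A \<in> sets (F s))"
      using that unfolding pred_gen_def by blast
    then show ?thesis
    proof (elim disjE exE conjE)
      fix A assume "E = {0} \<times> A" "A \<in> sets (F 0)"
      then show ?thesis using zero[of A v] by (simp add: indicator_times)
    next
      fix s t A assume "E = {s<..t} \<times> A" "0 \<le> s" "s \<le> t" "t \<le> T" "A \<in> sets (F s)"
      then show ?thesis using interval[of s t A v] by (simp add: indicator_times)
    qed
  qed
  have sets: "R (?I E v)" if "E \<in> sets PS" for E v
    using that unfolding sets_PS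
  proof (induction rule: sigma_sets_induct_disjoint[OF Int_stable_pred_gen pred_gen_Pow, consumes 1, case_names basic empty compl union])
    case (basic A)
    then show ?case by (rule gen)
  next
    case empty
    then show ?case using R0 by simp
  next
    case (compl A)
    \<comment> \<open>The whole space is not a generator, but the disjoint union of two of
      them.\<close>
    have "{0} \<times> space M \<in> pred_gen" unfolding pred_gen_def using sets.top[of "F 0"] by auto
    moreover have "{0<..T} \<times> space M \<in> pred_gen"
      using pred_gen_interval[of 0 T "space M"] sets.top[of "F 0"] T_pos by simp
    ultimately have R1: "R (?I ({0} \<times> space M) v)" "R (?I ({0<..T} \<times> space M) v)"
      and S: "{0} \<times> space M \<in> sets PS" "{0<..T} \<times> space M \<in> sets PS" "A \<in> sets PS"
      using gen compl by (auto simp: sets_PS)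
    have RR: "R (\<lambda>u \<omega>. 1 *\<^sub>R (1 *\<^sub>R ?I ({0} \<times> space M) v u \<omega> + 1 *\<^sub>R ?I ({0<..T} \<times> space M) v u \<omega>) + (-1) *\<^sub>R ?I A v u \<omega>)"
      by (intro lin R1 compl bp_lincomb sets_PS_indicator S)
    have co: "({0..T} \<times> space M) - A \<in> sets PS" using sets.compl_sets[OF S(3)] by simp
    show ?case
    proof (rule cong[OF RR _ sets_PS_indicator[OF co]])
      fix t \<omega> assume "t \<in> {0..T}" "\<omega> \<in> space M"
      then show "1 *\<^sub>R (1 *\<^sub>R ?I ({0} \<times> space M) v t \<omega> + 1 *\<^sub>R ?I ({0<..T} \<times> space M) v t \<omega>) + (-1) *\<^sub>R ?I A v t \<omega>
          = ?I ({0..T} \<times> space M - A) v t \<omega>"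
        by (auto simp: indicator_def)
    qed (intro bp_lincomb sets_PS_indicator S)
  next
    case (union A)
    then have A: "A i \<in> sets PS" for i by (auto simp: sets_PS)
    have "bp (\<lambda>u \<omega>. \<Sum>i<n. ?I (A i) v u \<omega>) \<and> R (\<lambda>u \<omega>. \<Sum>i<n. ?I (A i) v u \<omega>)" for n
    proof (induction n)
      case 0
      have "bp (\<lambda>u \<omega>. 0 :: 'v)" using sets_PS_indicator[of "{}"] by simp
      then show ?case using R0 by simp
    next
      case (Suc n)
      have "R (\<lambda>u \<omega>. 1 *\<^sub>R (\<Sum>i<n. ?I (A i) v u \<omega>) + 1 *\<^sub>R ?I (A n) v u \<omega>)"
        "bp (\<lambda>u \<omega>. 1 *\<^sub>R (\<Sum>i<n. ?I (A i) v u \<omega>) + 1 *\<^sub>R ?I (A n) v u \<omega>)"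
        using Suc by (intro lin bp_lincomb sets_PS_indicator A union; blast)+
      then show ?case by simp
    qed
    moreover have sum: "(\<Sum>i<n. ?I (A i) v u \<omega>) = ?I (\<Union>i<n. A i) v u \<omega>" for n u \<omega>
      by (subst indicator_UN_disjoint) (use union in \<open>auto simp: scaleR_sum_left disjoint_family_on_def\<close>)
    ultimately have RU: "R (?I (\<Union>i<n. A i) v)" "bp (?I (\<Union>i<n. A i) v)" for n by simp_all
    show ?case
    proof (rule lim[of "\<lambda>n. ?I (\<Union>i<n. A i) v" _ "norm v"])
      show "R (?I (\<Union>i<n. A i) v)" "bp (?I (\<Union>i<n. A i) v)" for n by (fact RU)+
      show "bp (?I (\<Union>i. A i) v)" by (intro sets_PS_indicator sets.countable_UN) (use A in auto)
      fix t \<omega>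
      show "norm (?I (\<Union>i<n. A i) v t \<omega>) \<le> norm v" for n by (simp add: indicator_def)
      show "(\<lambda>n. ?I (\<Union>i<n. A i) v t \<omega>) \<longlonglongrightarrow> ?I (\<Union>i. A i) v t \<omega>"
        by (intro tendsto_scaleR LIMSEQ_indicator_UN tendsto_const)
    qed
  qed
  obtain c where c: "0 \<le> c" "\<forall>t\<in>{0..T}. \<forall>\<omega>\<in>space M. norm (H t \<omega>) \<le> c" by (rule bpE[OF H])
  have "case_prod H \<in> borel_measurable PS" using bp_predictable[OF H] by (simp add: predictable_def)
  from borel_measurable_implies_sequence_metric[OF this, of 0]
  obtain S where S': "\<forall>i. simple_function PS (S i)" "\<forall>z\<in>space PS. (\<lambda>i. S i z) \<longlonglongrightarrow> case_prod H z"
    "\<forall>i. \<forall>z\<in>space PS. dist (S i z) 0 \<le> 2 * dist (case_prod H z) 0"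
    by (elim exE conjE)
  have S: "\<And>i. simple_function PS (S i)" "\<And>z. z \<in> space PS \<Longrightarrow> (\<lambda>i. S i z) \<longlonglongrightarrow> case_prod H z"
    "\<And>z i. z \<in> space PS \<Longrightarrow> dist (S i z) 0 \<le> 2 * dist (case_prod H z) 0"
    using S' by blast+
  have simple: "R (\<lambda>u \<omega>. S i (u, \<omega>)) \<and> bp (\<lambda>u \<omega>. S i (u, \<omega>))" for i
  proof -
    let ?E = "\<lambda>y. S i -` {y} \<inter> space PS"
    have E: "?E y \<in> sets PS" for y using simple_functionD(2)[OF S(1)] by blast
    have fin: "finite (S i ` space PS)" using simple_functionD(1)[OF S(1)] .
    have "R (\<lambda>u \<omega>. \<Sum>y\<in>Y. ?I (?E y) y u \<omega>) \<and> bp (\<lambda>u \<omega>. \<Sum>y\<in>Y. ?I (?E y) y u \<omega>)" if "finite Y" for Y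
      using that
    proof (induction Y)
      case empty
      have "bp (\<lambda>u \<omega>. 0 :: 'v)" using sets_PS_indicator[of "{}"] by simp
      then show ?case using R0 by simp
    next
      case (insert x Y)
      have "R (\<lambda>u \<omega>. 1 *\<^sub>R ?I (?E x) x u \<omega> + 1 *\<^sub>R (\<Sum>y\<in>Y. ?I (?E y) y u \<omega>))"
        "bp (\<lambda>u \<omega>. 1 *\<^sub>R ?I (?E x) x u \<omega> + 1 *\<^sub>R (\<Sum>y\<in>Y. ?I (?E y) y u \<omega>))"
        using insert by (intro lin bp_lincomb sets_PS_indicator E sets; blast)+
      then show ?case unfolding sum.insert[OF insert.hyps] scaleR_one by blast
    qed
    from this[OF fin] have *: "R (\<lambda>u \<omega>. \<Sum>y\<in>S i ` space PS. ?I (?E y) y u \<omega>)" "bp (\<lambda>u \<omega>. \<Sum>y\<in>S i ` space PS. ?I (?E y) y u \<omega>)"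
      by blast+
    have eq: "(\<Sum>y\<in>S i ` space PS. ?I (?E y) y t \<omega>) = S i (t, \<omega>)" if "t \<in> {0..T}" "\<omega> \<in> space M" for t \<omega>
    proof -
      have "(\<Sum>y\<in>S i ` space PS. ?I (?E y) y t \<omega>) = (\<Sum>y\<in>{S i (t, \<omega>)}. ?I (?E y) y t \<omega>)"
        using fin that by (intro sum.mono_neutral_right) (auto simp: indicator_def)
      also have "\<dots> = ?I (?E (S i (t, \<omega>))) (S i (t, \<omega>)) t \<omega>" by (rule sum_singleton)
      also have "\<dots> = S i (t, \<omega>)"
      proof -
        have "(t, \<omega>) \<in> ?E (S i (t, \<omega>))" using that by simp
        then show ?thesis by (simp only: indicator_simps scaleR_one)
      qed
      finally show ?thesis .
    qed
    have "bp (\<lambda>u \<omega>. S i (u, \<omega>))"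
    proof (rule bpI)
      show "predictable M F T (\<lambda>u \<omega>. S i (u, \<omega>))"
        using borel_measurable_simple_function[OF S(1)] by (simp add: predictable_def)
      show "norm (S i (t, \<omega>)) \<le> 2 * c" if "t \<in> {0..T}" "\<omega> \<in> space M" for t \<omega>
        using S(3)[of "(t, \<omega>)" i] c(2)[rule_format, OF that] that by simp
    qed
    then show ?thesis using cong[OF *] eq by blast
  qed
  show ?thesis
  proof (rule lim[of "\<lambda>i u \<omega>. S i (u, \<omega>)" H "2 * c"])
    show "norm (S i (t, \<omega>)) \<le> 2 * c" if "t \<in> {0..T}" "\<omega> \<in> space M" for i t \<omega>
      using S(3)[of "(t, \<omega>)" i] c(2)[rule_format, OF that] that by simp
    show "(\<lambda>n. S n (t, \<omega>)) \<longlonglongrightarrow> H t \<omega>" if "t \<in> {0..T}" "\<omega> \<in> space M" for t \<omega>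
      using S(2)[of "(t, \<omega>)"] that by simp
  qed (use simple H in auto)
qed

end

section \<open>The stochastic integral of bounded predictable processes\<close>

context stoch_basis
begin

lemma sets_PS_Q: "sets PS \<subseteq> sets Q"
proof -
  have "pred_gen \<subseteq> sets Q"
  proof
    fix E assume "E \<in> pred_gen"
    then have "(\<exists>A. E = {0} \<times> A \<and> A \<in> sets (F 0)) \<or> (\<exists>s t A. E = {s<..t} \<times> A \<and> 0 \<le> s \<and> s \<le> t \<and> t \<le> T \<and> A \<in> sets (F s))"
      unfolding pred_gen_def by blast
    then show "E \<in> sets Q"
    proof (elim disjE exE conjE)
      fix A assume "E = {0} \<times> A" "A \<in> sets (F 0)"
      then show ?thesis using sets_F_M T_pos unfolding Q_def
        by (auto intro!: pair_measureI simp: sets_restrict_space_iff)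
    next
      fix s t A assume "E = {s<..t} \<times> A" "0 \<le> s" "s \<le> t" "t \<le> T" "A \<in> sets (F s)"
      then show ?thesis using sets_F_M unfolding Q_def
        by (auto intro!: pair_measureI simp: sets_restrict_space_iff)
    qed
  qed
  then show ?thesis unfolding sets_PS space_Q[symmetric] by (rule sets.sigma_sets_subset)
qed

lemma measurable_PS_Q: "f \<in> measurable PS N \<Longrightarrow> f \<in> measurable Q N"
  using sets_PS_Q by (auto simp: measurable_def space_Q)

lemma bdd_rv_PS_Q: "bdd_rv PS f \<Longrightarrow> bdd_rv Q f"
  unfolding bdd_rv_def by (auto intro: measurable_PS_Q simp: space_Q)

lemma bp_add: "bp H \<Longrightarrow> bp K \<Longrightarrow> bp (\<lambda>u \<omega>. H u \<omega> + K u \<omega> :: real)"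
  using bp_lincomb[of H K 1 1] by simp

lemma bp_diff: "bp H \<Longrightarrow> bp K \<Longrightarrow> bp (\<lambda>u \<omega>. H u \<omega> - K u \<omega> :: real)"
  using bp_lincomb[of H K 1 "-1"] by simp

lemma bp_cmult: "bp H \<Longrightarrow> bp (\<lambda>u \<omega>. c * H u \<omega> :: real)"
  using bp_lincomb[of H H c 0] by simp

lemma bp_const [simp]: "bp (\<lambda>u \<omega>. c :: real)"
  by (simp add: bp_bdd_rv)

lemma bp_interval:
  fixes \<xi> :: "'w \<Rightarrow> 'v::euclidean_space"
  assumes st: "0 \<le> s" "s \<le> t" "t \<le> T" and \<xi>: "\<xi> \<in> borel_measurable (F s)" "bounded (\<xi> ` space M)"
  shows "bp (\<lambda>u \<omega>. indicat_real {s<..t} u *\<^sub>R \<xi> \<omega>)"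
proof -
  obtain c where c: "\<And>\<omega>. \<omega> \<in> space M \<Longrightarrow> norm (\<xi> \<omega>) \<le> c" using \<xi>(2) unfolding bounded_iff by blast
  have "(\<lambda>z. indicat_real {s<..t} (fst z) *\<^sub>R \<xi> (snd z)) \<in> borel_measurable PS"
  proof (rule measurableI)
    fix B :: "'v set" assume B: "B \<in> sets borel"
    have m: "{s<..t} \<times> (\<xi> -` B' \<inter> space M) \<in> sets PS" if "B' \<in> sets borel" for B'
      unfolding sets_PS using measurable_sets[OF \<xi>(1) that] by (intro sigma_sets.Basic pred_gen_interval st) simp
    show "(\<lambda>z. indicat_real {s<..t} (fst z) *\<^sub>R \<xi> (snd z)) -` B \<inter> space PS \<in> sets PS"
    proof (cases "0 \<in> B")
      case False
      then have "(\<lambda>z. indicat_real {s<..t} (fst z) *\<^sub>R \<xi> (snd z)) -` B \<inter> space PS = {s<..t} \<times> (\<xi> -` B \<inter> space M)"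
        using st by (auto simp: indicator_def of_bool_def split: if_splits)
      then show ?thesis using m[OF B] by simp
    next
      case True
      then have "(\<lambda>z. indicat_real {s<..t} (fst z) *\<^sub>R \<xi> (snd z)) -` B \<inter> space PS = space PS - {s<..t} \<times> (\<xi> -` (- B) \<inter> space M)"
        using st by (auto simp: indicator_def of_bool_def split: if_splits)
      then show ?thesis using sets.compl_sets[OF m[of "- B"]] B by auto
    qed
  qed simp
  then have "predictable M F T (\<lambda>u \<omega>. indicat_real {s<..t} u *\<^sub>R \<xi> \<omega>)"
    by (simp add: predictable_def case_prod_beta')
  then show ?thesis
  proof (rule bpI)
    show "norm (indicat_real {s<..t} u *\<^sub>R \<xi> \<omega>) \<le> max 0 c" if "\<omega> \<in> space M" for u \<omega>
      using c[OF that] by (auto simp: indicator_def)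
  qed
qed

lemma bp_zero:
  fixes \<xi> :: "'w \<Rightarrow> 'v::euclidean_space"
  assumes \<xi>: "\<xi> \<in> borel_measurable (F 0)" "bounded (\<xi> ` space M)"
  shows "bp (\<lambda>u \<omega>. indicat_real {0} u *\<^sub>R \<xi> \<omega>)"
proof -
  obtain c where c: "\<And>\<omega>. \<omega> \<in> space M \<Longrightarrow> norm (\<xi> \<omega>) \<le> c" using \<xi>(2) unfolding bounded_iff by blast
  have "(\<lambda>z. indicat_real {0} (fst z) *\<^sub>R \<xi> (snd z)) \<in> borel_measurable PS"
  proof (rule measurableI)
    fix B :: "'v set" assume B: "B \<in> sets borel"
    have m: "{0} \<times> (\<xi> -` B' \<inter> space M) \<in> sets PS" if "B' \<in> sets borel" for B'
      unfolding sets_PS using measurable_sets[OF \<xi>(1) that] by (intro sigma_sets.Basic) (auto simp: pred_gen_def)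
    show "(\<lambda>z. indicat_real {0} (fst z) *\<^sub>R \<xi> (snd z)) -` B \<inter> space PS \<in> sets PS"
    proof (cases "0 \<in> B")
      case False
      then have "(\<lambda>z. indicat_real {0} (fst z) *\<^sub>R \<xi> (snd z)) -` B \<inter> space PS = {0} \<times> (\<xi> -` B \<inter> space M)"
        using T_pos by (auto simp: indicator_def of_bool_def split: if_splits)
      then show ?thesis using m[OF B] by simp
    next
      case True
      then have "(\<lambda>z. indicat_real {0} (fst z) *\<^sub>R \<xi> (snd z)) -` B \<inter> space PS = space PS - {0} \<times> (\<xi> -` (- B) \<inter> space M)"
        using T_pos by (auto simp: indicator_def of_bool_def split: if_splits)
      then show ?thesis using sets.compl_sets[OF m[of "- B"]] B by auto
    qed
  qed simp
  then have "predictable M F T (\<lambda>u \<omega>. indicat_real {0} u *\<^sub>R \<xi> \<omega>)"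
    by (simp add: predictable_def case_prod_beta')
  then show ?thesis
  proof (rule bpI)
    show "norm (indicat_real {0} u *\<^sub>R \<xi> \<omega>) \<le> max 0 c" if "\<omega> \<in> space M" for u \<omega>
      using c[OF that] by (auto simp: indicator_def)
  qed
qed

lemma bdd_rv_bounded: "bdd_rv (F s) \<xi> \<longleftrightarrow> \<xi> \<in> borel_measurable (F s) \<and> bounded (\<xi> ` space M)"
  unfolding bdd_rv_def bounded_iff by simp

lemma bp_elem: "valid_elem rs \<Longrightarrow> bp (elem rs)"
proof (induction rs)
  case Nil
  have "elem [] = (\<lambda>_ _. 0)" by (simp add: fun_eq_iff)
  then show ?case by simp
next
  case (Cons r rs)
  obtain s t \<xi> where r: "r = (s, t, \<xi>)" by (cases r)
  have "bp (\<lambda>u \<omega>. indicat_real {s<..t} u *\<^sub>R \<xi> \<omega> + elem rs u \<omega>)"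
    using Cons r by (intro bp_add bp_interval) (auto simp: bdd_rv_bounded)
  moreover have "elem (r # rs) = (\<lambda>u \<omega>. indicat_real {s<..t} u *\<^sub>R \<xi> \<omega> + elem rs u \<omega>)"
    by (simp add: r fun_eq_iff)
  ultimately show ?case by simp
qed

section \<open>The distance \<open>qnorm\<close> and density of elementary processes\<close>

definition qfun :: "('w, real) process \<Rightarrow> real \<times> 'w \<Rightarrow> real" where
  "qfun H z = \<bar>H (fst z) (snd z)\<bar> + (H (fst z) (snd z))\<^sup>2"

lemma qnorm_qfun: "qnorm H = integral\<^sup>L Q (qfun H)"
  unfolding qnorm_def qfun_def[abs_def] ..

lemma qfun_bdd: "bp H \<Longrightarrow> bdd_rv Q (qfun H)"
  unfolding qfun_def[abs_def] by (intro bdd_rv_PS_Q bdd_rv_intros) (simp_all add: bp_bdd_rv)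

lemma qfun_integrable: "bp H \<Longrightarrow> integrable Q (qfun H)"
  by (rule finite_measure.bdd_rv_integrable[OF finite_Q qfun_bdd])

lemma qnorm_nonneg: "0 \<le> qnorm H"
  by (simp add: qnorm_def)

lemma qfun_add_le: "qfun (\<lambda>u \<omega>. H u \<omega> + K u \<omega>) z \<le> 2 * (qfun H z + qfun K z)"
proof -
  let ?h = "H (fst z) (snd z)" and ?k = "K (fst z) (snd z)"
  have "(?h + ?k)\<^sup>2 \<le> 2 * (?h\<^sup>2 + ?k\<^sup>2)"
    using sum_squares_bound[of ?h ?k] by (simp add: power2_sum)
  moreover have "\<bar>?h + ?k\<bar> \<le> 2 * (\<bar>?h\<bar> + \<bar>?k\<bar>)"
    using abs_triangle_ineq[of ?h ?k] abs_ge_zero[of ?h] abs_ge_zero[of ?k] by argo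
  ultimately show ?thesis unfolding qfun_def by argo
qed

text \<open>\<open>qnorm\<close> is not homogeneous and satisfies the triangle inequality only up to
  a factor 2, the price for the square in it. The later arguments use it only to express convergence
  to 0.\<close>

lemma qnorm_add:
  assumes "bp H" "bp K"
  shows "qnorm (\<lambda>u \<omega>. H u \<omega> + K u \<omega>) \<le> 2 * (qnorm H + qnorm K)"
proof -
  have "qnorm (\<lambda>u \<omega>. H u \<omega> + K u \<omega>) \<le> integral\<^sup>L Q (\<lambda>z. 2 * (qfun H z + qfun K z))"
    unfolding qnorm_qfun by (intro integral_mono qfun_add_le qfun_integrable bp_add assms) (use qfun_integrable assms in auto)
  also have "\<dots> = 2 * (qnorm H + qnorm K)"
    using qfun_integrable assms by (simp add: qnorm_qfun)
  finally show ?thesis .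
qed

lemma qnorm_cmult:
  assumes "bp H"
  shows "qnorm (\<lambda>u \<omega>. c * H u \<omega>) \<le> (\<bar>c\<bar> + c\<^sup>2) * qnorm H"
proof -
  have "qfun (\<lambda>u \<omega>. c * H u \<omega>) z \<le> (\<bar>c\<bar> + c\<^sup>2) * qfun H z" for z
    by (simp add: qfun_def abs_mult power_mult_distrib algebra_simps)
  then have "qnorm (\<lambda>u \<omega>. c * H u \<omega>) \<le> integral\<^sup>L Q (\<lambda>z. (\<bar>c\<bar> + c\<^sup>2) * qfun H z)"
    unfolding qnorm_qfun by (intro integral_mono qfun_integrable bp_cmult assms) (use qfun_integrable assms in auto)
  then show ?thesis by (simp add: qnorm_qfun)
qed

lemma qnorm_triangle:
  assumes "bp H" "bp K" "bp L"
  shows "qnorm (\<lambda>u \<omega>. H u \<omega> - L u \<omega>) \<le> 2 * (qnorm (\<lambda>u \<omega>. H u \<omega> - K u \<omega>) + qnorm (\<lambda>u \<omega>. K u \<omega> - L u \<omega>))"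
  using qnorm_add[OF bp_diff[OF assms(1,2)] bp_diff[OF assms(2,3)]] by simp

lemma qnorm_commute: "qnorm (\<lambda>u \<omega>. H u \<omega> - K u \<omega>) = qnorm (\<lambda>u \<omega>. K u \<omega> - H u \<omega>)"
  by (simp add: qnorm_def abs_minus_commute power2_commute)

text \<open>A single time is a Lebesgue null set. This matches the convention that integrals do not
  charge time 0.\<close>

lemma qnorm_zero_time: "qnorm (\<lambda>u \<omega>. indicat_real {0} u *\<^sub>R \<xi> \<omega>) = 0"
proof -
  have "AE z in Q. fst z \<noteq> 0"
  proof -
    have "{0} \<times> space M \<in> null_sets Q"
    proof
      have "{0} \<in> sets (restrict_space lborel {0..T})" using T_pos by (auto simp: sets_restrict_space_iff)
      then have "emeasure Q ({0} \<times> space M) = emeasure (restrict_space lborel {0..T}) {0} * emeasure M (space M)"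
        unfolding Q_def by (rule emeasure_pair_measure_Times) simp
      then show "emeasure Q ({0} \<times> space M) = 0" using T_pos by (simp add: emeasure_restrict_space)
      show "{0} \<times> space M \<in> sets Q" 
        by (rule subsetD[OF sets_PS_Q], unfold sets_PS, rule sigma_sets.Basic) (use sets.top[of "F 0"] in \<open>auto simp: pred_gen_def\<close>)
    qed
    from AE_not_in[OF this] AE_space show ?thesis
      by eventually_elim (auto simp: space_Q)
  qed
  then have "AE z in Q. qfun (\<lambda>u \<omega>. indicat_real {0} u *\<^sub>R \<xi> \<omega>) z = 0"
    by eventually_elim (simp add: qfun_def)
  then show ?thesis unfolding qnorm_qfun by (simp add: integral_eq_zero_AE)
qed

lemma qnorm_bounded_limit:
  assumes "\<And>n. bp (Hn n)" "bp H" "\<And>n t \<omega>. t \<in> {0..T} \<Longrightarrow> \<omega> \<in> space M \<Longrightarrow> \<bar>Hn n t \<omega>\<bar> \<le> c"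
    "\<And>t \<omega>. t \<in> {0..T} \<Longrightarrow> \<omega> \<in> space M \<Longrightarrow> (\<lambda>n. Hn n t \<omega>) \<longlonglongrightarrow> H t \<omega>"
  shows "(\<lambda>n. qnorm (\<lambda>u \<omega>. Hn n u \<omega> - H u \<omega>)) \<longlonglongrightarrow> 0"
proof -
  interpret finite_measure Q by (rule finite_Q)
  have bound: "\<bar>Hn n t \<omega> - H t \<omega>\<bar> \<le> 2 * c" if "t \<in> {0..T}" "\<omega> \<in> space M" for n t \<omega>
  proof -
    have "\<bar>H t \<omega>\<bar> \<le> c"
      by (rule LIMSEQ_le_const2[OF tendsto_rabs[OF assms(4)[OF that]]]) (use assms(3)[OF that] in auto)
    then show ?thesis using assms(3)[OF that, of n] by linarith
  qed
  have "(\<lambda>n. integral\<^sup>L Q (qfun (\<lambda>u \<omega>. Hn n u \<omega> - H u \<omega>))) \<longlonglongrightarrow> integral\<^sup>L Q (\<lambda>_. 0 :: real)"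
  proof (rule integral_dominated_convergence[where w="\<lambda>_. 2 * c + (2 * c)\<^sup>2"])
    show "AE z in Q. (\<lambda>n. qfun (\<lambda>u \<omega>. Hn n u \<omega> - H u \<omega>) z) \<longlonglongrightarrow> 0"
    proof (rule AE_I2)
      fix z assume "z \<in> space Q"
      then have "(\<lambda>n. Hn n (fst z) (snd z) - H (fst z) (snd z)) \<longlonglongrightarrow> H (fst z) (snd z) - H (fst z) (snd z)"
        by (intro tendsto_diff tendsto_const assms(4)) (auto simp: space_Q)
      then have "(\<lambda>n. Hn n (fst z) (snd z) - H (fst z) (snd z)) \<longlonglongrightarrow> 0" by simp
      from tendsto_add[OF tendsto_rabs[OF this] tendsto_power[OF this, of 2]]
      show "(\<lambda>n. qfun (\<lambda>u \<omega>. Hn n u \<omega> - H u \<omega>) z) \<longlonglongrightarrow> 0" by (simp add: qfun_def)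
    qed
    show "AE z in Q. norm (qfun (\<lambda>u \<omega>. Hn n u \<omega> - H u \<omega>) z) \<le> 2 * c + (2 * c)\<^sup>2" for n
    proof (rule AE_I2)
      fix z assume "z \<in> space Q"
      then have b: "\<bar>Hn n (fst z) (snd z) - H (fst z) (snd z)\<bar> \<le> 2 * c" by (intro bound) (auto simp: space_Q)
      then have "\<bar>Hn n (fst z) (snd z) - H (fst z) (snd z)\<bar>\<^sup>2 \<le> (2 * c)\<^sup>2" by (intro power_mono) auto
      with b show "norm (qfun (\<lambda>u \<omega>. Hn n u \<omega> - H u \<omega>) z) \<le> 2 * c + (2 * c)\<^sup>2"
        by (simp add: qfun_def)
    qed
  qed (use assms qfun_bdd[OF bp_diff] in \<open>auto intro: bdd_rv_measurable\<close>)
  then show ?thesis by (simp add: qnorm_qfun)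
qed

text \<open>The processes that can be approximated satisfy
  \<open>bounded_predictable_induct\<close>. Generators at time 0 have \<open>qnorm\<close> zero and
  are approximated by the empty list, all other generators are elementary already.\<close>

lemma elem_dense:
  assumes "bp H" "\<delta> > 0"
  obtains rs where "valid_elem rs" "qnorm (\<lambda>u \<omega>. H u \<omega> - elem rs u \<omega>) < \<delta>"
proof -
  have "\<forall>\<delta>>0. \<exists>rs. valid_elem rs \<and> qnorm (\<lambda>u \<omega>. H u \<omega> - elem rs u \<omega>) < \<delta>"
    using assms(1)
  proof (induction H rule: bounded_predictable_induct)
    case (zero A v)
    have "qnorm (\<lambda>u \<omega>. indicat_real {0} u *\<^sub>R (indicat_real A \<omega> *\<^sub>R v) - elem [] u \<omega>) = 0"
      unfolding elem_simps diff_zero by (rule qnorm_zero_time)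
    then show ?case by (intro allI impI exI[of _ "[]"] conjI) (simp_all only: valid_elem_simps)
  next
    case (interval s t A v)
    have "bdd_rv (F s) (\<lambda>\<omega>. indicat_real A \<omega> * v)"
      using interval by (intro bdd_rv_mult bdd_rv_const bdd_rvI[where c=1]) auto
    then have v: "valid_elem [(s, t, \<lambda>\<omega>. indicat_real A \<omega> * v)]" using interval by simp
    have "(\<lambda>u \<omega>. indicat_real {s<..t} u *\<^sub>R indicat_real A \<omega> *\<^sub>R v - elem [(s, t, \<lambda>\<omega>. indicat_real A \<omega> * v)] u \<omega>) = (\<lambda>_ _. 0)"
      by (simp add: fun_eq_iff)
    then have "qnorm (\<lambda>u \<omega>. indicat_real {s<..t} u *\<^sub>R indicat_real A \<omega> *\<^sub>R v - elem [(s, t, \<lambda>\<omega>. indicat_real A \<omega> * v)] u \<omega>) = 0"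
      by (simp add: qnorm_def)
    with v show ?case by (intro allI impI exI[of _ "[(s, t, \<lambda>\<omega>. indicat_real A \<omega> * v)]"] conjI) simp_all
  next
    case (lin H K a b)
    show ?case
    proof (intro allI impI)
      fix \<delta> :: real assume \<delta>: "\<delta> > 0"
      \<comment> \<open>A common bound for the two scaling factors, made positive by the summand 1.
        With errors below \<open>\<delta> / (4 * c)\<close> the factor 2 of \<open>qnorm_add\<close>
        and the two terms add up to \<delta>.\<close>
      define c where "c = (\<bar>a\<bar> + a\<^sup>2) + (\<bar>b\<bar> + b\<^sup>2) + 1"
      have c: "c > 0" "\<bar>a\<bar> + a\<^sup>2 \<le> c" "\<bar>b\<bar> + b\<^sup>2 \<le> c" by (auto simp: c_def add_nonneg_pos)
      have dc: "\<delta> / (4 * c) > 0" using \<delta> c(1) by simp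
      obtain rs where rs: "valid_elem rs" "qnorm (\<lambda>u \<omega>. H u \<omega> - elem rs u \<omega>) < \<delta> / (4 * c)"
        using lin(3)[rule_format, OF dc] by (elim exE conjE)
      obtain qs where qs: "valid_elem qs" "qnorm (\<lambda>u \<omega>. K u \<omega> - elem qs u \<omega>) < \<delta> / (4 * c)"
        using lin(4)[rule_format, OF dc] by (elim exE conjE)
      let ?ps = "elem_scale a rs @ elem_scale b qs"
      have "qnorm (\<lambda>u \<omega>. a *\<^sub>R H u \<omega> + b *\<^sub>R K u \<omega> - elem ?ps u \<omega>)
        = qnorm (\<lambda>u \<omega>. a * (H u \<omega> - elem rs u \<omega>) + b * (K u \<omega> - elem qs u \<omega>))"
        by (simp add: elem_append elem_scale algebra_simps)
      also have "\<dots> \<le> 2 * (qnorm (\<lambda>u \<omega>. a * (H u \<omega> - elem rs u \<omega>)) + qnorm (\<lambda>u \<omega>. b * (K u \<omega> - elem qs u \<omega>)))"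
        by (intro qnorm_add bp_cmult bp_diff bp_elem lin rs qs)
      also have "\<dots> \<le> 2 * ((\<bar>a\<bar> + a\<^sup>2) * qnorm (\<lambda>u \<omega>. H u \<omega> - elem rs u \<omega>) + (\<bar>b\<bar> + b\<^sup>2) * qnorm (\<lambda>u \<omega>. K u \<omega> - elem qs u \<omega>))"
        by (intro mult_left_mono add_mono qnorm_cmult bp_diff bp_elem lin rs qs) simp
      also have "\<dots> \<le> 2 * (c * qnorm (\<lambda>u \<omega>. H u \<omega> - elem rs u \<omega>) + c * qnorm (\<lambda>u \<omega>. K u \<omega> - elem qs u \<omega>))"
        by (intro mult_left_mono add_mono mult_right_mono c qnorm_nonneg) simp
      also have "\<dots> < \<delta>"
        using rs(2) qs(2) c(1) by (simp add: field_simps)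
      finally show "\<exists>rs. valid_elem rs \<and> qnorm (\<lambda>u \<omega>. a *\<^sub>R H u \<omega> + b *\<^sub>R K u \<omega> - elem rs u \<omega>) < \<delta>"
        using rs(1) qs(1) by (intro exI[of _ ?ps]) (simp add: valid_elem_scale)
    qed
  next
    case (lim Hn H c)
    show ?case
    proof (intro allI impI)
      fix \<delta> :: real assume \<delta>: "\<delta> > 0"
      have "(\<lambda>n. qnorm (\<lambda>u \<omega>. Hn n u \<omega> - H u \<omega>)) \<longlonglongrightarrow> 0"
        using lim by (intro qnorm_bounded_limit[where c=c]) auto
      then have "\<forall>\<^sub>F n in sequentially. qnorm (\<lambda>u \<omega>. Hn n u \<omega> - H u \<omega>) < \<delta> / 4"
        by (rule order_tendstoD) (use \<delta> in simp)
      then obtain n where n: "qnorm (\<lambda>u \<omega>. Hn n u \<omega> - H u \<omega>) < \<delta> / 4"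
        by (auto simp: eventually_sequentially)
      have d4: "\<delta> / 4 > 0" using \<delta> by simp
      have IHn: "\<forall>\<delta>>0. \<exists>rs. valid_elem rs \<and> qnorm (\<lambda>u \<omega>. Hn n u \<omega> - elem rs u \<omega>) < \<delta>" by (rule lim)
      obtain rs where rs: "valid_elem rs" "qnorm (\<lambda>u \<omega>. Hn n u \<omega> - elem rs u \<omega>) < \<delta> / 4"
        using IHn[rule_format, OF d4] by (elim exE conjE)
      have bpn: "bp (Hn n)" and bpH: "bp H" by (rule lim)+
      have "qnorm (\<lambda>u \<omega>. H u \<omega> - elem rs u \<omega>) < \<delta>"
        using qnorm_triangle[OF bpH bpn bp_elem[OF rs(1)]] n rs(2) qnorm_commute[of H "Hn n"] by simp
      then show "\<exists>rs. valid_elem rs \<and> qnorm (\<lambda>u \<omega>. H u \<omega> - elem rs u \<omega>) < \<delta>" using rs(1) by blast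
    qed
  qed
  then show ?thesis using assms(2) that by blast
qed

end

section \<open>Extension of the elementary integral by continuity\<close>

context stoch_basis
begin

text \<open>\<open>grid_estimate\<close> is uniform in the grid, so it survives the increasing limit
  of finite grids exhausting a countable dense set, and by right continuity reaches the supremum
  over all times. Half of \<open>e\<close> pays for paths leaving \<open>a / 2\<close>, the other
  half for the term with \<open>qnorm\<close>, whence the choice \<open>e / (2 * L)\<close>.\<close>

lemma elem_int_small:
  fixes X :: "('w, real) process"
  assumes X: "levy_increments X" and e: "e > 0"
  obtains \<delta> where "\<delta> > 0" "\<forall>rs. valid_elem rs \<and> qnorm (elem rs) < \<delta> \<longrightarrow> sup_prob (elem_int X rs) e \<le> e"
proof -
  obtain a K where a: "a > 0" and K: "K \<ge> 0" and sup: "prob {\<omega>\<in>space M. \<exists>t\<in>{0..T}. \<bar>X t \<omega>\<bar> > a / 2} \<le> e / 2"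
    and tail: "\<And>h. 0 \<le> h \<Longrightarrow> h \<le> T \<Longrightarrow> prob {\<omega>\<in>space M. \<bar>X h \<omega>\<bar> > a} \<le> K * h"
    and mean: "\<And>h. 0 \<le> h \<Longrightarrow> h \<le> T \<Longrightarrow> \<bar>expectation (\<lambda>\<omega>. trunc a (X h \<omega>))\<bar> \<le> K * h"
    and var: "\<And>h. 0 \<le> h \<Longrightarrow> h \<le> T \<Longrightarrow> variance (\<lambda>\<omega>. trunc a (X h \<omega>)) \<le> K * h"
    by (rule levy_trunc_estimates[OF X, of "e / 2"]) (use e in auto)
  define L where "L = (4 / e\<^sup>2 + 2 / e) * K + 1"
  have L: "L > 0" using K e by (auto simp: L_def intro!: add_nonneg_pos mult_nonneg_nonneg add_nonneg_nonneg)
  show ?thesis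
  proof (rule that[of "e / (2 * L)"])
    show "e / (2 * L) > 0" using e L by simp
    show "\<forall>rs. valid_elem rs \<and> qnorm (elem rs) < e / (2 * L) \<longrightarrow> sup_prob (elem_int X rs) e \<le> e"
    proof (intro allI impI, elim conjE)
      fix rs assume rs: "valid_elem rs" "qnorm (elem rs) < e / (2 * L)"
      define D where "D = {0..T} \<inter> (\<rat> \<union> {T})"
      define G where "G m = from_nat_into D ` {..m} \<union> ({0, T} \<union> elem_points rs)" for m :: nat
      have D: "countable D" "D \<noteq> {}" "D \<subseteq> {0..T}"
        using T_pos unfolding D_def by (auto intro!: countable_Int2 countable_Un countable_rat)
      have G: "finite (G m)" "0 \<in> G m" "T \<in> G m" "G m \<subseteq> {0..T}" "elem_points rs \<subseteq> G m" for m
        using finite_elem_points valid_elem_points[OF rs(1)] D(2,3) from_nat_into[OF D(2)] T_pos unfolding G_def by auto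
      define E where "E m = {\<omega>\<in>space M. \<exists>t\<in>G m. \<bar>elem_int X rs t \<omega>\<bar> > e}" for m
      have Icad: "cadlag_adapted M F T (elem_int X rs)" by (rule elem_int_cadlag[OF levy_cadlag[OF X] rs(1)])
      have E: "E m \<in> sets M" for m
        unfolding E_def
      proof (rule sets.sets_Collect_finite_Ex[OF _ G(1)])
        fix t assume "t \<in> G m"
        then have [measurable]: "elem_int X rs t \<in> borel_measurable M" using cadlag_adaptedD(3)[OF Icad] G(4) by fastforce
        show "{\<omega>\<in>space M. \<bar>elem_int X rs t \<omega>\<bar> > e} \<in> sets M" by measurable
      qed
      have "prob (E m) \<le> e" for m
      proof -
        have "prob (E m) \<le> prob {\<omega>\<in>space M. \<exists>t\<in>{0..T}. \<bar>X t \<omega>\<bar> > a / 2} + (4 / e\<^sup>2 + 2 / e) * K * qnorm (elem rs)"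
          unfolding E_def
          by (rule grid_estimate[OF X a K mean var e rs(1) G qfun_integrable[OF bp_elem[OF rs(1)], unfolded qfun_def[abs_def]]])
        also have "(4 / e\<^sup>2 + 2 / e) * K * qnorm (elem rs) \<le> L * qnorm (elem rs)"
          by (intro mult_right_mono qnorm_nonneg) (simp add: L_def)
        also have "L * qnorm (elem rs) \<le> e / 2"
          using rs(2) L by (simp add: field_simps)
        finally show ?thesis using sup by simp
      qed
      moreover have "(\<lambda>m. prob (E m)) \<longlonglongrightarrow> prob (\<Union>m. E m)"
      proof (rule finite_Lim_measure_incseq)
        show "incseq E"
        proof (rule incseq_SucI)
          fix m
          have "G m \<subseteq> G (Suc m)" unfolding G_def by (intro Un_mono image_mono) auto
          then show "E m \<le> E (Suc m)" unfolding E_def by blast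
        qed
      qed (use E in auto)
      ultimately have "prob (\<Union>m. E m) \<le> e" by (intro LIMSEQ_le_const2) auto
      moreover have "{\<omega>\<in>space M. \<exists>t\<in>{0..T}. \<bar>elem_int X rs t \<omega>\<bar> > e} \<subseteq> (\<Union>m. E m)"
      proof
        fix \<omega> assume \<omega>: "\<omega> \<in> {\<omega>\<in>space M. \<exists>t\<in>{0..T}. \<bar>elem_int X rs t \<omega>\<bar> > e}"
        have "open {x::real. \<bar>x\<bar> > e}" by (intro open_Collect_less continuous_intros)
        then have "\<exists>t\<in>D. \<bar>elem_int X rs t \<omega>\<bar> > e"
          using cadlag_ex_dense[OF cadlag_adaptedD(1)[OF Icad] _ T_pos, of \<omega> "{x. \<bar>x\<bar> > e}"] \<omega>
          unfolding D_def by simp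
        then obtain t where t: "t \<in> D" "\<bar>elem_int X rs t \<omega>\<bar> > e" by blast
        obtain m where "from_nat_into D m = t" using from_nat_into_surj[OF D(1) t(1)] by blast
        then have "t \<in> G m" unfolding G_def by blast
        then show "\<omega> \<in> (\<Union>m. E m)" using t(2) \<omega> unfolding E_def by blast
      qed
      then have "sup_prob (elem_int X rs) e \<le> prob (\<Union>m. E m)"
        unfolding sup_prob_def by (rule finite_measure_mono) (use E in auto)
      ultimately show "sup_prob (elem_int X rs) e \<le> e" by simp
    qed
  qed
qed

lemma elem_int_ucp0:
  fixes X :: "('w, real) process"
  assumes X: "levy_increments X" and rs: "\<And>n. valid_elem (rs n)" and lim: "(\<lambda>n. qnorm (elem (rs n))) \<longlonglongrightarrow> 0"
  shows "ucp0 (\<lambda>n. elem_int X (rs n))"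
  unfolding ucp0_def
proof (intro allI impI)
  fix e :: real assume e: "e > 0"
  show "(\<lambda>n. sup_prob (elem_int X (rs n)) e) \<longlonglongrightarrow> 0"
  proof (rule LIMSEQ_I)
    fix r :: real assume r: "r > 0"
    \<comment> \<open>One number serves as threshold and as bound for the probability in
      \<open>elem_int_small\<close>, so it has to lie below both \<open>e\<close> and
      \<open>r\<close>.\<close>
    define d where "d = min e (r / 2)"
    have d: "d > 0" "d \<le> e" "d < r" using e r by (auto simp: d_def)
    obtain \<delta> where \<delta>: "\<delta> > 0" "\<forall>rs. valid_elem rs \<and> qnorm (elem rs) < \<delta> \<longrightarrow> sup_prob (elem_int X rs) d \<le> d"
      by (rule elem_int_small[OF X d(1)])
    have "\<forall>\<^sub>F n in sequentially. qnorm (elem (rs n)) < \<delta>" using lim \<delta>(1) by (rule order_tendstoD)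
    then obtain N where N: "\<And>n. n \<ge> N \<Longrightarrow> qnorm (elem (rs n)) < \<delta>" unfolding eventually_sequentially by blast
    have "sup_prob (elem_int X (rs n)) e < r" if "n \<ge> N" for n
    proof -
      have "sup_prob (elem_int X (rs n)) e \<le> sup_prob (elem_int X (rs n)) d"
        using d(2) by (intro sup_prob_le elem_int_cadlag levy_cadlag X rs AE_I2) force
      also have "\<dots> \<le> d" using \<delta>(2) rs N[OF that] by blast
      finally show ?thesis using d(3) by simp
    qed
    then show "\<exists>N. \<forall>n\<ge>N. norm (sup_prob (elem_int X (rs n)) e - 0) < r"
      using sup_prob_nonneg by auto
  qed
qed

text \<open>The closure of the elementary integral, kept as a relation: it is total by
  \<open>is_int_exists\<close> and single-valued up to indistinguishability by
  \<open>is_int_indist\<close>.\<close>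

definition is_int :: "('w, real) process \<Rightarrow> ('w, real) process \<Rightarrow> ('w, real) process \<Rightarrow> bool" where
  "is_int X H Z \<longleftrightarrow> cadlag_adapted M F T Z \<and>
     (\<exists>rs. (\<forall>n. valid_elem (rs n)) \<and> (\<lambda>n. qnorm (\<lambda>u \<omega>. H u \<omega> - elem (rs n) u \<omega>)) \<longlonglongrightarrow> 0 \<and>
        ucp_lim M T (\<lambda>n. elem_int X (rs n)) Z)"

lemma is_int_cadlag: "is_int X H Z \<Longrightarrow> cadlag_adapted M F T Z"
  by (simp add: is_int_def)

lemma is_int_exists:
  fixes X :: "('w, real) process"
  assumes X: "levy_increments X" and H: "bp H"
  shows "\<exists>Z. is_int X H Z"
proof -
  have "\<exists>\<delta>>0. \<forall>rs. valid_elem rs \<and> qnorm (elem rs) < \<delta> \<longrightarrow> sup_prob (elem_int X rs) ((1 / 2) ^ n) \<le> (1 / 2) ^ n" for n :: nat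
  proof -
    obtain \<delta> where "\<delta> > 0" "\<forall>rs. valid_elem rs \<and> qnorm (elem rs) < \<delta> \<longrightarrow> sup_prob (elem_int X rs) ((1 / 2) ^ n) \<le> (1 / 2) ^ n"
      by (rule elem_int_small[OF X, of "(1 / 2) ^ n"]) simp
    then show ?thesis by blast
  qed
  then have "\<exists>\<delta>. \<forall>n::nat. \<delta> n > 0 \<and> (\<forall>rs. valid_elem rs \<and> qnorm (elem rs) < \<delta> n \<longrightarrow> sup_prob (elem_int X rs) ((1 / 2) ^ n) \<le> (1 / 2) ^ n)"
    by (intro choice allI)
  then obtain \<delta> where \<delta>: "\<forall>n::nat. \<delta> n > 0 \<and> (\<forall>rs. valid_elem rs \<and> qnorm (elem rs) < \<delta> n \<longrightarrow> sup_prob (elem_int X rs) ((1 / 2) ^ n) \<le> (1 / 2) ^ n)"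
    by (elim exE)
  \<comment> \<open>The minimum over all thresholds up to \<open>n\<close> makes \<eta> at
    \<open>Suc n\<close> small compared with \<delta> at \<open>n\<close> as well. The divisor 4
    absorbs the factor 2 of \<open>qnorm_triangle\<close> and its two terms.\<close>
  define \<eta> where "\<eta> n = Min (insert ((1 / 2) ^ n) (\<delta> ` {..n})) / 4" for n
  have \<eta>: "\<eta> n > 0" "\<eta> n \<le> (1 / 2) ^ n" for n
  proof -
    show "\<eta> n > 0" using \<delta> by (auto simp: \<eta>_def)
    have "Min (insert ((1 / 2) ^ n) (\<delta> ` {..n})) \<le> (1 / 2) ^ n" by (rule Min_le) auto
    moreover have "0 \<le> (1 / 2 :: real) ^ n" by simp
    ultimately show "\<eta> n \<le> (1 / 2) ^ n" unfolding \<eta>_def by linarith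
  qed
  have \<eta>\<delta>: "\<eta> m \<le> \<delta> n / 4" if "n \<le> m" for n m
    unfolding \<eta>_def using that by (intro divide_right_mono Min_le) auto
  have "\<exists>rs. valid_elem rs \<and> qnorm (\<lambda>u \<omega>. H u \<omega> - elem rs u \<omega>) < \<eta> n" for n
    using elem_dense[OF H \<eta>(1)] by blast
  then have "\<exists>rs. \<forall>n. valid_elem (rs n) \<and> qnorm (\<lambda>u \<omega>. H u \<omega> - elem (rs n) u \<omega>) < \<eta> n"
    by (intro choice allI)
  then obtain rs where rs: "\<forall>n. valid_elem (rs n) \<and> qnorm (\<lambda>u \<omega>. H u \<omega> - elem (rs n) u \<omega>) < \<eta> n"
    by (elim exE)
  then have v: "valid_elem (rs n)" for n by blast
  have cad: "cadlag_adapted M F T (elem_int X (rs n))" for n by (intro elem_int_cadlag levy_cadlag X v)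
  have "sup_prob (\<lambda>t \<omega>. elem_int X (rs (Suc n)) t \<omega> - elem_int X (rs n) t \<omega>) ((1 / 2) ^ n) \<le> (1 / 2) ^ n" for n
  proof -
    define qs where "qs = rs (Suc n) @ elem_scale (-1) (rs n)"
    have e: "elem qs = (\<lambda>u \<omega>. elem (rs (Suc n)) u \<omega> - elem (rs n) u \<omega>)"
      "elem_int X qs = (\<lambda>u \<omega>. elem_int X (rs (Suc n)) u \<omega> - elem_int X (rs n) u \<omega>)"
      by (simp_all add: qs_def fun_eq_iff elem_append elem_int_append elem_scale elem_int_scale)
    have "qnorm (elem qs) \<le> 2 * (qnorm (\<lambda>u \<omega>. elem (rs (Suc n)) u \<omega> - H u \<omega>) + qnorm (\<lambda>u \<omega>. H u \<omega> - elem (rs n) u \<omega>))"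
      unfolding e by (intro qnorm_triangle bp_elem v H)
    also have "\<dots> < 2 * (\<delta> n / 4 + \<delta> n / 4)"
      using rs[rule_format, of n] rs[rule_format, of "Suc n"] \<eta>\<delta>[of n n] \<eta>\<delta>[of n "Suc n"] qnorm_commute[of H "elem (rs (Suc n))"] by simp
    finally have "qnorm (elem qs) < \<delta> n" by simp
    moreover have "valid_elem qs" using v by (simp add: qs_def valid_elem_scale)
    ultimately show ?thesis using \<delta> unfolding e(2)[symmetric] by blast
  qed
  then obtain Z where "cadlag_adapted M F T Z" "ucp_lim M T (\<lambda>n. elem_int X (rs n)) Z"
    by (rule ucp_complete[OF cad])
  moreover have "(\<lambda>n. qnorm (\<lambda>u \<omega>. H u \<omega> - elem (rs n) u \<omega>)) \<longlonglongrightarrow> 0"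
  proof (rule tendsto_sandwich[OF _ _ tendsto_const])
    show "(\<lambda>n. (1 / 2 :: real) ^ n) \<longlonglongrightarrow> 0" by (rule LIMSEQ_realpow_zero) auto
    show "\<forall>\<^sub>F n in sequentially. qnorm (\<lambda>u \<omega>. H u \<omega> - elem (rs n) u \<omega>) \<le> (1 / 2) ^ n"
      using rs \<eta>(2) by (intro always_eventually allI) (meson less_imp_le order_trans)
  qed (simp add: qnorm_nonneg)
  ultimately show ?thesis unfolding is_int_def using v by blast
qed

lemma is_int_elem:
  assumes "cadlag_adapted M F T X" "valid_elem rs"
  shows "is_int X (elem rs) (elem_int X rs)"
  unfolding is_int_def
  using assms by (intro conjI exI[of _ "\<lambda>_. rs"] elem_int_cadlag) (auto simp: qnorm_def ucp_lim_iff sup_prob_def)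

lemma is_int_lin:
  fixes X :: "('w, real) process"
  assumes X: "cadlag_adapted M F T X" and H: "bp H" "bp K" and int: "is_int X H Z" "is_int X K W"
  shows "is_int X (\<lambda>u \<omega>. a * H u \<omega> + b * K u \<omega>) (\<lambda>u \<omega>. a * Z u \<omega> + b * W u \<omega>)"
proof -
  obtain rs where rs: "\<forall>n. valid_elem (rs n)" "(\<lambda>n. qnorm (\<lambda>u \<omega>. H u \<omega> - elem (rs n) u \<omega>)) \<longlonglongrightarrow> 0"
    "ucp_lim M T (\<lambda>n. elem_int X (rs n)) Z" using int(1) unfolding is_int_def by blast
  obtain qs where qs: "\<forall>n. valid_elem (qs n)" "(\<lambda>n. qnorm (\<lambda>u \<omega>. K u \<omega> - elem (qs n) u \<omega>)) \<longlonglongrightarrow> 0"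
    "ucp_lim M T (\<lambda>n. elem_int X (qs n)) W" using int(2) unfolding is_int_def by blast
  note v = rs(1)[rule_format] qs(1)[rule_format]
  note cad = is_int_cadlag[OF int(1)] is_int_cadlag[OF int(2)]
  define ps where "ps n = elem_scale a (rs n) @ elem_scale b (qs n)" for n
  have vp: "valid_elem (ps n)" for n using v by (simp add: ps_def valid_elem_scale)
  have "(\<lambda>n. qnorm (\<lambda>u \<omega>. a * H u \<omega> + b * K u \<omega> - elem (ps n) u \<omega>)) \<longlonglongrightarrow> 0"
  proof (rule tendsto_sandwich[OF _ _ tendsto_const])
    show "\<forall>\<^sub>F n in sequentially. qnorm (\<lambda>u \<omega>. a * H u \<omega> + b * K u \<omega> - elem (ps n) u \<omega>)
      \<le> 2 * ((\<bar>a\<bar> + a\<^sup>2) * qnorm (\<lambda>u \<omega>. H u \<omega> - elem (rs n) u \<omega>) + (\<bar>b\<bar> + b\<^sup>2) * qnorm (\<lambda>u \<omega>. K u \<omega> - elem (qs n) u \<omega>))"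
    proof (rule always_eventually, rule allI)
      fix n
      have "qnorm (\<lambda>u \<omega>. a * H u \<omega> + b * K u \<omega> - elem (ps n) u \<omega>)
        = qnorm (\<lambda>u \<omega>. a * (H u \<omega> - elem (rs n) u \<omega>) + b * (K u \<omega> - elem (qs n) u \<omega>))"
        by (simp add: ps_def elem_append elem_scale algebra_simps)
      also have "\<dots> \<le> 2 * (qnorm (\<lambda>u \<omega>. a * (H u \<omega> - elem (rs n) u \<omega>)) + qnorm (\<lambda>u \<omega>. b * (K u \<omega> - elem (qs n) u \<omega>)))"
        by (intro qnorm_add bp_cmult bp_diff bp_elem v H)
      also have "\<dots> \<le> 2 * ((\<bar>a\<bar> + a\<^sup>2) * qnorm (\<lambda>u \<omega>. H u \<omega> - elem (rs n) u \<omega>) + (\<bar>b\<bar> + b\<^sup>2) * qnorm (\<lambda>u \<omega>. K u \<omega> - elem (qs n) u \<omega>))"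
        by (intro mult_left_mono add_mono qnorm_cmult bp_diff bp_elem v H) simp
      finally show "qnorm (\<lambda>u \<omega>. a * H u \<omega> + b * K u \<omega> - elem (ps n) u \<omega>)
        \<le> 2 * ((\<bar>a\<bar> + a\<^sup>2) * qnorm (\<lambda>u \<omega>. H u \<omega> - elem (rs n) u \<omega>) + (\<bar>b\<bar> + b\<^sup>2) * qnorm (\<lambda>u \<omega>. K u \<omega> - elem (qs n) u \<omega>))" .
    qed
    have "(\<lambda>n. 2 * ((\<bar>a\<bar> + a\<^sup>2) * qnorm (\<lambda>u \<omega>. H u \<omega> - elem (rs n) u \<omega>) + (\<bar>b\<bar> + b\<^sup>2) * qnorm (\<lambda>u \<omega>. K u \<omega> - elem (qs n) u \<omega>)))
      \<longlonglongrightarrow> 2 * ((\<bar>a\<bar> + a\<^sup>2) * 0 + (\<bar>b\<bar> + b\<^sup>2) * 0)"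
      by (intro tendsto_intros rs qs)
    then show "(\<lambda>n. 2 * ((\<bar>a\<bar> + a\<^sup>2) * qnorm (\<lambda>u \<omega>. H u \<omega> - elem (rs n) u \<omega>) + (\<bar>b\<bar> + b\<^sup>2) * qnorm (\<lambda>u \<omega>. K u \<omega> - elem (qs n) u \<omega>))) \<longlonglongrightarrow> 0"
      by simp
  qed (simp add: qnorm_nonneg)
  moreover have "ucp_lim M T (\<lambda>n. elem_int X (ps n)) (\<lambda>u \<omega>. a * Z u \<omega> + b * W u \<omega>)"
  proof -
    have "ucp0 (\<lambda>n u \<omega>. a * (elem_int X (rs n) u \<omega> - Z u \<omega>) + b * (elem_int X (qs n) u \<omega> - W u \<omega>))"
      using rs(3) qs(3) unfolding ucp_lim_ucp0
      by (intro ucp0_add ucp0_scale cadlag_adapted_scale cadlag_adapted_diff elem_int_cadlag X v cad)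
    moreover have "(\<lambda>n u \<omega>. elem_int X (ps n) u \<omega> - (a * Z u \<omega> + b * W u \<omega>)) =
      (\<lambda>n u \<omega>. a * (elem_int X (rs n) u \<omega> - Z u \<omega>) + b * (elem_int X (qs n) u \<omega> - W u \<omega>))"
      by (simp add: fun_eq_iff ps_def elem_int_append elem_int_scale algebra_simps)
    ultimately show ?thesis unfolding ucp_lim_ucp0 by simp
  qed
  ultimately show ?thesis unfolding is_int_def
    using vp cad by (intro conjI exI[of _ ps] cadlag_adapted_add cadlag_adapted_scale) auto
qed

text \<open>Diagonal argument: each integral is replaced by an elementary one that is
  \<open>(1 / 2) ^ n\<close> close both in \<open>qnorm\<close> and in probability, and
  \<open>elem_int_ucp0\<close> handles those.\<close>

lemma is_int_ucp0:
  fixes X :: "('w, real) process"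
  assumes X: "levy_increments X" and H: "\<And>n. bp (H n)" and int: "\<And>n. is_int X (H n) (Z n)"
    and lim: "(\<lambda>n. qnorm (H n)) \<longlonglongrightarrow> 0"
  shows "ucp0 Z"
proof -
  have "\<exists>rs. valid_elem rs \<and> qnorm (\<lambda>u \<omega>. H n u \<omega> - elem rs u \<omega>) < (1 / 2) ^ n \<and>
    sup_prob (\<lambda>t \<omega>. elem_int X rs t \<omega> - Z n t \<omega>) ((1 / 2) ^ n) < (1 / 2) ^ n" for n
  proof -
    obtain rs where rs: "\<forall>k. valid_elem (rs k)" "(\<lambda>k. qnorm (\<lambda>u \<omega>. H n u \<omega> - elem (rs k) u \<omega>)) \<longlonglongrightarrow> 0"
      "ucp_lim M T (\<lambda>k. elem_int X (rs k)) (Z n)" using int[of n] unfolding is_int_def by blast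
    have "\<forall>\<^sub>F k in sequentially. qnorm (\<lambda>u \<omega>. H n u \<omega> - elem (rs k) u \<omega>) < (1 / 2) ^ n"
      by (rule order_tendstoD[OF rs(2)]) simp
    moreover have "\<forall>\<^sub>F k in sequentially. sup_prob (\<lambda>t \<omega>. elem_int X (rs k) t \<omega> - Z n t \<omega>) ((1 / 2) ^ n) < (1 / 2) ^ n"
      using rs(3) unfolding ucp_lim_iff by (intro order_tendstoD(2)[of _ 0]) auto
    ultimately have "\<forall>\<^sub>F k in sequentially. qnorm (\<lambda>u \<omega>. H n u \<omega> - elem (rs k) u \<omega>) < (1 / 2) ^ n \<and>
      sup_prob (\<lambda>t \<omega>. elem_int X (rs k) t \<omega> - Z n t \<omega>) ((1 / 2) ^ n) < (1 / 2) ^ n" by eventually_elim blast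
    then show ?thesis using rs(1) unfolding eventually_sequentially by blast
  qed
  then have "\<exists>rs. \<forall>n. valid_elem (rs n) \<and> qnorm (\<lambda>u \<omega>. H n u \<omega> - elem (rs n) u \<omega>) < (1 / 2) ^ n \<and>
    sup_prob (\<lambda>t \<omega>. elem_int X (rs n) t \<omega> - Z n t \<omega>) ((1 / 2) ^ n) < (1 / 2) ^ n" by (intro choice allI)
  then obtain rs where rs: "\<forall>n. valid_elem (rs n) \<and> qnorm (\<lambda>u \<omega>. H n u \<omega> - elem (rs n) u \<omega>) < (1 / 2) ^ n \<and>
    sup_prob (\<lambda>t \<omega>. elem_int X (rs n) t \<omega> - Z n t \<omega>) ((1 / 2) ^ n) < (1 / 2) ^ n" by (elim exE)
  have v: "valid_elem (rs n)" for n using rs by blast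
  note cadZ = is_int_cadlag[OF int]
  have cadI: "cadlag_adapted M F T (elem_int X (rs n))" for n by (intro elem_int_cadlag levy_cadlag X v)
  have half: "(\<lambda>n. (1 / 2 :: real) ^ n) \<longlonglongrightarrow> 0" by (rule LIMSEQ_realpow_zero) auto
  have "(\<lambda>n. qnorm (elem (rs n))) \<longlonglongrightarrow> 0"
  proof (rule tendsto_sandwich[OF _ _ tendsto_const])
    show "\<forall>\<^sub>F n in sequentially. qnorm (elem (rs n)) \<le> 2 * (qnorm (H n) + (1 / 2) ^ n)"
    proof (rule always_eventually, rule allI)
      fix n
      have "qnorm (elem (rs n)) = qnorm (\<lambda>u \<omega>. H n u \<omega> + (elem (rs n) u \<omega> - H n u \<omega>))" by simp
      also have "\<dots> \<le> 2 * (qnorm (H n) + qnorm (\<lambda>u \<omega>. elem (rs n) u \<omega> - H n u \<omega>))"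
        by (intro qnorm_add bp_diff bp_elem v H)
      also have "\<dots> \<le> 2 * (qnorm (H n) + (1 / 2) ^ n)"
        using rs[rule_format, of n] qnorm_commute[of "elem (rs n)" "H n"] by simp
      finally show "qnorm (elem (rs n)) \<le> 2 * (qnorm (H n) + (1 / 2) ^ n)" .
    qed
    show "(\<lambda>n. 2 * (qnorm (H n) + (1 / 2) ^ n)) \<longlonglongrightarrow> 0"
      using tendsto_mult_left[OF tendsto_add[OF lim half], of 2] by simp
  qed (simp add: qnorm_nonneg)
  then have I0: "ucp0 (\<lambda>n. elem_int X (rs n))" by (rule elem_int_ucp0[OF X v])
  have D0: "ucp0 (\<lambda>n t \<omega>. elem_int X (rs n) t \<omega> - Z n t \<omega>)"
    unfolding ucp0_def
  proof (intro allI impI)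
    fix e :: real assume e: "e > 0"
    have "\<forall>\<^sub>F n in sequentially. (1 / 2 :: real) ^ n < e" using half e by (rule order_tendstoD)
    then have le: "\<forall>\<^sub>F n in sequentially. sup_prob (\<lambda>t \<omega>. elem_int X (rs n) t \<omega> - Z n t \<omega>) e \<le> (1 / 2) ^ n"
    proof eventually_elim
      case (elim n)
      have "sup_prob (\<lambda>t \<omega>. elem_int X (rs n) t \<omega> - Z n t \<omega>) e \<le> sup_prob (\<lambda>t \<omega>. elem_int X (rs n) t \<omega> - Z n t \<omega>) ((1 / 2) ^ n)"
        using elim by (intro sup_prob_le cadlag_adapted_diff cadI cadZ AE_I2) force
      then show ?case using rs[rule_format, of n] by linarith
    qed
    show "(\<lambda>n. sup_prob (\<lambda>t \<omega>. elem_int X (rs n) t \<omega> - Z n t \<omega>) e) \<longlonglongrightarrow> 0"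
      by (rule tendsto_sandwich[OF _ le tendsto_const half]) (simp add: sup_prob_nonneg)
  qed
  have "ucp0 (\<lambda>n t \<omega>. elem_int X (rs n) t \<omega> + (-1) * (elem_int X (rs n) t \<omega> - Z n t \<omega>))"
    by (intro ucp0_add ucp0_scale cadlag_adapted_scale cadlag_adapted_diff cadI cadZ I0 D0)
  then show ?thesis by simp
qed

end

context stoch_basis
begin

text \<open>Apply \<open>is_int_ucp0\<close> to the constant sequence of differences. This is where
  the integral becomes blind to \<open>Q\<close>-null sets.\<close>

lemma is_int_indist:
  fixes X :: "('w, real) process"
  assumes X: "levy_increments X" and H: "bp H" "bp K" and int: "is_int X H Z" "is_int X K W"
    and eq: "qnorm (\<lambda>u \<omega>. H u \<omega> - K u \<omega>) = 0"
  shows "indist M T Z W"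
proof -
  have "is_int X (\<lambda>u \<omega>. 1 * H u \<omega> + (-1) * K u \<omega>) (\<lambda>u \<omega>. 1 * Z u \<omega> + (-1) * W u \<omega>)"
    by (rule is_int_lin[OF levy_cadlag[OF X] H int])
  then have D: "is_int X (\<lambda>u \<omega>. H u \<omega> - K u \<omega>) (\<lambda>u \<omega>. Z u \<omega> - W u \<omega>)" by simp
  have "ucp0 (\<lambda>n::nat. \<lambda>u \<omega>. Z u \<omega> - W u \<omega>)"
    by (rule is_int_ucp0[OF X bp_diff[OF H] D]) (simp add: eq)
  then have "indist M T (\<lambda>u \<omega>. Z u \<omega> - W u \<omega>) (\<lambda>_ _. 0)"
    using ucp0_const_iff[OF is_int_cadlag[OF D]] by blast
  then show ?thesis by (simp add: indist_def)
qed

definition J1 :: "('w, real) process \<Rightarrow> ('w, real) process \<Rightarrow> ('w, real) process" where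
  "J1 X H = (SOME Z. is_int X H Z)"

lemma J1: "levy_increments X \<Longrightarrow> bp H \<Longrightarrow> is_int X H (J1 X H)"
  unfolding J1_def by (rule someI_ex[OF is_int_exists])

lemma levy_component:
  fixes R :: "('w, 'v::euclidean_space) process"
  assumes R: "levy_increments R"
  shows "levy_increments (\<lambda>t \<omega>. R t \<omega> \<bullet> b)"
  unfolding levy_increments_def
proof (intro conjI allI impI)
  show "cadlag_adapted M F T (\<lambda>t \<omega>. R t \<omega> \<bullet> b)"
    by (rule cadlag_adapted_combine[OF levy_cadlag[OF R] levy_cadlag[OF R], where h="\<lambda>x y. x \<bullet> b"]) (intro continuous_intros)
  fix s t assume "0 \<le> s \<and> s \<le> t \<and> t \<le> T"
  then have st: "0 \<le> s" "s \<le> t" "t \<le> T" by auto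
  let ?D = "\<lambda>\<omega>. R t \<omega> - R s \<omega>"
  have ind: "indep_set (sets (F s)) {?D -` B \<inter> space M | B. B \<in> sets borel}"
    using R st by (simp add: levy_increments_def)
  have sub: "{(\<lambda>\<omega>. R t \<omega> \<bullet> b - R s \<omega> \<bullet> b) -` B \<inter> space M | B. B \<in> sets borel} \<subseteq> {?D -` B \<inter> space M | B. B \<in> sets borel}"
  proof clarify
    fix B :: "real set" assume "B \<in> sets borel"
    then have "(\<lambda>x::'v. x \<bullet> b) -` B \<in> sets borel"
      using measurable_sets[of "\<lambda>x::'v. x \<bullet> b" borel borel B] by simp
    then show "\<exists>B'. (\<lambda>\<omega>. R t \<omega> \<bullet> b - R s \<omega> \<bullet> b) -` B \<inter> space M = ?D -` B' \<inter> space M \<and> B' \<in> sets borel"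
      by (intro exI[of _ "(\<lambda>x. x \<bullet> b) -` B"]) (auto simp: inner_diff_left)
  qed
  show "indep_set (sets (F s)) {(\<lambda>\<omega>. R t \<omega> \<bullet> b - R s \<omega> \<bullet> b) -` B \<inter> space M | B. B \<in> sets borel}"
    by (rule indep_setI[OF _ _ indep_setD[OF ind]])
      (use sub indep_setD_ev1[OF ind] indep_setD_ev2[OF ind] in \<open>meson subset_trans subsetD\<close>)+
  have [measurable]: "R t \<in> borel_measurable M" "R s \<in> borel_measurable M" "R (t - s) \<in> borel_measurable M"
    using levy_measurable(2)[OF R] st by auto
  have "distr M borel (\<lambda>\<omega>. R t \<omega> \<bullet> b - R s \<omega> \<bullet> b) = distr (distr M borel ?D) borel (\<lambda>x. x \<bullet> b)"
    by (subst distr_distr) (auto simp: comp_def inner_diff_left)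
  also have "\<dots> = distr (distr M borel (R (t - s))) borel (\<lambda>x. x \<bullet> b)"
    using levy_distr_eq[OF R st] by simp
  also have "\<dots> = distr M borel (\<lambda>\<omega>. R (t - s) \<omega> \<bullet> b)"
    by (subst distr_distr) (auto simp: comp_def)
  finally show "distr M borel (\<lambda>\<omega>. R t \<omega> \<bullet> b - R s \<omega> \<bullet> b) = distr M borel (\<lambda>\<omega>. R (t - s) \<omega> \<bullet> b)" .
qed

lemma bp_component:
  fixes H :: "('w, 'v::euclidean_space) process"
  assumes "bp H"
  shows "bp (\<lambda>u \<omega>. H u \<omega> \<bullet> b)"
proof -
  obtain c where c: "0 \<le> c" "\<forall>t\<in>{0..T}. \<forall>\<omega>\<in>space M. norm (H t \<omega>) \<le> c" by (rule bpE[OF assms])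
  show ?thesis
  proof (rule bpI)
    show "predictable M F T (\<lambda>u \<omega>. H u \<omega> \<bullet> b)"
      by (rule predictable_compose[OF bp_predictable[OF assms], where h="\<lambda>x. x \<bullet> b"]) simp
    fix t \<omega> assume "t \<in> {0..T}" "\<omega> \<in> space M"
    then have "norm (H t \<omega>) * norm b \<le> c * norm b" using c by (intro mult_right_mono) auto
    then show "norm (H t \<omega> \<bullet> b) \<le> c * norm b"
      using Cauchy_Schwarz_ineq2[of "H t \<omega>" b] by simp
  qed
qed

lemma indist_sum:
  assumes "finite B" "\<And>b. b \<in> B \<Longrightarrow> indist M T (Y b) (Z b)"
  shows "indist M T (\<lambda>t \<omega>. \<Sum>b\<in>B. Y b t \<omega>) (\<lambda>t \<omega>. \<Sum>b\<in>B. Z b t \<omega> :: real)"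
proof -
  have "AE \<omega> in M. \<forall>b\<in>B. \<forall>t\<in>{0..T}. Y b t \<omega> = Z b t \<omega>"
    by (rule AE_finite_allI[OF assms(1) assms(2)[unfolded indist_def]])
  then show ?thesis unfolding indist_def by eventually_elim (auto intro: sum.cong)
qed

lemma cadlag_adapted_sum:
  fixes Y :: "'b \<Rightarrow> ('w, real) process"
  assumes "finite B" "\<And>b. b \<in> B \<Longrightarrow> cadlag_adapted M F T (Y b)"
  shows "cadlag_adapted M F T (\<lambda>t \<omega>. \<Sum>b\<in>B. Y b t \<omega>)"
  using assms by (induction B) (auto intro: cadlag_adapted_const cadlag_adapted_add)

lemma ucp0_sum:
  fixes Y :: "'b \<Rightarrow> nat \<Rightarrow> ('w, real) process"
  assumes "finite B" "\<And>b n. b \<in> B \<Longrightarrow> cadlag_adapted M F T (Y b n)" "\<And>b. b \<in> B \<Longrightarrow> ucp0 (Y b)"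
  shows "ucp0 (\<lambda>n t \<omega>. \<Sum>b\<in>B. Y b n t \<omega>)"
  using assms
proof (induction B)
  case empty
  then show ?case by (simp add: ucp0_def sup_prob_def)
next
  case (insert b B)
  have "ucp0 (\<lambda>n t \<omega>. Y b n t \<omega> + (\<Sum>b\<in>B. Y b n t \<omega>))"
    using insert by (intro ucp0_add cadlag_adapted_sum) auto
  then show ?case using insert by simp
qed

lemma qnorm_AE_zero:
  assumes "AE z in Q. H (fst z) (snd z) = 0"
  shows "qnorm H = 0"
proof -
  have "AE z in Q. qfun H z = 0" using assms by eventually_elim (simp add: qfun_def)
  then show ?thesis unfolding qnorm_qfun by (simp add: integral_eq_zero_AE)
qed

text \<open>The coordinates of \<open>R\<close> are integrated separately and summed; each has Levy
  increments for the same filtration. The second claim does not belong to the definition of an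
  integration operator: it comes from the \<open>qnorm\<close> construction and is the reason for
  it.\<close>

lemma levy_integration_operator:
  fixes R :: "('w, 'v::euclidean_space) process"
  assumes R: "levy_increments R"
  obtains J where "integration_operator M F T R J"
    "\<forall>H. bp H \<and> (AE z in Q. H (fst z) (snd z) = 0) \<longrightarrow> indist M T (J H) (\<lambda>_ _. 0)"
proof -
  define X where "X b t \<omega> = R t \<omega> \<bullet> b" for b t \<omega>
  define C where "C H b u \<omega> = H u \<omega> \<bullet> b" for H :: "('w, 'v) process" and b u \<omega>
  define J where "J H u \<omega> = (\<Sum>b\<in>Basis. J1 (X b) (C H b) u \<omega>)" for H u \<omega>
  have X: "levy_increments (X b)" for b unfolding X_def[abs_def] by (rule levy_component[OF R])
  have C: "bp (C H b)" if "bp H" for H b unfolding C_def[abs_def] by (rule bp_component[OF that])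
  have I: "is_int (X b) (C H b) (J1 (X b) (C H b))" if "bp H" for H b
    by (rule J1[OF X C[OF that]])
  have cad: "cadlag_adapted M F T (J H)" if "bp H" for H
    unfolding J_def[abs_def] by (intro cadlag_adapted_sum is_int_cadlag[OF I[OF that]]) simp
  have cong: "indist M T (J H) (\<lambda>t \<omega>. \<Sum>b\<in>Basis. Z b t \<omega>)"
    if "bp H" "\<And>b. b \<in> Basis \<Longrightarrow> indist M T (J1 (X b) (C H b)) (Z b)" for H Z
    unfolding J_def[abs_def] using that(2) by (intro indist_sum) auto
  have zero: "indist M T (J H) (\<lambda>_ _. 0)" if H: "bp H" "\<And>b. qnorm (C H b) = 0" for H
  proof -
    have Z: "is_int (X b) (\<lambda>_ _. 0) (\<lambda>_ _. 0)" for b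
    proof -
      have "elem ([] :: 'w elementary) = (\<lambda>_ _. 0)" "elem_int (X b) [] = (\<lambda>_ _. 0)" by (simp_all add: fun_eq_iff)
      then show ?thesis using is_int_elem[OF levy_cadlag[OF X], of "[]" b] by simp
    qed
    have "indist M T (J1 (X b) (C H b)) (\<lambda>_ _. 0)" for b
      by (rule is_int_indist[OF X C[OF H(1)] bp_const I[OF H(1)] Z]) (use H in simp)
    then show ?thesis using cong[OF H(1), of "\<lambda>_ _ _. 0"] by simp
  qed
  have "integration_operator M F T R J"
    unfolding integration_operator_def
  proof (intro conjI allI impI)
    fix H :: "('w, 'v) process" assume "bp H"
    then show "cadlag_adapted M F T (J H)" by (rule cad)
  next
    fix \<xi> :: "'w \<Rightarrow> 'v" assume "\<xi> \<in> borel_measurable (F 0) \<and> bounded (\<xi> ` space M)"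
    then have b: "bp (\<lambda>u \<omega>. indicat_real {0} u *\<^sub>R \<xi> \<omega>)" by (intro bp_zero) auto
    show "indist M T (J (\<lambda>u \<omega>. indicat_real {0} u *\<^sub>R \<xi> \<omega>)) (\<lambda>u \<omega>. 0)"
    proof (rule zero[OF b])
      show "qnorm (C (\<lambda>u \<omega>. indicat_real {0} u *\<^sub>R \<xi> \<omega>) b) = 0" for b
        using qnorm_zero_time[of "\<lambda>\<omega>. \<xi> \<omega> \<bullet> b"] unfolding C_def[abs_def] by simp
    qed
  next
    fix s t and \<xi> :: "'w \<Rightarrow> 'v"
    assume "0 \<le> s \<and> s \<le> t \<and> t \<le> T \<and> \<xi> \<in> borel_measurable (F s) \<and> bounded (\<xi> ` space M)"
    then have st: "0 \<le> s" "s \<le> t" "t \<le> T" and \<xi>: "\<xi> \<in> borel_measurable (F s)" "bounded (\<xi> ` space M)" by auto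
    have b: "bp (\<lambda>u \<omega>. indicat_real {s<..t} u *\<^sub>R \<xi> \<omega>)" by (intro bp_interval st \<xi>)
    have "indist M T (J (\<lambda>u \<omega>. indicat_real {s<..t} u *\<^sub>R \<xi> \<omega>))
        (\<lambda>u \<omega>. \<Sum>b\<in>Basis. elem_int (X b) [(s, t, \<lambda>\<omega>. \<xi> \<omega> \<bullet> b)] u \<omega>)"
    proof (rule cong[OF b])
      fix b :: 'v assume bB: "b \<in> Basis"
      obtain c where c: "\<forall>\<omega>\<in>space M. norm (\<xi> \<omega>) \<le> c" using \<xi>(2) unfolding bounded_iff by blast
      have \<xi>b: "bdd_rv (F s) (\<lambda>\<omega>. \<xi> \<omega> \<bullet> b)"
      proof (rule bdd_rvI)
        show "(\<lambda>\<omega>. \<xi> \<omega> \<bullet> b) \<in> borel_measurable (F s)" using \<xi>(1) by simp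
        show "\<bar>\<xi> \<omega> \<bullet> b\<bar> \<le> c" if "\<omega> \<in> space (F s)" for \<omega>
          using Basis_le_norm[OF bB, of "\<xi> \<omega>"] c that by auto
      qed
      then have v: "valid_elem [(s, t, \<lambda>\<omega>. \<xi> \<omega> \<bullet> b)]" using st by simp
      show "indist M T (J1 (X b) (C (\<lambda>u \<omega>. indicat_real {s<..t} u *\<^sub>R \<xi> \<omega>) b)) (elem_int (X b) [(s, t, \<lambda>\<omega>. \<xi> \<omega> \<bullet> b)])"
        by (rule is_int_indist[OF X C[OF b] bp_elem[OF v] I[OF b] is_int_elem[OF levy_cadlag[OF X] v]])
          (simp add: C_def qnorm_def)
    qed
    moreover have "(\<lambda>u \<omega>. \<Sum>b\<in>Basis. elem_int (X b) [(s, t, \<lambda>\<omega>. \<xi> \<omega> \<bullet> b)] u \<omega>)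
      = (\<lambda>u \<omega>. \<xi> \<omega> \<bullet> (R (min u t) \<omega> - R (min u s) \<omega>))"
    proof (intro ext)
      fix u \<omega>
      have "(\<Sum>b\<in>Basis. elem_int (X b) [(s, t, \<lambda>\<omega>. \<xi> \<omega> \<bullet> b)] u \<omega>)
        = (\<Sum>b\<in>Basis. (\<xi> \<omega> \<bullet> b) * ((R (min u t) \<omega> - R (min u s) \<omega>) \<bullet> b))"
        by (simp add: X_def inner_diff_left)
      also have "\<dots> = \<xi> \<omega> \<bullet> (R (min u t) \<omega> - R (min u s) \<omega>)" by (rule euclidean_inner[symmetric])
      finally show "(\<Sum>b\<in>Basis. elem_int (X b) [(s, t, \<lambda>\<omega>. \<xi> \<omega> \<bullet> b)] u \<omega>) = \<xi> \<omega> \<bullet> (R (min u t) \<omega> - R (min u s) \<omega>)" .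
    qed
    ultimately show "indist M T (J (\<lambda>u \<omega>. indicat_real {s<..t} u *\<^sub>R \<xi> \<omega>))
        (\<lambda>u \<omega>. \<xi> \<omega> \<bullet> (R (min u t) \<omega> - R (min u s) \<omega>))" by simp
  next
    fix H K :: "('w, 'v) process" and a b :: real
    assume "bp H \<and> bp K"
    then have H: "bp H" and K: "bp K" by auto
    have HK: "bp (\<lambda>u \<omega>. a *\<^sub>R H u \<omega> + b *\<^sub>R K u \<omega>)" by (rule bp_lincomb[OF H K])
    have "indist M T (J (\<lambda>u \<omega>. a *\<^sub>R H u \<omega> + b *\<^sub>R K u \<omega>))
       (\<lambda>u \<omega>. \<Sum>i\<in>Basis. a * J1 (X i) (C H i) u \<omega> + b * J1 (X i) (C K i) u \<omega>)"
    proof (rule cong[OF HK])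
      fix i :: 'v
      have eq: "C (\<lambda>u \<omega>. a *\<^sub>R H u \<omega> + b *\<^sub>R K u \<omega>) i = (\<lambda>u \<omega>. a * C H i u \<omega> + b * C K i u \<omega>)"
        by (simp add: C_def fun_eq_iff inner_add_left)
      have L: "is_int (X i) (\<lambda>u \<omega>. a * C H i u \<omega> + b * C K i u \<omega>) (\<lambda>u \<omega>. a * J1 (X i) (C H i) u \<omega> + b * J1 (X i) (C K i) u \<omega>)"
        by (rule is_int_lin[OF levy_cadlag[OF X] C[OF H] C[OF K] I[OF H] I[OF K]])
      have bL: "bp (\<lambda>u \<omega>. a * C H i u \<omega> + b * C K i u \<omega>)" using C[OF HK, of i] unfolding eq .
      show "indist M T (J1 (X i) (C (\<lambda>u \<omega>. a *\<^sub>R H u \<omega> + b *\<^sub>R K u \<omega>) i))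
        (\<lambda>u \<omega>. a * J1 (X i) (C H i) u \<omega> + b * J1 (X i) (C K i) u \<omega>)"
        by (rule is_int_indist[OF X C[OF HK] bL I[OF HK] L]) (simp add: eq qnorm_def)
    qed
    then show "indist M T (J (\<lambda>u \<omega>. a *\<^sub>R H u \<omega> + b *\<^sub>R K u \<omega>)) (\<lambda>u \<omega>. a * J H u \<omega> + b * J K u \<omega>)"
      by (simp add: J_def sum.distrib sum_distrib_left)
  next
    fix Hn and H :: "('w, 'v) process" and c :: real
    assume as: "(\<forall>n. predictable M F T (Hn n)) \<and> predictable M F T H \<and>
        (\<forall>n. \<forall>t\<in>{0..T}. \<forall>\<omega>\<in>space M. norm (Hn n t \<omega>) \<le> c) \<and>
        (\<forall>t\<in>{0..T}. \<forall>\<omega>\<in>space M. (\<lambda>n. Hn n t \<omega>) \<longlonglongrightarrow> H t \<omega>)"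
    have Hn: "bp (Hn n)" for n using as by (intro bpI[where c=c]) auto
    have H: "bp H"
    proof (rule bpI[where c=c])
      fix t \<omega> assume t: "t \<in> {0..T}" "\<omega> \<in> space M"
      then have "(\<lambda>n. norm (Hn n t \<omega>)) \<longlonglongrightarrow> norm (H t \<omega>)" using as by (intro tendsto_norm) auto
      then show "norm (H t \<omega>) \<le> c" by (rule LIMSEQ_le_const2) (use as t in auto)
    qed (use as in auto)
    have "ucp0 (\<lambda>n u \<omega>. \<Sum>b\<in>Basis. J1 (X b) (C (Hn n) b) u \<omega> - J1 (X b) (C H b) u \<omega>)"
    proof (rule ucp0_sum)
      fix b :: 'v assume bB: "b \<in> Basis"
      show "cadlag_adapted M F T (\<lambda>u \<omega>. J1 (X b) (C (Hn n) b) u \<omega> - J1 (X b) (C H b) u \<omega>)" for n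
        by (intro cadlag_adapted_diff is_int_cadlag[OF I[OF Hn]] is_int_cadlag[OF I[OF H]])
      have "is_int (X b) (\<lambda>u \<omega>. 1 * C (Hn n) b u \<omega> + (-1) * C H b u \<omega>) (\<lambda>u \<omega>. 1 * J1 (X b) (C (Hn n) b) u \<omega> + (-1) * J1 (X b) (C H b) u \<omega>)" for n
        by (rule is_int_lin[OF levy_cadlag[OF X] C[OF Hn] C[OF H] I[OF Hn] I[OF H]])
      then have D: "is_int (X b) (\<lambda>u \<omega>. C (Hn n) b u \<omega> - C H b u \<omega>) (\<lambda>u \<omega>. J1 (X b) (C (Hn n) b) u \<omega> - J1 (X b) (C H b) u \<omega>)" for n
        by simp
      have "(\<lambda>n. qnorm (\<lambda>u \<omega>. C (Hn n) b u \<omega> - C H b u \<omega>)) \<longlonglongrightarrow> 0"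
      proof (rule qnorm_bounded_limit[OF C[OF Hn] C[OF H]])
        fix n t \<omega> assume t: "t \<in> {0..T}" "\<omega> \<in> space M"
        show "\<bar>C (Hn n) b t \<omega>\<bar> \<le> c"
        proof -
          have "norm (Hn n t \<omega>) \<le> c" using as t by blast
          then show ?thesis using Basis_le_norm[OF bB, of "Hn n t \<omega>"] unfolding C_def by linarith
        qed
        show "(\<lambda>n. C (Hn n) b t \<omega>) \<longlonglongrightarrow> C H b t \<omega>"
        proof -
          have "(\<lambda>n. Hn n t \<omega>) \<longlonglongrightarrow> H t \<omega>" using as t by blast
          then show ?thesis unfolding C_def by (intro tendsto_inner tendsto_const)
        qed
      qed
      then show "ucp0 (\<lambda>n u \<omega>. J1 (X b) (C (Hn n) b) u \<omega> - J1 (X b) (C H b) u \<omega>)"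
        by (rule is_int_ucp0[OF X bp_diff[OF C[OF Hn] C[OF H]] D])
    qed simp
    then show "ucp_lim M T (\<lambda>n. J (Hn n)) (J H)"
      unfolding ucp_lim_ucp0 J_def by (simp add: sum_subtractf)
  qed
  moreover have "\<forall>H. bp H \<and> (AE z in Q. H (fst z) (snd z) = 0) \<longrightarrow> indist M T (J H) (\<lambda>_ _. 0)"
  proof (intro allI impI, elim conjE)
    fix H :: "('w, 'v) process" assume H: "bp H" "AE z in Q. H (fst z) (snd z) = 0"
    show "indist M T (J H) (\<lambda>_ _. 0)"
    proof (rule zero[OF H(1)])
      show "qnorm (C H b) = 0" for b
        by (rule qnorm_AE_zero) (use H(2) in eventually_elim, simp add: C_def)
    qed
  qed
  ultimately show ?thesis by (rule that)
qed

end

section \<open>Calculus of integration operators\<close>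

lemma left_limit_cong:
  assumes "\<And>s. s \<in> {0..T} \<Longrightarrow> f s = g s" "t \<in> {0..T}"
  shows "left_limit f t = left_limit g t"
proof (cases "t = 0")
  case False
  then have "\<forall>\<^sub>F s in at_left t. f s = g s"
    using assms by (intro eventually_at_leftI[of 0]) auto
  then have "(f \<longlongrightarrow> l) (at_left t) = (g \<longlongrightarrow> l) (at_left t)" for l by (rule tendsto_cong)
  then have "Lim (at_left t) f = Lim (at_left t) g" by (simp add: t2_space_class.Lim_def)
  moreover have "f 0 = g 0" using assms by auto
  ultimately show ?thesis unfolding left_limit_def by simp
qed (use assms in \<open>simp add: left_limit_0\<close>)

lemma path_jump_lincomb:
  fixes f g :: "real \<Rightarrow> real"
  assumes c: "cadlag_path T f" "cadlag_path T g" and t: "t \<le> T"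
  shows "path_jump (\<lambda>u. a * f u + b * g u) t = a * path_jump f t + b * path_jump g t"
proof -
  have "left_limit (\<lambda>u. a * fst (f u, g u) + b * snd (f u, g u)) t
     = a * fst (left_limit (\<lambda>u. (f u, g u)) t) + b * snd (left_limit (\<lambda>u. (f u, g u)) t)"
    using t by (intro left_limit_compose[OF cadlag_path_Pair[OF c], where h="\<lambda>x. a * fst x + b * snd x"] isCont_add isCont_mult isCont_fst isCont_snd) auto
  then show ?thesis using left_limit_Pair[OF c] t unfolding path_jump_def by (simp add: algebra_simps)
qed

context stoch_basis
begin

abbreviation op :: "('w, 'v::euclidean_space) process \<Rightarrow> (('w, 'v) process \<Rightarrow> ('w, real) process) \<Rightarrow> bool" where
  "op \<equiv> integration_operator M F T"

lemma op_cadlag: "op X J \<Longrightarrow> bp H \<Longrightarrow> cadlag_adapted M F T (J H)"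
  by (simp add: integration_operator_def)

lemma op_zero: "op X J \<Longrightarrow> \<xi> \<in> borel_measurable (F 0) \<Longrightarrow> bounded (\<xi> ` space M) \<Longrightarrow>
    indist M T (J (\<lambda>u \<omega>. indicat_real {0} u *\<^sub>R \<xi> \<omega>)) (\<lambda>u \<omega>. 0)"
  by (simp add: integration_operator_def)

lemma op_interval: "op X J \<Longrightarrow> 0 \<le> s \<Longrightarrow> s \<le> t \<Longrightarrow> t \<le> T \<Longrightarrow> \<xi> \<in> borel_measurable (F s) \<Longrightarrow> bounded (\<xi> ` space M) \<Longrightarrow>
    indist M T (J (\<lambda>u \<omega>. indicat_real {s<..t} u *\<^sub>R \<xi> \<omega>)) (\<lambda>u \<omega>. \<xi> \<omega> \<bullet> (X (min u t) \<omega> - X (min u s) \<omega>))"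
  by (simp add: integration_operator_def)

lemma op_lin: "op X J \<Longrightarrow> bp H \<Longrightarrow> bp K \<Longrightarrow>
    indist M T (J (\<lambda>u \<omega>. a *\<^sub>R H u \<omega> + b *\<^sub>R K u \<omega>)) (\<lambda>u \<omega>. a * J H u \<omega> + b * J K u \<omega>)"
  by (simp add: integration_operator_def)

lemma op_lim:
  assumes "op X J" "\<And>n. bp (Hn n)" "bp H"
    "\<And>n t \<omega>. t \<in> {0..T} \<Longrightarrow> \<omega> \<in> space M \<Longrightarrow> norm (Hn n t \<omega>) \<le> c"
    "\<And>t \<omega>. t \<in> {0..T} \<Longrightarrow> \<omega> \<in> space M \<Longrightarrow> (\<lambda>n. Hn n t \<omega>) \<longlonglongrightarrow> H t \<omega>"
  shows "ucp_lim M T (\<lambda>n. J (Hn n)) (J H)"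
proof -
  have "(\<forall>n. predictable M F T (Hn n)) \<and> predictable M F T H \<and>
        (\<forall>n. \<forall>t\<in>{0..T}. \<forall>\<omega>\<in>space M. norm (Hn n t \<omega>) \<le> c) \<and>
        (\<forall>t\<in>{0..T}. \<forall>\<omega>\<in>space M. (\<lambda>n. Hn n t \<omega>) \<longlonglongrightarrow> H t \<omega>)"
    using assms(2-5) bp_predictable by blast
  then show ?thesis using assms(1) unfolding integration_operator_def by blast
qed

lemma bp_0 [simp]: "bp (\<lambda>_ _. 0 :: 'v::euclidean_space)"
  using sets_PS_indicator[of "{}" "0 :: 'v"] by simp

lemma op_0: "op X J \<Longrightarrow> indist M T (J (\<lambda>_ _. 0)) (\<lambda>_ _. 0)"
  using op_zero[of X J "\<lambda>_. 0"] by (simp add: bounded_iff) (metis order_refl)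

lemma ucp_lim_cong:
  assumes "\<And>n. cadlag_adapted M F T (Y n)" "cadlag_adapted M F T Z"
    and "ucp_lim M T Y Z" "\<And>n. indist M T (Y n) (Y' n)" "indist M T Z Z'"
  shows "ucp_lim M T Y' Z'"
  using assms(3) unfolding ucp_lim_ucp0
proof (rule ucp0_cong[rotated])
  show "cadlag_adapted M F T (\<lambda>t \<omega>. Y n t \<omega> - Z t \<omega>)" for n by (rule cadlag_adapted_diff[OF assms(1,2)])
  show "indist M T (\<lambda>t \<omega>. Y n t \<omega> - Z t \<omega>) (\<lambda>t \<omega>. Y' n t \<omega> - Z' t \<omega>)" for n
    by (rule indist_combine[OF assms(4,5), where h="\<lambda>_ _ x y. x - y"])
qed

lemma indist_stopped_increment:
  assumes "indist M T X Y" "0 \<le> s" "0 \<le> t"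
  shows "indist M T (\<lambda>u \<omega>. \<xi> \<omega> \<bullet> (X (min u t) \<omega> - X (min u s) \<omega>)) (\<lambda>u \<omega>. \<xi> \<omega> \<bullet> (Y (min u t) \<omega> - Y (min u s) \<omega>))"
  using assms(1) unfolding indist_def
proof eventually_elim
  case (elim \<omega>)
  show ?case
  proof
    fix u assume "u \<in> {0..T}"
    then have "min u t \<in> {0..T}" "min u s \<in> {0..T}" using assms by auto
    then show "\<xi> \<omega> \<bullet> (X (min u t) \<omega> - X (min u s) \<omega>) = \<xi> \<omega> \<bullet> (Y (min u t) \<omega> - Y (min u s) \<omega>)"
      using elim by simp
  qed
qed

lemma indicator_rv:
  fixes v :: "'v::euclidean_space"
  assumes "A \<in> sets (F s)"
  shows "(\<lambda>\<omega>. indicat_real A \<omega> *\<^sub>R v) \<in> borel_measurable (F s)" "bounded ((\<lambda>\<omega>. indicat_real A \<omega> *\<^sub>R v) ` space M)"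
proof -
  show "(\<lambda>\<omega>. indicat_real A \<omega> *\<^sub>R v) \<in> borel_measurable (F s)"
    by (intro borel_measurable_scaleR borel_measurable_indicator assms borel_measurable_const)
  show "bounded ((\<lambda>\<omega>. indicat_real A \<omega> *\<^sub>R v) ` space M)"
    unfolding bounded_iff by (intro exI[of _ "norm v"]) (auto simp: indicator_def)
qed

text \<open>Two operators agree on the generators, and linearity and limits in probability propagate
  this. The definitions quantify existentially over operators; this lemma allows all those
  occurrences to be replaced by a single one.\<close>

lemma op_unique:
  fixes X :: "('w, 'v::euclidean_space) process"
  assumes J: "op X J" and L: "op X' L" and X: "indist M T X X'" and H: "bp H"
  shows "indist M T (J H) (L H)"
  using H
proof (induction H rule: bounded_predictable_induct)
  case (zero A v)
  show ?case
    using op_zero[OF J indicator_rv[OF zero]] op_zero[OF L indicator_rv[OF zero]] indist_trans indist_sym by blast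
next
  case (interval s t A v)
  note st = interval(1-3) and A = indicator_rv[OF interval(4), of v]
  from indist_trans[OF op_interval[OF J st A] indist_trans[OF indist_stopped_increment[OF X] indist_sym[OF op_interval[OF L st A]]]]
  show ?case using st by simp
next
  case (lin H K a b)
  have "indist M T (\<lambda>u \<omega>. a * J H u \<omega> + b * J K u \<omega>) (\<lambda>u \<omega>. a * L H u \<omega> + b * L K u \<omega>)"
    by (rule indist_combine[OF lin(3,4), where h="\<lambda>_ _ x y. a * x + b * y"])
  then show ?case
    using op_lin[OF J lin(1,2), of a b] op_lin[OF L lin(1,2), of a b] indist_trans indist_sym by blast
next
  case (lim Hn H c)
  have bps: "\<And>n. bp (Hn n)" "bp H" by (rule lim)+
  have 1: "ucp_lim M T (\<lambda>n. J (Hn n)) (J H)" by (rule op_lim[OF J bps, where c=c]) (rule lim; assumption)+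
  have 2: "ucp_lim M T (\<lambda>n. L (Hn n)) (L H)" by (rule op_lim[OF L bps, where c=c]) (rule lim; assumption)+
  have IH: "indist M T (J (Hn n)) (L (Hn n))" for n by (rule lim)
  have "ucp_lim M T (\<lambda>n. J (Hn n)) (L H)"
    by (rule ucp_lim_cong[OF op_cadlag[OF L bps(1)] op_cadlag[OF L bps(2)] 2 indist_sym[OF IH] indist_refl])
  from ucp_lim_unique[OF op_cadlag[OF J bps(1)] op_cadlag[OF J bps(2)] op_cadlag[OF L bps(2)] 1 this]
  show ?case .
qed

text \<open>The limit clause of the definition speaks of predictable integrands with a common bound.
  The bound passes to the limit, so it is enough to treat bounded predictable ones.\<close>

lemma opI:
  fixes X :: "('w, 'v::euclidean_space) process"
  assumes cad: "\<And>H. bp H \<Longrightarrow> cadlag_adapted M F T (J H)"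
    and zero: "\<And>\<xi>. \<xi> \<in> borel_measurable (F 0) \<Longrightarrow> bounded (\<xi> ` space M) \<Longrightarrow>
      indist M T (J (\<lambda>u \<omega>. indicat_real {0} u *\<^sub>R \<xi> \<omega>)) (\<lambda>u \<omega>. 0)"
    and interval: "\<And>s t \<xi>. 0 \<le> s \<Longrightarrow> s \<le> t \<Longrightarrow> t \<le> T \<Longrightarrow> \<xi> \<in> borel_measurable (F s) \<Longrightarrow> bounded (\<xi> ` space M) \<Longrightarrow>
      indist M T (J (\<lambda>u \<omega>. indicat_real {s<..t} u *\<^sub>R \<xi> \<omega>)) (\<lambda>u \<omega>. \<xi> \<omega> \<bullet> (X (min u t) \<omega> - X (min u s) \<omega>))"
    and lin: "\<And>H K a b. bp H \<Longrightarrow> bp K \<Longrightarrow>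
      indist M T (J (\<lambda>u \<omega>. a *\<^sub>R H u \<omega> + b *\<^sub>R K u \<omega>)) (\<lambda>u \<omega>. a * J H u \<omega> + b * J K u \<omega>)"
    and lim: "\<And>Hn H c::real. \<forall>n. bp (Hn n) \<Longrightarrow> bp H \<Longrightarrow> \<forall>n. \<forall>t\<in>{0..T}. \<forall>\<omega>\<in>space M. norm (Hn n t \<omega>) \<le> c \<Longrightarrow>
      \<forall>t\<in>{0..T}. \<forall>\<omega>\<in>space M. (\<lambda>n. Hn n t \<omega>) \<longlonglongrightarrow> H t \<omega> \<Longrightarrow> ucp_lim M T (\<lambda>n. J (Hn n)) (J H)"
  shows "op X J"
proof -
  have main: "ucp_lim M T (\<lambda>n. J (Hn n)) (J H)"
    if pr: "\<forall>n. predictable M F T (Hn n)" "predictable M F T H"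
      and b: "\<forall>n. \<forall>t\<in>{0..T}. \<forall>\<omega>\<in>space M. norm (Hn n t \<omega>) \<le> c"
      and l: "\<forall>t\<in>{0..T}. \<forall>\<omega>\<in>space M. (\<lambda>n. Hn n t \<omega>) \<longlonglongrightarrow> H t \<omega>" for Hn H c
  proof (rule lim[OF _ _ b l])
    have "norm (H t \<omega>) \<le> c" if t: "t \<in> {0..T}" "\<omega> \<in> space M" for t \<omega>
    proof (rule LIMSEQ_le_const2)
      show "(\<lambda>n. norm (Hn n t \<omega>)) \<longlonglongrightarrow> norm (H t \<omega>)" by (rule tendsto_norm) (use l t in blast)
      show "\<exists>N. \<forall>n\<ge>N. norm (Hn n t \<omega>) \<le> c" using b t by blast
    qed
    with pr(2) show "bp H" unfolding bounded_predictable_def by blast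
    show "\<forall>n. bp (Hn n)" using pr(1) b unfolding bounded_predictable_def by blast
  qed
  show ?thesis unfolding integration_operator_def
    by (intro conjI allI impI; (elim conjE)?; (rule cad zero interval lin main; assumption))
qed

lemma op_indist:
  fixes X X' :: "('w, 'v::euclidean_space) process"
  assumes J: "op X J" and X: "indist M T X X'"
  shows "op X' J"
proof (rule opI)
  fix s t :: real and \<xi> :: "'w \<Rightarrow> 'v"
  assume as: "0 \<le> s" "s \<le> t" "t \<le> T" "\<xi> \<in> borel_measurable (F s)" "bounded (\<xi> ` space M)"
  from indist_trans[OF op_interval[OF J as] indist_stopped_increment[OF X]]
  show "indist M T (J (\<lambda>u \<omega>. indicat_real {s<..t} u *\<^sub>R \<xi> \<omega>)) (\<lambda>u \<omega>. \<xi> \<omega> \<bullet> (X' (min u t) \<omega> - X' (min u s) \<omega>))"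
    using as by simp
next
  fix Hn and H :: "('w, 'v) process" and c :: real
  assume "\<forall>n. bp (Hn n)" "bp H" "\<forall>n. \<forall>t\<in>{0..T}. \<forall>\<omega>\<in>space M. norm (Hn n t \<omega>) \<le> c"
      "\<forall>t\<in>{0..T}. \<forall>\<omega>\<in>space M. (\<lambda>n. Hn n t \<omega>) \<longlonglongrightarrow> H t \<omega>"
  then show "ucp_lim M T (\<lambda>n. J (Hn n)) (J H)" by (intro op_lim[OF J, where c=c]) blast+
qed (rule op_cadlag[OF J] op_zero[OF J] op_lin[OF J]; assumption)+

lemma op_combine:
  fixes X Y :: "('w, 'v::euclidean_space) process"
  assumes J: "op X J" and L: "op Y L"
  shows "op (\<lambda>u \<omega>. a *\<^sub>R X u \<omega> + b *\<^sub>R Y u \<omega>) (\<lambda>H u \<omega>. a * J H u \<omega> + b * L H u \<omega>)"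
proof (rule opI)
  fix H :: "('w, 'v) process" assume "bp H"
  then show "cadlag_adapted M F T (\<lambda>u \<omega>. a * J H u \<omega> + b * L H u \<omega>)"
    by (intro cadlag_adapted_add cadlag_adapted_scale op_cadlag[OF J] op_cadlag[OF L])
next
  fix \<xi> :: "'w \<Rightarrow> 'v" assume as: "\<xi> \<in> borel_measurable (F 0)" "bounded (\<xi> ` space M)"
  from indist_combine[OF op_zero[OF J as] op_zero[OF L as], where h="\<lambda>_ _ x y. a * x + b * y"]
  show "indist M T (\<lambda>u \<omega>. a * J (\<lambda>u \<omega>. indicat_real {0} u *\<^sub>R \<xi> \<omega>) u \<omega> + b * L (\<lambda>u \<omega>. indicat_real {0} u *\<^sub>R \<xi> \<omega>) u \<omega>) (\<lambda>u \<omega>. 0)"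
    by simp
next
  fix s t :: real and \<xi> :: "'w \<Rightarrow> 'v"
  let ?H = "\<lambda>u \<omega>. indicat_real {s<..t} u *\<^sub>R \<xi> \<omega>"
  assume as: "0 \<le> s" "s \<le> t" "t \<le> T" "\<xi> \<in> borel_measurable (F s)" "bounded (\<xi> ` space M)"
  have "(\<lambda>u \<omega>. a * (\<xi> \<omega> \<bullet> (X (min u t) \<omega> - X (min u s) \<omega>)) + b * (\<xi> \<omega> \<bullet> (Y (min u t) \<omega> - Y (min u s) \<omega>)))
    = (\<lambda>u \<omega>. \<xi> \<omega> \<bullet> ((a *\<^sub>R X (min u t) \<omega> + b *\<^sub>R Y (min u t) \<omega>) - (a *\<^sub>R X (min u s) \<omega> + b *\<^sub>R Y (min u s) \<omega>)))"
    by (simp add: fun_eq_iff inner_simps algebra_simps)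
  with indist_combine[OF op_interval[OF J as] op_interval[OF L as], where h="\<lambda>_ _ x y. a * x + b * y"]
  show "indist M T (\<lambda>u \<omega>. a * J ?H u \<omega> + b * L ?H u \<omega>)
    (\<lambda>u \<omega>. \<xi> \<omega> \<bullet> ((a *\<^sub>R X (min u t) \<omega> + b *\<^sub>R Y (min u t) \<omega>) - (a *\<^sub>R X (min u s) \<omega> + b *\<^sub>R Y (min u s) \<omega>)))"
    by simp
next
  fix H K :: "('w, 'v) process" and c d assume HK: "bp H" "bp K"
  from indist_combine[OF op_lin[OF J HK, of c d] op_lin[OF L HK, of c d], where h="\<lambda>_ _ x y. a * x + b * y"]
  show "indist M T (\<lambda>u \<omega>. a * J (\<lambda>u \<omega>. c *\<^sub>R H u \<omega> + d *\<^sub>R K u \<omega>) u \<omega> + b * L (\<lambda>u \<omega>. c *\<^sub>R H u \<omega> + d *\<^sub>R K u \<omega>) u \<omega>)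
    (\<lambda>u \<omega>. c * (a * J H u \<omega> + b * L H u \<omega>) + d * (a * J K u \<omega> + b * L K u \<omega>))"
    by (simp add: algebra_simps)
next
  fix Hn and H :: "('w, 'v) process" and c :: real
  assume as: "\<forall>n. bp (Hn n)" "bp H" "\<forall>n. \<forall>t\<in>{0..T}. \<forall>\<omega>\<in>space M. norm (Hn n t \<omega>) \<le> c"
      "\<forall>t\<in>{0..T}. \<forall>\<omega>\<in>space M. (\<lambda>n. Hn n t \<omega>) \<longlonglongrightarrow> H t \<omega>"
  have Hn: "bp (Hn n)" for n using as(1) by blast
  have "ucp_lim M T (\<lambda>n. J (Hn n)) (J H)" by (rule op_lim[OF J, where c=c]) (use as in blast)+
  moreover have "ucp_lim M T (\<lambda>n. L (Hn n)) (L H)" by (rule op_lim[OF L, where c=c]) (use as in blast)+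
  ultimately have "ucp0 (\<lambda>n u \<omega>. a * (J (Hn n) u \<omega> - J H u \<omega>) + b * (L (Hn n) u \<omega> - L H u \<omega>))"
    unfolding ucp_lim_ucp0
    by (intro ucp0_add ucp0_scale cadlag_adapted_scale cadlag_adapted_diff op_cadlag[OF J] op_cadlag[OF L] Hn as(2))
  then show "ucp_lim M T (\<lambda>n u \<omega>. a * J (Hn n) u \<omega> + b * L (Hn n) u \<omega>) (\<lambda>u \<omega>. a * J H u \<omega> + b * L H u \<omega>)"
    unfolding ucp_lim_ucp0 by (simp add: algebra_simps)
qed

text \<open>The sections of the generators at time 0 are members of \<open>F 0\<close> or empty. It
  is used in \<open>op_assoc\<close>, where a product concentrated at time 0 takes the value of
  \<open>H\<close> there.\<close>

lemma predictable_at_0: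
  assumes "predictable M F T H"
  shows "H 0 \<in> borel_measurable (F 0)"
proof -
  have "Pair 0 \<in> measurable (F 0) PS"
    unfolding predictable_sigma_def
  proof (rule measurable_measure_of)
    show "Pair 0 \<in> space (F 0) \<rightarrow> {0..T} \<times> space M" using T_pos by auto
    fix E assume "E \<in> {{0} \<times> A | A. A \<in> sets (F 0)} \<union>
      {{s<..t} \<times> A | s t A. 0 \<le> s \<and> s \<le> t \<and> t \<le> T \<and> A \<in> sets (F s)}"
    then show "Pair 0 -` E \<inter> space (F 0) \<in> sets (F 0)"
    proof
      assume "E \<in> {{0} \<times> A | A. A \<in> sets (F 0)}"
      then obtain A where A: "A \<in> sets (F 0)" "E = {0} \<times> A" by blast
      then have "Pair 0 -` E \<inter> space (F 0) = A" using sets_F_space by auto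
      then show ?thesis using A by simp
    next
      assume "E \<in> {{s<..t} \<times> A | s t A. 0 \<le> s \<and> s \<le> t \<and> t \<le> T \<and> A \<in> sets (F s)}"
      then have "Pair 0 -` E \<inter> space (F 0) = {}" by auto
      then show ?thesis by simp
    qed
  qed (use pred_gen_Pow in \<open>simp add: pred_gen_def\<close>)
  from measurable_comp[OF this assms[unfolded predictable_def]] show ?thesis by (simp add: comp_def)
qed

text \<open>Both sides are the increment over the intersection of the two intervals, stopped at
  \<open>u\<close>. The outer maximum in \<open>b\<close> makes the increment vanish when they are
  disjoint.\<close>

lemma min_interval_increment:
  fixes f :: "real \<Rightarrow> 'a::ab_group_add"
  assumes "s \<le> t" "s' \<le> t'"
  defines "a \<equiv> max s s'"
  defines "b \<equiv> max a (min t t')"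
  shows "f (min u b) - f (min u a) =
    (f (min (min u t) t') - f (min (min u t) s')) - (f (min (min u s) t') - f (min (min u s) s'))"
proof -
  consider "t \<le> s'" | "t' \<le> s" | "s' < t" "s < t'" by linarith
  then show ?thesis
  proof cases
    case 1
    then have "min (min u t) t' = min u t" "min (min u t) s' = min u t" "min (min u s) t' = min u s" "min (min u s) s' = min u s"
      using assms by auto
    moreover have "b = a" using 1 assms by auto
    ultimately show ?thesis by simp
  next
    case 2
    then have "min (min u t) t' = min u t'" "min (min u t) s' = min u s'" "min (min u s) t' = min u t'" "min (min u s) s' = min u s'"
      using assms by auto
    moreover have "b = a" using 2 assms by auto
    ultimately show ?thesis by simp
  next
    case 3
    then have b: "b = min t t'" using assms by auto
    show ?thesis
    proof (cases "s \<le> s'")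
      case True
      then have "a = s'" "min (min u t) s' = min u s'" "min (min u s) t' = min u s" "min (min u s) s' = min u s"
        using assms 3 by auto
      then show ?thesis using b by (simp add: min.assoc)
    next
      case False
      then have "a = s" "min (min u t) s' = min u s'" "min (min u s) t' = min u s" "min (min u s) s' = min u s'"
        using assms 3 by auto
      then show ?thesis using b by (simp add: min.assoc)
    qed
  qed
qed

lemma ucp_lim_stopped_increment:
  fixes Y :: "nat \<Rightarrow> ('w, real) process"
  assumes Y: "\<And>n. cadlag_adapted M F T (Y n)" "cadlag_adapted M F T Z" and lim: "ucp_lim M T Y Z"
    and st: "0 \<le> s" "s \<le> t" "t \<le> T" and \<xi>: "bounded (\<xi> ` space M)"
  shows "ucp_lim M T (\<lambda>n u \<omega>. \<xi> \<omega> * (Y n (min u t) \<omega> - Y n (min u s) \<omega>)) (\<lambda>u \<omega>. \<xi> \<omega> * (Z (min u t) \<omega> - Z (min u s) \<omega>))"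
proof -
  obtain c where c: "\<forall>\<omega>\<in>space M. \<bar>\<xi> \<omega>\<bar> \<le> c" using \<xi> unfolding bounded_iff by auto
  define d where "d = max c 1"
  show ?thesis
    unfolding ucp_lim_ucp0
  proof (rule ucp0_dominate[OF cadlag_adapted_diff[OF Y] lim[unfolded ucp_lim_ucp0], where C="2 * d"])
    show "2 * d > 0" unfolding d_def by simp
    show "AE \<omega> in M. \<forall>r. (\<forall>t\<in>{0..T}. \<bar>Y n t \<omega> - Z t \<omega>\<bar> \<le> r) \<longrightarrow>
      (\<forall>u\<in>{0..T}. \<bar>\<xi> \<omega> * (Y n (min u t) \<omega> - Y n (min u s) \<omega>) - \<xi> \<omega> * (Z (min u t) \<omega> - Z (min u s) \<omega>)\<bar> \<le> 2 * d * r)" for n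
    proof (rule AE_I2, intro allI impI ballI)
      fix \<omega> r u assume w: "\<omega> \<in> space M" and r: "\<forall>t\<in>{0..T}. \<bar>Y n t \<omega> - Z t \<omega>\<bar> \<le> r" and u: "u \<in> {0..T}"
      have 1: "\<bar>Y n (min u t) \<omega> - Z (min u t) \<omega>\<bar> \<le> r" "\<bar>Y n (min u s) \<omega> - Z (min u s) \<omega>\<bar> \<le> r"
        using r u st by auto
      have "\<bar>\<xi> \<omega>\<bar> \<le> d" using c w unfolding d_def by force
      then have "\<bar>\<xi> \<omega>\<bar> * \<bar>(Y n (min u t) \<omega> - Z (min u t) \<omega>) - (Y n (min u s) \<omega> - Z (min u s) \<omega>)\<bar> \<le> d * (2 * r)"
        using 1 by (intro mult_mono) linarith+
      then show "\<bar>\<xi> \<omega> * (Y n (min u t) \<omega> - Y n (min u s) \<omega>) - \<xi> \<omega> * (Z (min u t) \<omega> - Z (min u s) \<omega>)\<bar> \<le> 2 * d * r"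
        by (simp add: abs_mult[symmetric] algebra_simps)
    qed
qed
qed

text \<open>Associativity with an elementary factor, by induction on \<open>H\<close>. For an
  interval \<open>H\<close> the product is again supported on an interval, namely the intersection;
  if \<open>H\<close> is concentrated at time 0 the product vanishes.\<close>

lemma op_assoc_interval:
  fixes X :: "('w, 'v::euclidean_space) process" and \<xi> :: "'w \<Rightarrow> real"
  assumes J: "op X J" and H: "bp H" and st: "0 \<le> s" "s \<le> t" "t \<le> T"
    and \<xi>: "\<xi> \<in> borel_measurable (F s)" "bounded (\<xi> ` space M)"
  shows "indist M T (J (\<lambda>u \<omega>. (indicat_real {s<..t} u * \<xi> \<omega>) *\<^sub>R H u \<omega>)) (\<lambda>u \<omega>. \<xi> \<omega> * (J H (min u t) \<omega> - J H (min u s) \<omega>))"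
  using H
proof (induction H rule: bounded_predictable_induct)
  case (zero A v)
  have eq: "(indicat_real {s<..t} u * \<xi> \<omega>) *\<^sub>R indicat_real {0} u *\<^sub>R indicat_real A \<omega> *\<^sub>R v = 0" for u \<omega>
    using st by (auto simp: indicator_def)
  have "indist M T (J (\<lambda>u \<omega>. indicat_real {0} u *\<^sub>R indicat_real A \<omega> *\<^sub>R v)) (\<lambda>_ _. 0)"
    by (rule op_zero[OF J indicator_rv[OF zero]])
  from indist_stopped_increment[OF this, of s t \<xi>]
  have "indist M T (\<lambda>u \<omega>. \<xi> \<omega> * (J (\<lambda>u \<omega>. indicat_real {0} u *\<^sub>R indicat_real A \<omega> *\<^sub>R v) (min u t) \<omega>
    - J (\<lambda>u \<omega>. indicat_real {0} u *\<^sub>R indicat_real A \<omega> *\<^sub>R v) (min u s) \<omega>)) (\<lambda>_ _. 0)"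
    using st by simp
  from indist_trans[OF op_0[OF J] indist_sym[OF this]] show ?case unfolding eq .
next
  case (interval s' t' A v)
  note st' = interval(1-3)
  let ?H = "\<lambda>u \<omega>. indicat_real {s'<..t'} u *\<^sub>R indicat_real A \<omega> *\<^sub>R v"
  define a where "a = max s s'"
  define b where "b = max a (min t t')"
  have ab: "0 \<le> a" "a \<le> b" "b \<le> T" unfolding a_def b_def using st st' by auto
  have eq: "(\<lambda>u \<omega>. (indicat_real {s<..t} u * \<xi> \<omega>) *\<^sub>R ?H u \<omega>) = (\<lambda>u \<omega>. indicat_real {a<..b} u *\<^sub>R (\<xi> \<omega> *\<^sub>R indicat_real A \<omega> *\<^sub>R v))"
    unfolding a_def b_def using st st' by (auto simp: fun_eq_iff indicator_def)
  have m: "(\<lambda>\<omega>. \<xi> \<omega> *\<^sub>R indicat_real A \<omega> *\<^sub>R v) \<in> borel_measurable (F a)"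
  proof (intro borel_measurable_scaleR borel_measurable_indicator borel_measurable_const)
    show "\<xi> \<in> borel_measurable (F a)" using \<xi>(1) by (rule measurable_F_mono) (simp add: a_def)
    show "A \<in> sets (F a)" using interval(4) by (rule sets_F_mono[THEN subsetD, rotated]) (simp add: a_def)
  qed
  obtain c where c: "\<forall>\<omega>\<in>space M. \<bar>\<xi> \<omega>\<bar> \<le> c" using \<xi>(2) unfolding bounded_iff by auto
  have bd: "bounded ((\<lambda>\<omega>. \<xi> \<omega> *\<^sub>R indicat_real A \<omega> *\<^sub>R v) ` space M)"
    unfolding bounded_iff
  proof (intro exI[of _ "max c 0 * norm v"] ballI, elim imageE, simp only:)
    fix \<omega> assume "\<omega> \<in> space M"
    then have "\<bar>\<xi> \<omega>\<bar> * (\<bar>indicat_real A \<omega>\<bar> * norm v) \<le> max c 0 * (1 * norm v)"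
      using c by (intro mult_mono) (auto simp: indicator_def)
    then show "norm (\<xi> \<omega> *\<^sub>R indicat_real A \<omega> *\<^sub>R v) \<le> max c 0 * norm v" unfolding norm_scaleR by simp
  qed
  let ?v = "\<lambda>\<omega>. indicat_real A \<omega> *\<^sub>R v"
  have "indist M T (J ?H) (\<lambda>u \<omega>. ?v \<omega> \<bullet> (X (min u t') \<omega> - X (min u s') \<omega>))"
    by (rule op_interval[OF J st' indicator_rv[OF interval(4)]])
  from indist_stopped_increment[OF this, of s t \<xi>] st
  have 1: "indist M T (\<lambda>u \<omega>. \<xi> \<omega> * (J ?H (min u t) \<omega> - J ?H (min u s) \<omega>))
     (\<lambda>u \<omega>. \<xi> \<omega> * (?v \<omega> \<bullet> (X (min (min u t) t') \<omega> - X (min (min u t) s') \<omega>) - ?v \<omega> \<bullet> (X (min (min u s) t') \<omega> - X (min (min u s) s') \<omega>)))"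
    by simp
  have 2: "indist M T (J (\<lambda>u \<omega>. indicat_real {a<..b} u *\<^sub>R (\<xi> \<omega> *\<^sub>R ?v \<omega>))) (\<lambda>u \<omega>. (\<xi> \<omega> *\<^sub>R ?v \<omega>) \<bullet> (X (min u b) \<omega> - X (min u a) \<omega>))"
    by (rule op_interval[OF J ab m bd])
  have inn: "(c *\<^sub>R w) \<bullet> (x - y) = c * (w \<bullet> x - w \<bullet> y)" for c and w x y :: 'v
    by (simp add: inner_diff_right right_diff_distrib)
  have "X (min u b) \<omega> - X (min u a) \<omega> = (X (min (min u t) t') \<omega> - X (min (min u t) s') \<omega>) - (X (min (min u s) t') \<omega> - X (min (min u s) s') \<omega>)" for u \<omega>
    using min_interval_increment[OF st(2) st'(2), of "\<lambda>u. X u \<omega>" u] unfolding a_def b_def .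
  then have "(\<xi> \<omega> *\<^sub>R ?v \<omega>) \<bullet> (X (min u b) \<omega> - X (min u a) \<omega>) =
    \<xi> \<omega> * (?v \<omega> \<bullet> (X (min (min u t) t') \<omega> - X (min (min u t) s') \<omega>) - ?v \<omega> \<bullet> (X (min (min u s) t') \<omega> - X (min (min u s) s') \<omega>))" for u \<omega>
    by (simp only: inn)
  from 2[unfolded this] indist_sym[OF 1] show ?case unfolding eq by (rule indist_trans)
next
  case (lin H K a b)
  let ?I = "\<lambda>u \<omega>. indicat_real {s<..t} u * \<xi> \<omega>"
  have I: "bp ?I" using bp_interval[OF st \<xi>] by simp
  have "indist M T (\<lambda>u \<omega>. a * J (\<lambda>u \<omega>. ?I u \<omega> *\<^sub>R H u \<omega>) u \<omega> + b * J (\<lambda>u \<omega>. ?I u \<omega> *\<^sub>R K u \<omega>) u \<omega>)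
    (\<lambda>u \<omega>. a * (\<xi> \<omega> * (J H (min u t) \<omega> - J H (min u s) \<omega>)) + b * (\<xi> \<omega> * (J K (min u t) \<omega> - J K (min u s) \<omega>)))"
    by (rule indist_combine[OF lin(3,4), where h="\<lambda>_ _ x y. a * x + b * y"])
  from indist_trans[OF op_lin[OF J bp_scaleR[OF I lin(1)] bp_scaleR[OF I lin(2)]] this]
  have 1: "indist M T (J (\<lambda>u \<omega>. ?I u \<omega> *\<^sub>R (a *\<^sub>R H u \<omega> + b *\<^sub>R K u \<omega>)))
    (\<lambda>u \<omega>. a * (\<xi> \<omega> * (J H (min u t) \<omega> - J H (min u s) \<omega>)) + b * (\<xi> \<omega> * (J K (min u t) \<omega> - J K (min u s) \<omega>)))"
    by (simp add: scaleR_right_distrib mult.commute)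
  have 2: "indist M T (\<lambda>u \<omega>. \<xi> \<omega> * (J (\<lambda>u \<omega>. a *\<^sub>R H u \<omega> + b *\<^sub>R K u \<omega>) (min u t) \<omega> - J (\<lambda>u \<omega>. a *\<^sub>R H u \<omega> + b *\<^sub>R K u \<omega>) (min u s) \<omega>))
     (\<lambda>u \<omega>. a * (\<xi> \<omega> * (J H (min u t) \<omega> - J H (min u s) \<omega>)) + b * (\<xi> \<omega> * (J K (min u t) \<omega> - J K (min u s) \<omega>)))"
    using indist_stopped_increment[OF op_lin[OF J lin(1,2), of a b], of s t \<xi>] st by (simp add: algebra_simps)
  from indist_trans[OF 1 indist_sym[OF 2]] show ?case .
next
  case (lim Hn H c)
  let ?I = "\<lambda>u \<omega>. indicat_real {s<..t} u * \<xi> \<omega>"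
  have I: "bp ?I" using bp_interval[OF st \<xi>] by simp
  have bps: "\<And>n. bp (Hn n)" "bp H" by (rule lim)+
  have b: "norm (Hn n t \<omega>) \<le> c" if "t \<in> {0..T}" "\<omega> \<in> space M" for n t \<omega> using that by (rule lim)
  have l: "(\<lambda>n. Hn n t \<omega>) \<longlonglongrightarrow> H t \<omega>" if "t \<in> {0..T}" "\<omega> \<in> space M" for t \<omega> using that by (rule lim)
  obtain d where d: "0 \<le> d" "\<forall>t\<in>{0..T}. \<forall>\<omega>\<in>space M. norm (?I t \<omega>) \<le> d" by (rule bpE[OF I])
  have bI: "\<And>n. bp (\<lambda>u \<omega>. ?I u \<omega> *\<^sub>R Hn n u \<omega>)" "bp (\<lambda>u \<omega>. ?I u \<omega> *\<^sub>R H u \<omega>)" by (intro bp_scaleR I bps)+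
  have 1: "ucp_lim M T (\<lambda>n. J (\<lambda>u \<omega>. ?I u \<omega> *\<^sub>R Hn n u \<omega>)) (J (\<lambda>u \<omega>. ?I u \<omega> *\<^sub>R H u \<omega>))"
  proof (rule op_lim[OF J bI])
    fix n u \<omega> assume u: "u \<in> {0..T}" "\<omega> \<in> space M"
    show "norm (?I u \<omega> *\<^sub>R Hn n u \<omega>) \<le> d * c"
      unfolding norm_scaleR using d u b[OF u] by (intro mult_mono) auto
    show "(\<lambda>n. ?I u \<omega> *\<^sub>R Hn n u \<omega>) \<longlonglongrightarrow> ?I u \<omega> *\<^sub>R H u \<omega>" by (intro tendsto_scaleR tendsto_const l u)
  qed
  have "ucp_lim M T (\<lambda>n. J (Hn n)) (J H)" by (rule op_lim[OF J bps b l])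
  from ucp_lim_stopped_increment[OF op_cadlag[OF J bps(1)] op_cadlag[OF J bps(2)] this st \<xi>(2)]
  have 2: "ucp_lim M T (\<lambda>n u \<omega>. \<xi> \<omega> * (J (Hn n) (min u t) \<omega> - J (Hn n) (min u s) \<omega>)) (\<lambda>u \<omega>. \<xi> \<omega> * (J H (min u t) \<omega> - J H (min u s) \<omega>))" .
  have IH: "indist M T (J (\<lambda>u \<omega>. ?I u \<omega> *\<^sub>R Hn n u \<omega>)) (\<lambda>u \<omega>. \<xi> \<omega> * (J (Hn n) (min u t) \<omega> - J (Hn n) (min u s) \<omega>))" for n
    by (rule lim)
  have ci: "cadlag_adapted M F T (\<lambda>u \<omega>. \<xi> \<omega> * (J K (min u t) \<omega> - J K (min u s) \<omega>))" if "bp K" for K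
    using cadlag_adapted_stopped_increment[OF op_cadlag[OF J that] st \<xi>(1)] by simp
  have "ucp_lim M T (\<lambda>n. J (\<lambda>u \<omega>. ?I u \<omega> *\<^sub>R Hn n u \<omega>)) (\<lambda>u \<omega>. \<xi> \<omega> * (J H (min u t) \<omega> - J H (min u s) \<omega>))"
    by (rule ucp_lim_cong[OF ci[OF bps(1)] ci[OF bps(2)] 2 indist_sym[OF IH] indist_refl])
  from ucp_lim_unique[OF op_cadlag[OF J bI(1)] op_cadlag[OF J bI(2)] ci[OF bps(2)] 1 this]
  show ?case .
qed

text \<open>Integrating \<open>K\<close> against \<open>J H\<close> means integrating the product
  against \<open>X\<close>. Exhibiting the latter as an operator for \<open>J H\<close> proves this
  through \<open>op_unique\<close>; the clause for intervals is
  \<open>op_assoc_interval\<close>.\<close>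

lemma op_assoc:
  fixes X :: "('w, 'v::euclidean_space) process"
  assumes J: "op X J" and H: "bp H"
  shows "op (J H) (\<lambda>K. J (\<lambda>u \<omega>. K u \<omega> *\<^sub>R H u \<omega>))"
proof (rule opI)
  fix K :: "('w, real) process" assume "bp K"
  then show "cadlag_adapted M F T (J (\<lambda>u \<omega>. K u \<omega> *\<^sub>R H u \<omega>))" by (intro op_cadlag[OF J] bp_scaleR H)
next
  fix \<xi> :: "'w \<Rightarrow> real" assume \<xi>: "\<xi> \<in> borel_measurable (F 0)" "bounded (\<xi> ` space M)"
  have eq: "(\<lambda>u \<omega>. (indicat_real {0} u *\<^sub>R \<xi> \<omega>) *\<^sub>R H u \<omega>) = (\<lambda>u \<omega>. indicat_real {0} u *\<^sub>R (\<xi> \<omega> *\<^sub>R H 0 \<omega>))"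
    by (auto simp: fun_eq_iff indicator_def)
  obtain c where c: "\<forall>\<omega>\<in>space M. \<bar>\<xi> \<omega>\<bar> \<le> c" using \<xi>(2) unfolding bounded_iff by auto
  obtain d where d: "0 \<le> d" "\<forall>t\<in>{0..T}. \<forall>\<omega>\<in>space M. norm (H t \<omega>) \<le> d" by (rule bpE[OF H])
  have "norm (\<xi> \<omega> *\<^sub>R H 0 \<omega>) \<le> c * d" if "\<omega> \<in> space M" for \<omega>
    unfolding norm_scaleR using c d T_pos that by (intro mult_mono) (auto intro: order_trans[OF abs_ge_zero])
  then have "bounded ((\<lambda>\<omega>. \<xi> \<omega> *\<^sub>R H 0 \<omega>) ` space M)" unfolding bounded_iff by blast
  from op_zero[OF J _ this] show "indist M T (J (\<lambda>u \<omega>. (indicat_real {0} u *\<^sub>R \<xi> \<omega>) *\<^sub>R H u \<omega>)) (\<lambda>u \<omega>. 0)"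
    unfolding eq using \<xi>(1) predictable_at_0[OF bp_predictable[OF H]] by simp
next
  fix s t :: real and \<xi> :: "'w \<Rightarrow> real"
  assume as: "0 \<le> s" "s \<le> t" "t \<le> T" "\<xi> \<in> borel_measurable (F s)" "bounded (\<xi> ` space M)"
  from op_assoc_interval[OF J H as]
  show "indist M T (J (\<lambda>u \<omega>. (indicat_real {s<..t} u *\<^sub>R \<xi> \<omega>) *\<^sub>R H u \<omega>)) (\<lambda>u \<omega>. \<xi> \<omega> \<bullet> (J H (min u t) \<omega> - J H (min u s) \<omega>))"
    by simp
next
  fix K L :: "('w, real) process" and a b assume "bp K" "bp L"
  from op_lin[OF J bp_scaleR[OF this(1) H] bp_scaleR[OF this(2) H], of a b]
  show "indist M T (J (\<lambda>u \<omega>. (a *\<^sub>R K u \<omega> + b *\<^sub>R L u \<omega>) *\<^sub>R H u \<omega>))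
    (\<lambda>u \<omega>. a * J (\<lambda>u \<omega>. K u \<omega> *\<^sub>R H u \<omega>) u \<omega> + b * J (\<lambda>u \<omega>. L u \<omega> *\<^sub>R H u \<omega>) u \<omega>)"
    by (simp add: scaleR_left_distrib)
next
  fix Kn and K :: "('w, real) process" and c :: real
  assume as: "\<forall>n. bp (Kn n)" "bp K" "\<forall>n. \<forall>t\<in>{0..T}. \<forall>\<omega>\<in>space M. norm (Kn n t \<omega>) \<le> c"
      "\<forall>t\<in>{0..T}. \<forall>\<omega>\<in>space M. (\<lambda>n. Kn n t \<omega>) \<longlonglongrightarrow> K t \<omega>"
  obtain d where d: "0 \<le> d" "\<forall>t\<in>{0..T}. \<forall>\<omega>\<in>space M. norm (H t \<omega>) \<le> d" by (rule bpE[OF H])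
  show "ucp_lim M T (\<lambda>n. J (\<lambda>u \<omega>. Kn n u \<omega> *\<^sub>R H u \<omega>)) (J (\<lambda>u \<omega>. K u \<omega> *\<^sub>R H u \<omega>))"
  proof (rule op_lim[OF J])
    show "bp (\<lambda>u \<omega>. Kn n u \<omega> *\<^sub>R H u \<omega>)" for n using as(1) by (intro bp_scaleR H) blast
    show "bp (\<lambda>u \<omega>. K u \<omega> *\<^sub>R H u \<omega>)" by (intro bp_scaleR H as(2))
    fix t \<omega> assume t: "t \<in> {0..T}" "\<omega> \<in> space M"
    have "norm (Kn n t \<omega>) \<le> c" for n using as(3) t by blast
    then show "norm (Kn n t \<omega> *\<^sub>R H t \<omega>) \<le> c * d" for n
      unfolding norm_scaleR using d t by (intro mult_mono) (auto intro: order_trans[OF abs_ge_zero])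
    show "(\<lambda>n. Kn n t \<omega> *\<^sub>R H t \<omega>) \<longlonglongrightarrow> K t \<omega> *\<^sub>R H t \<omega>"
      using as(4) t by (intro tendsto_scaleR tendsto_const) blast
  qed
qed

section \<open>Jumps of integrals\<close>

lemma indist_jump:
  assumes "indist M T X Y"
  shows "AE \<omega> in M. \<forall>t\<in>{0..T}. jump X t \<omega> = jump Y t \<omega>"
  using assms unfolding indist_def
proof eventually_elim
  case (elim \<omega>)
  show ?case
  proof
    fix t assume t: "t \<in> {0..T}"
    have "left_limit (\<lambda>s. X s \<omega>) t = left_limit (\<lambda>s. Y s \<omega>) t"
      by (rule left_limit_cong[OF _ t]) (use elim in blast)
    then show "jump X t \<omega> = jump Y t \<omega>" unfolding jump_eq path_jump_def using elim t by simp
  qed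
qed

lemma jump_stopped_increment:
  fixes X :: "('w, 'v::euclidean_space) process"
  assumes X: "cadlag_adapted M F T X" and st: "0 \<le> s" "s \<le> t" "t \<le> T" and u: "u \<in> {0..T}" and w: "\<omega> \<in> space M"
  shows "jump (\<lambda>u \<omega>. v \<omega> \<bullet> (X (min u t) \<omega> - X (min u s) \<omega>)) u \<omega> = (indicat_real {s<..t} u *\<^sub>R v \<omega>) \<bullet> jump X u \<omega>"
proof -
  define f where "f = (\<lambda>u. X u \<omega>)"
  have f: "cadlag_path T f" unfolding f_def by (rule cadlag_adaptedD(1)[OF X w])
  have c: "cadlag_path T (\<lambda>u. f (min u t))" "cadlag_path T (\<lambda>u. f (min u s))"
    using left_limit_min(1)[OF f] st by auto
  have "left_limit (\<lambda>u. v \<omega> \<bullet> (fst (f (min u t), f (min u s)) - snd (f (min u t), f (min u s)))) u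
     = v \<omega> \<bullet> (fst (left_limit (\<lambda>u. (f (min u t), f (min u s))) u) - snd (left_limit (\<lambda>u. (f (min u t), f (min u s))) u))"
    using u by (intro left_limit_compose[OF cadlag_path_Pair[OF c], where h="\<lambda>x. v \<omega> \<bullet> (fst x - snd x)"] isCont_inner isCont_diff isCont_fst isCont_snd) auto
  then have "left_limit (\<lambda>u. v \<omega> \<bullet> (f (min u t) - f (min u s))) u = v \<omega> \<bullet> ((if u \<le> t then left_limit f u else f t) - (if u \<le> s then left_limit f u else f s))"
    using left_limit_Pair[OF c] left_limit_min(2)[OF f] u st by simp
  then show ?thesis
    unfolding jump_eq path_jump_def f_def using st by (auto simp: inner_simps min_def indicator_def)
qed

text \<open>In the limit step, convergence in probability gives a subsequence converging uniformly
  on almost every path, and \<open>cadlag_uniform_limit\<close> carries the left limits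
  along.\<close>

lemma op_jump:
  fixes X :: "('w, 'v::euclidean_space) process"
  assumes J: "op X J" and X: "cadlag_adapted M F T X" and H: "bp H"
  shows "AE \<omega> in M. \<forall>t\<in>{0..T}. jump (J H) t \<omega> = H t \<omega> \<bullet> jump X t \<omega>"
  using H
proof (induction H rule: bounded_predictable_induct)
  case (zero A v)
  show ?case
    using indist_jump[OF op_zero[OF J indicator_rv[OF zero], of v]]
  proof eventually_elim
    case (elim \<omega>)
    show ?case
    proof
      fix t assume "t \<in> {0..T}"
      moreover have "jump (\<lambda>_ _. 0 :: real) t \<omega> = 0" unfolding jump_eq using \<open>t \<in> {0..T}\<close> by (intro path_jump_continuous[where T=T]) auto
      moreover have "(indicat_real {0} t *\<^sub>R indicat_real A \<omega> *\<^sub>R v) \<bullet> jump X t \<omega> = 0"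
        by (cases "t = 0") (auto simp: jump_eq)
      ultimately show "jump (J (\<lambda>u \<omega>. indicat_real {0} u *\<^sub>R indicat_real A \<omega> *\<^sub>R v)) t \<omega> = (indicat_real {0} t *\<^sub>R indicat_real A \<omega> *\<^sub>R v) \<bullet> jump X t \<omega>"
        using elim by simp
    qed
  qed
next
  case (interval s t A v)
  note st = interval(1-3)
  show ?case
    using indist_jump[OF op_interval[OF J st indicator_rv[OF interval(4), of v]]] AE_space
  proof eventually_elim
    case (elim \<omega>)
    then show ?case using jump_stopped_increment[OF X st _ elim(2), of _ "\<lambda>\<omega>. indicat_real A \<omega> *\<^sub>R v"] by auto
  qed
next
  case (lin H K a b)
  show ?case
    using indist_jump[OF op_lin[OF J lin(1,2), of a b]] lin(3,4) AE_space
  proof eventually_elim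
    case (elim \<omega>)
    show ?case
    proof
      fix t assume t: "t \<in> {0..T}"
      have "cadlag_path T (\<lambda>u. J H u \<omega>)" "cadlag_path T (\<lambda>u. J K u \<omega>)"
        using cadlag_adaptedD(1)[OF op_cadlag[OF J]] lin(1,2) elim(4) by auto
      then have "jump (\<lambda>u \<omega>. a * J H u \<omega> + b * J K u \<omega>) t \<omega> = a * jump (J H) t \<omega> + b * jump (J K) t \<omega>"
        unfolding jump_eq using t by (intro path_jump_lincomb) auto
      then show "jump (J (\<lambda>u \<omega>. a *\<^sub>R H u \<omega> + b *\<^sub>R K u \<omega>)) t \<omega> = (a *\<^sub>R H t \<omega> + b *\<^sub>R K t \<omega>) \<bullet> jump X t \<omega>"
        using elim t by (simp add: inner_simps)
    qed
  qed
next
  case (lim Hn H c)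
  have bps: "\<And>n. bp (Hn n)" "bp H" by (rule lim)+
  have b: "norm (Hn n t \<omega>) \<le> c" if "t \<in> {0..T}" "\<omega> \<in> space M" for n t \<omega> using that by (rule lim)
  have l: "(\<lambda>n. Hn n t \<omega>) \<longlonglongrightarrow> H t \<omega>" if "t \<in> {0..T}" "\<omega> \<in> space M" for t \<omega> using that by (rule lim)
  have IH: "AE \<omega> in M. \<forall>t\<in>{0..T}. jump (J (Hn n)) t \<omega> = Hn n t \<omega> \<bullet> jump X t \<omega>" for n by (rule lim)
  have "ucp_lim M T (\<lambda>n. J (Hn n)) (J H)" by (rule op_lim[OF J bps b l])
  then have u: "ucp0 (\<lambda>n t \<omega>. J (Hn n) t \<omega> - J H t \<omega>)" unfolding ucp_lim_ucp0 .
  obtain r :: "nat \<Rightarrow> nat" where r: "strict_mono r"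
    "AE \<omega> in M. uniform_limit {0..T} (\<lambda>n t. J (Hn (r n)) t \<omega> - J H t \<omega>) (\<lambda>_. 0) sequentially"
    by (rule ucp0_subseq_uniform[OF cadlag_adapted_diff[OF op_cadlag[OF J bps(1)] op_cadlag[OF J bps(2)]] u])
  have IH': "AE \<omega> in M. \<forall>n. \<forall>t\<in>{0..T}. jump (J (Hn n)) t \<omega> = Hn n t \<omega> \<bullet> jump X t \<omega>"
    by (rule AE_all_countable[THEN iffD2]) (intro allI IH)
  show ?case
    using r(2) IH' AE_space
  proof eventually_elim
    case (elim \<omega>)
    have cp: "cadlag_path T (\<lambda>t. J (Hn n) t \<omega>)" for n by (rule cadlag_adaptedD(1)[OF op_cadlag[OF J bps(1)] elim(3)])
    have ul: "uniform_limit {0..T} (\<lambda>n t. J (Hn (r n)) t \<omega>) (\<lambda>t. J H t \<omega>) sequentially"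
      using elim(1) unfolding uniform_limit_iff by (simp add: dist_real_def)
    show ?case
    proof
      fix t assume t: "t \<in> {0..T}"
      have 1: "(\<lambda>n. J (Hn (r n)) t \<omega>) \<longlonglongrightarrow> J H t \<omega>" by (rule tendsto_uniform_limitI[OF ul t])
      have 2: "(\<lambda>n. left_limit (\<lambda>t. J (Hn (r n)) t \<omega>) t) \<longlonglongrightarrow> left_limit (\<lambda>t. J H t \<omega>) t"
        by (rule cadlag_uniform_limit(2)[OF cp ul t])
      have "(\<lambda>n. jump (J (Hn (r n))) t \<omega>) \<longlonglongrightarrow> jump (J H) t \<omega>"
        unfolding jump_eq path_jump_def by (rule tendsto_diff[OF 1 2])
      then have 3: "(\<lambda>n. Hn (r n) t \<omega> \<bullet> jump X t \<omega>) \<longlonglongrightarrow> jump (J H) t \<omega>" using elim(2) t by simp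
      have "(\<lambda>n. Hn (r n) t \<omega>) \<longlonglongrightarrow> H t \<omega>"
        using LIMSEQ_subseq_LIMSEQ[OF l[OF t elim(3)] r(1)] by (simp add: comp_def)
      then have "(\<lambda>n. Hn (r n) t \<omega> \<bullet> jump X t \<omega>) \<longlonglongrightarrow> H t \<omega> \<bullet> jump X t \<omega>" by (intro tendsto_inner tendsto_const)
      from LIMSEQ_unique[OF 3 this] show "jump (J H) t \<omega> = H t \<omega> \<bullet> jump X t \<omega>" .
    qed
  qed
qed

end

section \<open>Unbounded integrands\<close>

context stoch_basis
begin

text \<open>The truncation in \<open>has_stoch_integral\<close>, written as a bounded predictable
  multiplier so that it commutes with other multipliers.\<close>

definition level_ind :: "('w, 'v::euclidean_space) process \<Rightarrow> nat \<Rightarrow> ('w, real) process" where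
  "level_ind H m u \<omega> = (if norm (H u \<omega>) \<le> real m then 1 else 0)"

lemma level_ind_bp:
  fixes H :: "('w, 'v::euclidean_space) process"
  assumes "predictable M F T H"
  shows "bp (level_ind H m)"
proof (rule bpI[where c=1])
  have "(\<lambda>x::'v. if norm x \<le> real m then 1 else 0 :: real) \<in> borel_measurable borel" by measurable
  from predictable_compose[OF assms this] show "predictable M F T (level_ind H m)"
    by (simp add: level_ind_def[abs_def])
qed (simp add: level_ind_def)

lemma level_ind_bp_mult:
  fixes H :: "('w, 'v::euclidean_space) process" and K :: "('w, real) process"
  assumes "predictable M F T H" "bp K"
  shows "bp (\<lambda>u \<omega>. level_ind H m u \<omega> * K u \<omega>)"
  using bp_scaleR[OF level_ind_bp[OF assms(1)] assms(2)] by simp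

lemma level_ind_scaleR: "level_ind H m u \<omega> *\<^sub>R H u \<omega> = (if norm (H u \<omega>) \<le> real m then H u \<omega> else 0)"
  by (simp add: level_ind_def)

lemma level_ind_bound: "norm (level_ind H m u \<omega> *\<^sub>R x) \<le> norm x"
  by (simp add: level_ind_def)

lemma level_ind_tendsto: "(\<lambda>m. level_ind H m u \<omega>) \<longlonglongrightarrow> 1"
proof (rule tendsto_eventually)
  obtain m :: nat where "norm (H u \<omega>) \<le> real m" using real_arch_simple by blast
  then show "\<forall>\<^sub>F n in sequentially. level_ind H n u \<omega> = 1"
    unfolding eventually_sequentially level_ind_def by (intro exI[of _ m]) auto
qed

lemma level_ind_tendsto_scaleR:
  fixes x :: "'a::real_normed_vector"
  shows "(\<lambda>m. level_ind H m u \<omega> *\<^sub>R x) \<longlonglongrightarrow> x"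
  using tendsto_scaleR[OF level_ind_tendsto tendsto_const, of H u \<omega> x] by simp

lemma level_ind_bp_scaleR:
  fixes H :: "('w, 'v::euclidean_space) process"
  assumes "predictable M F T H"
  shows "bp (\<lambda>u \<omega>. level_ind H m u \<omega> *\<^sub>R H u \<omega>)"
proof (rule bpI[where c="real m"])
  show "predictable M F T (\<lambda>u \<omega>. level_ind H m u \<omega> *\<^sub>R H u \<omega>)"
    by (rule predictable_scaleR[OF bp_predictable[OF level_ind_bp[OF assms]] assms])
qed (simp add: level_ind_def)

lemma op_level_tendsto:
  fixes X :: "('w, 'v::euclidean_space) process" and H :: "('w, 'u::euclidean_space) process"
  assumes J: "op X J" and H: "predictable M F T H" and K: "bp K"
  shows "ucp_lim M T (\<lambda>m. J (\<lambda>u \<omega>. level_ind H m u \<omega> *\<^sub>R K u \<omega>)) (J K)"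
proof -
  obtain c where c: "0 \<le> c" "\<forall>t\<in>{0..T}. \<forall>\<omega>\<in>space M. norm (K t \<omega>) \<le> c" by (rule bpE[OF K])
  show ?thesis
  proof (rule op_lim[OF J bp_scaleR[OF level_ind_bp[OF H] K] K])
    fix n t \<omega> assume "t \<in> {0..T}" "\<omega> \<in> space M"
    then show "norm (level_ind H n t \<omega> *\<^sub>R K t \<omega>) \<le> c"
      using level_ind_bound[of H n t \<omega> "K t \<omega>"] c(2) by (meson order_trans)
  qed (rule level_ind_tendsto_scaleR)
qed

lemma op_scale:
  assumes J: "op X J" and H: "bp H"
  shows "indist M T (J (\<lambda>u \<omega>. c *\<^sub>R H u \<omega>)) (\<lambda>u \<omega>. c * J H u \<omega>)"
  using op_lin[OF J H H, of c 0] by simp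

lemma op_diff:
  fixes X Y :: "('w, 'v::euclidean_space) process"
  assumes "op X J" "op Y L"
  shows "op (\<lambda>u \<omega>. X u \<omega> - Y u \<omega>) (\<lambda>H u \<omega>. J H u \<omega> - L H u \<omega>)"
  using op_combine[OF assms, of 1 "-1"] by simp

lemma op_add:
  fixes X Y :: "('w, 'v::euclidean_space) process"
  assumes "op X J" "op Y L"
  shows "op (\<lambda>u \<omega>. X u \<omega> + Y u \<omega>) (\<lambda>H u \<omega>. J H u \<omega> + L H u \<omega>)"
  using op_combine[OF assms, of 1 1] by simp

lemma sup_prob_cong:
  assumes Y: "cadlag_adapted M F T (Y :: ('w, real) process)" and "indist M T Y W"
  shows "sup_prob W e \<le> sup_prob Y e"
  by (rule sup_prob_le[OF Y]) (use assms(2) in \<open>auto simp: indist_def elim!: eventually_mono\<close>)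

text \<open>Each truncated integral in the definition comes with an operator of its own.
  \<open>op_unique\<close> lets one \<open>J\<close> serve them all, and \<open>op_assoc\<close>
  rewrites integrals against \<open>Zn n\<close> as integrals against \<open>X\<close>.\<close>

lemma has_stoch_integral_estimate:
  fixes X :: "('w, 'v::euclidean_space) process"
  assumes I: "has_stoch_integral M F T H X Z"
  obtains J JZ where "op X J" "op Z JZ"
    "\<forall>\<epsilon>>0. \<exists>n0. \<forall>n\<ge>n0. \<forall>K. bp K \<and> (\<forall>t\<in>{0..T}. \<forall>\<omega>\<in>space M. \<bar>K t \<omega>\<bar> \<le> 1) \<longrightarrow>
      sup_prob (\<lambda>t \<omega>. JZ K t \<omega> - J (\<lambda>u \<omega>. K u \<omega> *\<^sub>R level_ind H n u \<omega> *\<^sub>R H u \<omega>) t \<omega>) \<epsilon> \<le> \<epsilon>"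
proof -
  define N where "N n = (\<lambda>u \<omega>. level_ind H n u \<omega> *\<^sub>R H u \<omega>)" for n
  have H: "predictable M F T H" using I by (simp add: has_stoch_integral_def)
  have bpN: "bp (N n)" for n unfolding N_def by (rule level_ind_bp_scaleR[OF H])
  obtain Zn where Zn: "\<forall>n. bounded_stoch_integral M F T (N n) X (Zn n)" and em: "emery_lim M F T Zn Z"
    using I unfolding has_stoch_integral_def N_def level_ind_scaleR by blast
  obtain J where J: "op X J" using Zn unfolding bounded_stoch_integral_def by blast
  have ZnJ: "indist M T (J (N n)) (Zn n)" for n
  proof -
    obtain J' where J': "op X J'" "indist M T (Zn n) (J' (N n))"
      using Zn unfolding bounded_stoch_integral_def by blast
    have "indist M T (J (N n)) (J' (N n))" by (rule op_unique[OF J J'(1) indist_refl bpN])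
    then show ?thesis using J'(2) indist_trans indist_sym by blast
  qed
  define L where "L n = (\<lambda>K::('w, real) process. J (\<lambda>u \<omega>. K u \<omega> *\<^sub>R N n u \<omega>))" for n
  have L: "op (Zn n) (L n)" for n unfolding L_def by (rule op_indist[OF op_assoc[OF J bpN] ZnJ])
  have em': "\<exists>n0. \<forall>n\<ge>n0. \<forall>K. bp K \<and> (\<forall>t\<in>{0..T}. \<forall>\<omega>\<in>space M. \<bar>K t \<omega>\<bar> \<le> 1) \<longrightarrow>
     (\<exists>J'. op (\<lambda>t \<omega>. Z t \<omega> - Zn n t \<omega>) J' \<and> sup_prob (J' K) \<epsilon> \<le> \<epsilon>)" if e: "\<epsilon> > 0" for \<epsilon>
  proof -
    obtain n0 where n0: "\<forall>n\<ge>n0. \<forall>K::('w, real) process.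
        predictable M F T K \<and> (\<forall>t\<in>{0..T}. \<forall>\<omega>\<in>space M. \<bar>K t \<omega>\<bar> \<le> 1) \<longrightarrow>
        (\<exists>D. bounded_stoch_integral M F T K (\<lambda>t \<omega>. Z t \<omega> - Zn n t \<omega>) D \<and>
             measure M {\<omega>\<in>space M. \<exists>t\<in>{0..T}. \<bar>D t \<omega>\<bar> > \<epsilon>} \<le> \<epsilon>)"
      using em e unfolding emery_lim_def by blast
    show ?thesis
    proof (intro exI[of _ n0] allI impI)
      fix n and K :: "('w, real) process"
      assume n: "n0 \<le> n" and K: "bp K \<and> (\<forall>t\<in>{0..T}. \<forall>\<omega>\<in>space M. \<bar>K t \<omega>\<bar> \<le> 1)"
      then obtain D where D: "bounded_stoch_integral M F T K (\<lambda>t \<omega>. Z t \<omega> - Zn n t \<omega>) D" "sup_prob D \<epsilon> \<le> \<epsilon>"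
        using n0 bp_predictable[of K] unfolding sup_prob_def by blast
      then obtain J' where J': "op (\<lambda>t \<omega>. Z t \<omega> - Zn n t \<omega>) J'" "indist M T D (J' K)" and Dc: "cadlag_adapted M F T D"
        unfolding bounded_stoch_integral_def by blast
      have "sup_prob (J' K) \<epsilon> \<le> sup_prob D \<epsilon>" by (rule sup_prob_cong[OF Dc J'(2)])
      then show "\<exists>J'. op (\<lambda>t \<omega>. Z t \<omega> - Zn n t \<omega>) J' \<and> sup_prob (J' K) \<epsilon> \<le> \<epsilon>" using D(2) J'(1) by force
    qed
  qed
  \<comment> \<open>Emery convergence at level 1, tested with the integrand 0, already yields an
    operator for \<open>Z - Zn n1\<close>; adding the one for \<open>Zn n1\<close> gives an operator
    for \<open>Z\<close>.\<close>
  obtain n1 J1 where J1: "op (\<lambda>t \<omega>. Z t \<omega> - Zn n1 t \<omega>) J1"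
    using em'[of 1] bp_const[of 0] by fastforce
  define JZ where "JZ K = (\<lambda>u \<omega>. J1 K u \<omega> + L n1 K u \<omega>)" for K
  have JZ: "op Z JZ" using op_add[OF J1 L[of n1]] unfolding JZ_def[abs_def] by simp
  show ?thesis
  proof (rule that[OF J JZ], intro allI impI)
    fix \<epsilon> :: real assume "0 < \<epsilon>"
    from em'[OF this] obtain n0 where n0: "\<forall>n\<ge>n0. \<forall>K. bp K \<and> (\<forall>t\<in>{0..T}. \<forall>\<omega>\<in>space M. \<bar>K t \<omega>\<bar> \<le> 1) \<longrightarrow>
     (\<exists>J'. op (\<lambda>t \<omega>. Z t \<omega> - Zn n t \<omega>) J' \<and> sup_prob (J' K) \<epsilon> \<le> \<epsilon>)" by (rule exE)
    show "\<exists>n0. \<forall>n\<ge>n0. \<forall>K. bp K \<and> (\<forall>t\<in>{0..T}. \<forall>\<omega>\<in>space M. \<bar>K t \<omega>\<bar> \<le> 1) \<longrightarrow>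
      sup_prob (\<lambda>t \<omega>. JZ K t \<omega> - J (\<lambda>u \<omega>. K u \<omega> *\<^sub>R level_ind H n u \<omega> *\<^sub>R H u \<omega>) t \<omega>) \<epsilon> \<le> \<epsilon>"
    proof (intro exI[of _ n0] allI impI)
      fix n and K :: "('w, real) process"
      assume n: "n0 \<le> n" and K: "bp K \<and> (\<forall>t\<in>{0..T}. \<forall>\<omega>\<in>space M. \<bar>K t \<omega>\<bar> \<le> 1)"
      then obtain J' where J': "op (\<lambda>t \<omega>. Z t \<omega> - Zn n t \<omega>) J'" "sup_prob (J' K) \<epsilon> \<le> \<epsilon>" using n0 by blast
      have bK: "bp K" using K by simp
      have "indist M T (J' K) (\<lambda>u \<omega>. JZ K u \<omega> - L n K u \<omega>)"
        by (rule op_unique[OF J'(1) op_diff[OF JZ L[of n]] indist_refl bK])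
      from sup_prob_cong[OF op_cadlag[OF J'(1) bK] this, of \<epsilon>] J'(2)
      show "sup_prob (\<lambda>t \<omega>. JZ K t \<omega> - J (\<lambda>u \<omega>. K u \<omega> *\<^sub>R level_ind H n u \<omega> *\<^sub>R H u \<omega>) t \<omega>) \<epsilon> \<le> \<epsilon>"
        unfolding L_def N_def by linarith
    qed
  qed
qed

lemma sup_prob_antimono:
  assumes Y: "cadlag_adapted M F T (Y :: ('w, real) process)" and "e \<le> e'"
  shows "sup_prob Y e' \<le> sup_prob Y e"
  by (rule sup_prob_le[OF Y]) (use assms(2) in force)

text \<open>On integrands that make both sides bounded, integration against \<open>Z\<close> is integration of the
  product against \<open>X\<close>; together with \<open>has_stoch_integralI\<close> this characterizes \<open>Z = \<integral>H dX\<close>.\<close>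

lemma has_stoch_integralE:
  fixes X :: "('w, 'v::euclidean_space) process"
  assumes I: "has_stoch_integral M F T H X Z" and J: "op X J"
  obtains JZ where "op Z JZ"
    "\<forall>K. bp K \<and> bp (\<lambda>u \<omega>. K u \<omega> *\<^sub>R H u \<omega>) \<longrightarrow> indist M T (JZ K) (J (\<lambda>u \<omega>. K u \<omega> *\<^sub>R H u \<omega>))"
proof (rule has_stoch_integral_estimate[OF I])
  fix J' JZ assume J': "op X J'" and JZ: "op Z JZ" and
    est: "\<forall>\<epsilon>>0. \<exists>n0. \<forall>n\<ge>n0. \<forall>K. bp K \<and> (\<forall>t\<in>{0..T}. \<forall>\<omega>\<in>space M. \<bar>K t \<omega>\<bar> \<le> 1) \<longrightarrow>
      sup_prob (\<lambda>t \<omega>. JZ K t \<omega> - J' (\<lambda>u \<omega>. K u \<omega> *\<^sub>R level_ind H n u \<omega> *\<^sub>R H u \<omega>) t \<omega>) \<epsilon> \<le> \<epsilon>"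
  have H: "predictable M F T H" using I by (simp add: has_stoch_integral_def)
  \<comment> \<open>Such a \<open>K\<close> vanishes where the norm of \<open>H\<close> exceeds
    \<open>m\<close>. From \<open>n \<ge> m\<close> on the truncation is invisible, and the estimate
    concerns one fixed difference.\<close>
  have step1: "indist M T (JZ K) (J' (\<lambda>u \<omega>. K u \<omega> *\<^sub>R H u \<omega>))"
    if K: "bp K" "\<forall>t\<in>{0..T}. \<forall>\<omega>\<in>space M. \<bar>K t \<omega>\<bar> \<le> 1" and KH: "bp (\<lambda>u \<omega>. K u \<omega> *\<^sub>R H u \<omega>)"
      and level: "\<exists>m. \<forall>u \<omega>. norm (H u \<omega>) > real m \<longrightarrow> K u \<omega> = 0" for K
  proof -
    obtain m where m: "\<forall>u \<omega>. norm (H u \<omega>) > real m \<longrightarrow> K u \<omega> = 0" using level by (rule exE)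
    define D where "D = (\<lambda>t \<omega>. JZ K t \<omega> - J' (\<lambda>u \<omega>. K u \<omega> *\<^sub>R H u \<omega>) t \<omega>)"
    have Dc: "cadlag_adapted M F T D" unfolding D_def by (intro cadlag_adapted_diff op_cadlag[OF JZ K(1)] op_cadlag[OF J' KH])
    have D: "sup_prob D e \<le> e" if e: "e > 0" for e
    proof -
      obtain n0 where n0: "\<forall>n\<ge>n0. \<forall>K. bp K \<and> (\<forall>t\<in>{0..T}. \<forall>\<omega>\<in>space M. \<bar>K t \<omega>\<bar> \<le> 1) \<longrightarrow>
      sup_prob (\<lambda>t \<omega>. JZ K t \<omega> - J' (\<lambda>u \<omega>. K u \<omega> *\<^sub>R level_ind H n u \<omega> *\<^sub>R H u \<omega>) t \<omega>) e \<le> e"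
        using est e by blast
      define n where "n = max n0 m"
      have "K u \<omega> *\<^sub>R level_ind H n u \<omega> *\<^sub>R H u \<omega> = K u \<omega> *\<^sub>R H u \<omega>" for u \<omega>
        using m[rule_format, of u \<omega>] by (cases "norm (H u \<omega>) \<le> real m") (auto simp: level_ind_def n_def)
      note eqK = this
      have "n0 \<le> n" unfolding n_def by simp
      then have "sup_prob (\<lambda>t \<omega>. JZ K t \<omega> - J' (\<lambda>u \<omega>. K u \<omega> *\<^sub>R level_ind H n u \<omega> *\<^sub>R H u \<omega>) t \<omega>) e \<le> e"
        using n0 K by blast
      then show ?thesis unfolding D_def by (simp only: eqK)
    qed
    \<comment> \<open>An exceedance probability that is at most \<open>e\<close> at every level
      \<open>e\<close> must be 0: pass to a level of at most half that probability.\<close>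
    have "sup_prob D e = 0" if e: "e > 0" for e
    proof (rule ccontr)
      assume "sup_prob D e \<noteq> 0"
      then have p: "sup_prob D e > 0" using sup_prob_nonneg[of D e] by linarith
      define e' where "e' = min e (sup_prob D e / 2)"
      have "sup_prob D e \<le> sup_prob D e'" by (rule sup_prob_antimono[OF Dc]) (simp add: e'_def)
      also have "\<dots> \<le> e'" by (rule D) (use e p in \<open>simp add: e'_def\<close>)
      finally show False using p unfolding e'_def by linarith
    qed
    then show ?thesis unfolding indist_iff_sup_prob[OF op_cadlag[OF JZ K(1)] op_cadlag[OF J' KH]] D_def by blast
  qed
  \<comment> \<open>A general \<open>K\<close> is multiplied by level indicators and recovered in
    the limit; the bound 1 is removed by rescaling at the end.\<close>
  have step2: "indist M T (JZ K) (J' (\<lambda>u \<omega>. K u \<omega> *\<^sub>R H u \<omega>))"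
    if K: "bp K" "\<forall>t\<in>{0..T}. \<forall>\<omega>\<in>space M. \<bar>K t \<omega>\<bar> \<le> 1" and KH: "bp (\<lambda>u \<omega>. K u \<omega> *\<^sub>R H u \<omega>)" for K
  proof -
    define Km where "Km m = (\<lambda>u \<omega>. level_ind H m u \<omega> *\<^sub>R K u \<omega>)" for m
    have Km: "bp (Km m)" for m unfolding Km_def by (rule bp_scaleR[OF level_ind_bp[OF H] K(1)])
    have eq: "(\<lambda>u \<omega>. Km m u \<omega> *\<^sub>R H u \<omega>) = (\<lambda>u \<omega>. level_ind H m u \<omega> *\<^sub>R K u \<omega> *\<^sub>R H u \<omega>)" for m
      by (simp add: Km_def)
    have KmH: "bp (\<lambda>u \<omega>. Km m u \<omega> *\<^sub>R H u \<omega>)" for m unfolding eq by (rule bp_scaleR[OF level_ind_bp[OF H] KH])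
    have i: "indist M T (JZ (Km m)) (J' (\<lambda>u \<omega>. Km m u \<omega> *\<^sub>R H u \<omega>))" for m
      by (rule step1[OF Km _ KmH]) (use K in \<open>auto simp: Km_def level_ind_def intro!: exI[of _ m]\<close>)
    have 1: "ucp_lim M T (\<lambda>m. JZ (Km m)) (JZ K)" unfolding Km_def by (rule op_level_tendsto[OF JZ H K(1)])
    have 2: "ucp_lim M T (\<lambda>m. J' (\<lambda>u \<omega>. Km m u \<omega> *\<^sub>R H u \<omega>)) (J' (\<lambda>u \<omega>. K u \<omega> *\<^sub>R H u \<omega>))"
      unfolding eq by (rule op_level_tendsto[OF J' H KH])
    have 3: "ucp_lim M T (\<lambda>m. JZ (Km m)) (J' (\<lambda>u \<omega>. K u \<omega> *\<^sub>R H u \<omega>))"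
      by (rule ucp_lim_cong[OF op_cadlag[OF J' KmH] op_cadlag[OF J' KH] 2 indist_sym[OF i] indist_refl])
    show ?thesis by (rule ucp_lim_unique[OF op_cadlag[OF JZ Km] op_cadlag[OF JZ K(1)] op_cadlag[OF J' KH] 1 3])
  qed
  show thesis
  proof (rule that[OF JZ], intro allI impI)
    fix K :: "('w, real) process"
    assume as: "bp K \<and> bp (\<lambda>u \<omega>. K u \<omega> *\<^sub>R H u \<omega>)"
    have K: "bp K" and KH: "bp (\<lambda>u \<omega>. K u \<omega> *\<^sub>R H u \<omega>)" using as by auto
    obtain c where c: "0 \<le> c" "\<forall>t\<in>{0..T}. \<forall>\<omega>\<in>space M. norm (K t \<omega>) \<le> c" by (rule bpE[OF K])
    define d where "d = c + 1"
    define K1 where "K1 = (\<lambda>u \<omega>. (1 / d) *\<^sub>R K u \<omega>)"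
    have d: "d > 0" using c unfolding d_def by simp
    have K1: "bp K1" unfolding K1_def using bp_lincomb[OF K K, of "1 / d" 0] by simp
    have eq: "(\<lambda>u \<omega>. K1 u \<omega> *\<^sub>R H u \<omega>) = (\<lambda>u \<omega>. (1 / d) *\<^sub>R K u \<omega> *\<^sub>R H u \<omega>)" unfolding K1_def by simp
    have K1H: "bp (\<lambda>u \<omega>. K1 u \<omega> *\<^sub>R H u \<omega>)" unfolding eq using bp_lincomb[OF KH KH, of "1 / d" 0] by simp
    have "\<bar>K1 t \<omega>\<bar> \<le> 1" if "t \<in> {0..T}" "\<omega> \<in> space M" for t \<omega>
    proof -
      have "\<bar>K t \<omega>\<bar> \<le> d" using c(2) that unfolding d_def by force
      then show ?thesis unfolding K1_def using d by (simp add: abs_mult)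
    qed
    then have i: "indist M T (JZ K1) (J' (\<lambda>u \<omega>. K1 u \<omega> *\<^sub>R H u \<omega>))" by (intro step2 K1 K1H) blast
    have "indist M T (JZ K) (\<lambda>u \<omega>. d * JZ K1 u \<omega>)"
      using op_scale[OF JZ K1, of d] d unfolding K1_def by simp
    moreover have "indist M T (\<lambda>u \<omega>. d * JZ K1 u \<omega>) (\<lambda>u \<omega>. d * J' (\<lambda>u \<omega>. K1 u \<omega> *\<^sub>R H u \<omega>) u \<omega>)"
      by (rule indist_combine[OF i i, where h="\<lambda>_ _ x y. d * x"])
    moreover have "indist M T (J' (\<lambda>u \<omega>. K u \<omega> *\<^sub>R H u \<omega>)) (\<lambda>u \<omega>. d * J' (\<lambda>u \<omega>. K1 u \<omega> *\<^sub>R H u \<omega>) u \<omega>)"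
      using op_scale[OF J' K1H, of d] d unfolding K1_def by simp
    moreover have "indist M T (J' (\<lambda>u \<omega>. K u \<omega> *\<^sub>R H u \<omega>)) (J (\<lambda>u \<omega>. K u \<omega> *\<^sub>R H u \<omega>))"
      by (rule op_unique[OF J' J indist_refl KH])
    ultimately show "indist M T (JZ K) (J (\<lambda>u \<omega>. K u \<omega> *\<^sub>R H u \<omega>))"
      using indist_trans indist_sym by meson
  qed
qed

text \<open>Emery convergence is uniform over all \<open>K\<close> bounded by 1, which follows by
  contradiction. If it failed, there would be \<open>K i\<close> and levels
  \<open>n i \<ge> i\<close> with large errors. The error is the integral of
  \<open>(1 - level_ind H (n i)) * K i\<close>, and these integrands are bounded by 1 and tend to 0
  pointwise, so their integrals tend to 0 in probability.\<close>

lemma has_stoch_integralI: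
  fixes X :: "('w, 'v::euclidean_space) process"
  assumes H: "predictable M F T H" and Z: "semimartingale M F T Z" "AE \<omega> in M. Z 0 \<omega> = 0"
    and J: "op X J" and JZ: "op Z JZ"
    and char: "\<And>K. bp K \<Longrightarrow> bp (\<lambda>u \<omega>. K u \<omega> *\<^sub>R H u \<omega>) \<Longrightarrow> indist M T (JZ K) (J (\<lambda>u \<omega>. K u \<omega> *\<^sub>R H u \<omega>))"
  shows "has_stoch_integral M F T H X Z"
proof -
  define N where "N n = (\<lambda>u \<omega>. level_ind H n u \<omega> *\<^sub>R H u \<omega>)" for n
  have bpN: "bp (N n)" for n unfolding N_def by (rule level_ind_bp_scaleR[OF H])
  define L where "L n = (\<lambda>K::('w, real) process. J (\<lambda>u \<omega>. K u \<omega> *\<^sub>R N n u \<omega>))" for n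
  have L: "op (J (N n)) (L n)" for n unfolding L_def by (rule op_assoc[OF J bpN])
  have eN: "N n = (\<lambda>u \<omega>. if norm (H u \<omega>) \<le> real n then H u \<omega> else 0)" for n
    unfolding N_def level_ind_scaleR ..
  have bsi: "bounded_stoch_integral M F T K (\<lambda>t \<omega>. Z t \<omega> - J (N n) t \<omega>) (\<lambda>u \<omega>. JZ K u \<omega> - L n K u \<omega>)" if "bp K" for n K
    unfolding bounded_stoch_integral_def
    using op_diff[OF JZ L[of n]] op_cadlag[OF op_diff[OF JZ L[of n]] that] that indist_refl by blast
  have diff: "indist M T (\<lambda>u \<omega>. JZ K u \<omega> - L n K u \<omega>) (JZ (\<lambda>u \<omega>. (1 - level_ind H n u \<omega>) * K u \<omega>))" if K: "bp K" for n K
  proof -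
    define Kn where "Kn = (\<lambda>u \<omega>. level_ind H n u \<omega> * K u \<omega>)"
    have Kn: "bp Kn" unfolding Kn_def by (rule level_ind_bp_mult[OF H K])
    have eq: "(\<lambda>u \<omega>. Kn u \<omega> *\<^sub>R H u \<omega>) = (\<lambda>u \<omega>. K u \<omega> *\<^sub>R N n u \<omega>)" unfolding Kn_def N_def by (simp add: mult.commute)
    have "bp (\<lambda>u \<omega>. Kn u \<omega> *\<^sub>R H u \<omega>)" unfolding eq by (rule bp_scaleR[OF K bpN])
    from char[OF Kn this] have i: "indist M T (L n K) (JZ Kn)" unfolding eq L_def by (rule indist_sym)
    have "indist M T (\<lambda>u \<omega>. JZ K u \<omega> - L n K u \<omega>) (\<lambda>u \<omega>. JZ K u \<omega> - JZ Kn u \<omega>)"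
      by (rule indist_combine[OF indist_refl i, where h="\<lambda>_ _ x y. x - y"])
    moreover have "indist M T (JZ (\<lambda>u \<omega>. (1 - level_ind H n u \<omega>) * K u \<omega>)) (\<lambda>u \<omega>. JZ K u \<omega> - JZ Kn u \<omega>)"
      using op_lin[OF JZ K Kn, of 1 "-1"] unfolding Kn_def by (simp add: left_diff_distrib)
    ultimately show ?thesis using indist_trans indist_sym by blast
  qed
  have "emery_lim M F T (\<lambda>n. J (N n)) Z"
    unfolding emery_lim_def
  proof (intro allI impI)
    fix \<epsilon> :: real assume e: "\<epsilon> > 0"
    have "\<exists>n0. \<forall>n\<ge>n0. \<forall>K. bp K \<and> (\<forall>t\<in>{0..T}. \<forall>\<omega>\<in>space M. \<bar>K t \<omega>\<bar> \<le> 1) \<longrightarrow>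
      sup_prob (\<lambda>u \<omega>. JZ K u \<omega> - L n K u \<omega>) \<epsilon> \<le> \<epsilon>"
    proof (rule ccontr)
      assume "\<not> ?thesis"
      then have "\<forall>i. \<exists>n K. i \<le> n \<and> bp K \<and> (\<forall>t\<in>{0..T}. \<forall>\<omega>\<in>space M. \<bar>K t \<omega>\<bar> \<le> 1) \<and>
        sup_prob (\<lambda>u \<omega>. JZ K u \<omega> - L n K u \<omega>) \<epsilon> > \<epsilon>" by (metis not_le)
      then obtain n where "\<forall>i. \<exists>K. i \<le> n i \<and> bp K \<and> (\<forall>t\<in>{0..T}. \<forall>\<omega>\<in>space M. \<bar>K t \<omega>\<bar> \<le> 1) \<and>
        sup_prob (\<lambda>u \<omega>. JZ K u \<omega> - L (n i) K u \<omega>) \<epsilon> > \<epsilon>" by (rule choice[THEN exE])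
      then obtain K where nK: "\<forall>i::nat. i \<le> n i \<and> bp (K i) \<and> (\<forall>t\<in>{0..T}. \<forall>\<omega>\<in>space M. \<bar>K i t \<omega>\<bar> \<le> 1) \<and>
        sup_prob (\<lambda>u \<omega>. JZ (K i) u \<omega> - L (n i) (K i) u \<omega>) \<epsilon> > \<epsilon>" by (rule choice[THEN exE])
      define G where "G i = (\<lambda>u \<omega>. (1 - level_ind H (n i) u \<omega>) * K i u \<omega>)" for i
      have bK: "bp (K i)" for i using nK by blast
      have G: "bp (G i)" for i
        using bp_scaleR[OF bp_diff[OF bp_const[of 1] level_ind_bp[OF H]] bK[of i]] unfolding G_def by simp
      have "ucp_lim M T (\<lambda>i. JZ (G i)) (JZ (\<lambda>_ _. 0))"
      proof (rule op_lim[OF JZ G bp_0])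
        fix i t \<omega> assume t: "t \<in> {0..T}" "\<omega> \<in> space M"
        then have "\<bar>K i t \<omega>\<bar> \<le> 1" using nK by blast
        then show "norm (G i t \<omega>) \<le> 1" unfolding G_def level_ind_def by auto
      next
        fix t \<omega>
        obtain m :: nat where m: "norm (H t \<omega>) \<le> real m" using real_arch_simple by blast
        have "\<forall>\<^sub>F i in sequentially. G i t \<omega> = 0"
          unfolding eventually_sequentially
        proof (intro exI[of _ m] allI impI)
          fix i assume "m \<le> i"
          then have "m \<le> n i" using nK order_trans by blast
          then show "G i t \<omega> = 0" using m unfolding G_def level_ind_def by auto
        qed
        then show "(\<lambda>i. G i t \<omega>) \<longlonglongrightarrow> 0" by (rule tendsto_eventually)
      qed
      from ucp_lim_cong[OF op_cadlag[OF JZ G] op_cadlag[OF JZ bp_0] this indist_refl op_0[OF JZ]]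
      have "(\<lambda>i. sup_prob (\<lambda>t \<omega>. JZ (G i) t \<omega> - 0) \<epsilon>) \<longlonglongrightarrow> 0" using e unfolding ucp_lim_iff by blast
      then have "\<forall>\<^sub>F i in sequentially. sup_prob (JZ (G i)) \<epsilon> < \<epsilon>" using e by (simp add: order_tendsto_iff)
      then obtain i where i: "sup_prob (JZ (G i)) \<epsilon> < \<epsilon>" by (auto simp: eventually_sequentially)
      have "sup_prob (\<lambda>u \<omega>. JZ (K i) u \<omega> - L (n i) (K i) u \<omega>) \<epsilon> \<le> sup_prob (JZ (G i)) \<epsilon>"
        by (rule sup_prob_cong[OF op_cadlag[OF JZ G]]) (unfold G_def, rule indist_sym[OF diff[OF bK]])
      then show False using i nK by (meson less_asym' order_le_less_trans)
    qed
    then obtain n0 where n0: "\<forall>n\<ge>n0. \<forall>K. bp K \<and> (\<forall>t\<in>{0..T}. \<forall>\<omega>\<in>space M. \<bar>K t \<omega>\<bar> \<le> 1) \<longrightarrow>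
      sup_prob (\<lambda>u \<omega>. JZ K u \<omega> - L n K u \<omega>) \<epsilon> \<le> \<epsilon>" by (rule exE)
    show "\<exists>n0. \<forall>n\<ge>n0. \<forall>K::('w, real) process.
        predictable M F T K \<and> (\<forall>t\<in>{0..T}. \<forall>\<omega>\<in>space M. \<bar>K t \<omega>\<bar> \<le> 1) \<longrightarrow>
        (\<exists>D. bounded_stoch_integral M F T K (\<lambda>t \<omega>. Z t \<omega> - J (N n) t \<omega>) D \<and>
             measure M {\<omega>\<in>space M. \<exists>t\<in>{0..T}. \<bar>D t \<omega>\<bar> > \<epsilon>} \<le> \<epsilon>)"
    proof (intro exI[of _ n0] allI impI)
      fix n and K :: "('w, real) process"
      assume n: "n0 \<le> n" and K: "predictable M F T K \<and> (\<forall>t\<in>{0..T}. \<forall>\<omega>\<in>space M. \<bar>K t \<omega>\<bar> \<le> 1)"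
      have bK: "bp K" by (rule bpI[where c=1]) (use K in auto)
      show "\<exists>D. bounded_stoch_integral M F T K (\<lambda>t \<omega>. Z t \<omega> - J (N n) t \<omega>) D \<and>
             measure M {\<omega>\<in>space M. \<exists>t\<in>{0..T}. \<bar>D t \<omega>\<bar> > \<epsilon>} \<le> \<epsilon>"
        using bsi[OF bK, of n] n0 n K bK unfolding sup_prob_def by blast
    qed
  qed
  moreover have "\<forall>n. bounded_stoch_integral M F T (N n) X (J (N n))"
    unfolding bounded_stoch_integral_def using bpN op_cadlag[OF J bpN] J indist_refl by blast
  ultimately show ?thesis
    unfolding has_stoch_integral_def eN[symmetric] by (intro conjI H Z exI[of _ "\<lambda>n. J (N n)"])
qed

text \<open>If \<open>K\<close> makes the product with \<open>H'\<close> bounded, its product with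
  \<open>H\<close> may still be unbounded. Multiplying \<open>K\<close> by the level indicators of
  \<open>H\<close> bounds both, the two characterizations can be compared there, and the levels are
  then removed in the limit.\<close>

lemma has_stoch_integral_transfer:
  fixes X :: "('w, 'v::euclidean_space) process" and X' :: "('w, 'u::euclidean_space) process"
  assumes I: "has_stoch_integral M F T H X Z" and J: "op X J" and J': "op X' J'" and H': "predictable M F T H'"
    and eq: "\<And>K. bp K \<Longrightarrow> bp (\<lambda>u \<omega>. K u \<omega> *\<^sub>R H u \<omega>) \<Longrightarrow> bp (\<lambda>u \<omega>. K u \<omega> *\<^sub>R H' u \<omega>) \<Longrightarrow>
      indist M T (J (\<lambda>u \<omega>. K u \<omega> *\<^sub>R H u \<omega>)) (J' (\<lambda>u \<omega>. K u \<omega> *\<^sub>R H' u \<omega>))"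
  shows "has_stoch_integral M F T H' X' Z"
proof (rule has_stoch_integralE[OF I J])
  fix JZ assume JZ: "op Z JZ" and char: "\<forall>K. bp K \<and> bp (\<lambda>u \<omega>. K u \<omega> *\<^sub>R H u \<omega>) \<longrightarrow>
    indist M T (JZ K) (J (\<lambda>u \<omega>. K u \<omega> *\<^sub>R H u \<omega>))"
  have H: "predictable M F T H" and Z: "semimartingale M F T Z" "AE \<omega> in M. Z 0 \<omega> = 0"
    using I by (simp_all add: has_stoch_integral_def)
  show ?thesis
  proof (rule has_stoch_integralI[OF H' Z J' JZ])
    fix K :: "('w, real) process" assume K: "bp K" and KH': "bp (\<lambda>u \<omega>. K u \<omega> *\<^sub>R H' u \<omega>)"
    define Km where "Km m = (\<lambda>u \<omega>. level_ind H m u \<omega> *\<^sub>R K u \<omega>)" for m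
    have Km: "bp (Km m)" for m unfolding Km_def by (rule bp_scaleR[OF level_ind_bp[OF H] K])
    have "(\<lambda>u \<omega>. Km m u \<omega> *\<^sub>R H u \<omega>) = (\<lambda>u \<omega>. K u \<omega> *\<^sub>R level_ind H m u \<omega> *\<^sub>R H u \<omega>)" for m
      by (simp add: Km_def mult.commute)
    then have KmH: "bp (\<lambda>u \<omega>. Km m u \<omega> *\<^sub>R H u \<omega>)" for m using bp_scaleR[OF K level_ind_bp_scaleR[OF H, of m]] by simp
    have eq': "(\<lambda>u \<omega>. Km m u \<omega> *\<^sub>R H' u \<omega>) = (\<lambda>u \<omega>. level_ind H m u \<omega> *\<^sub>R K u \<omega> *\<^sub>R H' u \<omega>)" for m
      by (simp add: Km_def)
    have KmH': "bp (\<lambda>u \<omega>. Km m u \<omega> *\<^sub>R H' u \<omega>)" for m unfolding eq' by (rule bp_scaleR[OF level_ind_bp[OF H] KH'])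
    have "indist M T (JZ (Km m)) (J (\<lambda>u \<omega>. Km m u \<omega> *\<^sub>R H u \<omega>))" for m using char Km KmH by blast
    then have i: "indist M T (JZ (Km m)) (J' (\<lambda>u \<omega>. Km m u \<omega> *\<^sub>R H' u \<omega>))" for m
      using eq[OF Km KmH KmH', of m] indist_trans by blast
    have 1: "ucp_lim M T (\<lambda>m. JZ (Km m)) (JZ K)" unfolding Km_def by (rule op_level_tendsto[OF JZ H K])
    have 2: "ucp_lim M T (\<lambda>m. J' (\<lambda>u \<omega>. Km m u \<omega> *\<^sub>R H' u \<omega>)) (J' (\<lambda>u \<omega>. K u \<omega> *\<^sub>R H' u \<omega>))"
      unfolding eq' by (rule op_level_tendsto[OF J' H KH'])
    have 3: "ucp_lim M T (\<lambda>m. JZ (Km m)) (J' (\<lambda>u \<omega>. K u \<omega> *\<^sub>R H' u \<omega>))"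
      by (rule ucp_lim_cong[OF op_cadlag[OF J' KmH'] op_cadlag[OF J' KH'] 2 indist_sym[OF i] indist_refl])
    show "indist M T (JZ K) (J' (\<lambda>u \<omega>. K u \<omega> *\<^sub>R H' u \<omega>))"
      by (rule ucp_lim_unique[OF op_cadlag[OF JZ Km] op_cadlag[OF JZ K] op_cadlag[OF J' KH'] 1 3])
  qed
qed

lemma semimartingale_cadlag: "semimartingale M F T X \<Longrightarrow> cadlag_adapted M F T X"
  by (simp add: semimartingale_def)

text \<open>The jumps are compared after multiplication by each level indicator, where
  \<open>op_jump\<close> applies; at any time some level indicator is 1.\<close>

lemma has_stoch_integral_jump:
  fixes X :: "('w, 'v::euclidean_space) process"
  assumes I: "has_stoch_integral M F T H X Z" and X: "cadlag_adapted M F T X"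
  shows "AE \<omega> in M. \<forall>t\<in>{0..T}. jump Z t \<omega> = H t \<omega> \<bullet> jump X t \<omega>"
proof (rule has_stoch_integral_estimate[OF I])
  fix J assume J: "op X J"
  show ?thesis
  proof (rule has_stoch_integralE[OF I J])
    fix JZ assume JZ: "op Z JZ" and char: "\<forall>K. bp K \<and> bp (\<lambda>u \<omega>. K u \<omega> *\<^sub>R H u \<omega>) \<longrightarrow>
      indist M T (JZ K) (J (\<lambda>u \<omega>. K u \<omega> *\<^sub>R H u \<omega>))"
    have H: "predictable M F T H" and Z: "cadlag_adapted M F T Z"
      using I semimartingale_cadlag by (auto simp: has_stoch_integral_def)
    let ?I = "level_ind H"
    have b: "bp (?I m)" "bp (\<lambda>u \<omega>. ?I m u \<omega> *\<^sub>R H u \<omega>)" for m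
      by (rule level_ind_bp[OF H], rule level_ind_bp_scaleR[OF H])
    have "AE \<omega> in M. \<forall>t\<in>{0..T}. ?I m t \<omega> * jump Z t \<omega> = ?I m t \<omega> * (H t \<omega> \<bullet> jump X t \<omega>)" for m
    proof -
      have "indist M T (JZ (?I m)) (J (\<lambda>u \<omega>. ?I m u \<omega> *\<^sub>R H u \<omega>))" using char b by blast
      from indist_jump[OF this] op_jump[OF JZ Z b(1)[of m]] op_jump[OF J X b(2)[of m]]
      show ?thesis
      proof eventually_elim
        case (elim \<omega>)
        then show ?case by simp
      qed
    qed
    then have "AE \<omega> in M. \<forall>m. \<forall>t\<in>{0..T}. ?I m t \<omega> * jump Z t \<omega> = ?I m t \<omega> * (H t \<omega> \<bullet> jump X t \<omega>)"
      by (intro AE_all_countable[THEN iffD2] allI)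
    then show ?thesis
    proof eventually_elim
      case (elim \<omega>)
      show ?case
      proof
        fix t assume t: "t \<in> {0..T}"
        obtain m :: nat where "norm (H t \<omega>) \<le> real m" using real_arch_simple by blast
        then show "jump Z t \<omega> = H t \<omega> \<bullet> jump X t \<omega>" using elim[rule_format, OF t, of m] by (simp add: level_ind_def)
      qed
    qed
  qed
qed

end

section \<open>The jump measure of a Levy process\<close>

text \<open>Cauchy's functional equation. Nonnegativity gives monotonicity, which takes the place of
  continuity: \<open>x\<close> is squeezed between neighbouring multiples of
  \<open>T / real n\<close>, with error at most \<open>G T / real n\<close>.\<close>

lemma additive_imp_linear:
  fixes G :: "real \<Rightarrow> real"
  assumes add: "\<And>x y. 0 \<le> x \<Longrightarrow> 0 \<le> y \<Longrightarrow> x + y \<le> T \<Longrightarrow> G (x + y) = G x + G y"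
    and nonneg: "\<And>x. 0 \<le> x \<Longrightarrow> x \<le> T \<Longrightarrow> 0 \<le> G x" and T: "T > 0" and x: "0 \<le> x" "x \<le> T"
  shows "G x = x / T * G T"
proof (cases "x = T")
  case False
  have mono: "G a \<le> G b" if "0 \<le> a" "a \<le> b" "b \<le> T" for a b
    using add[of a "b - a"] nonneg[of "b - a"] that by simp
  have mult: "G (real k * h) = real k * G h" if "0 \<le> h" "real k * h \<le> T" for k h
    using that
  proof (induction k)
    case 0
    then show ?case using add[of 0 0] T by simp
  next
    case (Suc k)
    have "real k * h \<le> T" using Suc.prems by (simp add: algebra_simps)
    then have "G (real k * h) = real k * G h" using Suc by simp
    moreover have "real k * h + h = real (Suc k) * h" by (simp add: algebra_simps)
    ultimately show ?case using add[of "real k * h" h] Suc.prems by (simp add: algebra_simps)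
  qed
  have frac: "G (real k * (T / real n)) = real k / real n * G T" if "n > 0" "k \<le> n" for k n
  proof -
    have kn: "real k * (T / real n) \<le> T"
      using that T by (simp add: field_simps)
    have "G T = real n * G (T / real n)" using mult[of "T / real n" n] that T by simp
    moreover have "G (real k * (T / real n)) = real k * G (T / real n)"
      using mult[of "T / real n" k] kn T by simp
    ultimately show ?thesis using that by simp
  qed
  have close: "\<bar>G x - x / T * G T\<bar> \<le> G T / real n" if n: "n > 0" for n
  proof -
    define k where "k = nat \<lfloor>real n * x / T\<rfloor>"
    have k: "real k \<le> real n * x / T" "real n * x / T < real k + 1"
      unfolding k_def using x T by (auto simp: le_floor_iff)
    have "real n * x / T < real n" using x False T n by (simp add: field_simps)
    then have kn: "k + 1 \<le> n" using k(1) by linarith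
    have l: "real k * (T / real n) \<le> x" and u: "x \<le> real (k + 1) * (T / real n)"
      using k T n by (auto simp: field_simps)
    have uT: "real (k + 1) * (T / real n) \<le> T"
    proof -
      have "real (k + 1) * (T / real n) \<le> real n * (T / real n)" using kn T by (intro mult_right_mono) auto
      then show ?thesis using n by simp
    qed
    have 1: "real k / real n * G T \<le> G x" using mono[OF _ l] x T frac[of n k] n kn by simp
    have 2: "G x \<le> real (k + 1) / real n * G T" using mono[OF x(1) u uT] frac[of n "k + 1"] n kn by simp
    have g: "G T \<ge> 0" using nonneg[of T] T by simp
    have kx: "real k / real n \<le> x / T" "x / T \<le> real (k + 1) / real n" using k n T by (auto simp: field_simps)
    have 3: "real k / real n * G T \<le> x / T * G T" "x / T * G T \<le> real (k + 1) / real n * G T"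
      using mult_right_mono[OF kx(1) g] mult_right_mono[OF kx(2) g] by auto
    have "real (k + 1) / real n * G T - real k / real n * G T = G T / real n" by (simp add: add_divide_distrib algebra_simps)
    then show ?thesis using 1 2 3 by linarith
  qed
  have "\<bar>G x - x / T * G T\<bar> \<le> 0"
  proof (rule LIMSEQ_le_const)
    show "(\<lambda>n. G T / real n) \<longlonglongrightarrow> 0" by (rule lim_const_over_n)
    show "\<exists>N. \<forall>n\<ge>N. \<bar>G x - x / T * G T\<bar> \<le> G T / real n" by (intro exI[of _ 1]) (use close in auto)
  qed
  then show ?thesis by simp
qed (use T in simp)

lemma min_remainder: "0 \<le> (x::real) \<Longrightarrow> 0 < m \<Longrightarrow> 0 \<le> x - min x m \<and> x - min x m \<le> x\<^sup>2 / m"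
proof -
  assume x: "0 \<le> x" and m: "0 < m"
  have "x \<le> x\<^sup>2 / m" if "m \<le> x"
    using m x that mult_left_mono[OF that x] by (simp add: power2_eq_square field_simps)
  then show ?thesis using x m by (cases "x \<le> m") (auto simp: min_def intro: order_trans)
qed

text \<open>The bounded second moments make the sequence uniformly integrable.\<close>

lemma (in prob_space) second_moment_limit:
  fixes S :: "nat \<Rightarrow> 'a \<Rightarrow> real"
  assumes S: "\<And>n. bdd_rv M (S n)" "\<And>n \<omega>. \<omega> \<in> space M \<Longrightarrow> 0 \<le> S n \<omega>"
    and C: "\<And>n. expectation (\<lambda>\<omega>. (S n \<omega>)\<^sup>2) \<le> C"
    and lim: "\<And>\<omega>. \<omega> \<in> space M \<Longrightarrow> (\<lambda>n. S n \<omega>) \<longlonglongrightarrow> S' \<omega>"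
    and Y: "Y \<in> borel_measurable M" "\<And>\<omega>. \<omega> \<in> space M \<Longrightarrow> 0 \<le> Y \<omega> \<and> Y \<omega> \<le> 1"
  shows "integrable M S'" and "(\<lambda>n. expectation (\<lambda>\<omega>. Y \<omega> * S n \<omega>)) \<longlonglongrightarrow> expectation (\<lambda>\<omega>. Y \<omega> * S' \<omega>)"
proof -
  note [measurable] = bdd_rv_measurable[OF S(1)] Y(1)
  have S'm [measurable]: "S' \<in> borel_measurable M" by (rule borel_measurable_LIMSEQ_real[OF lim]) simp_all
  have S'0: "0 \<le> S' \<omega>" if "\<omega> \<in> space M" for \<omega>
    by (rule LIMSEQ_le_const[OF lim[OF that]]) (use S(2) that in auto)
  have C0: "C \<ge> 0" using order_trans[OF _ C[of 0]] by (simp add: integral_nonneg_AE)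
  have nnS: "(\<integral>\<^sup>+\<omega>. ennreal ((S n \<omega>)\<^sup>2) \<partial>M) \<le> ennreal C" for n
  proof -
    have "(\<integral>\<^sup>+\<omega>. ennreal ((S n \<omega>)\<^sup>2) \<partial>M) = ennreal (expectation (\<lambda>\<omega>. (S n \<omega>)\<^sup>2))"
      by (rule nn_integral_eq_integral) (auto intro!: bdd_rv_integrable bdd_rv_intros S)
    then show ?thesis using C[of n] by (simp add: ennreal_leI)
  qed
  have "(\<integral>\<^sup>+\<omega>. ennreal ((S' \<omega>)\<^sup>2) \<partial>M) = (\<integral>\<^sup>+\<omega>. liminf (\<lambda>n. ennreal ((S n \<omega>)\<^sup>2)) \<partial>M)"
  proof (rule nn_integral_cong)
    fix \<omega> assume "\<omega> \<in> space M"
    then have "(\<lambda>n. ennreal ((S n \<omega>)\<^sup>2)) \<longlonglongrightarrow> ennreal ((S' \<omega>)\<^sup>2)" by (intro tendsto_ennrealI tendsto_power lim)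
    from lim_imp_Liminf[OF _ this] show "ennreal ((S' \<omega>)\<^sup>2) = liminf (\<lambda>n. ennreal ((S n \<omega>)\<^sup>2))" by simp
  qed
  also have "\<dots> \<le> liminf (\<lambda>n. \<integral>\<^sup>+\<omega>. ennreal ((S n \<omega>)\<^sup>2) \<partial>M)" by (rule nn_integral_liminf) simp
  also have "\<dots> \<le> ennreal C"
    by (rule order_trans[OF Liminf_le_Limsup Limsup_bounded]) (auto simp: nnS)
  finally have nnS': "(\<integral>\<^sup>+\<omega>. ennreal ((S' \<omega>)\<^sup>2) \<partial>M) \<le> ennreal C" .
  have sq: "integrable M (\<lambda>\<omega>. (S' \<omega>)\<^sup>2)"
    by (rule integrableI_bounded) (use nnS' in \<open>auto simp: le_less_trans\<close>)
  have "ennreal (expectation (\<lambda>\<omega>. (S' \<omega>)\<^sup>2)) \<le> ennreal C"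
    using nnS' by (subst nn_integral_eq_integral[symmetric, OF sq]) auto
  then have CS': "expectation (\<lambda>\<omega>. (S' \<omega>)\<^sup>2) \<le> C" using C0 by simp
  show int: "integrable M S'" by (rule square_integrable_imp_integrable[OF S'm sq])
  have intS: "integrable M (S n)" "integrable M (\<lambda>\<omega>. (S n \<omega>)\<^sup>2)" for n
    by (auto intro!: bdd_rv_integrable bdd_rv_intros S)
  have YU: "integrable M (\<lambda>\<omega>. Y \<omega> * U \<omega>)" if "integrable M U" for U :: "'a \<Rightarrow> real"
  proof (rule Bochner_Integration.integrable_bound[OF that])
    show "(\<lambda>\<omega>. Y \<omega> * U \<omega>) \<in> borel_measurable M" using that by simp
    show "AE \<omega> in M. norm (Y \<omega> * U \<omega>) \<le> norm (U \<omega>)"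
      using Y(2) by (intro AE_I2) (auto simp: abs_mult intro!: mult_left_le_one_le)
  qed
  \<comment> \<open>\<open>min_remainder\<close> turns the second moment into a truncation error
    \<open>C / m\<close> that is the same for all \<open>S n\<close>. Fatou's lemma has given the
    limit the same bound on its second moment.\<close>
  have close: "\<bar>expectation (\<lambda>\<omega>. Y \<omega> * U \<omega>) - expectation (\<lambda>\<omega>. Y \<omega> * min (U \<omega>) m)\<bar> \<le> C / m"
    if U: "integrable M U" "integrable M (\<lambda>\<omega>. (U \<omega>)\<^sup>2)" "\<And>\<omega>. \<omega> \<in> space M \<Longrightarrow> 0 \<le> U \<omega>" "expectation (\<lambda>\<omega>. (U \<omega>)\<^sup>2) \<le> C" and m: "m > 0" for U m
  proof -
    have im: "integrable M (\<lambda>\<omega>. min (U \<omega>) m)" by (intro integrable_min U integrable_const)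
    have "expectation (\<lambda>\<omega>. Y \<omega> * U \<omega>) - expectation (\<lambda>\<omega>. Y \<omega> * min (U \<omega>) m) = expectation (\<lambda>\<omega>. Y \<omega> * (U \<omega> - min (U \<omega>) m))"
      by (simp add: YU[OF U(1)] YU[OF im] right_diff_distrib)
    also have "\<bar>\<dots>\<bar> \<le> expectation (\<lambda>\<omega>. (U \<omega>)\<^sup>2 / m)"
    proof (rule order_trans[OF integral_abs_bound integral_mono])
      show "integrable M (\<lambda>\<omega>. \<bar>Y \<omega> * (U \<omega> - min (U \<omega>) m)\<bar>)" by (intro integrable_abs YU Bochner_Integration.integrable_diff U im)
      show "integrable M (\<lambda>\<omega>. (U \<omega>)\<^sup>2 / m)" using U(2) by simp
      fix \<omega> assume w: "\<omega> \<in> space M"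
      have "\<bar>Y \<omega> * (U \<omega> - min (U \<omega>) m)\<bar> \<le> \<bar>U \<omega> - min (U \<omega>) m\<bar>"
        using Y(2)[OF w] by (auto simp: abs_mult intro!: mult_left_le_one_le)
      then show "\<bar>Y \<omega> * (U \<omega> - min (U \<omega>) m)\<bar> \<le> (U \<omega>)\<^sup>2 / m"
        using min_remainder[OF U(3)[OF w] m] by linarith
    qed
    also have "\<dots> = expectation (\<lambda>\<omega>. (U \<omega>)\<^sup>2) / m" by simp
    also have "\<dots> \<le> C / m" using U(4) m by (simp add: divide_right_mono)
    finally show ?thesis .
  qed
  show "(\<lambda>n. expectation (\<lambda>\<omega>. Y \<omega> * S n \<omega>)) \<longlonglongrightarrow> expectation (\<lambda>\<omega>. Y \<omega> * S' \<omega>)"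
  proof (rule LIMSEQ_I)
    fix r :: real assume r: "0 < r"
    \<comment> \<open>The two truncations cost at most \<open>r / 4\<close> each, leaving
      \<open>r / 2\<close> for the dominated convergence of the truncated terms.\<close>
    define m where "m = 4 * (C + 1) / r"
    have m: "m > 0" "C / m \<le> r / 4" unfolding m_def using r C0 by (auto simp: field_simps)
    have "(\<lambda>n. expectation (\<lambda>\<omega>. Y \<omega> * min (S n \<omega>) m)) \<longlonglongrightarrow> expectation (\<lambda>\<omega>. Y \<omega> * min (S' \<omega>) m)"
    proof (rule integral_dominated_convergence[where w="\<lambda>_. m"])
      show "AE \<omega> in M. (\<lambda>n. Y \<omega> * min (S n \<omega>) m) \<longlonglongrightarrow> Y \<omega> * min (S' \<omega>) m"
        by (intro AE_I2 tendsto_mult tendsto_min tendsto_const lim)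
      show "AE \<omega> in M. norm (Y \<omega> * min (S n \<omega>) m) \<le> m" for n
      proof (rule AE_I2)
        fix \<omega> assume w: "\<omega> \<in> space M"
        have "\<bar>Y \<omega>\<bar> * \<bar>min (S n \<omega>) m\<bar> \<le> 1 * m" using Y(2)[OF w] S(2)[OF w] m by (intro mult_mono) auto
        then show "norm (Y \<omega> * min (S n \<omega>) m) \<le> m" by (simp add: abs_mult)
      qed
    qed (simp_all add: integrable_const)
    then have "\<forall>\<^sub>F n in sequentially. dist (expectation (\<lambda>\<omega>. Y \<omega> * min (S n \<omega>) m)) (expectation (\<lambda>\<omega>. Y \<omega> * min (S' \<omega>) m)) < r / 2"
      using r by (intro tendstoD) auto
    then obtain N where N: "\<And>n. N \<le> n \<Longrightarrow> \<bar>expectation (\<lambda>\<omega>. Y \<omega> * min (S n \<omega>) m) - expectation (\<lambda>\<omega>. Y \<omega> * min (S' \<omega>) m)\<bar> < r / 2"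
      unfolding eventually_sequentially dist_real_def by auto
    show "\<exists>N. \<forall>n\<ge>N. norm (expectation (\<lambda>\<omega>. Y \<omega> * S n \<omega>) - expectation (\<lambda>\<omega>. Y \<omega> * S' \<omega>)) < r"
    proof (intro exI[of _ N] allI impI)
      fix n assume "N \<le> n"
      then show "norm (expectation (\<lambda>\<omega>. Y \<omega> * S n \<omega>) - expectation (\<lambda>\<omega>. Y \<omega> * S' \<omega>)) < r"
        using N[of n] m(2) close[OF intS S(2) C m(1), of n] close[OF int sq S'0 CS' m(1)]
        unfolding real_norm_def by linarith
    qed
  qed
qed

section \<open>Increments above an arbitrary positive level\<close>

context stoch_basis
begin

text \<open>The tail estimate concerns only the large level \<open>a\<close>. Below it Chebyshev's
  inequality applies to the truncated increment, whose second moment, variance plus squared mean, is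
  at most \<open>(K + K\<^sup>2 * T) * h\<close>.\<close>

lemma levy_large_real:
  fixes X :: "('w, real) process"
  assumes X: "levy_increments X" and e: "e > 0"
  shows "\<exists>K\<ge>0. \<forall>h\<in>{0..T}. prob {\<omega>\<in>space M. \<bar>X h \<omega>\<bar> \<ge> e} \<le> K * h"
proof (rule levy_trunc_estimates[OF X zero_less_one])
  fix a K :: real
  assume a: "a > 0" and K: "K \<ge> 0" and tail: "\<And>h. 0 \<le> h \<Longrightarrow> h \<le> T \<Longrightarrow> prob {\<omega>\<in>space M. \<bar>X h \<omega>\<bar> > a} \<le> K * h"
    and mean: "\<And>h. 0 \<le> h \<Longrightarrow> h \<le> T \<Longrightarrow> \<bar>expectation (\<lambda>\<omega>. trunc a (X h \<omega>))\<bar> \<le> K * h"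
    and var: "\<And>h. 0 \<le> h \<Longrightarrow> h \<le> T \<Longrightarrow> variance (\<lambda>\<omega>. trunc a (X h \<omega>)) \<le> K * h"
  show ?thesis
  proof (intro exI[of _ "K + (K + K\<^sup>2 * T) / e\<^sup>2"] conjI ballI)
    show "0 \<le> K + (K + K\<^sup>2 * T) / e\<^sup>2" using K T_pos by simp
    fix h assume "h \<in> {0..T}"
    then have h: "0 \<le> h" "h \<le> T" by auto
    have [measurable]: "X h \<in> borel_measurable M" by (rule levy_measurable(2)[OF X h])
    define Y where "Y \<omega> = trunc a (X h \<omega>)" for \<omega>
    have Y: "bdd_rv M Y" unfolding Y_def by (rule bdd_rv_compose[OF bdd_rv_trunc]) simp
    have [measurable]: "Y \<in> borel_measurable M" by (rule bdd_rv_measurable[OF Y])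
    have Yi: "integrable M Y" "integrable M (\<lambda>\<omega>. (Y \<omega>)\<^sup>2)" by (auto intro!: bdd_rv_integrable bdd_rv_intros Y)
    have "(expectation Y)\<^sup>2 \<le> (K * h)\<^sup>2" using power_mono[OF mean[OF h] abs_ge_zero, of 2] by (simp add: Y_def[abs_def])
    also have "\<dots> \<le> K\<^sup>2 * T * h"
      using mult_left_mono[OF mult_right_mono[OF h(2) h(1)], of "K\<^sup>2"] by (simp add: power2_eq_square ac_simps)
    finally have "expectation (\<lambda>\<omega>. (Y \<omega>)\<^sup>2) \<le> (K + K\<^sup>2 * T) * h"
      using variance_eq[OF Yi] var[OF h] unfolding Y_def[abs_def] by (simp add: algebra_simps)
    then have 1: "prob {\<omega>\<in>space M. \<bar>Y \<omega>\<bar> \<ge> e} \<le> (K + K\<^sup>2 * T) * h / e\<^sup>2"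
      using second_moment_method[OF _ Yi(2) e] e by (force intro: order_trans divide_right_mono)
    have "prob {\<omega>\<in>space M. \<bar>X h \<omega>\<bar> \<ge> e} \<le> prob ({\<omega>\<in>space M. \<bar>X h \<omega>\<bar> > a} \<union> {\<omega>\<in>space M. \<bar>Y \<omega>\<bar> \<ge> e})"
      by (rule finite_measure_mono) (auto simp: Y_def trunc_def)
    also have "\<dots> \<le> prob {\<omega>\<in>space M. \<bar>X h \<omega>\<bar> > a} + prob {\<omega>\<in>space M. \<bar>Y \<omega>\<bar> \<ge> e}"
      by (rule measure_Un_le) auto
    also have "\<dots> \<le> K * h + (K + K\<^sup>2 * T) * h / e\<^sup>2" using tail[OF h] 1 by simp
    also have "\<dots> = (K + (K + K\<^sup>2 * T) / e\<^sup>2) * h" by (simp add: algebra_simps)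
    finally show "prob {\<omega>\<in>space M. \<bar>X h \<omega>\<bar> \<ge> e} \<le> (K + (K + K\<^sup>2 * T) / e\<^sup>2) * h" .
  qed
qed

lemma levy_large:
  fixes R :: "('w, 'v::euclidean_space) process"
  assumes R: "levy_increments R" and e: "e > 0"
  obtains K where "K \<ge> 0" "\<forall>h\<in>{0..T}. prob {\<omega>\<in>space M. norm (R h \<omega>) \<ge> e} \<le> K * h"
proof -
  define d where "d = e / real DIM('v)"
  have d: "d > 0" unfolding d_def using e by simp
  have "\<forall>b. \<exists>K\<ge>0. \<forall>h\<in>{0..T}. prob {\<omega>\<in>space M. \<bar>R h \<omega> \<bullet> b\<bar> \<ge> d} \<le> K * h"
    by (rule allI) (rule levy_large_real[OF levy_component[OF R] d])
  then obtain K where K: "\<forall>b. 0 \<le> K b \<and> (\<forall>h\<in>{0..T}. prob {\<omega>\<in>space M. \<bar>R h \<omega> \<bullet> b\<bar> \<ge> d} \<le> K b * h)"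
    by (rule choice[THEN exE])
  show ?thesis
  proof (rule that[of "\<Sum>b\<in>Basis. K b"])
    show "0 \<le> (\<Sum>b\<in>Basis. K b)" using K by (intro sum_nonneg) blast
    show "\<forall>h\<in>{0..T}. prob {\<omega>\<in>space M. norm (R h \<omega>) \<ge> e} \<le> (\<Sum>b\<in>Basis. K b) * h"
    proof
      fix h assume h: "h \<in> {0..T}"
      have [measurable]: "R h \<in> borel_measurable M" by (rule levy_measurable(2)[OF R]) (use h in auto)
      have "prob {\<omega>\<in>space M. norm (R h \<omega>) \<ge> e} \<le> prob (\<Union>b\<in>Basis. {\<omega>\<in>space M. \<bar>R h \<omega> \<bullet> b\<bar> \<ge> d})"
      proof (rule finite_measure_mono)
        show "{\<omega>\<in>space M. norm (R h \<omega>) \<ge> e} \<subseteq> (\<Union>b\<in>Basis. {\<omega>\<in>space M. \<bar>R h \<omega> \<bullet> b\<bar> \<ge> d})"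
        proof (rule subsetI, rule ccontr)
          fix \<omega> assume w: "\<omega> \<in> {\<omega>\<in>space M. norm (R h \<omega>) \<ge> e}" "\<omega> \<notin> (\<Union>b\<in>Basis. {\<omega>\<in>space M. \<bar>R h \<omega> \<bullet> b\<bar> \<ge> d})"
          have "norm (R h \<omega>) \<le> (\<Sum>b\<in>Basis. \<bar>R h \<omega> \<bullet> b\<bar>)" by (rule norm_le_l1)
          also have "\<dots> < (\<Sum>b\<in>(Basis::'v set). d)" by (rule sum_strict_mono) (use w in \<open>auto simp: not_le\<close>)
          also have "\<dots> = e" unfolding d_def by simp
          finally show False using w by simp
        qed
      qed (intro sets.finite_UN; measurable)
      also have "\<dots> \<le> (\<Sum>b\<in>Basis. prob {\<omega>\<in>space M. \<bar>R h \<omega> \<bullet> b\<bar> \<ge> d})"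
        by (rule finite_measure_subadditive_finite) auto
      also have "\<dots> \<le> (\<Sum>b\<in>Basis. K b * h)" by (rule sum_mono) (use K h in blast)
      also have "\<dots> = (\<Sum>b\<in>Basis. K b) * h" by (simp add: sum_distrib_right)
      finally show "prob {\<omega>\<in>space M. norm (R h \<omega>) \<ge> e} \<le> (\<Sum>b\<in>Basis. K b) * h" .
    qed
  qed
qed

end

lemma finite_jumps_interval:
  fixes f :: "real \<Rightarrow> 'v::real_normed_vector"
  assumes "cadlag_path T f" "e > 0" "0 \<le> s" "t \<le> T"
  shows "finite {u\<in>{s<..t}. norm (path_jump f u) \<ge> e}"
  by (rule finite_subset[OF _ finite_big_jumps[OF assms(1,2)]]) (use assms in auto)

section \<open>Expected sums over the big jumps\<close>

locale levy_jumps = stoch_basis M F T for M :: "'w measure" and F T +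
  fixes R :: "('w, 'v::euclidean_space) process" and e :: real
  assumes levy: "levy_increments R" and e_pos: "e > 0"
begin

definition jump_sum :: "('v \<Rightarrow> real) \<Rightarrow> real \<Rightarrow> real \<Rightarrow> 'w \<Rightarrow> real" where
  "jump_sum g s t \<omega> = (\<Sum>u\<in>{u\<in>{s<..t}. norm (jump R u \<omega>) \<ge> e}. g (jump R u \<omega>))"

text \<open>Continuity makes sums over grid increments converge to sums over jumps, vanishing below
  \<open>e\<close> leaves finitely many jumps, and the range \<open>{0..1}\<close> gives
  \<open>(g x)\<^sup>2 \<le> g x\<close>, hence bounded second moments.\<close>

definition test_fun :: "('v \<Rightarrow> real) \<Rightarrow> bool" where
  "test_fun g \<longleftrightarrow> (\<forall>x. isCont g x) \<and> (\<forall>x. 0 \<le> g x \<and> g x \<le> 1) \<and> (\<forall>x. norm x < e \<longrightarrow> g x = 0)"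

lemma path_cadlag: "\<omega> \<in> space M \<Longrightarrow> cadlag_path T (\<lambda>t. R t \<omega>)"
  by (rule cadlag_adaptedD(1)[OF levy_cadlag[OF levy]])

lemma finite_jumps: "\<omega> \<in> space M \<Longrightarrow> 0 \<le> s \<Longrightarrow> t \<le> T \<Longrightarrow> finite {u\<in>{s<..t}. norm (jump R u \<omega>) \<ge> e}"
  unfolding jump_eq by (rule finite_jumps_interval[OF path_cadlag e_pos])

lemma test_fun_measurable: "test_fun g \<Longrightarrow> g \<in> borel_measurable borel"
  unfolding test_fun_def by (intro borel_measurable_continuous_onI) (auto simp: continuous_on_eq_continuous_at)

lemma test_fun_bdd: "test_fun g \<Longrightarrow> bdd_rv borel g"
  by (rule bdd_rvI[OF test_fun_measurable, where c=1]) (auto simp: test_fun_def)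

definition incr :: "('v \<Rightarrow> real) \<Rightarrow> real \<Rightarrow> real \<Rightarrow> nat \<Rightarrow> nat \<Rightarrow> 'w \<Rightarrow> real" where
  "incr g s h n i \<omega> = g (R (s + real (Suc i) * h / real (Suc n)) \<omega> - R (s + real i * h / real (Suc n)) \<omega>)"

text \<open>The summands are independent with values between 0 and 1 and common mean
  \<open>q\<close>. Squaring their sum gives at most \<open>k * q\<close> from the diagonal and
  \<open>(k * q)\<^sup>2\<close> from the rest. With \<open>q \<le> K * (h / real (Suc n))\<close>
  this is bounded uniformly in the mesh.\<close>

lemma incr_facts:
  assumes g: "test_fun g" and s: "0 \<le> s" "0 < h" "s + h \<le> T" and k: "k \<le> Suc n"
    and K: "\<forall>h\<in>{0..T}. prob {\<omega>\<in>space M. norm (R h \<omega>) \<ge> e} \<le> K * h"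
  defines "S \<equiv> \<lambda>\<omega>. \<Sum>i<k. incr g s h n i \<omega>"
    and "q \<equiv> expectation (\<lambda>\<omega>. g (R (h / real (Suc n)) \<omega>))"
  shows "0 \<le> q" "q \<le> K * (h / real (Suc n))"
    and "bdd_rv (F (s + real k * h / real (Suc n))) S"
    and "A \<in> sets (F s) \<Longrightarrow> expectation (\<lambda>\<omega>. indicat_real A \<omega> * S \<omega>) = prob A * (real k * q)"
    and "expectation (\<lambda>\<omega>. (S \<omega>)\<^sup>2) \<le> real k * q + (real k * q)\<^sup>2"
proof -
  define p where "p i = s + real i * h / real (Suc n)" for i
  have p0: "0 \<le> p i" for i unfolding p_def using s by simp
  have pT: "p i \<le> T" if "i \<le> Suc n" for i
  proof -
    have "real i * h \<le> real (Suc n) * h" using that s by (intro mult_right_mono) auto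
    then have "real i * h / real (Suc n) \<le> h" by (simp add: field_simps)
    then show ?thesis unfolding p_def using s by linarith
  qed
  have pm: "p i \<le> p j" if "i \<le> j" for i j
    unfolding p_def using that s by (simp add: divide_right_mono mult_right_mono)
  have ps: "s \<le> p i" for i unfolding p_def using s by simp
  have step: "p (Suc i) - p i = h / real (Suc n)" for i
  proof -
    have "real (Suc i) * h = real i * h + h" by (simp add: algebra_simps)
    then show ?thesis unfolding p_def by (simp add: add_divide_distrib)
  qed
  have hT: "0 \<le> h / real (Suc n)" "h / real (Suc n) \<le> T"
    using step[of 0] p0[of 0] pT[of 1] pm[of 0 1] by auto
  note gm [measurable] = test_fun_measurable[OF g]
  have D: "incr g s h n i = (\<lambda>\<omega>. g (R (p (Suc i)) \<omega> - R (p i) \<omega>))" for i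
    by (simp add: incr_def p_def fun_eq_iff)
  have Db: "bdd_rv (F (p (Suc i))) (incr g s h n i)" if "i < Suc n" for i
    unfolding D
    by (rule bdd_rv_compose[OF test_fun_bdd[OF g] levy_increment_measurable[OF levy p0 pm order_refl pT]]) (use that in auto)
  have Rm [measurable]: "R (h / real (Suc n)) \<in> borel_measurable M" by (rule levy_measurable(2)[OF levy hT])
  have g01: "0 \<le> g x" "g x \<le> 1" for x using g unfolding test_fun_def by auto
  have gR: "bdd_rv M (\<lambda>\<omega>. g (R (h / real (Suc n)) \<omega>))" by (rule bdd_rv_compose[OF test_fun_bdd[OF g] Rm])
  show q0: "0 \<le> q" unfolding q_def by (intro integral_nonneg_AE AE_I2 g01)
  have "q \<le> expectation (indicat_real {\<omega>\<in>space M. norm (R (h / real (Suc n)) \<omega>) \<ge> e})"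
    unfolding q_def
  proof (rule integral_mono)
    show "g (R (h / real (Suc n)) \<omega>) \<le> indicat_real {\<omega>\<in>space M. norm (R (h / real (Suc n)) \<omega>) \<ge> e} \<omega>" if "\<omega> \<in> space M" for \<omega>
      using g g01 that unfolding test_fun_def by (auto simp: indicator_def not_le)
    have "bdd_rv M (indicat_real {\<omega>\<in>space M. norm (R (h / real (Suc n)) \<omega>) \<ge> e})"
      by (rule bdd_rvI[where c=1], measurable)
    then show "integrable M (indicat_real {\<omega>\<in>space M. norm (R (h / real (Suc n)) \<omega>) \<ge> e})" by (rule bdd_rv_integrable)
  qed (rule bdd_rv_integrable[OF gR])
  also have "\<dots> = prob {\<omega>\<in>space M. norm (R (h / real (Suc n)) \<omega>) \<ge> e}"
    unfolding Bochner_Integration.integral_indicator by (rule arg_cong[where f=prob]) blast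
  also have "\<dots> \<le> K * (h / real (Suc n))"
    by (rule bspec[OF K]) (simp only: atLeastAtMost_iff hT)
  finally show "q \<le> K * (h / real (Suc n))" .
  define Sk where "Sk k \<omega> = (\<Sum>i<k. incr g s h n i \<omega>)" for k \<omega>
  have Sb: "bdd_rv (F (p k)) (Sk k)" if "k \<le> Suc n" for k
    unfolding Sk_def
  proof (rule bdd_rv_sum)
    fix i assume "i \<in> {..<k}"
    then show "bdd_rv (F (p k)) (incr g s h n i)" using that by (intro bdd_rv_F_mono[OF Db] pm) auto
  qed
  then show "bdd_rv (F (s + real k * h / real (Suc n))) S" using k unfolding S_def Sk_def p_def by simp
  have cond: "expectation (\<lambda>\<omega>. Y \<omega> * incr g s h n i \<omega>) = expectation Y * q" if Y: "bdd_rv (F (p i)) Y" and i: "i < Suc n" for Y i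
  proof -
    have "expectation (\<lambda>\<omega>. Y \<omega> * g (R (p (Suc i)) \<omega> - R (p i) \<omega>)) = expectation Y * expectation (\<lambda>\<omega>. g (R (p (Suc i) - p i) \<omega>))"
      by (rule levy_expectation_mult[OF levy p0 pm pT bdd_rv_measurable[OF Y] bdd_rv_integrable[OF bdd_rv_F_M[OF Y]] gm])
        (use i bdd_rv_integrable[OF bdd_rv_F_M[OF Db[OF i]]] in \<open>auto simp: D\<close>)
    then show ?thesis unfolding D q_def step .
  qed
  show "expectation (\<lambda>\<omega>. indicat_real A \<omega> * S \<omega>) = prob A * (real k * q)" if A: "A \<in> sets (F s)"
  proof -
    have Ab: "bdd_rv (F (p i)) (indicat_real A)" for i
      by (rule bdd_rvI[where c=1]) (use A sets_F_mono[OF ps[of i]] in \<open>auto simp: indicator_def\<close>)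
    have AM: "A \<in> sets M" using A sets_F_M by blast
    have "expectation (\<lambda>\<omega>. indicat_real A \<omega> * S \<omega>) = (\<Sum>i<k. expectation (\<lambda>\<omega>. indicat_real A \<omega> * incr g s h n i \<omega>))"
      unfolding S_def sum_distrib_left
      by (rule Bochner_Integration.integral_sum)
         (use k in \<open>auto intro!: bdd_rv_integrable bdd_rv_mult bdd_rv_F_M[OF Db] bdd_rv_F_M[OF Ab]\<close>)
    also have "\<dots> = (\<Sum>i<k. prob A * q)"
      by (rule sum.cong) (use k cond[OF Ab] AM in auto)
    finally show ?thesis by simp
  qed
  have mean: "expectation (Sk k) = real k * q" if "k \<le> Suc n" for k
  proof -
    have "expectation (Sk k) = (\<Sum>i<k. expectation (incr g s h n i))"
      unfolding Sk_def by (rule Bochner_Integration.integral_sum) (use that in \<open>auto intro!: bdd_rv_integrable bdd_rv_F_M[OF Db]\<close>)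
    also have "\<dots> = (\<Sum>i<k. q)"
      by (rule sum.cong) (use that cond[OF bdd_rv_const[of _ 1]] in \<open>auto simp: prob_space\<close>)
    finally show ?thesis by simp
  qed
  have "expectation (\<lambda>\<omega>. (Sk k \<omega>)\<^sup>2) \<le> real k * q + (real k * q)\<^sup>2" if "k \<le> Suc n" for k
    using that
  proof (induction k)
    case (Suc k)
    let ?D = "incr g s h n k"
    have k: "k < Suc n" "k \<le> Suc n" using Suc.prems by auto
    note b = bdd_rv_F_M[OF Sb[OF k(2)]] bdd_rv_F_M[OF Db[OF k(1)]]
    have i: "integrable M (\<lambda>\<omega>. (Sk k \<omega>)\<^sup>2)" "integrable M (\<lambda>\<omega>. Sk k \<omega> * ?D \<omega>)" "integrable M (\<lambda>\<omega>. (?D \<omega>)\<^sup>2)" "integrable M ?D"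
      by (intro bdd_rv_integrable bdd_rv_intros b)+
    have "expectation (\<lambda>\<omega>. (?D \<omega>)\<^sup>2) \<le> expectation ?D"
      by (rule integral_mono[OF i(3,4)]) (use g01 in \<open>auto simp: D power2_eq_square intro!: mult_left_le\<close>)
    also have "\<dots> = q" using cond[OF bdd_rv_const[of _ 1] k(1)] by (simp add: prob_space)
    finally have D2: "expectation (\<lambda>\<omega>. (?D \<omega>)\<^sup>2) \<le> q" .
    have "expectation (\<lambda>\<omega>. (Sk (Suc k) \<omega>)\<^sup>2) = expectation (\<lambda>\<omega>. (Sk k \<omega>)\<^sup>2 + 2 * (Sk k \<omega> * ?D \<omega>) + (?D \<omega>)\<^sup>2)"
      by (rule Bochner_Integration.integral_cong) (simp_all add: Sk_def power2_sum algebra_simps)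
    also have "\<dots> = expectation (\<lambda>\<omega>. (Sk k \<omega>)\<^sup>2) + 2 * expectation (\<lambda>\<omega>. Sk k \<omega> * ?D \<omega>) + expectation (\<lambda>\<omega>. (?D \<omega>)\<^sup>2)"
      using i by simp
    also have "expectation (\<lambda>\<omega>. Sk k \<omega> * ?D \<omega>) = real k * q * q" using cond[OF Sb[OF k(2)] k(1)] mean[OF k(2)] by simp
    finally have "expectation (\<lambda>\<omega>. (Sk (Suc k) \<omega>)\<^sup>2) \<le> (real k * q + (real k * q)\<^sup>2) + 2 * (real k * q * q) + q"
      using Suc.IH[OF k(2)] D2 by linarith
    also have "\<dots> \<le> real (Suc k) * q + (real (Suc k) * q)\<^sup>2"
      by (simp add: power2_eq_square algebra_simps)
    finally show ?case .
  qed (simp add: Sk_def)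
  then show "expectation (\<lambda>\<omega>. (S \<omega>)\<^sup>2) \<le> real k * q + (real k * q)\<^sup>2" using k unfolding S_def Sk_def by simp
qed

lemma jump_sum_limit:
  assumes g: "test_fun g" and s: "0 \<le> s" "0 < h" "s + h \<le> T" and w: "\<omega> \<in> space M"
  shows "(\<lambda>n. \<Sum>i<Suc n. incr g s h n i \<omega>) \<longlonglongrightarrow> jump_sum g s (s + h) \<omega>"
  unfolding incr_def jump_sum_def jump_eq
  by (rule discretize_jump_sum[OF path_cadlag[OF w] e_pos _ _ s]) (use g in \<open>auto simp: test_fun_def\<close>)

lemma jump_sum_empty: "jump_sum g s s = (\<lambda>_. 0)"
  by (simp add: jump_sum_def fun_eq_iff)

lemma jump_sum_add:
  assumes "\<omega> \<in> space M" "0 \<le> s" "s \<le> t" "t \<le> v" "v \<le> T"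
  shows "jump_sum g s v \<omega> = jump_sum g s t \<omega> + jump_sum g t v \<omega>"
proof -
  have eq: "{u\<in>{s<..v}. norm (jump R u \<omega>) \<ge> e} = {u\<in>{s<..t}. norm (jump R u \<omega>) \<ge> e} \<union> {u\<in>{t<..v}. norm (jump R u \<omega>) \<ge> e}"
    using assms by auto
  show ?thesis unfolding jump_sum_def eq by (rule sum.union_disjoint) (use finite_jumps assms in auto)
qed

text \<open>The sequence \<open>a\<close> involves neither \<open>s\<close> nor \<open>A\<close>. In
  the limit, the expected sum over a time window depends only on its length and does not feel the
  past; this is the compensation formula on one window. The bound \<open>K * h\<close> does not
  involve \<open>g\<close>, which permits monotone limits in \<open>g\<close> later.\<close>

lemma jump_sum_expectation_aux:
  assumes g: "test_fun g" and s: "0 \<le> s" "0 < h" "s + h \<le> T"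
    and K: "K \<ge> 0" "\<forall>h\<in>{0..T}. prob {\<omega>\<in>space M. norm (R h \<omega>) \<ge> e} \<le> K * h"
  defines "a \<equiv> \<lambda>n. real (Suc n) * expectation (\<lambda>\<omega>. g (R (h / real (Suc n)) \<omega>))"
  shows "integrable M (jump_sum g s (s + h))"
    and "A \<in> sets (F s) \<Longrightarrow> (\<lambda>n. prob A * a n) \<longlonglongrightarrow> expectation (\<lambda>\<omega>. indicat_real A \<omega> * jump_sum g s (s + h) \<omega>)"
    and "0 \<le> a n" "a n \<le> K * h"
proof -
  note facts = incr_facts[OF g s order_refl K(2)]
  show a0: "0 \<le> a n" for n unfolding a_def using facts(1)[of n] by simp
  have "a n \<le> real (Suc n) * (K * (h / real (Suc n)))" for n
    unfolding a_def by (rule mult_left_mono[OF facts(2)]) simp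
  also have "real (Suc n) * (K * (h / real (Suc n))) = K * h" for n by simp
  finally show aK: "a n \<le> K * h" for n .
  have "expectation (\<lambda>\<omega>. (\<Sum>i<Suc n. incr g s h n i \<omega>)\<^sup>2) \<le> K * h + (K * h)\<^sup>2" for n
    using facts(5)[of n] aK[of n] power_mono[OF aK[of n] a0[of n], of 2] unfolding a_def by linarith
  note lim = second_moment_limit[OF bdd_rv_F_M[OF facts(3)] _ this jump_sum_limit[OF g s]]
  have nn: "0 \<le> (\<Sum>i<Suc n. incr g s h n i \<omega>)" for n \<omega>
    by (rule sum_nonneg) (use g in \<open>auto simp: incr_def test_fun_def\<close>)
  show "integrable M (jump_sum g s (s + h))"
    by (rule lim(1)[OF nn, where Y="\<lambda>_. 0"]) auto
  assume A: "A \<in> sets (F s)"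
  then have AM: "A \<in> sets M" using sets_F_M by blast
  have "(\<lambda>n. expectation (\<lambda>\<omega>. indicat_real A \<omega> * (\<Sum>i<Suc n. incr g s h n i \<omega>))) \<longlonglongrightarrow> expectation (\<lambda>\<omega>. indicat_real A \<omega> * jump_sum g s (s + h) \<omega>)"
    by (rule lim(2)[OF nn]) (use AM in \<open>auto simp: indicator_def\<close>)
  then show "(\<lambda>n. prob A * a n) \<longlonglongrightarrow> expectation (\<lambda>\<omega>. indicat_real A \<omega> * jump_sum g s (s + h) \<omega>)"
    unfolding facts(4)[OF A] a_def .
qed

text \<open>The expectation over a window of length \<open>x\<close> is additive in
  \<open>x\<close>, as jump sums add up and windows may be shifted, and nonnegative, hence linear by
  \<open>additive_imp_linear\<close>.\<close>

lemma jump_sum_expectation: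
  assumes g: "test_fun g" and st: "0 \<le> s" "s \<le> t" "t \<le> T"
    and K: "K \<ge> 0" "\<forall>h\<in>{0..T}. prob {\<omega>\<in>space M. norm (R h \<omega>) \<ge> e} \<le> K * h"
  shows "integrable M (jump_sum g s t)"
    and "A \<in> sets (F s) \<Longrightarrow> expectation (\<lambda>\<omega>. indicat_real A \<omega> * jump_sum g s t \<omega>) = prob A * ((t - s) / T * expectation (jump_sum g 0 T))"
    and "expectation (jump_sum g 0 T) \<le> K * T"
proof -
  note aux = jump_sum_expectation_aux[OF g _ _ _ K]
  define a where "a h n = real (Suc n) * expectation (\<lambda>\<omega>. g (R (h / real (Suc n)) \<omega>))" for h n
  have whole: "expectation (\<lambda>\<omega>. indicat_real (space M) \<omega> * U \<omega>) = expectation U" for U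
    by (rule Bochner_Integration.integral_cong) auto
  have top: "space M \<in> sets (F s)" for s using sets.top[of "F s"] by simp
  have lim: "a h \<longlonglongrightarrow> expectation (jump_sum g s (s + h))" if "0 \<le> s" "0 < h" "s + h \<le> T" for s h
    using aux(2)[OF that top] unfolding whole a_def by (simp add: prob_space)
  have int: "integrable M (jump_sum g s t)" if "0 \<le> s" "s \<le> t" "t \<le> T" for s t
    using aux(1)[of s "t - s"] that by (cases "s = t") (auto simp: jump_sum_empty)
  show "integrable M (jump_sum g s t)" by (rule int[OF st])
  show "expectation (jump_sum g 0 T) \<le> K * T"
    using lim[of 0 T] aux(4)[of 0 T] T_pos by (intro LIMSEQ_le_const2[of "a T"]) (auto simp: a_def)
  define G where "G x = expectation (jump_sum g 0 x)" for x
  have shift: "expectation (jump_sum g s (s + h)) = G h" if "0 \<le> s" "0 \<le> h" "s + h \<le> T" for s h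
  proof (cases "h = 0")
    case True
    then show ?thesis by (simp add: G_def jump_sum_empty)
  next
    case False
    with that LIMSEQ_unique[OF lim[of s h] lim[of 0 h]] show ?thesis unfolding G_def by simp
  qed
  have "G (x + y) = G x + G y" if "0 \<le> x" "0 \<le> y" "x + y \<le> T" for x y
  proof -
    have "G (x + y) = expectation (\<lambda>\<omega>. jump_sum g 0 x \<omega> + jump_sum g x (x + y) \<omega>)"
      unfolding G_def by (rule Bochner_Integration.integral_cong) (use that jump_sum_add[of _ 0 x "x + y"] in auto)
    also have "\<dots> = G x + expectation (jump_sum g x (x + y))"
      unfolding G_def by (rule Bochner_Integration.integral_add) (use int that in auto)
    finally show ?thesis using shift that by simp
  qed
  moreover have "0 \<le> G x" for x
    unfolding G_def by (rule integral_nonneg_AE) (use g in \<open>auto simp: jump_sum_def test_fun_def intro!: AE_I2 sum_nonneg\<close>)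
  ultimately have linear: "G x = x / T * G T" if "0 \<le> x" "x \<le> T" for x
    using that T_pos by (intro additive_imp_linear) auto
  assume A: "A \<in> sets (F s)"
  show "expectation (\<lambda>\<omega>. indicat_real A \<omega> * jump_sum g s t \<omega>) = prob A * ((t - s) / T * expectation (jump_sum g 0 T))"
  proof (cases "s = t")
    case True
    then show ?thesis by (simp add: jump_sum_empty)
  next
    case False
    then have h: "0 < t - s" "s + (t - s) \<le> T" using st by auto
    have "(\<lambda>n. prob A * a (t - s) n) \<longlonglongrightarrow> prob A * G (t - s)"
      using lim[OF st(1) h] shift[of s "t - s"] st by (intro tendsto_mult tendsto_const) simp
    from LIMSEQ_unique[OF aux(2)[OF st(1) h A, folded a_def] this]
    show ?thesis using linear[of "t - s"] st unfolding G_def by simp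
  qed
qed

text \<open>The indicator of an open set is the increasing limit of the functions
  \<open>min 1 (real j * infdist x (- U))\<close>, which are test functions because \<open>U\<close>
  keeps away from the ball of radius \<open>e\<close>. Open sets suffice: they are stable under
  intersection and generate the Borel sets.\<close>

lemma jump_sum_expectation_open:
  assumes U: "open U" "U \<subseteq> {x. norm x > e}" and st: "0 \<le> s" "s \<le> t" "t \<le> T"
    and K: "K \<ge> 0" "\<forall>h\<in>{0..T}. prob {\<omega>\<in>space M. norm (R h \<omega>) \<ge> e} \<le> K * h"
  shows "integrable M (jump_sum (indicat_real U) s t)"
    and "A \<in> sets (F s) \<Longrightarrow> expectation (\<lambda>\<omega>. indicat_real A \<omega> * jump_sum (indicat_real U) s t \<omega>)
      = prob A * ((t - s) / T * expectation (jump_sum (indicat_real U) 0 T))"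
proof -
  define g where "g j x = min 1 (real j * infdist x (- U))" for j x
  have "(0::'v) \<notin> U" using U(2) e_pos by auto
  then have ne: "- U \<noteq> {}" by blast
  have g: "test_fun (g j)" for j
    unfolding test_fun_def
  proof (intro conjI allI impI)
    show "isCont (g j) x" for x unfolding g_def by (intro continuous_intros)
    show "0 \<le> g j x" "g j x \<le> 1" for x unfolding g_def by (auto simp: infdist_nonneg)
    fix x :: 'v assume "norm x < e"
    then have "x \<in> - U" using U(2) by force
    then show "g j x = 0" unfolding g_def by simp
  qed
  have mono: "g i x \<le> g j x" if "i \<le> j" for i j x
    unfolding g_def using that by (intro min.mono order_refl mult_right_mono infdist_nonneg) auto
  have lim: "(\<lambda>j. g j x) \<longlonglongrightarrow> indicat_real U x" for x
  proof (cases "x \<in> U")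
    case True
    then have p: "infdist x (- U) > 0" using U(1) ne by (intro infdist_pos_not_in_closed) auto
    obtain n where n: "1 < real n * infdist x (- U)" using reals_Archimedean3[OF p] by blast
    have "\<forall>\<^sub>F j in sequentially. g j x = 1"
      unfolding eventually_sequentially
    proof (intro exI[of _ n] allI impI)
      fix j assume "n \<le> j"
      then have "real n * infdist x (- U) \<le> real j * infdist x (- U)" using p by (intro mult_right_mono) auto
      then show "g j x = 1" unfolding g_def using n by auto
    qed
    then show ?thesis using True by (simp add: tendsto_eventually)
  next
    case False
    then show ?thesis unfolding g_def by simp
  qed
  note E = jump_sum_expectation[OF g _ _ _ K]
  have g01: "0 \<le> g j x" for j x unfolding g_def by (simp add: infdist_nonneg)
  have jmono: "jump_sum (g i) s t \<omega> \<le> jump_sum (g j) s t \<omega>" if "i \<le> j" for i j s t \<omega>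
    unfolding jump_sum_def by (intro sum_mono mono that)
  have jlim: "(\<lambda>j. jump_sum (g j) s t \<omega>) \<longlonglongrightarrow> jump_sum (indicat_real U) s t \<omega>" for s t \<omega>
    unfolding jump_sum_def by (intro tendsto_sum lim)
  have jnn: "0 \<le> jump_sum (g j) s t \<omega>" for j s t \<omega> unfolding jump_sum_def by (intro sum_nonneg g01)
  have T0: "0 \<le> T" using T_pos by simp
  define \<gamma> where "\<gamma> j = expectation (jump_sum (g j) 0 T)" for j
  have "incseq \<gamma>"
    unfolding \<gamma>_def incseq_def
    by (intro allI impI integral_mono E(1)[OF order_refl T0 order_refl] jmono)
  moreover have "\<forall>j. \<gamma> j \<le> K * T" unfolding \<gamma>_def by (intro allI E(3)[OF order_refl T0 order_refl])
  ultimately obtain G where G: "\<gamma> \<longlonglongrightarrow> G" by (rule incseq_convergent) blast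
  have main: "integrable M (\<lambda>\<omega>. indicat_real A \<omega> * jump_sum (indicat_real U) s t \<omega>)"
    "expectation (\<lambda>\<omega>. indicat_real A \<omega> * jump_sum (indicat_real U) s t \<omega>) = prob A * ((t - s) / T * G)"
    if st: "0 \<le> s" "s \<le> t" "t \<le> T" and A: "A \<in> sets (F s)" for s t A
  proof -
    have AM [measurable]: "A \<in> sets M" using A sets_F_M by blast
    have i: "integrable M (\<lambda>\<omega>. indicat_real A \<omega> * jump_sum (g j) s t \<omega>)" for j
      using integrable_mult_indicator[OF AM E(1)[OF st]] by simp
    have l: "(\<lambda>j. indicat_real A \<omega> * jump_sum (g j) s t \<omega>) \<longlonglongrightarrow> indicat_real A \<omega> * jump_sum (indicat_real U) s t \<omega>" for \<omega>
      by (intro tendsto_mult tendsto_const jlim)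
    have l2: "(\<lambda>j. expectation (\<lambda>\<omega>. indicat_real A \<omega> * jump_sum (g j) s t \<omega>)) \<longlonglongrightarrow> prob A * ((t - s) / T * G)"
      unfolding E(2)[OF st A] using G unfolding \<gamma>_def by (intro tendsto_mult tendsto_const)
    have m: "(\<lambda>\<omega>. indicat_real A \<omega> * jump_sum (indicat_real U) s t \<omega>) \<in> borel_measurable M"
      by (rule borel_measurable_LIMSEQ_real[OF l]) (rule borel_measurable_integrable[OF i])
    have AE1: "AE \<omega> in M. mono (\<lambda>j. indicat_real A \<omega> * jump_sum (g j) s t \<omega>)"
      by (intro AE_I2 monoI mult_left_mono jmono) auto
    have AE2: "AE \<omega> in M. 0 \<le> indicat_real A \<omega> * jump_sum (g j) s t \<omega>" for j
      by (intro AE_I2 mult_nonneg_nonneg jnn) auto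
    note mc = integral_monotone_convergence_nonneg[OF i AE1 AE2 AE_I2[OF l] l2 m]
    show "integrable M (\<lambda>\<omega>. indicat_real A \<omega> * jump_sum (indicat_real U) s t \<omega>)" by (rule mc(1))
    show "expectation (\<lambda>\<omega>. indicat_real A \<omega> * jump_sum (indicat_real U) s t \<omega>) = prob A * ((t - s) / T * G)" by (rule mc(2))
  qed
  have whole: "expectation (\<lambda>\<omega>. indicat_real (space M) \<omega> * V \<omega>) = expectation V"
    "integrable M (\<lambda>\<omega>. indicat_real (space M) \<omega> * V \<omega>) = integrable M V" for V
    by (rule Bochner_Integration.integral_cong Bochner_Integration.integrable_cong; simp)+
  have top: "space M \<in> sets (F s)" for s using sets.top[of "F s"] by simp
  show "integrable M (jump_sum (indicat_real U) s t)" using main(1)[OF st top] unfolding whole .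
  have "expectation (jump_sum (indicat_real U) 0 T) = G"
    using main(2)[OF order_refl T0 order_refl top] T_pos unfolding whole by (simp add: prob_space)
  then show "A \<in> sets (F s) \<Longrightarrow> expectation (\<lambda>\<omega>. indicat_real A \<omega> * jump_sum (indicat_real U) s t \<omega>)
      = prob A * ((t - s) / T * expectation (jump_sum (indicat_real U) 0 T))"
    using main(2)[OF st] by simp
qed

end

section \<open>Counting jumps and the compensation formula\<close>

context levy_jumps
begin

text \<open>The inequality is strict, in contrast to \<open>jump_sum\<close>: the region beyond
  \<open>e\<close> is then open, and \<open>jump_sum_expectation_open\<close> applies to its
  intersection with any open set.\<close>

definition big_jumps :: "'w \<Rightarrow> real set" where
  "big_jumps \<omega> = {u\<in>{0<..T}. norm (jump R u \<omega>) > e}"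

definition jump_count :: "((real \<times> 'w) \<times> 'v) set \<Rightarrow> 'w \<Rightarrow> ennreal" where
  "jump_count W \<omega> = (\<Sum>u\<in>big_jumps \<omega>. indicator W ((u, \<omega>), jump R u \<omega>))"

lemma finite_big_jumps_set: "\<omega> \<in> space M \<Longrightarrow> finite (big_jumps \<omega>)"
  by (rule finite_subset[OF _ finite_jumps[of \<omega> 0 T]]) (auto simp: big_jumps_def)

lemma jump_count_interval:
  assumes w: "\<omega> \<in> space M" and st: "0 \<le> s" "s \<le> t" "t \<le> T"
  shows "jump_count (({s<..t} \<times> A) \<times> B) \<omega> = ennreal (indicat_real A \<omega> * jump_sum (indicat_real (B \<inter> {x. norm x > e})) s t \<omega>)"
proof -
  let ?D = "{u\<in>{0<..T}. norm (jump R u \<omega>) \<ge> e}"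
  let ?U = "B \<inter> {x. norm x > e}"
  define h where "h u = ennreal (indicat_real A \<omega> * (indicat_real {s<..t} u * indicat_real ?U (jump R u \<omega>)))" for u
  have fin: "finite ?D" by (rule finite_jumps[OF w]) simp_all
  have "jump_count (({s<..t} \<times> A) \<times> B) \<omega> = (\<Sum>u\<in>?D. h u)"
    unfolding jump_count_def
    by (rule sum.mono_neutral_cong_left[OF fin]) (auto simp: big_jumps_def h_def indicator_def)
  also have "\<dots> = (\<Sum>u\<in>{u\<in>{s<..t}. norm (jump R u \<omega>) \<ge> e}. ennreal (indicat_real A \<omega> * indicat_real ?U (jump R u \<omega>)))"
    by (rule sum.mono_neutral_cong_right[OF fin]) (use st in \<open>auto simp: h_def indicator_def\<close>)
  also have "\<dots> = ennreal (indicat_real A \<omega> * jump_sum (indicat_real ?U) s t \<omega>)"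
    unfolding jump_sum_def sum_distrib_left by (rule sum_ennreal) simp
  finally show ?thesis .
qed

lemma jump_count_zero: "jump_count (({0} \<times> A) \<times> B) \<omega> = 0"
  unfolding jump_count_def by (rule sum.neutral) (auto simp: big_jumps_def)

lemma jump_count_space:
  "\<omega> \<in> space M \<Longrightarrow> jump_count ((({0..T} \<times> space M)) \<times> B) \<omega> = jump_count (({0<..T} \<times> space M) \<times> B) \<omega>"
  unfolding jump_count_def by (rule sum.cong) (auto simp: big_jumps_def indicator_def)

lemma jump_count_compl:
  assumes "\<omega> \<in> space M" "W \<subseteq> ({0..T} \<times> space M) \<times> UNIV"
  shows "jump_count ((({0..T} \<times> space M) \<times> UNIV) - W) \<omega> + jump_count W \<omega> = jump_count (({0..T} \<times> space M) \<times> UNIV) \<omega>"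
  unfolding jump_count_def sum.distrib[symmetric]
  by (rule sum.cong) (use assms in \<open>auto simp: big_jumps_def indicator_def\<close>)

lemma jump_count_UN:
  assumes "disjoint_family W"
  shows "jump_count (\<Union>i. W i) \<omega> = (\<Sum>i. jump_count (W i) \<omega>)"
  unfolding jump_count_def by (subst suminf_sum) (auto simp: suminf_indicator[OF assms])

lemma jump_count_finite: "jump_count W \<omega> < \<infinity>"
  unfolding jump_count_def by (cases "finite (big_jumps \<omega>)") (auto simp: indicator_def of_nat_less_top)

definition jump_gen :: "((real \<times> 'w) \<times> 'v) set set" where
  "jump_gen = {E \<times> B | E B. E \<in> pred_gen \<and> B \<in> {B. open B}}"

lemma jump_gen_Pow: "jump_gen \<subseteq> Pow (({0..T} \<times> space M) \<times> UNIV)"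
  unfolding jump_gen_def using pred_gen_Pow by auto

lemma jump_gen_Int_stable: "Int_stable jump_gen"
proof (rule Int_stableI)
  fix a b assume "a \<in> jump_gen" "b \<in> jump_gen"
  then obtain E B E' B' where *: "a = E \<times> B" "b = E' \<times> B'" "E \<in> pred_gen" "E' \<in> pred_gen" "open B" "open B'"
    unfolding jump_gen_def by blast
  then have "E \<inter> E' \<in> pred_gen" using Int_stable_pred_gen unfolding Int_stable_def by blast
  then show "a \<inter> b \<in> jump_gen" unfolding jump_gen_def using * by (auto simp: Times_Int_Times)
qed

lemma jump_gen_sets: "sets (PS \<Otimes>\<^sub>M (borel :: 'v measure)) = sigma_sets (({0..T} \<times> space M) \<times> UNIV) jump_gen"
proof -
  have top: "space M \<in> sets (F s)" for s using sets.top[of "F s"] by simp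
  have "sets (PS \<Otimes>\<^sub>M (borel :: 'v measure)) = sets (sigma (space PS \<times> space borel) {a \<times> b | a b. a \<in> pred_gen \<and> b \<in> {B :: 'v set. open B}})"
  proof (rule sets_pair_eq)
    show "pred_gen \<subseteq> Pow (space PS)" "sets PS = sigma_sets (space PS) pred_gen"
      using pred_gen_Pow sets_PS by simp_all
    show "countable {{0} \<times> space M, {0<..T} \<times> space M}" by simp
    show "{{0} \<times> space M, {0<..T} \<times> space M} \<subseteq> pred_gen"
      using pred_gen_interval[of 0 T, OF _ _ _ top] T_pos top unfolding pred_gen_def by auto
    show "\<Union>{{0} \<times> space M, {0<..T} \<times> space M} = space PS" using T_pos by auto
    show "countable {UNIV :: 'v set}" "{UNIV :: 'v set} \<subseteq> {B. open B}" "\<Union>{UNIV :: 'v set} = space borel"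
      "{B :: 'v set. open B} \<subseteq> Pow (space borel)" by auto
    show "sets (borel :: 'v measure) = sigma_sets (space borel) {B. open B}" by (simp add: sets_borel)
  qed
  then show ?thesis using jump_gen_Pow by (simp add: jump_gen_def sets_measure_of)
qed

lemma jump_count_rect_measurable:
  assumes "W \<in> jump_gen"
  shows "jump_count W \<in> borel_measurable M"
proof -
  obtain K where K: "K \<ge> 0" "\<forall>h\<in>{0..T}. prob {\<omega>\<in>space M. norm (R h \<omega>) \<ge> e} \<le> K * h"
    by (rule levy_large[OF levy e_pos])
  obtain E B where W: "W = E \<times> B" "E \<in> pred_gen" "open B" using assms unfolding jump_gen_def by blast
  consider A where "E = {0} \<times> A" "A \<in> sets (F 0)" | s t A where "E = {s<..t} \<times> A" "0 \<le> s" "s \<le> t" "t \<le> T" "A \<in> sets (F s)"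
    using W(2) unfolding pred_gen_def by blast
  then show ?thesis
  proof cases
    case 1
    then show ?thesis unfolding W by (simp add: jump_count_zero[abs_def])
  next
    case 2
    have U: "open (B \<inter> {x. norm x > e})" "B \<inter> {x. norm x > e} \<subseteq> {x. norm x > e}"
      using W(3) by (auto intro!: open_Int open_Collect_less continuous_intros)
    have [measurable]: "jump_sum (indicat_real (B \<inter> {x. norm x > e})) s t \<in> borel_measurable M"
      by (rule borel_measurable_integrable[OF jump_sum_expectation_open(1)[OF U 2(2-4) K]])
    have [measurable]: "A \<in> sets M" using 2(5) sets_F_M by blast
    have "(\<lambda>\<omega>. ennreal (indicat_real A \<omega> * jump_sum (indicat_real (B \<inter> {x. norm x > e})) s t \<omega>)) \<in> borel_measurable M"
      by measurable
    then show ?thesis unfolding W 2(1)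
      by (subst measurable_cong[OF jump_count_interval[OF _ 2(2-4)]])
  qed
qed

lemma jump_count_all_measurable: "jump_count (({0..T} \<times> space M) \<times> B) \<in> borel_measurable M" if "open B"
proof -
  have "({0<..T} \<times> space M) \<times> B \<in> jump_gen"
    unfolding jump_gen_def using pred_gen_interval[of 0 T "space M"] sets.top[of "F 0"] T_pos that by auto
  from jump_count_rect_measurable[OF this] show ?thesis
    by (subst measurable_cong[OF jump_count_space])
qed

lemma jump_count_measurable:
  assumes "W \<in> sets (PS \<Otimes>\<^sub>M borel)"
  shows "jump_count W \<in> borel_measurable M"
  using jump_gen_Int_stable jump_gen_Pow assms[unfolded jump_gen_sets]
proof (induction rule: sigma_sets_induct_disjoint)
  case (basic A)
  then show ?case by (rule jump_count_rect_measurable)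
next
  case empty
  then show ?case by (simp add: jump_count_def)
next
  case (compl A)
  have sub: "A \<subseteq> ({0..T} \<times> space M) \<times> UNIV" using sigma_sets_into_sp[OF jump_gen_Pow compl(1)] .
  have "jump_count (({0..T} \<times> space M) \<times> UNIV - A) \<omega> = jump_count (({0..T} \<times> space M) \<times> UNIV) \<omega> - jump_count A \<omega>" if "\<omega> \<in> space M" for \<omega>
    using jump_count_compl[OF that sub] jump_count_finite[of A \<omega>] by (metis ennreal_add_diff_cancel_right infinity_ennreal_def less_irrefl)
  moreover have "(\<lambda>\<omega>. jump_count (({0..T} \<times> space M) \<times> UNIV) \<omega> - jump_count A \<omega>) \<in> borel_measurable M"
    by (intro borel_measurable_minus_ennreal jump_count_all_measurable compl) simp
  ultimately show ?case by (subst measurable_cong)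
next
  case (union A)
  then show ?case unfolding jump_count_UN[OF union(1), abs_def] by (intro borel_measurable_suminf_order) auto
qed

lemma rect_sets: "B \<in> sets borel \<Longrightarrow> ({0..T} \<times> space M) \<times> B \<in> sets (PS \<Otimes>\<^sub>M borel)"
  using pair_measureI[OF sets.top[of PS], of B borel] by simp

text \<open>Up to the factor \<open>T\<close>, this is the Levy measure restricted to \<open>{x. norm x > e}\<close>.\<close>

definition jump_law :: "'v measure" where
  "jump_law = measure_of UNIV (sets borel) (\<lambda>B. \<integral>\<^sup>+\<omega>. jump_count (({0..T} \<times> space M) \<times> B) \<omega> \<partial>M)"

lemma sets_jump_law [simp, measurable_cong]: "sets jump_law = sets borel"
  unfolding jump_law_def using sets.sigma_sets_eq[of "borel :: 'v measure"] by simp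

lemma space_jump_law [simp]: "space jump_law = UNIV"
  unfolding jump_law_def by simp

lemma emeasure_jump_law:
  assumes "B \<in> sets borel"
  shows "emeasure jump_law B = (\<integral>\<^sup>+\<omega>. jump_count (({0..T} \<times> space M) \<times> B) \<omega> \<partial>M)"
proof (rule emeasure_measure_of[OF jump_law_def])
  show "sets borel \<subseteq> Pow (UNIV :: 'v set)" by simp
  show "B \<in> sets jump_law" using assms by simp
  show "positive (sets jump_law) (\<lambda>B. \<integral>\<^sup>+\<omega>. jump_count (({0..T} \<times> space M) \<times> B) \<omega> \<partial>M)"
    by (simp add: positive_def jump_count_def)
  show "countably_additive (sets jump_law) (\<lambda>B. \<integral>\<^sup>+\<omega>. jump_count (({0..T} \<times> space M) \<times> B) \<omega> \<partial>M)"
    unfolding sets_jump_law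
  proof (rule countably_additiveI)
    fix B :: "nat \<Rightarrow> 'v set" assume B: "range B \<subseteq> sets borel" "disjoint_family B"
    have d: "disjoint_family (\<lambda>i. ({0..T} \<times> space M) \<times> B i)" using B(2) unfolding disjoint_family_on_def by blast
    have eq: "({0..T} \<times> space M) \<times> (\<Union>i. B i) = (\<Union>i. ({0..T} \<times> space M) \<times> B i)" by blast
    have m: "jump_count (({0..T} \<times> space M) \<times> B i) \<in> borel_measurable M" for i
      by (rule jump_count_measurable[OF rect_sets]) (use B in blast)
    show "(\<Sum>i. \<integral>\<^sup>+\<omega>. jump_count (({0..T} \<times> space M) \<times> B i) \<omega> \<partial>M) = (\<integral>\<^sup>+\<omega>. jump_count (({0..T} \<times> space M) \<times> (\<Union>i. B i)) \<omega> \<partial>M)"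
      unfolding eq jump_count_UN[OF d] by (rule nn_integral_suminf[symmetric, OF m])
  qed
qed

lemma jump_law_open:
  assumes B: "open B"
  shows "emeasure jump_law B = ennreal (expectation (jump_sum (indicat_real (B \<inter> {x. norm x > e})) 0 T))"
proof -
  obtain K where K: "K \<ge> 0" "\<forall>h\<in>{0..T}. prob {\<omega>\<in>space M. norm (R h \<omega>) \<ge> e} \<le> K * h"
    by (rule levy_large[OF levy e_pos])
  have U: "open (B \<inter> {x. norm x > e})" "B \<inter> {x. norm x > e} \<subseteq> {x. norm x > e}"
    using B by (auto intro!: open_Int open_Collect_less continuous_intros)
  have T0: "0 \<le> T" using T_pos by simp
  have "emeasure jump_law B = (\<integral>\<^sup>+\<omega>. ennreal (jump_sum (indicat_real (B \<inter> {x. norm x > e})) 0 T \<omega>) \<partial>M)"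
    unfolding emeasure_jump_law[OF borel_open[OF B]]
    by (rule nn_integral_cong) (simp add: jump_count_space jump_count_interval T0)
  also have "\<dots> = ennreal (expectation (jump_sum (indicat_real (B \<inter> {x. norm x > e})) 0 T))"
    by (rule nn_integral_eq_integral[OF jump_sum_expectation_open(1)[OF U order_refl T0 order_refl K]])
       (auto simp: jump_sum_def intro!: AE_I2 sum_nonneg)
  finally show ?thesis .
qed

lemma finite_jump_law: "finite_measure jump_law"
  by (rule finite_measureI) (simp add: jump_law_open)

lemma Q_rect:
  assumes "S \<in> sets borel" "S \<subseteq> {0..T}" "A \<in> sets M"
  shows "S \<times> A \<in> sets Q" "emeasure Q (S \<times> A) = emeasure lborel S * emeasure M A"
proof -
  have S: "S \<in> sets (restrict_space lborel {0..T})" using assms by (simp add: sets_restrict_space_iff)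
  show "S \<times> A \<in> sets Q" unfolding Q_def by (rule pair_measureI[OF S assms(3)])
  show "emeasure Q (S \<times> A) = emeasure lborel S * emeasure M A"
    unfolding Q_def emeasure_pair_measure_Times[OF S assms(3)] using assms by (simp add: emeasure_restrict_space)
qed

lemma jump_section_measurable:
  "W \<in> sets (PS \<Otimes>\<^sub>M borel) \<Longrightarrow> (\<lambda>z. emeasure jump_law (Pair z -` W)) \<in> borel_measurable Q"
proof -
  assume W: "W \<in> sets (PS \<Otimes>\<^sub>M borel)"
  interpret J: finite_measure jump_law by (rule finite_jump_law)
  have "sets (PS \<Otimes>\<^sub>M jump_law) = sets (PS \<Otimes>\<^sub>M borel)" by (intro sets_pair_measure_cong) simp_all
  then show ?thesis using W by (intro measurable_PS_Q J.measurable_emeasure_Pair) simp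
qed

text \<open>On a rectangle this is \<open>jump_sum_expectation_open\<close>; the rest is Dynkin's
  lemma. The factor \<open>T\<close> appears because \<open>jump_law\<close> counts the jumps of the
  whole horizon and not those per unit of time.\<close>

lemma jump_compensator:
  assumes "W \<in> sets (PS \<Otimes>\<^sub>M borel)"
  shows "ennreal T * (\<integral>\<^sup>+\<omega>. jump_count W \<omega> \<partial>M) = (\<integral>\<^sup>+z. emeasure jump_law (Pair z -` W) \<partial>Q)"
  using jump_gen_Int_stable jump_gen_Pow assms[unfolded jump_gen_sets]
proof (induction rule: sigma_sets_induct_disjoint)
  case (basic W)
  obtain K where K: "K \<ge> 0" "\<forall>h\<in>{0..T}. prob {\<omega>\<in>space M. norm (R h \<omega>) \<ge> e} \<le> K * h"
    by (rule levy_large[OF levy e_pos])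
  obtain E B where W: "W = E \<times> B" "E \<in> pred_gen" "open B" using basic unfolding jump_gen_def by blast
  have sec: "emeasure jump_law (Pair z -` (E \<times> B)) = emeasure jump_law B * indicator E z" for z
    by (auto simp: indicator_def)
  consider A where "E = {0} \<times> A" "A \<in> sets (F 0)" | s t A where "E = {s<..t} \<times> A" "0 \<le> s" "s \<le> t" "t \<le> T" "A \<in> sets (F s)"
    using W(2) unfolding pred_gen_def by blast
  then show ?case
  proof cases
    case 1
    have A: "A \<in> sets M" using 1(2) sets_F_M by blast
    note q = Q_rect[OF _ _ A, of "{0}"]
    show ?thesis
      unfolding W sec unfolding 1(1) using q T_pos by (simp add: jump_count_zero nn_integral_cmult)
  next
    case 2
    have A: "A \<in> sets M" using 2(5) sets_F_M by blast
    have "{s<..t} \<subseteq> {0..T}" using 2 by auto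
    then have q: "{s<..t} \<times> A \<in> sets Q" "emeasure Q ({s<..t} \<times> A) = emeasure lborel {s<..t} * emeasure M A"
      using Q_rect[OF _ _ A, of "{s<..t}"] by auto
    let ?U = "B \<inter> {x. norm x > e}"
    have U: "open ?U" "?U \<subseteq> {x. norm x > e}"
      using W(3) by (auto intro!: open_Int open_Collect_less continuous_intros)
    note E = jump_sum_expectation_open[OF U 2(2-4) K]
    have nn: "0 \<le> expectation (jump_sum (indicat_real ?U) 0 T)"
      by (rule integral_nonneg_AE) (auto simp: jump_sum_def intro!: AE_I2 sum_nonneg)
    have i: "integrable M (\<lambda>\<omega>. indicat_real A \<omega> * jump_sum (indicat_real ?U) s t \<omega>)"
      using integrable_mult_indicator[OF A E(1)] by simp
    have "(\<integral>\<^sup>+\<omega>. jump_count W \<omega> \<partial>M) = (\<integral>\<^sup>+\<omega>. ennreal (indicat_real A \<omega> * jump_sum (indicat_real ?U) s t \<omega>) \<partial>M)"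
      unfolding W 2(1) by (rule nn_integral_cong) (rule jump_count_interval[OF _ 2(2-4)])
    also have "\<dots> = ennreal (prob A * ((t - s) / T * expectation (jump_sum (indicat_real ?U) 0 T)))"
      unfolding E(2)[OF 2(5), symmetric]
      by (rule nn_integral_eq_integral[OF i]) (auto simp: jump_sum_def intro!: AE_I2 mult_nonneg_nonneg sum_nonneg)
    finally have N: "(\<integral>\<^sup>+\<omega>. jump_count W \<omega> \<partial>M) = ennreal (prob A * ((t - s) / T * expectation (jump_sum (indicat_real ?U) 0 T)))" .
    have "0 \<le> prob A * ((t - s) / T * expectation (jump_sum (indicat_real ?U) 0 T))" using nn 2 T_pos by simp
    then have "ennreal T * (\<integral>\<^sup>+\<omega>. jump_count W \<omega> \<partial>M) = ennreal (T * (prob A * ((t - s) / T * expectation (jump_sum (indicat_real ?U) 0 T))))"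
      unfolding N using T_pos by (intro ennreal_mult[symmetric]) simp_all
    also have "\<dots> = ennreal (expectation (jump_sum (indicat_real ?U) 0 T) * ((t - s) * prob A))"
    proof -
      have "T * (x * (d / T * c)) = c * (d * x)" for x d c :: real using T_pos by simp
      then show ?thesis by (simp only:)
    qed
    also have "\<dots> = emeasure jump_law B * (emeasure lborel {s<..t} * emeasure M A)"
      unfolding jump_law_open[OF W(3)] emeasure_eq_measure[of A] using nn 2 by (simp add: ennreal_mult)
    also have "\<dots> = (\<integral>\<^sup>+z. emeasure jump_law (Pair z -` W) \<partial>Q)"
      unfolding W sec unfolding 2(1) q(2)[symmetric] using q(1) by (simp add: nn_integral_cmult)
    finally show ?thesis .
  qed
next
  case empty
  then show ?case by (simp add: jump_count_def)
next
  case (compl W)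
  let ?\<Omega> = "({0..T} \<times> space M) \<times> (UNIV :: 'v set)"
  have W: "W \<in> sets (PS \<Otimes>\<^sub>M borel)" using compl(1) unfolding jump_gen_sets .
  have top: "?\<Omega> \<in> sets (PS \<Otimes>\<^sub>M borel)" by (rule rect_sets) simp
  have W': "?\<Omega> - W \<in> sets (PS \<Otimes>\<^sub>M borel)" using top W by (rule sets.Diff)
  have sub: "W \<subseteq> ?\<Omega>" using sigma_sets_into_sp[OF jump_gen_Pow compl(1)] .
  have "(\<integral>\<^sup>+\<omega>. jump_count (?\<Omega> - W) \<omega> \<partial>M) + (\<integral>\<^sup>+\<omega>. jump_count W \<omega> \<partial>M) = (\<integral>\<^sup>+\<omega>. jump_count ?\<Omega> \<omega> \<partial>M)"
    by (subst nn_integral_add[symmetric, OF jump_count_measurable[OF W'] jump_count_measurable[OF W]])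
       (rule nn_integral_cong, rule jump_count_compl[OF _ sub])
  then have 1: "ennreal T * (\<integral>\<^sup>+\<omega>. jump_count (?\<Omega> - W) \<omega> \<partial>M) + ennreal T * (\<integral>\<^sup>+\<omega>. jump_count W \<omega> \<partial>M) = ennreal T * emeasure jump_law UNIV"
    by (simp add: distrib_left[symmetric] emeasure_jump_law)
  have "emeasure jump_law (Pair z -` (?\<Omega> - W)) + emeasure jump_law (Pair z -` W) = emeasure jump_law UNIV" if "z \<in> space Q" for z
  proof -
    have "Pair z -` (?\<Omega> - W) \<in> sets jump_law" "Pair z -` W \<in> sets jump_law" using W W' by (auto intro: sets_Pair1)
    moreover have "Pair z -` (?\<Omega> - W) \<inter> Pair z -` W = {}" "Pair z -` (?\<Omega> - W) \<union> Pair z -` W = UNIV"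
      using that sub by (auto simp: space_Q)
    ultimately show ?thesis using plus_emeasure by metis
  qed
  then have "(\<integral>\<^sup>+z. emeasure jump_law (Pair z -` (?\<Omega> - W)) + emeasure jump_law (Pair z -` W) \<partial>Q) = (\<integral>\<^sup>+z. emeasure jump_law UNIV \<partial>Q)"
    by (rule nn_integral_cong)
  then have 2: "(\<integral>\<^sup>+z. emeasure jump_law (Pair z -` (?\<Omega> - W)) \<partial>Q) + (\<integral>\<^sup>+z. emeasure jump_law (Pair z -` W) \<partial>Q) = emeasure jump_law UNIV * emeasure Q (space Q)"
    by (simp add: nn_integral_add jump_section_measurable[OF W] jump_section_measurable[OF W'])
  have "emeasure Q (space Q) = ennreal T"
    unfolding space_Q using Q_rect(2)[of "{0..T}" "space M"] T_pos by (simp add: emeasure_space_1)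
  then have eq: "ennreal T * (\<integral>\<^sup>+\<omega>. jump_count W \<omega> \<partial>M) + ennreal T * (\<integral>\<^sup>+\<omega>. jump_count (?\<Omega> - W) \<omega> \<partial>M)
      = ennreal T * (\<integral>\<^sup>+\<omega>. jump_count W \<omega> \<partial>M) + (\<integral>\<^sup>+z. emeasure jump_law (Pair z -` (?\<Omega> - W)) \<partial>Q)"
    using 1 2 compl(2) by (simp add: ac_simps)
  \<comment> \<open>The common summand may be cancelled only if it is finite, and it is bounded by
    \<open>T\<close> times the total mass of the jump law.\<close>
  have "ennreal T * (\<integral>\<^sup>+\<omega>. jump_count W \<omega> \<partial>M) \<le> ennreal T * emeasure jump_law UNIV"
    unfolding 1[symmetric] by simp
  also have "\<dots> < \<infinity>" by (simp add: jump_law_open ennreal_mult_less_top)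
  finally show ?case using eq by (auto simp: ennreal_add_left_cancel)
next
  case (union W)
  have W: "W i \<in> sets (PS \<Otimes>\<^sub>M borel)" for i using union(2) unfolding jump_gen_sets by blast
  have "ennreal T * (\<integral>\<^sup>+\<omega>. jump_count (\<Union>i. W i) \<omega> \<partial>M) = (\<Sum>i. ennreal T * (\<integral>\<^sup>+\<omega>. jump_count (W i) \<omega> \<partial>M))"
    unfolding jump_count_UN[OF union(1)] by (simp add: nn_integral_suminf jump_count_measurable[OF W])
  also have "\<dots> = (\<Sum>i. \<integral>\<^sup>+z. emeasure jump_law (Pair z -` (W i)) \<partial>Q)" unfolding union(3) ..
  also have "\<dots> = (\<integral>\<^sup>+z. (\<Sum>i. emeasure jump_law (Pair z -` (W i))) \<partial>Q)"
    by (rule nn_integral_suminf[symmetric, OF jump_section_measurable[OF W]])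
  also have "\<dots> = (\<integral>\<^sup>+z. emeasure jump_law (Pair z -` (\<Union>i. W i)) \<partial>Q)"
  proof (rule nn_integral_cong)
    fix z
    have "range (\<lambda>i. Pair z -` W i) \<subseteq> sets jump_law" using W by (auto intro: sets_Pair1)
    moreover have "disjoint_family (\<lambda>i. Pair z -` W i)" using union(1) unfolding disjoint_family_on_def by blast
    ultimately have "(\<Sum>i. emeasure jump_law (Pair z -` W i)) = emeasure jump_law (\<Union>i. Pair z -` W i)" by (rule suminf_emeasure)
    then show "(\<Sum>i. emeasure jump_law (Pair z -` (W i))) = emeasure jump_law (Pair z -` (\<Union>i. W i))"
      by (simp add: vimage_UN)
  qed
  finally show ?case .
qed

end

section \<open>Comparison with the Levy measure\<close>

context levy_jumps
begin

lemma jump_count_eq_emeasure: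
  assumes w: "\<omega> \<in> space M"
  shows "jump_count (({0..T} \<times> space M) \<times> B) \<omega> = emeasure (count_space UNIV) {t\<in>{0<..T}. norm (jump R t \<omega>) > e \<and> jump R t \<omega> \<in> B}"
proof -
  have eq: "{t\<in>{0<..T}. norm (jump R t \<omega>) > e \<and> jump R t \<omega> \<in> B} = {t\<in>big_jumps \<omega>. jump R t \<omega> \<in> B}"
    unfolding big_jumps_def by auto
  have "jump_count (({0..T} \<times> space M) \<times> B) \<omega> = (\<Sum>t\<in>{t\<in>big_jumps \<omega>. jump R t \<omega> \<in> B}. 1)"
    unfolding jump_count_def
    by (rule sum.mono_neutral_cong_right[OF finite_big_jumps_set[OF w]]) (use w in \<open>auto simp: big_jumps_def indicator_def\<close>)
  then show ?thesis unfolding eq using finite_big_jumps_set[OF w] by (subst emeasure_count_space_finite) auto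
qed

lemma levy_measure_null_imp_jump_law:
  assumes B: "B \<in> sets borel" and null: "levy_measure M T R B = 0"
  shows "emeasure jump_law B = 0"
proof -
  have "emeasure jump_law B \<le> (\<integral>\<^sup>+\<omega>. emeasure (count_space UNIV) {t\<in>{0<..T}. jump R t \<omega> \<in> B - {0}} \<partial>M)"
    unfolding emeasure_jump_law[OF B]
  proof (rule nn_integral_mono)
    fix \<omega> assume w: "\<omega> \<in> space M"
    show "jump_count (({0..T} \<times> space M) \<times> B) \<omega> \<le> emeasure (count_space UNIV) {t\<in>{0<..T}. jump R t \<omega> \<in> B - {0}}"
      unfolding jump_count_eq_emeasure[OF w] by (rule emeasure_mono) (use e_pos in auto)
  qed
  also have "\<dots> = 0" using null T_pos unfolding levy_measure_def by (simp add: ennreal_divide_eq_0_iff)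
  finally show ?thesis by simp
qed

lemma levy_measure_eq_jump_law:
  assumes B: "B \<in> sets borel" "B \<subseteq> {x. norm x > e}"
  shows "levy_measure M T R B = emeasure jump_law B / ennreal T"
proof -
  have "{t\<in>{0<..T}. norm (jump R t \<omega>) > e \<and> jump R t \<omega> \<in> B} = {t\<in>{0<..T}. jump R t \<omega> \<in> B - {0}}" for \<omega>
    using B(2) e_pos by auto
  then show ?thesis unfolding levy_measure_def emeasure_jump_law[OF B(1)]
    by (intro arg_cong2[where f="(/)"] nn_integral_cong) (simp_all add: jump_count_eq_emeasure)
qed

lemma AE_no_jumps:
  assumes W: "W \<in> sets (PS \<Otimes>\<^sub>M borel)" and null: "(\<integral>\<^sup>+\<omega>. jump_count W \<omega> \<partial>M) = 0"
  shows "AE \<omega> in M. \<forall>t\<in>{0<..T}. norm (jump R t \<omega>) > e \<longrightarrow> ((t, \<omega>), jump R t \<omega>) \<notin> W"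
proof -
  have "AE \<omega> in M. jump_count W \<omega> = 0"
    using null nn_integral_0_iff_AE[OF jump_count_measurable[OF W]] by simp
  then show ?thesis
    using AE_space
  proof eventually_elim
    case (elim \<omega>)
    then have "\<forall>u\<in>big_jumps \<omega>. (indicator W ((u, \<omega>), jump R u \<omega>) :: ennreal) = 0"
      unfolding jump_count_def using finite_big_jumps_set by (simp add: sum_eq_0_iff)
    then show ?case unfolding big_jumps_def by (auto simp: indicator_eq_0_iff)
  qed
qed

lemma no_jumps_null:
  assumes "AE \<omega> in M. \<forall>t\<in>{0<..T}. ((t, \<omega>), jump R t \<omega>) \<notin> W"
  shows "(\<integral>\<^sup>+\<omega>. jump_count W \<omega> \<partial>M) = 0"
proof -
  have "(\<integral>\<^sup>+\<omega>. jump_count W \<omega> \<partial>M) = (\<integral>\<^sup>+\<omega>. 0 \<partial>M)"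
    using assms by (intro nn_integral_cong_AE) (auto elim!: eventually_mono simp: jump_count_def big_jumps_def intro!: sum.neutral)
  then show ?thesis by simp
qed

end

section \<open>The set \<open>C0star\<close> and the jumps of the returns\<close>

context stoch_basis
begin

lemma halfspace_sets: "{x. y \<bullet> x \<le> -1} \<in> sets (borel :: 'v::euclidean_space measure)"
  by (intro borel_closed closed_halfspace_le)

text \<open>By Cauchy-Schwarz the half-space keeps a distance from 0, so every cutoff
  \<open>d\<close> with \<open>d * norm y < 1\<close> sees all of it.\<close>

lemma halfspace_norm:
  fixes y x :: "'v::euclidean_space"
  assumes "y \<bullet> x \<le> -1" "d > 0" "1 / d > norm y"
  shows "norm x > d"
proof (rule ccontr)
  assume "\<not> norm x > d"
  then have "norm y * norm x \<le> norm y * d" by (intro mult_left_mono) auto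
  also have "\<dots> < 1" using assms(2,3) by (simp add: field_simps)
  finally show False using Cauchy_Schwarz_ineq2[of y x] assms(1) by linarith
qed

lemma levy_jumps_level: "levy_increments R \<Longrightarrow> levy_jumps M F T R (1 / real (Suc k))"
  by unfold_locales simp_all

text \<open>Once \<open>1 / real (Suc k)\<close> is small compared with \<open>1 / norm y\<close>,
  the cutoff loses nothing of the half-space. All cutoffs are quantified, instead of one depending
  on \<open>y\<close>, so that the condition is a countable conjunction; the Borel and almost
  everywhere arguments rely on this.\<close>

lemma C0star_iff:
  fixes R :: "('w, 'v::euclidean_space) process"
  assumes R: "levy_increments R"
  shows "y \<in> C0star M T R \<longleftrightarrow> (\<forall>k. emeasure (levy_jumps.jump_law M T R (1 / real (Suc k))) {x. y \<bullet> x \<le> -1} = 0)"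
proof
  assume "y \<in> C0star M T R"
  then show "\<forall>k. emeasure (levy_jumps.jump_law M T R (1 / real (Suc k))) {x. y \<bullet> x \<le> -1} = 0"
    using levy_jumps.levy_measure_null_imp_jump_law[OF levy_jumps_level[OF R] halfspace_sets] unfolding C0star_def by blast
next
  assume null: "\<forall>k. emeasure (levy_jumps.jump_law M T R (1 / real (Suc k))) {x. y \<bullet> x \<le> -1} = 0"
  obtain k :: nat where "norm y < real k" using reals_Archimedean2 by blast
  then have k: "1 / (1 / real (Suc k)) > norm y" by simp
  have "{x. y \<bullet> x \<le> -1} \<subseteq> {x. norm x > 1 / real (Suc k)}" using halfspace_norm[OF _ _ k] by auto
  from levy_jumps.levy_measure_eq_jump_law[OF levy_jumps_level[OF R] halfspace_sets this] null
  show "y \<in> C0star M T R" unfolding C0star_def by simp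
qed

text \<open>Sections of a measurable set have measurably varying finite measure. The Borel property
  keeps a strategy predictable when its values outside \<open>C0star\<close> are replaced by
  0.\<close>

lemma C0star_borel:
  fixes R :: "('w, 'v::euclidean_space) process"
  assumes R: "levy_increments R"
  shows "C0star M T R \<in> sets borel"
proof -
  define L where "L k = levy_jumps.jump_law M T R (1 / real (Suc k))" for k
  define W where "W = {z\<in>space ((borel :: 'v measure) \<Otimes>\<^sub>M (borel :: 'v measure)). fst z \<bullet> snd z \<le> -1}"
  have m: "(\<lambda>y. emeasure (L k) {x. y \<bullet> x \<le> -1}) \<in> borel_measurable borel" for k
  proof -
    interpret levy_jumps M F T R "1 / real (Suc k)" by (rule levy_jumps_level[OF R])
    interpret J: finite_measure jump_law by (rule finite_jump_law)
    have "W \<in> sets ((borel :: 'v measure) \<Otimes>\<^sub>M (borel :: 'v measure))" unfolding W_def by measurable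
    also have "sets ((borel :: 'v measure) \<Otimes>\<^sub>M (borel :: 'v measure)) = sets (borel \<Otimes>\<^sub>M jump_law)"
      by (rule sets_pair_measure_cong[OF refl sets_jump_law[symmetric]])
    finally have "(\<lambda>y. emeasure jump_law (Pair y -` W)) \<in> borel_measurable borel" by (rule J.measurable_emeasure_Pair)
    moreover have "Pair y -` W = {x. y \<bullet> x \<le> -1}" for y unfolding W_def by (auto simp: space_pair_measure)
    ultimately show ?thesis unfolding L_def by simp
  qed
  have "C0star M T R = (\<Inter>k. (\<lambda>y. emeasure (L k) {x. y \<bullet> x \<le> -1}) -` {0} \<inter> space borel)"
    using C0star_iff[OF R] unfolding L_def by auto
  also have "\<dots> \<in> sets borel"
    by (rule sets.countable_INT'') (simp_all add: measurable_sets_borel[OF m])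
  finally show ?thesis .
qed

text \<open>A \<open>y\<close> in this set makes the half-space null for a sufficiently fine jump
  law; then almost surely no jump falls into it.\<close>

lemma C0star_jumps:
  fixes R :: "('w, 'v::euclidean_space) process"
  assumes R: "levy_increments R" and y: "y \<in> C0star M T R"
  shows "AE \<omega> in M. \<forall>t\<in>{0..T}. y \<bullet> jump R t \<omega> > -1"
proof -
  obtain k :: nat where "norm y < real k" using reals_Archimedean2 by blast
  then have k: "1 / (1 / real (Suc k)) > norm y" by simp
  interpret levy_jumps M F T R "1 / real (Suc k)" by (rule levy_jumps_level[OF R])
  have "emeasure jump_law {x. y \<bullet> x \<le> -1} = 0" using y C0star_iff[OF R] by blast
  from AE_no_jumps[OF rect_sets[OF halfspace_sets] this[unfolded emeasure_jump_law[OF halfspace_sets]]]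
  show ?thesis
    using AE_space
  proof eventually_elim
    case (elim \<omega>)
    show ?case
    proof
      fix t assume t: "t \<in> {0..T}"
      show "y \<bullet> jump R t \<omega> > -1"
      proof (cases "t = 0")
        case True
        then show ?thesis by (simp add: jump_eq)
      next
        case False
        show ?thesis
        proof (rule ccontr)
          assume "\<not> y \<bullet> jump R t \<omega> > -1"
          then have le: "y \<bullet> jump R t \<omega> \<le> -1" by simp
          have "norm (jump R t \<omega>) > 1 / real (Suc k)" by (rule halfspace_norm[OF le _ k]) simp
          then have "((t, \<omega>), jump R t \<omega>) \<notin> ({0..T} \<times> space M) \<times> {x. y \<bullet> x \<le> -1}"
            using elim(1) t False by auto
          then show False using le t elim(2) by simp
        qed
      qed
    qed
  qed
qed

text \<open>Let \<open>W\<close> collect the times, scenarios and jump sizes with return at most -1.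
  No jump of \<open>R\<close> falls into \<open>W\<close>, so \<open>jump_compensator\<close> makes
  almost every section of \<open>W\<close> null for the jump law, and these sections are the
  half-spaces of \<open>C0star_iff\<close>.\<close>

lemma predictable_C0star:
  fixes R :: "('w, 'v::euclidean_space) process"
  assumes R: "levy_increments R" and \<pi>: "predictable M F T \<pi>"
    and AE: "AE \<omega> in M. \<forall>t\<in>{0..T}. \<pi> t \<omega> \<bullet> jump R t \<omega> > -1"
  shows "AE z in Q. \<pi> (fst z) (snd z) \<in> C0star M T R"
proof -
  define W where "W = {z\<in>space (PS \<Otimes>\<^sub>M (borel :: 'v measure)). case_prod \<pi> (fst z) \<bullet> snd z \<le> -1}"
  have [measurable]: "case_prod \<pi> \<in> borel_measurable PS" using \<pi> unfolding predictable_def .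
  have W: "W \<in> sets (PS \<Otimes>\<^sub>M borel)" unfolding W_def by measurable
  have sec: "Pair z -` W = {x. \<pi> (fst z) (snd z) \<bullet> x \<le> -1}" if "z \<in> space Q" for z
    using that unfolding W_def by (auto simp: space_pair_measure space_Q case_prod_beta')
  have "AE z in Q. emeasure (levy_jumps.jump_law M T R (1 / real (Suc k))) {x. \<pi> (fst z) (snd z) \<bullet> x \<le> -1} = 0" for k
  proof -
    interpret levy_jumps M F T R "1 / real (Suc k)" by (rule levy_jumps_level[OF R])
    have "AE \<omega> in M. \<forall>t\<in>{0<..T}. ((t, \<omega>), jump R t \<omega>) \<notin> W"
      using AE unfolding W_def by eventually_elim (auto simp: not_le)
    from no_jumps_null[OF this] have "(\<integral>\<^sup>+z. emeasure jump_law (Pair z -` W) \<partial>Q) = 0"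
      using jump_compensator[OF W] by simp
    then have "AE z in Q. emeasure jump_law (Pair z -` W) = 0"
      using nn_integral_0_iff_AE[OF jump_section_measurable[OF W]] by simp
    then show ?thesis using AE_space by eventually_elim (simp add: sec)
  qed
  then have "AE z in Q. \<forall>k. emeasure (levy_jumps.jump_law M T R (1 / real (Suc k))) {x. \<pi> (fst z) (snd z) \<bullet> x \<le> -1} = 0"
    by (intro AE_all_countable[THEN iffD2] allI)
  then show ?thesis unfolding C0star_iff[OF R] .
qed

end

section \<open>Transforming the market\<close>

text \<open>Consumption is paid continuously and contributes no jump to the wealth.\<close>

lemma continuous_set_integral:
  fixes k :: "real \<Rightarrow> real"
  assumes "set_integrable lborel {0..T} k"
  shows "continuous_on {0..T} (\<lambda>t. LINT s:{0..t}|lborel. k s)"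
proof -
  have 1: "continuous_on {0..T} (\<lambda>t. integral {0..t} k)"
    by (rule indefinite_integral_continuous_1) (use set_borel_integral_eq_integral(1)[OF assms] in simp)
  have 2: "(LINT s:{0..t}|lborel. k s) = integral {0..t} k" if "t \<in> {0..T}" for t
    by (rule set_borel_integral_eq_integral(2)[OF set_integrable_subset[OF assms]]) (use that in auto)
  show ?thesis by (rule continuous_on_eq[OF 1]) (rule 2[symmetric])
qed

context stoch_basis
begin

text \<open>The jump of the stochastic exponential gives
  \<open>E = left_lim E * (1 + jump Y)\<close>, where \<open>Y\<close> jumps like the return of the
  strategy. The left limit of a positive path is only known to be nonnegative, but a positive
  product with it forces the second factor to be positive.\<close>

lemma positive_wealth_jumps:
  fixes R :: "('w, 'v::euclidean_space) process"
  assumes X: "is_wealth M F T x0 \<delta> R \<pi> \<kappa> X" "AE \<omega> in M. \<forall>t\<in>{0..T}. X t \<omega> > 0" and x0: "x0 > 0"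
    and \<kappa>: "propensity_to_consume M F T \<kappa>" and R: "cadlag_adapted M F T R"
  shows "AE \<omega> in M. \<forall>t\<in>{0..T}. \<pi> t \<omega> \<bullet> jump R t \<omega> > -1"
proof -
  obtain G Y E where G: "has_stoch_integral M F T \<pi> R G" and Y: "cadlag_adapted M F T Y"
    "indist M T Y (\<lambda>t \<omega>. G t \<omega> - \<delta> * (LINT s:{0..t}|lborel. \<kappa> s \<omega>))"
    and E: "stoch_exponential M F T Y E" and XE: "indist M T X (\<lambda>t \<omega>. x0 * E t \<omega>)"
    using X(1) unfolding is_wealth_def by blast
  obtain Z where Ec: "cadlag_adapted M F T E" and Z: "has_stoch_integral M F T (left_lim E) Y Z"
    "indist M T E (\<lambda>t \<omega>. 1 + Z t \<omega>)"
    using E unfolding stoch_exponential_def by blast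
  have Gc: "cadlag_adapted M F T G" and Zc: "cadlag_adapted M F T Z"
    using G Z(1) semimartingale_cadlag unfolding has_stoch_integral_def by auto
  have \<kappa>i: "AE \<omega> in M. set_integrable lborel {0..T} (\<lambda>s. \<kappa> s \<omega>)" using \<kappa> unfolding propensity_to_consume_def by simp
  show ?thesis
    using X(2) XE[unfolded indist_def] indist_jump[OF Y(2)] indist_jump[OF Z(2)] \<kappa>i AE_space
      has_stoch_integral_jump[OF G R] has_stoch_integral_jump[OF Z(1) Y(1)]
  proof eventually_elim
    case (elim \<omega>)
    note w = elim(6)
    have pE: "E t \<omega> > 0" if "t \<in> {0..T}" for t
    proof -
      have "x0 * E t \<omega> > 0" using elim(1,2) that by metis
      then show ?thesis using x0 by (simp add: zero_less_mult_iff)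
    qed
    have cont: "continuous_on {0..T} (\<lambda>t. LINT s:{0..t}|lborel. \<kappa> s \<omega>)" by (rule continuous_set_integral[OF elim(5)])
    show ?case
    proof
      fix t assume t: "t \<in> {0..T}"
      show "\<pi> t \<omega> \<bullet> jump R t \<omega> > -1"
      proof (cases "t = 0")
        case True
        then show ?thesis by (simp add: jump_eq)
      next
        case False
        have "jump Y t \<omega> = path_jump (\<lambda>t. 1 * G t \<omega> + (- \<delta>) * (LINT s:{0..t}|lborel. \<kappa> s \<omega>)) t"
          using elim(3) t by (simp add: jump_eq)
        also have "\<dots> = jump G t \<omega>"
          using path_jump_lincomb[OF cadlag_adaptedD(1)[OF Gc w] cadlag_path_continuous[OF cont], of t 1 "- \<delta>"]
            path_jump_continuous[OF cont] t by (simp add: jump_eq)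
        finally have jY: "jump Y t \<omega> = \<pi> t \<omega> \<bullet> jump R t \<omega>" using elim(7) t by simp
        have "jump E t \<omega> = path_jump (\<lambda>t. 1 * 1 + 1 * Z t \<omega>) t" using elim(4) t by (simp add: jump_eq)
        also have "\<dots> = jump Z t \<omega>"
          using path_jump_lincomb[OF cadlag_path_const cadlag_adaptedD(1)[OF Zc w], of t 1 1 1]
            path_jump_continuous[OF continuous_on_const, of t T "1::real"] t by (simp add: jump_eq)
        finally have "jump E t \<omega> = left_lim E t \<omega> * jump Y t \<omega>" using elim(8) t by simp
        then have Et: "E t \<omega> = left_lim E t \<omega> * (1 + jump Y t \<omega>)" unfolding jump_def by (simp add: algebra_simps)
        have "((\<lambda>s. E s \<omega>) \<longlongrightarrow> left_limit (\<lambda>s. E s \<omega>) t) (at_left t)"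
          using cadlag_left_limit[OF cadlag_adaptedD(1)[OF Ec w]] t False by auto
        moreover have "\<forall>\<^sub>F s in at_left t. 0 \<le> E s \<omega>"
          by (rule eventually_at_leftI[of 0]) (use pE t False in \<open>auto intro: less_imp_le\<close>)
        ultimately have "left_lim E t \<omega> \<ge> 0" unfolding left_lim_eq by (rule tendsto_lowerbound) simp
        then have "1 + jump Y t \<omega> > 0" using pE[OF t] unfolding Et by (simp add: zero_less_mult_iff)
        then show ?thesis unfolding jY by simp
      qed
    qed
  qed
qed

text \<open>\<open>A\<close> is the adjoint of \<open>B\<close>, so transforming the integrator by
  \<open>A\<close> amounts to transforming the integrand by \<open>B\<close>. In the theorem these
  are \<Lambda> and its transpose.\<close>

lemma op_linear:
  fixes B :: "'u::euclidean_space \<Rightarrow> 'v::euclidean_space" and X :: "('w, 'v) process"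
  assumes J: "op X J" and B: "bounded_linear B" and adj: "\<And>x y. B x \<bullet> y = x \<bullet> A y"
  shows "op (\<lambda>t \<omega>. A (X t \<omega>)) (\<lambda>H. J (\<lambda>u \<omega>. B (H u \<omega>)))"
proof -
  interpret bounded_linear B by (rule B)
  obtain c where c: "0 \<le> c" "\<And>x. norm (B x) \<le> norm x * c" using nonneg_bounded by blast
  have Bm: "B \<in> borel_measurable borel" by (intro borel_measurable_continuous_onI linear_continuous_on B)
  have bpB: "bp (\<lambda>u \<omega>. B (H u \<omega>))" if H: "bp H" for H
  proof -
    obtain d where d: "0 \<le> d" "\<forall>t\<in>{0..T}. \<forall>\<omega>\<in>space M. norm (H t \<omega>) \<le> d" by (rule bpE[OF H])
    show ?thesis
    proof (rule bpI[where c="d * c"])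
      show "predictable M F T (\<lambda>u \<omega>. B (H u \<omega>))" by (rule predictable_compose[OF bp_predictable[OF H] Bm])
      show "norm (B (H t \<omega>)) \<le> d * c" if t: "t \<in> {0..T}" "\<omega> \<in> space M" for t \<omega>
      proof -
        have "norm (H t \<omega>) \<le> d" using d(2) t by blast
        from order_trans[OF c(2) mult_right_mono[OF this c(1)]] show ?thesis .
      qed
    qed
  qed
  have m: "(\<lambda>\<omega>. B (\<xi> \<omega>)) \<in> borel_measurable (F s)" "bounded ((\<lambda>\<omega>. B (\<xi> \<omega>)) ` space M)"
    if "\<xi> \<in> borel_measurable (F s)" "bounded (\<xi> ` space M)" for \<xi> s
    using measurable_compose[OF that(1) Bm] bounded_linear_image[OF that(2) B] by (simp_all add: image_image)
  show ?thesis
  proof (rule opI)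
    fix H :: "('w, 'u) process" assume "bp H"
    then show "cadlag_adapted M F T (J (\<lambda>u \<omega>. B (H u \<omega>)))" by (intro op_cadlag[OF J] bpB)
  next
    fix \<xi> :: "'w \<Rightarrow> 'u" assume "\<xi> \<in> borel_measurable (F 0)" "bounded (\<xi> ` space M)"
    from op_zero[OF J m[OF this]] show "indist M T (J (\<lambda>u \<omega>. B (indicat_real {0} u *\<^sub>R \<xi> \<omega>))) (\<lambda>u \<omega>. 0)"
      by (simp add: scaleR)
  next
    fix s t :: real and \<xi> :: "'w \<Rightarrow> 'u"
    assume as: "0 \<le> s" "s \<le> t" "t \<le> T" "\<xi> \<in> borel_measurable (F s)" "bounded (\<xi> ` space M)"
    from op_interval[OF J as(1-3) m[OF as(4,5)]]
    show "indist M T (J (\<lambda>u \<omega>. B (indicat_real {s<..t} u *\<^sub>R \<xi> \<omega>))) (\<lambda>u \<omega>. \<xi> \<omega> \<bullet> (A (X (min u t) \<omega>) - A (X (min u s) \<omega>)))"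
      by (simp add: scaleR inner_diff_right adj)
  next
    fix H K :: "('w, 'u) process" and a b assume "bp H" "bp K"
    from op_lin[OF J bpB[OF this(1)] bpB[OF this(2)], of a b]
    show "indist M T (J (\<lambda>u \<omega>. B (a *\<^sub>R H u \<omega> + b *\<^sub>R K u \<omega>))) (\<lambda>u \<omega>. a * J (\<lambda>u \<omega>. B (H u \<omega>)) u \<omega> + b * J (\<lambda>u \<omega>. B (K u \<omega>)) u \<omega>)"
      by (simp add: add scaleR)
  next
    fix Hn and H :: "('w, 'u) process" and d :: real
    assume as: "\<forall>n. bp (Hn n)" "bp H" "\<forall>n. \<forall>t\<in>{0..T}. \<forall>\<omega>\<in>space M. norm (Hn n t \<omega>) \<le> d"
      "\<forall>t\<in>{0..T}. \<forall>\<omega>\<in>space M. (\<lambda>n. Hn n t \<omega>) \<longlonglongrightarrow> H t \<omega>"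
    show "ucp_lim M T (\<lambda>n. J (\<lambda>u \<omega>. B (Hn n u \<omega>))) (J (\<lambda>u \<omega>. B (H u \<omega>)))"
    proof (rule op_lim[OF J])
      show "bp (\<lambda>u \<omega>. B (Hn n u \<omega>))" for n using as(1) by (intro bpB) blast
      show "bp (\<lambda>u \<omega>. B (H u \<omega>))" by (rule bpB[OF as(2)])
      fix t \<omega> assume t: "t \<in> {0..T}" "\<omega> \<in> space M"
      show "norm (B (Hn n t \<omega>)) \<le> d * c" for n
      proof -
        have "norm (Hn n t \<omega>) \<le> d" using as(3) t by blast
        from order_trans[OF c(2) mult_right_mono[OF this c(1)]] show ?thesis .
      qed
      show "(\<lambda>n. B (Hn n t \<omega>)) \<longlonglongrightarrow> B (H t \<omega>)" by (rule tendsto) (use as(4) t in blast)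
    qed
  qed
qed

lemma op_AE_cong:
  fixes X :: "('w, 'v::euclidean_space) process"
  assumes J: "op X J" and null: "\<forall>H. bp H \<and> (AE z in Q. H (fst z) (snd z) = 0) \<longrightarrow> indist M T (J H) (\<lambda>_ _. 0)"
    and H: "bp H" and K: "bp K" and eq: "AE z in Q. H (fst z) (snd z) = K (fst z) (snd z)"
  shows "indist M T (J H) (J K)"
proof -
  let ?D = "\<lambda>u \<omega>. 1 *\<^sub>R H u \<omega> + (-1) *\<^sub>R K u \<omega>"
  have "indist M T (J ?D) (\<lambda>_ _. 0)"
  proof (rule null[rule_format], rule conjI)
    show "bp ?D" by (rule bp_lincomb[OF H K])
    show "AE z in Q. ?D (fst z) (snd z) = 0" using eq by eventually_elim simp
  qed
  with op_lin[OF J H K, of 1 "-1"] have "indist M T (\<lambda>u \<omega>. 1 * J H u \<omega> + (-1) * J K u \<omega>) (\<lambda>_ _. 0)"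
    using indist_trans indist_sym by blast
  then show ?thesis unfolding indist_def by eventually_elim simp
qed

text \<open>A strategy enters the wealth only through its integral, so two strategies sharing their
  integrals share their wealth processes.\<close>

lemma is_wealth_transfer:
  assumes "\<And>G. has_stoch_integral M F T \<pi> R G \<Longrightarrow> has_stoch_integral M F T \<pi>' R' G"
    and "is_wealth M F T x0 \<delta> R \<pi> \<kappa> X"
  shows "is_wealth M F T x0 \<delta> R' \<pi>' \<kappa> X"
  using assms(2) unfolding is_wealth_def
  by (elim conjE exE) (intro conjI exI assms(1); assumption)

lemma admissible_constraint:
  "admissible M F T x0 \<delta> R C \<pi> \<kappa> \<Longrightarrow> t \<in> {0..T} \<Longrightarrow> \<omega> \<in> space M \<Longrightarrow> \<pi> t \<omega> \<in> C"
  by (simp add: admissible_def)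

lemma admissible_transfer:
  assumes "\<And>G. has_stoch_integral M F T \<pi> R G \<Longrightarrow> has_stoch_integral M F T \<pi>' R' G"
    and "admissible M F T x0 \<delta> R C \<pi> \<kappa>" and "\<And>t \<omega>. t \<in> {0..T} \<Longrightarrow> \<omega> \<in> space M \<Longrightarrow> \<pi>' t \<omega> \<in> C'"
  shows "admissible M F T x0 \<delta> R' C' \<pi>' \<kappa>"
proof -
  obtain G where "has_stoch_integral M F T \<pi> R G" using assms(2) unfolding admissible_def trading_strategy_def by blast
  then have G: "has_stoch_integral M F T \<pi>' R' G" by (rule assms(1))
  then have "predictable M F T \<pi>'" unfolding has_stoch_integral_def by (rule conjunct1)
  then have ts: "trading_strategy M F T R' \<pi>'" unfolding trading_strategy_def using G by blast
  obtain X where X: "is_wealth M F T x0 \<delta> R \<pi> \<kappa> X" "AE \<omega> in M. \<forall>t\<in>{0..T}. X t \<omega> > 0"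
    using assms(2) unfolding admissible_def by blast
  have \<kappa>: "propensity_to_consume M F T \<kappa>" using assms(2) by (simp add: admissible_def)
  show ?thesis
    unfolding admissible_def
  proof (intro conjI ballI ts \<kappa> exI[of _ X])
    show "is_wealth M F T x0 \<delta> R' \<pi>' \<kappa> X" by (rule is_wealth_transfer[OF assms(1) X(1)])
  qed (use X(2) assms(3) in auto)
qed

end

lemma transpose_axis:
  fixes A :: "real ^ 'n ^ 'm"
  shows "transpose A *v axis j 1 = A $ j"
  by (simp add: matrix_vector_mult_basis column_transpose row_def vec_eq_iff)

text \<open>The rows of \<open>\<Lambda>\<close> are a basis of the span of \<open>S\<close> taken from \<open>S\<close>, padded with zeros.\<close>

lemma spanning_matrix:
  fixes S :: "(real ^ 'd) set"
  assumes S0: "0 \<in> S"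
  shows "\<exists>(\<Lambda> :: real ^ 'd ^ 'd) L. (\<forall>j. \<Lambda> $ j \<in> S) \<and> linear L \<and> (\<forall>y\<in>S. transpose \<Lambda> *v L y = y)"
proof -
  obtain B where B: "B \<subseteq> S" "independent B" "S \<subseteq> span B" "card B = dim S" by (rule basis_exists)
  have fin: "finite B" using B(2) by (rule independent_imp_finite)
  have "card B \<le> CARD('d)" using B(4) dim_subset_UNIV[of S] by simp
  then obtain f :: "real ^ 'd \<Rightarrow> 'd" where f: "inj_on f B"
    using card_le_inj[OF fin, of "UNIV :: 'd set"] by auto
  define \<Lambda> :: "real ^ 'd ^ 'd" where "\<Lambda> = (\<chi> j. if j \<in> f ` B then inv_into B f j else 0)"
  \<comment> \<open>\<open>L\<close> sends a basis vector to the coordinate whose row it is, and the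
    transpose sends that coordinate back to the row. By linearity \<open>L\<close> is a right
    inverse of the transpose on the whole span of \<open>S\<close>.\<close>
  obtain L :: "real ^ 'd \<Rightarrow> real ^ 'd" where L: "linear L" "\<forall>b\<in>B. L b = axis (f b) 1"
    using linear_independent_extend[OF B(2), of "\<lambda>b. axis (f b) 1"] by blast
  show ?thesis
  proof (intro exI[of _ \<Lambda>] exI[of _ L] conjI allI ballI L(1))
    show "\<Lambda> $ j \<in> S" for j
      using B(1) S0 inv_into_into[of j f B] by (auto simp: \<Lambda>_def)
    fix y assume "y \<in> S"
    then have y: "y \<in> span B" using B(3) by blast
    have lin: "linear (\<lambda>y. transpose \<Lambda> *v L y)" using linear_compose[OF L(1) matrix_vector_mul_linear[of "transpose \<Lambda>"]] unfolding comp_def .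
    have "transpose \<Lambda> *v L b = id b" if "b \<in> B" for b
    proof -
      have "transpose \<Lambda> *v L b = \<Lambda> $ f b"
        using bspec[OF L(2) that] by (simp only: transpose_axis)
      then show ?thesis using that f by (simp add: \<Lambda>_def)
    qed
    from linear_eq_on[OF lin linear_id y this] show "transpose \<Lambda> *v L y = y" by (simp only: id_apply)
  qed
qed

theorem theorem4p2:
  fixes M :: "'w measure" and F :: "real \<Rightarrow> 'w measure" and T \<delta> x0 :: real
    and R :: "real \<Rightarrow> 'w \<Rightarrow> real ^ 'd" and C :: "(real ^ 'd) set"
  assumes "T > 0" and "\<delta> \<in> {0, 1}" and "x0 > 0"
    and "usual_conditions M F T"
    and "trivial_sigma_algebra M (F 0)"
    and "levy_process M F T R"
    and "0 \<in> C"
  shows "\<exists>\<Lambda> :: real ^ 'd ^ 'd.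
    let R' = (\<lambda>t \<omega>. \<Lambda> *v R t \<omega>);
        C' = (\<lambda>y. transpose \<Lambda> *v y) -` C;
        C0star' = (\<lambda>y. transpose \<Lambda> *v y) -` C0star M T R
    in (\<forall>j. (AE \<omega> in M. \<forall>t\<in>{0..T}. jump R' t \<omega> $ j > -1)) \<and>
       (\<forall>j. axis j 1 \<in> C' \<inter> C0star') \<and>
       same_wealth_processes M F T x0 \<delta> R C R' C'"
proof -
  interpret stoch_basis M F T by unfold_locales (rule assms)+
  have R: "levy_increments R" by (rule levy_process_increments[OF assms(6)])
  have Rc: "cadlag_adapted M F T R" by (rule levy_cadlag[OF R])
  define D where "D = C0star M T R"
  have D0: "0 \<in> D" unfolding D_def C0star_def by (simp add: levy_measure_def)
  have Dm: "D \<in> sets borel" unfolding D_def by (rule C0star_borel[OF R])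
  from spanning_matrix[OF IntI[OF assms(7) D0]] obtain \<Lambda> :: "real ^ 'd ^ 'd" and L
    where \<Lambda>': "\<forall>j. \<Lambda> $ j \<in> C \<inter> D" and L: "linear L" and inv': "\<forall>y\<in>C \<inter> D. transpose \<Lambda> *v L y = y"
    by (elim exE conjE)
  have \<Lambda>: "\<Lambda> $ j \<in> C \<inter> D" for j using \<Lambda>' by (rule spec)
  have inv: "transpose \<Lambda> *v L y = y" if "y \<in> C \<inter> D" for y using inv' that by (rule bspec)
  define R' where "R' t \<omega> = \<Lambda> *v R t \<omega>" for t \<omega>
  define C' where "C' = (\<lambda>y. transpose \<Lambda> *v y) -` C"
  obtain J where J: "op R J"
    and null: "\<forall>H. bp H \<and> (AE z in Q. H (fst z) (snd z) = 0) \<longrightarrow> indist M T (J H) (\<lambda>_ _. 0)"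
    by (rule levy_integration_operator[OF R])
  define J' where "J' H = J (\<lambda>u \<omega>. transpose \<Lambda> *v H u \<omega>)" for H :: "('w, real ^ 'd) process"
  have J': "op R' J'"
    unfolding R'_def J'_def
    by (rule op_linear[OF J matrix_vector_mul_bounded_linear]) (simp add: transpose_matrix_vector dot_lmul_matrix)
  have jumps: "AE \<omega> in M. \<forall>t\<in>{0..T}. jump R' t \<omega> $ j > -1" for j
  proof -
    have "\<Lambda> $ j \<in> C0star M T R" using \<Lambda>[of j] unfolding D_def by blast
    from C0star_jumps[OF R this] AE_space show ?thesis
    proof eventually_elim
      case (elim \<omega>)
      show ?case
      proof
        fix t assume t: "t \<in> {0..T}"
        have "left_limit (\<lambda>u. \<Lambda> *v R u \<omega>) t = \<Lambda> *v left_limit (\<lambda>u. R u \<omega>) t"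
          using t by (intro left_limit_compose[OF cadlag_adaptedD(1)[OF Rc]] linear_continuous_at matrix_vector_mul_bounded_linear) (use elim in auto)
        then have "jump R' t \<omega> = \<Lambda> *v jump R t \<omega>"
          unfolding jump_eq path_jump_def R'_def by (simp add: matrix_vector_mult_diff_distrib)
        then show "jump R' t \<omega> $ j > -1" using elim t by (simp add: matrix_vector_mul_component)
      qed
  qed
  qed
  have backward: "has_stoch_integral M F T (\<lambda>t \<omega>. transpose \<Lambda> *v \<pi> t \<omega>) R G" if I: "has_stoch_integral M F T \<pi> R' G" for \<pi> G
  proof (rule has_stoch_integral_transfer[OF I J' J])
    show "predictable M F T (\<lambda>t \<omega>. transpose \<Lambda> *v \<pi> t \<omega>)"
      using I unfolding has_stoch_integral_def
      by (intro predictable_compose[where h="\<lambda>y. transpose \<Lambda> *v y"] borel_measurable_continuous_onI linear_continuous_on matrix_vector_mul_bounded_linear) (rule conjunct1)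
    show "indist M T (J' (\<lambda>u \<omega>. K u \<omega> *\<^sub>R \<pi> u \<omega>)) (J (\<lambda>u \<omega>. K u \<omega> *\<^sub>R (transpose \<Lambda> *v \<pi> u \<omega>)))" for K
      unfolding J'_def matrix_vector_mult_scaleR by (rule indist_refl)
  qed
  \<comment> \<open>\<open>P\<close> changes the values of an admissible strategy only on a
    \<open>Q\<close>-null set. As 0 lies in both \<open>C\<close> and \<open>D\<close>, it maps
    \<open>C\<close> into their intersection, where the transpose undoes \<open>L\<close>. Thus the
    transformed strategy meets the constraint at every time and scenario, not just almost
    everywhere.\<close>
  define P where "P y = (if y \<in> D then y else 0)" for y :: "real ^ 'd"
  have Lm: "L \<in> borel_measurable borel"
    using L by (intro borel_measurable_continuous_onI linear_continuous_on linear_conv_bounded_linear[THEN iffD1])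
  have Pm: "P \<in> borel_measurable borel" unfolding P_def using Dm by measurable
  have PC: "P y \<in> C \<inter> D" if "y \<in> C" for y unfolding P_def using that assms(7) D0 by auto
  have forward: "has_stoch_integral M F T (\<lambda>t \<omega>. L (P (\<pi> t \<omega>))) R' G"
    if I: "has_stoch_integral M F T \<pi> R G" and C: "\<forall>t\<in>{0..T}. \<forall>\<omega>\<in>space M. \<pi> t \<omega> \<in> C"
      and D: "AE z in Q. \<pi> (fst z) (snd z) \<in> D" for \<pi> G
  proof (rule has_stoch_integral_transfer[OF I J J'])
    show pr: "predictable M F T (\<lambda>t \<omega>. L (P (\<pi> t \<omega>)))"
      by (rule predictable_compose[where h="\<lambda>y. L (P y)", OF conjunct1[OF I[unfolded has_stoch_integral_def]] measurable_compose[OF Pm Lm]])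
    fix K :: "('w, real) process"
    assume K: "bp K" "bp (\<lambda>u \<omega>. K u \<omega> *\<^sub>R \<pi> u \<omega>)" "bp (\<lambda>u \<omega>. K u \<omega> *\<^sub>R L (P (\<pi> u \<omega>)))"
    have inv': "transpose \<Lambda> *v L (P (\<pi> t \<omega>)) = P (\<pi> t \<omega>)" if "t \<in> {0..T}" "\<omega> \<in> space M" for t \<omega>
      by (rule inv[OF PC]) (use C that in blast)
    have bpP: "bp (\<lambda>u \<omega>. transpose \<Lambda> *v (K u \<omega> *\<^sub>R L (P (\<pi> u \<omega>))))"
    proof -
      obtain c where c: "0 \<le> c" "\<forall>t\<in>{0..T}. \<forall>\<omega>\<in>space M. norm (K t \<omega> *\<^sub>R \<pi> t \<omega>) \<le> c" by (rule bpE[OF K(2)])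
      show ?thesis
      proof (rule bpI[where c=c])
        show "predictable M F T (\<lambda>u \<omega>. transpose \<Lambda> *v (K u \<omega> *\<^sub>R L (P (\<pi> u \<omega>))))"
          by (intro predictable_compose[where h="\<lambda>y. transpose \<Lambda> *v y"] bp_predictable[OF K(3)]
             borel_measurable_continuous_onI linear_continuous_on matrix_vector_mul_bounded_linear)
        fix t \<omega> assume t: "t \<in> {0..T}" "\<omega> \<in> space M"
        have "norm (K t \<omega> *\<^sub>R P (\<pi> t \<omega>)) \<le> norm (K t \<omega> *\<^sub>R \<pi> t \<omega>)" by (simp add: P_def)
        also have "\<dots> \<le> c" using c(2) t by blast
        finally show "norm (transpose \<Lambda> *v (K t \<omega> *\<^sub>R L (P (\<pi> t \<omega>)))) \<le> c"
          unfolding matrix_vector_mult_scaleR inv'[OF t] .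
      qed
    qed
    show "indist M T (J (\<lambda>u \<omega>. K u \<omega> *\<^sub>R \<pi> u \<omega>)) (J' (\<lambda>u \<omega>. K u \<omega> *\<^sub>R L (P (\<pi> u \<omega>))))"
      unfolding J'_def
    proof (rule op_AE_cong[OF J null K(2) bpP])
      show "AE z in Q. K (fst z) (snd z) *\<^sub>R \<pi> (fst z) (snd z) = transpose \<Lambda> *v (K (fst z) (snd z) *\<^sub>R L (P (\<pi> (fst z) (snd z))))"
        using D AE_space
      proof eventually_elim
        case (elim z)
        then have z: "fst z \<in> {0..T}" "snd z \<in> space M" by (auto simp: space_Q)
        show ?case unfolding matrix_vector_mult_scaleR inv'[OF z] using elim(1) by (simp add: P_def)
      qed
    qed
  qed
  have "same_wealth_processes M F T x0 \<delta> R C R' C'"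
    unfolding same_wealth_processes_def
  proof (intro conjI ballI)
    fix X assume "X \<in> wealth_processes M F T x0 \<delta> R C"
    then obtain \<pi> \<kappa> where adm: "admissible M F T x0 \<delta> R C \<pi> \<kappa>" and X: "is_wealth M F T x0 \<delta> R \<pi> \<kappa> X"
      unfolding wealth_processes_def by blast
    \<comment> \<open>Positivity is provided by admissibility for some version \<open>X0\<close> of
      the wealth, which need not be \<open>X\<close>; the conclusion drawn from it concerns the
      strategy alone.\<close>
    obtain X0 where X0: "is_wealth M F T x0 \<delta> R \<pi> \<kappa> X0" "AE \<omega> in M. \<forall>t\<in>{0..T}. X0 t \<omega> > 0"
      using adm unfolding admissible_def by blast
    have \<pi>: "predictable M F T \<pi>" "propensity_to_consume M F T \<kappa>" "\<forall>t\<in>{0..T}. \<forall>\<omega>\<in>space M. \<pi> t \<omega> \<in> C"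
      using adm unfolding admissible_def trading_strategy_def by auto
    have D: "AE z in Q. \<pi> (fst z) (snd z) \<in> D"
      unfolding D_def by (rule predictable_C0star[OF R \<pi>(1) positive_wealth_jumps[OF X0 assms(3) \<pi>(2) Rc]])
    note fw = forward[OF _ \<pi>(3) D]
    have "admissible M F T x0 \<delta> R' C' (\<lambda>t \<omega>. L (P (\<pi> t \<omega>))) \<kappa>"
    proof (rule admissible_transfer[OF fw adm])
      fix t \<omega> assume "t \<in> {0..T}" "\<omega> \<in> space M"
      then have CD: "P (\<pi> t \<omega>) \<in> C \<inter> D" using \<pi>(3) by (intro PC) blast
      show "L (P (\<pi> t \<omega>)) \<in> C'" unfolding C'_def vimage_eq inv[OF CD] using CD by (rule IntD1)
    qed
    then have "X \<in> wealth_processes M F T x0 \<delta> R' C'"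
      unfolding wealth_processes_def using is_wealth_transfer[OF fw X] by blast
    then show "\<exists>X'\<in>wealth_processes M F T x0 \<delta> R' C'. indist M T X X'" using indist_refl by blast
  next
    fix X assume "X \<in> wealth_processes M F T x0 \<delta> R' C'"
    then obtain \<pi> \<kappa> where adm: "admissible M F T x0 \<delta> R' C' \<pi> \<kappa>" and X: "is_wealth M F T x0 \<delta> R' \<pi> \<kappa> X"
      unfolding wealth_processes_def by blast
    have "admissible M F T x0 \<delta> R C (\<lambda>t \<omega>. transpose \<Lambda> *v \<pi> t \<omega>) \<kappa>"
    proof (rule admissible_transfer[OF backward adm])
      fix t \<omega> assume "t \<in> {0..T}" "\<omega> \<in> space M"
      from admissible_constraint[OF adm this] show "transpose \<Lambda> *v \<pi> t \<omega> \<in> C" unfolding C'_def vimage_eq .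
    qed
    then have "X \<in> wealth_processes M F T x0 \<delta> R C"
      unfolding wealth_processes_def using is_wealth_transfer[OF backward X] by blast
    then show "\<exists>X'\<in>wealth_processes M F T x0 \<delta> R C. indist M T X' X" using indist_refl by blast
  qed
  then have same: "same_wealth_processes M F T x0 \<delta> R C (\<lambda>t \<omega>. \<Lambda> *v R t \<omega>) ((\<lambda>y. transpose \<Lambda> *v y) -` C)"
    unfolding R'_def C'_def .
  show ?thesis
  proof (intro exI[of _ \<Lambda>], unfold Let_def, intro conjI allI same)
    show "AE \<omega> in M. \<forall>t\<in>{0..T}. jump (\<lambda>t \<omega>. \<Lambda> *v R t \<omega>) t \<omega> $ j > -1" for j
      using jumps[of j] unfolding R'_def .
    show "axis j 1 \<in> (\<lambda>y. transpose \<Lambda> *v y) -` C \<inter> (\<lambda>y. transpose \<Lambda> *v y) -` C0star M T R" for j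
      unfolding Int_iff vimage_eq transpose_axis using \<Lambda>[of j] unfolding D_def by blast
  qed
qed

end
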